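(* Let $\mathfrak g\cong\mathfrak{sl}(m|n)$ or $\mathfrak{osp}(2|2n)$ with $1\le m\le n$, $n>1$, and let $A$ be an associative, commutative, finitely generated, unital $\mathbb C$-algebra. Let $\mathfrak m\subseteq A$ be a maximal ideal, let $\Theta\in\mathfrak z[A]^*$ be such that $\mathfrak m^p\subseteq\mathsf k_\Theta\subsetneq\mathfrak m$ for some integer $p>1$, and let $V$ be a finite-dimensional irreducible $\mathfrak g_0'$-module. Then $$\dim\mathbf K_{A/\mathsf k_\Theta}(\Theta\boxtimes V^{\mathfrak m})=2^{\dim\mathfrak g_{-1}\,\dim A/\mathsf k_\Theta}\dim V,\qquad \operatorname{sdim}\mathbf K_{A/\mathsf k_\Theta}(\Theta\boxtimes V^{\mathfrak m})=0,$$ $$\operatorname{ch}\mathbf K_{A/\mathsf k_\Theta}(\Theta\boxtimes V^{\mathfrak m})=\big(\operatorname{ch}\mathbf\Lambda(\mathfrak g_{-1})\big)^{\dim(A/\mathsf k_\Theta)}\operatorname{ch}(\Theta\boxtimes V),$$ $$\operatorname{sch}\mathbf K_{A/\mathsf k_\Theta}(\Theta\boxtimes V^{\mathfrak m})=\big(\operatorname{sch}\mathbf\Lambda(\mathfrak g_{-1})\big)^{\dim(A/\mathsf k_\Theta)}\operatorname{ch}(\Theta\boxtimes V).$$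
   Context: The ground field is $\mathbb C$. The Lie superalgebra $\mathfrak g$ has a consistent $\mathbb Z$-grading $\mathfrak g=\mathfrak g_{-1}\oplus\mathfrak g_0\oplus\mathfrak g_1$, where $\mathfrak g_0$ is the even part, $\mathfrak g_{-1}\oplus\mathfrak g_1$ is the odd part, $\mathfrak g_{\pm1}$ are irreducible $\mathfrak g_0$-modules, and $\mathfrak g_0=\mathfrak g_0'\oplus\mathfrak z$ is reductive with semisimple part $\mathfrak g_0'$ and one-dimensional centre $\mathfrak z$. Put $\mathfrak g_+=\mathfrak g_0\oplus\mathfrak g_1$ and let $\mathfrak h\subseteq\mathfrak g_0$ be a Cartan subalgebra. For a commutative algebra $B$ and a Lie superalgebra $\mathfrak a$, $\mathfrak a[B]:=\mathfrak a\otimes B$ with bracket $[x\otimes a,y\otimes b]=[x,y]\otimes ab$. For a quotient algebra $B$ of $A$ and a $\mathfrak g_0[B]$-module $N$, regarded as a $\mathfrak g_+[B]$-module by $\mathfrak g_1[B]N=0$, the Kac-like module is $\mathbf K_B(N):=\mathbf U(\mathfrak g[B])\otimes_{\mathbf U(\mathfrak g_+[B])}N$. For $\Theta\in\mathfrak z[A]^*$ and a $\mathfrak g_0'$-module $V$, $\Theta\boxtimes V^{\mathfrak m}$ denotes the $\mathfrak g_0[A]=\mathfrak z[A]\oplus\mathfrak g_0'[A]$-module with underlying space $V$ on which $\mathfrak z[A]$ acts through $\Theta$ and $\mathfrak g_0'[A]$ acts through $\mathfrak g_0'[A]\to\mathfrak g_0'[A/\mathfrak m]\cong\mathfrak g_0'$;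 it is also viewed as a $\mathfrak g_0[A/\mathsf k_\Theta]$-module, and is taken to be purely even. $\Theta\boxtimes V$ denotes its restriction to $\mathfrak g_0=\mathfrak g_0\otimes1$. For a nonzero $\Theta\in\mathfrak z[A]^*$, $\mathsf k_\Theta$ is the largest proper ideal $I$ of $A$ with $\Theta(\mathfrak z\otimes I)=0$. $\mathbf\Lambda(\mathfrak g_{-1})$ is the Grassmann algebra of the vector space $\mathfrak g_{-1}$, with $\mathfrak g_{-1}$ odd, identified with $\mathbf U(\mathfrak g_{-1})$, a $\mathfrak g_0$-module via the adjoint action. For a finite-dimensional $\mathbb Z_2$-graded $\mathfrak h$-weight module $M$, with $\operatorname{sdim}M=\dim M_{\bar0}-\dim M_{\bar1}$, set $\operatorname{ch}M=\sum_{\mu\in\mathfrak h^*}\dim(M_\mu)e^\mu$ and $\operatorname{sch}M=\sum_{\mu\in\mathfrak h^*}\operatorname{sdim}(M_\mu)e^\mu$. *)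

theory Defs
  imports
    "Jordan_Normal_Form.VS_Connect"
    "HOL-Algebra.Ideal_Product"
    "HOL-Algebra.Subrings"
    "HOL-Algebra.QuotRing"
    "HOL-Library.Poly_Mapping"
    "HOL-Library.Function_Algebras"
    "HOL-Library.Z2"
begin

section \<open>Complex vector spaces\<close>

text \<open>Vector spaces and algebras are records of type \<^typ>\<open>(complex, 'v) module\<close> over the field
  \<open>class_ring\<close>. As everywhere in HOL-Algebra, the fields \<^const>\<open>mult\<close> and \<^const>\<open>one\<close> are
  irrelevant for objects that are only used as vector spaces. A subspace \<open>W\<close> of \<open>V\<close> is a vector
  space via \<open>V\<lparr>carrier := W\<rparr>\<close>.\<close>

abbreviation CC :: "complex ring" where "CC \<equiv> class_ring"

abbreviation vspan :: "(complex, 'v, 'x) module_scheme \<Rightarrow> 'v set \<Rightarrow> 'v set" where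
  "vspan V S \<equiv> LinearCombinations.module.span CC V S"

abbreviation lin_maps ::
    "(complex, 'v, 'x) module_scheme \<Rightarrow> (complex, 'w, 'y) module_scheme \<Rightarrow> ('v \<Rightarrow> 'w) set" where
  "lin_maps V W \<equiv> LinearCombinations.module_hom CC V W"

abbreviation sub_dim :: "(complex, 'v, 'x) module_scheme \<Rightarrow> 'v set \<Rightarrow> nat" where
  "sub_dim V W \<equiv> vectorspace.dim CC (V\<lparr>carrier := W\<rparr>)"

definition direct_sum_decomp ::
    "(complex, 'v, 'x) module_scheme \<Rightarrow> 'v set \<Rightarrow> 'v set \<Rightarrow> 'v set \<Rightarrow> bool" where
  "direct_sum_decomp V W W1 W2 \<longleftrightarrow>
     VectorSpace.subspace CC W1 V \<and> VectorSpace.subspace CC W2 V \<and>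
     W = W1 <+>\<^bsub>V\<^esub> W2 \<and> W1 \<inter> W2 = {\<zero>\<^bsub>V\<^esub>}"

definition bilinear_map ::
    "(complex, 'u, 'x) module_scheme \<Rightarrow> (complex, 'v, 'y) module_scheme \<Rightarrow>
     (complex, 'w, 'z) module_scheme \<Rightarrow> ('u \<Rightarrow> 'v \<Rightarrow> 'w) \<Rightarrow> bool" where
  "bilinear_map U V W f \<longleftrightarrow>
     (\<forall>u \<in> carrier U. f u \<in> lin_maps V W) \<and>
     (\<forall>v \<in> carrier V. (\<lambda>u. f u v) \<in> lin_maps U W)"

text \<open>The dual space of a subspace \<open>W\<close> of \<open>V\<close>; functionals are extended by zero outside \<open>W\<close>, so
  that equality of functionals on \<open>W\<close> is equality of HOL functions.\<close>

definition dual_space :: "(complex, 'v, 'x) module_scheme \<Rightarrow> 'v set \<Rightarrow> ('v \<Rightarrow> complex) set" where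
  "dual_space V W = {\<phi>.
     (\<forall>x \<in> W. \<forall>y \<in> W. \<phi> (x \<oplus>\<^bsub>V\<^esub> y) = \<phi> x + \<phi> y) \<and>
     (\<forall>c. \<forall>x \<in> W. \<phi> (c \<odot>\<^bsub>V\<^esub> x) = c * \<phi> x) \<and>
     (\<forall>x. x \<notin> W \<longrightarrow> \<phi> x = 0)}"

text \<open>The quotient ring \<open>V Quot W\<close> together with its scalar multiplication. It serves both as
  quotient of an algebra by an ideal and as quotient of a vector space by a subspace.\<close>

definition quot :: "(complex, 'v, 'x) module_scheme \<Rightarrow> 'v set \<Rightarrow> (complex, 'v set) module" where
  "quot V W =
     \<lparr>carrier = carrier (V Quot W), mult = mult (V Quot W), one = one (V Quot W),
      zero = zero (V Quot W), add = add (V Quot W),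
      smult = (\<lambda>c X. \<Union>x\<in>X. W +>\<^bsub>V\<^esub> (c \<odot>\<^bsub>V\<^esub> x))\<rparr>"


section \<open>Free vector spaces, free algebras and tensor products\<close>

definition free_space :: "'x set \<Rightarrow> (complex, 'x \<Rightarrow>\<^sub>0 complex) module" where
  "free_space X =
     \<lparr>carrier = {f. Poly_Mapping.keys f \<subseteq> X}, mult = undefined, one = undefined, zero = 0, add = (+),
      smult = (\<lambda>c. Poly_Mapping.map ((*) c))\<rparr>"

text \<open>Words form a monoid under concatenation (written additively here), so that
  \<^typ>\<open>'x list \<Rightarrow>\<^sub>0 complex\<close> with the convolution product is the free algebra on \<^typ>\<open>'x\<close>.\<close>

instantiation list :: (type) monoid_add
begin
definition zero_list_def: "0 = ([] :: 'a list)"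
definition plus_list_def: "u + v = (u @ v :: 'a list)"
instance by standard (simp_all add: zero_list_def plus_list_def)
end

definition free_algebra :: "'x set \<Rightarrow> (complex, 'x list \<Rightarrow>\<^sub>0 complex) module" where
  "free_algebra X =
     \<lparr>carrier = {f. Poly_Mapping.keys f \<subseteq> lists X}, mult = (*), one = 1, zero = 0, add = (+),
      smult = (\<lambda>c. Poly_Mapping.map ((*) c))\<rparr>"

definition lin_ext :: "('x \<Rightarrow> 'y) \<Rightarrow> ('x \<Rightarrow>\<^sub>0 complex) \<Rightarrow> ('y \<Rightarrow>\<^sub>0 complex)" where
  "lin_ext \<phi> f = (\<Sum>k\<in>Poly_Mapping.keys f. Poly_Mapping.single (\<phi> k) (Poly_Mapping.lookup f k))"

definition bilin_ext ::
    "('x \<Rightarrow> 'y \<Rightarrow> 'z) \<Rightarrow> ('x \<Rightarrow>\<^sub>0 complex) \<Rightarrow> ('y \<Rightarrow>\<^sub>0 complex) \<Rightarrow> ('z \<Rightarrow>\<^sub>0 complex)" where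
  "bilin_ext \<phi> f g =
     (\<Sum>k\<in>Poly_Mapping.keys f. \<Sum>l\<in>Poly_Mapping.keys g. Poly_Mapping.single (\<phi> k l) (Poly_Mapping.lookup f k * Poly_Mapping.lookup g l))"

definition tensor_rels ::
    "(complex, 'v, 'x) module_scheme \<Rightarrow> (complex, 'w, 'y) module_scheme \<Rightarrow>
     ('v \<times> 'w \<Rightarrow>\<^sub>0 complex) set" where
  "tensor_rels V W =
     {Poly_Mapping.single (v \<oplus>\<^bsub>V\<^esub> v', w) 1 - Poly_Mapping.single (v, w) 1
        - Poly_Mapping.single (v', w) 1 | v v' w.
        v \<in> carrier V \<and> v' \<in> carrier V \<and> w \<in> carrier W} \<union>
     {Poly_Mapping.single (v, w \<oplus>\<^bsub>W\<^esub> w') 1 - Poly_Mapping.single (v, w) 1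
        - Poly_Mapping.single (v, w') 1 | v w w'.
        v \<in> carrier V \<and> w \<in> carrier W \<and> w' \<in> carrier W} \<union>
     {Poly_Mapping.single (c \<odot>\<^bsub>V\<^esub> v, w) 1 - Poly_Mapping.single (v, w) c | c v w.
        v \<in> carrier V \<and> w \<in> carrier W} \<union>
     {Poly_Mapping.single (v, c \<odot>\<^bsub>W\<^esub> w) 1 - Poly_Mapping.single (v, w) c | c v w.
        v \<in> carrier V \<and> w \<in> carrier W}"

definition tensor_null ::
    "(complex, 'v, 'x) module_scheme \<Rightarrow> (complex, 'w, 'y) module_scheme \<Rightarrow>
     ('v \<times> 'w \<Rightarrow>\<^sub>0 complex) set" where
  "tensor_null V W = vspan (free_space (carrier V \<times> carrier W)) (tensor_rels V W)"

definition tensor ::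
    "(complex, 'v, 'x) module_scheme \<Rightarrow> (complex, 'w, 'y) module_scheme \<Rightarrow>
     (complex, ('v \<times> 'w \<Rightarrow>\<^sub>0 complex) set) module" where
  "tensor V W = quot (free_space (carrier V \<times> carrier W)) (tensor_null V W)"

definition pure_tensor ::
    "(complex, 'v, 'x) module_scheme \<Rightarrow> (complex, 'w, 'y) module_scheme \<Rightarrow> 'v \<Rightarrow> 'w \<Rightarrow>
     ('v \<times> 'w \<Rightarrow>\<^sub>0 complex) set" where
  "pure_tensor V W v w =
     tensor_null V W +>\<^bsub>free_space (carrier V \<times> carrier W)\<^esub> Poly_Mapping.single (v, w) 1"


section \<open>Lie superalgebras\<close>

text \<open>\<open>hpart L p\<close> is the homogeneous component of parity \<open>p\<close> in \<open>\<int>/2\<close>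
  (\<open>0\<close> even, \<open>1\<close> odd).\<close>

record 'v lie_super = "(complex, 'v) module" +
  hpart :: "bit \<Rightarrow> 'v set"
  bracket :: "'v \<Rightarrow> 'v \<Rightarrow> 'v"

definition ssign :: "bit \<Rightarrow> bit \<Rightarrow> complex" where
  "ssign p q = (if p = 1 \<and> q = 1 then - 1 else 1)"

definition lie_superalgebra :: "'v lie_super \<Rightarrow> bool" where
  "lie_superalgebra L \<longleftrightarrow>
     vectorspace CC L \<and>
     direct_sum_decomp L (carrier L) (hpart L 0) (hpart L 1) \<and>
     bilinear_map L L L (bracket L) \<and>
     (\<forall>p q. \<forall>x \<in> hpart L p. \<forall>y \<in> hpart L q. bracket L x y \<in> hpart L (p + q)) \<and>
     (\<forall>p q. \<forall>x \<in> hpart L p. \<forall>y \<in> hpart L q.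
        bracket L x y = (- ssign p q) \<odot>\<^bsub>L\<^esub> bracket L y x) \<and>
     (\<forall>p q. \<forall>x \<in> hpart L p. \<forall>y \<in> hpart L q. \<forall>z \<in> carrier L.
        bracket L x (bracket L y z) =
          bracket L (bracket L x y) z \<oplus>\<^bsub>L\<^esub> ssign p q \<odot>\<^bsub>L\<^esub> bracket L y (bracket L x z))"

definition sub_super :: "'v lie_super \<Rightarrow> 'v set \<Rightarrow> 'v lie_super" where
  "sub_super L W = L\<lparr>carrier := W, hpart := (\<lambda>p. hpart L p \<inter> W)\<rparr>"

definition lie_super_isomorphic :: "'v lie_super \<Rightarrow> 'w lie_super \<Rightarrow> bool" where
  "lie_super_isomorphic L L' \<longleftrightarrow>
     (\<exists>f \<in> lin_maps L L'. bij_betw f (carrier L) (carrier L') \<and>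
        (\<forall>p. f ` hpart L p = hpart L' p) \<and>
        (\<forall>x \<in> carrier L. \<forall>y \<in> carrier L. f (bracket L x y) = bracket L' (f x) (f y)))"


subsection \<open>The Lie superalgebras \<open>gl(m|n)\<close>, \<open>sl(m|n)\<close> and \<open>osp(2|2n)\<close>\<close>

definition index_parity :: "nat \<Rightarrow> nat \<Rightarrow> bit" where
  "index_parity m i = (if i < m then 0 else 1)"

definition hcomp :: "nat \<Rightarrow> bit \<Rightarrow> complex mat \<Rightarrow> complex mat" where
  "hcomp m p X = mat (dim_row X) (dim_col X)
     (\<lambda>(i, j). if index_parity m i + index_parity m j = p then X $$ (i, j) else 0)"

text \<open>The supercommutator is \<open>XY - (-1)\<^bsup>|X||Y|\<^esup> YX\<close> for homogeneous \<open>X\<close>, \<open>Y\<close>; its bilinear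
  extension is \<open>XY - YX + 2 Y\<^sub>1 X\<^sub>1\<close> with \<open>X\<^sub>1\<close>, \<open>Y\<^sub>1\<close> the odd components.\<close>

definition supercommutator :: "nat \<Rightarrow> complex mat \<Rightarrow> complex mat \<Rightarrow> complex mat" where
  "supercommutator m X Y = X * Y - Y * X + 2 \<cdot>\<^sub>m (hcomp m 1 Y * hcomp m 1 X)"

definition gl_super :: "nat \<Rightarrow> nat \<Rightarrow> complex mat lie_super" where
  "gl_super m n =
     \<lparr>carrier = carrier_mat (m + n) (m + n), mult = (*), one = 1\<^sub>m (m + n),
      zero = 0\<^sub>m (m + n) (m + n), add = (+), smult = (\<cdot>\<^sub>m),
      hpart = (\<lambda>p. {X \<in> carrier_mat (m + n) (m + n). hcomp m p X = X}),
      bracket = supercommutator m\<rparr>"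

definition supertrace :: "nat \<Rightarrow> nat \<Rightarrow> complex mat \<Rightarrow> complex" where
  "supertrace m n X = (\<Sum>i = 0..<m. X $$ (i, i)) - (\<Sum>i = m..<m + n. X $$ (i, i))"

definition sl_super :: "nat \<Rightarrow> nat \<Rightarrow> complex mat lie_super" where
  "sl_super m n =
     sub_super (gl_super m n) {X \<in> carrier_mat (m + n) (m + n). supertrace m n X = 0}"

text \<open>The even supersymmetric non-degenerate form on \<open>\<complex>\<^bsup>2|2n\<^esup>\<close>: the symmetric form with
  matrix \<open>((0,1),(1,0))\<close> on the even part, the standard symplectic form on the odd part.\<close>

definition osp_form_mat :: "nat \<Rightarrow> complex mat" where
  "osp_form_mat n = mat (2 + 2 * n) (2 + 2 * n) (\<lambda>(i, j).
     if (i = 0 \<and> j = 1) \<or> (i = 1 \<and> j = 0) then 1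
     else if 2 \<le> i \<and> i < 2 + n \<and> j = i + n then 1
     else if 2 \<le> j \<and> j < 2 + n \<and> i = j + n then - 1
     else 0)"

definition osp_form :: "nat \<Rightarrow> complex vec \<Rightarrow> complex vec \<Rightarrow> complex" where
  "osp_form n v w = v \<bullet> (osp_form_mat n *\<^sub>v w)"

definition osp_super :: "nat \<Rightarrow> complex mat lie_super" where
  "osp_super n = sub_super (gl_super 2 (2 * n))
     {X \<in> carrier_mat (2 + 2 * n) (2 + 2 * n).
        \<forall>p q. \<forall>v \<in> carrier_vec (2 + 2 * n). \<forall>w \<in> carrier_vec (2 + 2 * n).
          (\<forall>i < 2 + 2 * n. v $ i \<noteq> 0 \<longrightarrow> index_parity 2 i = q) \<longrightarrow>
          osp_form n (hcomp 2 p X *\<^sub>v v) w = - ssign p q * osp_form n v (hcomp 2 p X *\<^sub>v w)}"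


subsection \<open>Structure of the even part and gradings\<close>

definition bracket_span :: "'v lie_super \<Rightarrow> 'v set \<Rightarrow> 'v set \<Rightarrow> 'v set" where
  "bracket_span L X Y = vspan L {bracket L x y | x y. x \<in> X \<and> y \<in> Y}"

definition lie_center :: "'v lie_super \<Rightarrow> 'v set \<Rightarrow> 'v set" where
  "lie_center L S = {x \<in> S. \<forall>y \<in> S. bracket L x y = \<zero>\<^bsub>L\<^esub>}"

definition derived_subalgebra :: "'v lie_super \<Rightarrow> 'v set \<Rightarrow> 'v set" where
  "derived_subalgebra L S = bracket_span L S S"

definition semisimple :: "'v lie_super \<Rightarrow> 'v set \<Rightarrow> bool" where
  "semisimple L S \<longleftrightarrow>
     (\<forall>I. VectorSpace.subspace CC I L \<and> I \<subseteq> S \<and> (\<forall>x \<in> S. \<forall>y \<in> I. bracket L x y \<in> I) \<and>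
          (\<exists>k. (derived_subalgebra L ^^ k) I = {\<zero>\<^bsub>L\<^esub>})
        \<longrightarrow> I = {\<zero>\<^bsub>L\<^esub>})"

text \<open>Irreducibility of the subspace \<open>W\<close> of \<open>V\<close> under the operators \<open>\<rho> x\<close>, \<open>x \<in> S\<close>.\<close>

definition irreducible_under ::
    "(complex, 'v, 'x) module_scheme \<Rightarrow> ('g \<Rightarrow> 'v \<Rightarrow> 'v) \<Rightarrow> 'g set \<Rightarrow> 'v set \<Rightarrow> bool" where
  "irreducible_under V \<rho> S W \<longleftrightarrow>
     VectorSpace.subspace CC W V \<and> W \<noteq> {\<zero>\<^bsub>V\<^esub>} \<and> (\<forall>x \<in> S. \<rho> x ` W \<subseteq> W) \<and>
     (\<forall>U. VectorSpace.subspace CC U V \<and> U \<subseteq> W \<and> (\<forall>x \<in> S. \<rho> x ` U \<subseteq> U) \<longrightarrow> U = {\<zero>\<^bsub>V\<^esub>} \<or> U = W)"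

text \<open>A consistent \<open>\<int>\<close>-grading \<open>g = g\<^sub>-\<^sub>1 \<oplus> g\<^sub>0 \<oplus> g\<^sub>1\<close> with \<open>g\<^sub>\<plusminus>\<^sub>1\<close> irreducible over \<open>g\<^sub>0\<close>, where
  \<open>g\<^sub>0\<close> is reductive with one-dimensional centre. The decomposition of \<open>g\<close> into its even and odd
  part is part of \<^const>\<open>lie_superalgebra\<close>.\<close>

definition type_I_grading :: "'v lie_super \<Rightarrow> (int \<Rightarrow> 'v set) \<Rightarrow> bool" where
  "type_I_grading L G \<longleftrightarrow>
     (\<forall>i. i \<notin> {- 1, 0, 1} \<longrightarrow> G i = {\<zero>\<^bsub>L\<^esub>}) \<and>
     (\<forall>i j. \<forall>x \<in> G i. \<forall>y \<in> G j. bracket L x y \<in> G (i + j)) \<and>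
     hpart L 0 = G 0 \<and>
     direct_sum_decomp L (hpart L 1) (G (- 1)) (G 1) \<and>
     irreducible_under L (bracket L) (G 0) (G (- 1)) \<and>
     irreducible_under L (bracket L) (G 0) (G 1) \<and>
     direct_sum_decomp L (G 0) (derived_subalgebra L (G 0)) (lie_center L (G 0)) \<and>
     semisimple L (derived_subalgebra L (G 0)) \<and>
     sub_dim L (lie_center L (G 0)) = 1"

text \<open>Cartan subalgebras of the complex reductive Lie algebra \<open>S\<close>: abelian, self-centralising
  (equivalently, maximal abelian), and acting on \<open>S\<close> by diagonalisable operators.\<close>

definition cartan_subalgebra :: "'v lie_super \<Rightarrow> 'v set \<Rightarrow> 'v set \<Rightarrow> bool" where
  "cartan_subalgebra L S H \<longleftrightarrow>
     VectorSpace.subspace CC H L \<and> H \<subseteq> S \<and>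
     (\<forall>x \<in> H. \<forall>y \<in> H. bracket L x y = \<zero>\<^bsub>L\<^esub>) \<and>
     (\<forall>x \<in> S. (\<forall>y \<in> H. bracket L y x = \<zero>\<^bsub>L\<^esub>) \<longrightarrow> x \<in> H) \<and>
     (\<forall>x \<in> H. vspan L {v \<in> S. \<exists>c. bracket L x v = c \<odot>\<^bsub>L\<^esub> v} = S)"

text \<open>Modules over a Lie subalgebra \<open>S\<close> of the even part.\<close>

definition lie_module ::
    "'g lie_super \<Rightarrow> 'g set \<Rightarrow> (complex, 'v) module \<Rightarrow> ('g \<Rightarrow> 'v \<Rightarrow> 'v) \<Rightarrow> bool" where
  "lie_module L S V \<rho> \<longleftrightarrow>
     vectorspace CC V \<and> bilinear_map (L\<lparr>carrier := S\<rparr>) V V \<rho> \<and>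
     (\<forall>x \<in> S. \<forall>y \<in> S. \<forall>v \<in> carrier V.
        \<rho> (bracket L x y) v = \<rho> x (\<rho> y v) \<ominus>\<^bsub>V\<^esub> \<rho> y (\<rho> x v))"


section \<open>Commutative algebras and current superalgebras\<close>

definition fin_gen_algebra :: "(complex, 'a) module \<Rightarrow> bool" where
  "fin_gen_algebra A \<longleftrightarrow>
     (\<exists>S. finite S \<and> S \<subseteq> carrier A \<and>
        (\<forall>B. VectorSpace.subspace CC B A \<and> subring B A \<and> S \<subseteq> B \<longrightarrow> B = carrier A))"

text \<open>\<open>L[B] = L \<otimes> B\<close>; the bracket is \<open>[x \<otimes> a, y \<otimes> b] = [x, y] \<otimes> ab\<close>, extended bilinearly to
  representatives and then, as in \<^const>\<open>rcoset_mult\<close>, to cosets.\<close>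

definition current ::
    "'g lie_super \<Rightarrow> (complex, 'b) module \<Rightarrow> ('g \<times> 'b \<Rightarrow>\<^sub>0 complex) set lie_super" where
  "current L B = module.extend (tensor L B) (lie_super.fields
     (\<lambda>p. vspan (tensor L B)
        {pure_tensor L B x b | x b. x \<in> hpart L p \<and> b \<in> carrier B})
     (\<lambda>X Y. \<Union>f\<in>X. \<Union>g\<in>Y.
        tensor_null L B +>\<^bsub>free_space (carrier L \<times> carrier B)\<^esub>
          bilin_ext (\<lambda>(x, a) (y, b). (bracket L x y, a \<otimes>\<^bsub>B\<^esub> b)) f g))"

text \<open>For a subspace \<open>S\<close> of \<open>L\<close>, the subspace \<open>S[B]\<close> of \<open>L[B]\<close>.\<close>

definition current_sub ::
    "'g lie_super \<Rightarrow> (complex, 'b) module \<Rightarrow> 'g set \<Rightarrow> ('g \<times> 'b \<Rightarrow>\<^sub>0 complex) set set" where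
  "current_sub L B S =
     vspan (current L B) {pure_tensor L B x b | x b. x \<in> S \<and> b \<in> carrier B}"

text \<open>The canonical map \<open>L[A] \<rightarrow> L[A/I]\<close>.\<close>

definition current_proj ::
    "'g lie_super \<Rightarrow> (complex, 'a) module \<Rightarrow> 'a set \<Rightarrow>
     ('g \<times> 'a \<Rightarrow>\<^sub>0 complex) set \<Rightarrow> ('g \<times> 'a set \<Rightarrow>\<^sub>0 complex) set" where
  "current_proj L A I X =
     (\<Union>f\<in>X. tensor_null L (quot A I)
        +>\<^bsub>free_space (carrier L \<times> carrier (quot A I))\<^esub> lin_ext (\<lambda>(x, a). (x, I +>\<^bsub>A\<^esub> a)) f)"


section \<open>Universal enveloping superalgebras and induced modules\<close>

definition env_ideal :: "'l lie_super \<Rightarrow> ('l list \<Rightarrow>\<^sub>0 complex) set" where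
  "env_ideal L = genideal (free_algebra (carrier L))
    ({Poly_Mapping.single [x \<oplus>\<^bsub>L\<^esub> y] 1 - Poly_Mapping.single [x] 1 - Poly_Mapping.single [y] 1
        | x y. x \<in> carrier L \<and> y \<in> carrier L} \<union>
     {Poly_Mapping.single [c \<odot>\<^bsub>L\<^esub> x] 1 - Poly_Mapping.single [x] c | c x. x \<in> carrier L} \<union>
     {Poly_Mapping.single [x, y] 1 - Poly_Mapping.single [y, x] (ssign p q)
        - Poly_Mapping.single [bracket L x y] 1 | x y p q. x \<in> hpart L p \<and> y \<in> hpart L q})"

definition env_alg :: "'l lie_super \<Rightarrow> (complex, ('l list \<Rightarrow>\<^sub>0 complex) set) module" where
  "env_alg L = quot (free_algebra (carrier L)) (env_ideal L)"

definition env_word :: "'l lie_super \<Rightarrow> 'l list \<Rightarrow> ('l list \<Rightarrow>\<^sub>0 complex) set" where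
  "env_word L w = env_ideal L +>\<^bsub>free_algebra (carrier L)\<^esub> Poly_Mapping.single w 1"

definition env_part :: "'l lie_super \<Rightarrow> bit \<Rightarrow> ('l list \<Rightarrow>\<^sub>0 complex) set set" where
  "env_part L p = vspan (env_alg L)
     {env_word L w | w. \<exists>ps. list_all2 (\<lambda>x q. x \<in> hpart L q) w ps \<and> sum_list ps = p}"

text \<open>The homomorphism \<open>U(P) \<rightarrow> U(L)\<close> for a subsuperalgebra \<open>P = sub_super L W\<close>: words in \<open>P\<close> are
  words in \<open>L\<close>.\<close>

definition env_incl :: "'l lie_super \<Rightarrow> ('l list \<Rightarrow>\<^sub>0 complex) set \<Rightarrow> ('l list \<Rightarrow>\<^sub>0 complex) set" where
  "env_incl L X = (\<Union>f\<in>X. env_ideal L +>\<^bsub>free_algebra (carrier L)\<^esub> f)"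

text \<open>The action of \<open>U(P)\<close> on a \<open>P\<close>-module \<open>N\<close> with action \<open>\<rho>\<close>: the word \<open>x\<^sub>1 \<cdots> x\<^sub>k\<close> acts as
  \<open>\<rho> x\<^sub>1 \<circ> \<cdots> \<circ> \<rho> x\<^sub>k\<close>.\<close>

definition env_act ::
    "(complex, 'v) module \<Rightarrow> ('l \<Rightarrow> 'v \<Rightarrow> 'v) \<Rightarrow> ('l list \<Rightarrow>\<^sub>0 complex) set \<Rightarrow> 'v \<Rightarrow> 'v" where
  "env_act N \<rho> X v =
     the_elem ((\<lambda>f. \<Oplus>\<^bsub>N\<^esub> w \<in> Poly_Mapping.keys f. Poly_Mapping.lookup f w \<odot>\<^bsub>N\<^esub> foldr \<rho> w v) ` X)"

text \<open>\<open>U(L) \<otimes>\<^bsub>U(P)\<^esub> N\<close> for the subsuperalgebra \<open>P\<close> of \<open>L\<close> with underlying space \<open>W\<close>.\<close>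

definition induced_null ::
    "'l lie_super \<Rightarrow> 'l set \<Rightarrow> (complex, 'v) module \<Rightarrow> ('l \<Rightarrow> 'v \<Rightarrow> 'v) \<Rightarrow>
     (('l list \<Rightarrow>\<^sub>0 complex) set \<times> 'v \<Rightarrow>\<^sub>0 complex) set" where
  "induced_null L W N \<rho> =
     vspan (free_space (carrier (env_alg L) \<times> carrier N))
       (tensor_rels (env_alg L) N \<union>
        {Poly_Mapping.single (u \<otimes>\<^bsub>env_alg L\<^esub> env_incl L a, v) 1
           - Poly_Mapping.single (u, env_act N \<rho> a v) 1 | u a v.
           u \<in> carrier (env_alg L) \<and> a \<in> carrier (env_alg (sub_super L W)) \<and> v \<in> carrier N})"

definition induced ::
    "'l lie_super \<Rightarrow> 'l set \<Rightarrow> (complex, 'v) module \<Rightarrow> ('l \<Rightarrow> 'v \<Rightarrow> 'v) \<Rightarrow>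
     (complex, (('l list \<Rightarrow>\<^sub>0 complex) set \<times> 'v \<Rightarrow>\<^sub>0 complex) set) module" where
  "induced L W N \<rho> =
     quot (free_space (carrier (env_alg L) \<times> carrier N)) (induced_null L W N \<rho>)"

definition induced_act ::
    "'l lie_super \<Rightarrow> 'l set \<Rightarrow> (complex, 'v) module \<Rightarrow> ('l \<Rightarrow> 'v \<Rightarrow> 'v) \<Rightarrow> 'l \<Rightarrow>
     (('l list \<Rightarrow>\<^sub>0 complex) set \<times> 'v \<Rightarrow>\<^sub>0 complex) set \<Rightarrow>
     (('l list \<Rightarrow>\<^sub>0 complex) set \<times> 'v \<Rightarrow>\<^sub>0 complex) set" where
  "induced_act L W N \<rho> y X =
     (\<Union>f\<in>X. induced_null L W N \<rho> +>\<^bsub>free_space (carrier (env_alg L) \<times> carrier N)\<^esub>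
        lin_ext (\<lambda>(u, v). (env_word L [y] \<otimes>\<^bsub>env_alg L\<^esub> u, v)) f)"

text \<open>The \<open>\<int>/2\<close>-grading of the induced module when \<open>N\<close> is purely even.\<close>

definition induced_part ::
    "'l lie_super \<Rightarrow> 'l set \<Rightarrow> (complex, 'v) module \<Rightarrow> ('l \<Rightarrow> 'v \<Rightarrow> 'v) \<Rightarrow> bit \<Rightarrow>
     (('l list \<Rightarrow>\<^sub>0 complex) set \<times> 'v \<Rightarrow>\<^sub>0 complex) set set" where
  "induced_part L W N \<rho> p = vspan (induced L W N \<rho>)
     {induced_null L W N \<rho> +>\<^bsub>free_space (carrier (env_alg L) \<times> carrier N)\<^esub>
        Poly_Mapping.single (u, v) 1 | u v. u \<in> env_part L p \<and> v \<in> carrier N}"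


section \<open>Kac-like modules\<close>

text \<open>\<open>g\<^sub>+[B]\<close> inside \<open>g[B]\<close>.\<close>

definition plus_current ::
    "'g lie_super \<Rightarrow> (int \<Rightarrow> 'g set) \<Rightarrow> (complex, 'b) module \<Rightarrow>
     ('g \<times> 'b \<Rightarrow>\<^sub>0 complex) set set" where
  "plus_current L G B = current_sub L B (G 0 <+>\<^bsub>L\<^esub> G 1)"

text \<open>A \<open>g\<^sub>0[B]\<close>-action \<open>\<sigma>\<close> extended to \<open>g\<^sub>+[B] = g\<^sub>0[B] \<oplus> g\<^sub>1[B]\<close> by zero on \<open>g\<^sub>1[B]\<close>.\<close>

definition plus_act ::
    "'g lie_super \<Rightarrow> (int \<Rightarrow> 'g set) \<Rightarrow> (complex, 'b) module \<Rightarrow>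
     (('g \<times> 'b \<Rightarrow>\<^sub>0 complex) set \<Rightarrow> 'v \<Rightarrow> 'v) \<Rightarrow> ('g \<times> 'b \<Rightarrow>\<^sub>0 complex) set \<Rightarrow> 'v \<Rightarrow> 'v" where
  "plus_act L G B \<sigma> y =
     \<sigma> (THE y0. y0 \<in> current_sub L B (G 0) \<and>
          (\<exists>y1 \<in> current_sub L B (G 1). y = y0 \<oplus>\<^bsub>current L B\<^esub> y1))"

definition kac_module where
  "kac_module L G B N \<sigma> =
     induced (current L B) (plus_current L G B) N (plus_act L G B \<sigma>)"

definition kac_part where
  "kac_part L G B N \<sigma> =
     induced_part (current L B) (plus_current L G B) N (plus_act L G B \<sigma>)"

definition kac_act where
  "kac_act L G B N \<sigma> =
     induced_act (current L B) (plus_current L G B) N (plus_act L G B \<sigma>)"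

text \<open>The action of \<open>x \<in> g\<close> on the Kac-like module, via \<open>x \<otimes> 1\<close>.\<close>

definition kac_act_const where
  "kac_act_const L G B N \<sigma> x = kac_act L G B N \<sigma> (pure_tensor L B x \<one>\<^bsub>B\<^esub>)"


subsection \<open>The modules \<open>\<Theta> \<boxtimes> V\<^sup>m\<close>\<close>

text \<open>\<open>Z\<close> is the centre of \<open>g\<^sub>0\<close>; meaningful for \<open>\<Theta> \<noteq> 0\<close>.\<close>

definition k_ideal ::
    "'g lie_super \<Rightarrow> 'g set \<Rightarrow> (complex, 'a) module \<Rightarrow>
     (('g \<times> 'a \<Rightarrow>\<^sub>0 complex) set \<Rightarrow> complex) \<Rightarrow> 'a set" where
  "k_ideal L Z A \<Theta> =
     (GREATEST I. ideal I A \<and> I \<noteq> carrier A \<and>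
        (\<forall>x \<in> Z. \<forall>a \<in> I. \<Theta> (pure_tensor L A x a) = 0))"

text \<open>The map \<open>S[A] \<rightarrow> S[A/m] \<cong> S\<close>, where the last isomorphism is the inverse of \<open>x \<mapsto> x \<otimes> 1\<close>.\<close>

definition eval_max ::
    "'g lie_super \<Rightarrow> (complex, 'a) module \<Rightarrow> 'a set \<Rightarrow> 'g set \<Rightarrow>
     ('g \<times> 'a \<Rightarrow>\<^sub>0 complex) set \<Rightarrow> 'g" where
  "eval_max L A m S X =
     (THE x. x \<in> S \<and> pure_tensor L (quot A m) x \<one>\<^bsub>quot A m\<^esub> = current_proj L A m X)"

text \<open>The action of \<open>g\<^sub>0[A] = z[A] \<oplus> g\<^sub>0'[A]\<close> on \<open>\<Theta> \<boxtimes> V\<^sup>m\<close>.\<close>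

definition box_act ::
    "'g lie_super \<Rightarrow> (int \<Rightarrow> 'g set) \<Rightarrow> (complex, 'a) module \<Rightarrow> 'a set \<Rightarrow>
     (('g \<times> 'a \<Rightarrow>\<^sub>0 complex) set \<Rightarrow> complex) \<Rightarrow> (complex, 'v) module \<Rightarrow> ('g \<Rightarrow> 'v \<Rightarrow> 'v) \<Rightarrow>
     ('g \<times> 'a \<Rightarrow>\<^sub>0 complex) set \<Rightarrow> 'v \<Rightarrow> 'v" where
  "box_act L G A m \<Theta> V \<rho> y v =
     (let (s, t) = (THE (s, t). s \<in> current_sub L A (lie_center L (G 0)) \<and>
                      t \<in> current_sub L A (derived_subalgebra L (G 0)) \<and>
                      y = s \<oplus>\<^bsub>current L A\<^esub> t)
      in \<Theta> s \<odot>\<^bsub>V\<^esub> v \<oplus>\<^bsub>V\<^esub> \<rho> (eval_max L A m (derived_subalgebra L (G 0)) t) v)"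

text \<open>The same module viewed as a \<open>g\<^sub>0[A/k]\<close>-module.\<close>

definition box_act_quot ::
    "'g lie_super \<Rightarrow> (int \<Rightarrow> 'g set) \<Rightarrow> (complex, 'a) module \<Rightarrow> 'a set \<Rightarrow> 'a set \<Rightarrow>
     (('g \<times> 'a \<Rightarrow>\<^sub>0 complex) set \<Rightarrow> complex) \<Rightarrow> (complex, 'v) module \<Rightarrow> ('g \<Rightarrow> 'v \<Rightarrow> 'v) \<Rightarrow>
     ('g \<times> 'a set \<Rightarrow>\<^sub>0 complex) set \<Rightarrow> 'v \<Rightarrow> 'v" where
  "box_act_quot L G A m k \<Theta> V \<rho> Y v =
     the_elem {box_act L G A m \<Theta> V \<rho> y v | y.
       y \<in> current_sub L A (G 0) \<and> current_proj L A k y = Y}"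

text \<open>The restriction to \<open>g\<^sub>0 = g\<^sub>0 \<otimes> 1\<close>.\<close>

definition box_act_const ::
    "'g lie_super \<Rightarrow> (int \<Rightarrow> 'g set) \<Rightarrow> (complex, 'a) module \<Rightarrow> 'a set \<Rightarrow>
     (('g \<times> 'a \<Rightarrow>\<^sub>0 complex) set \<Rightarrow> complex) \<Rightarrow> (complex, 'v) module \<Rightarrow> ('g \<Rightarrow> 'v \<Rightarrow> 'v) \<Rightarrow>
     'g \<Rightarrow> 'v \<Rightarrow> 'v" where
  "box_act_const L G A m \<Theta> V \<rho> x = box_act L G A m \<Theta> V \<rho> (pure_tensor L A x \<one>\<^bsub>A\<^esub>)"


subsection \<open>The Grassmann algebra of \<open>g\<^sub>-\<^sub>1\<close>\<close>

definition grassmann where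
  "grassmann L G = env_alg (sub_super L (G (- 1 :: int)))"

definition grassmann_part where
  "grassmann_part L G = env_part (sub_super L (G (- 1 :: int)))"

text \<open>The adjoint action of an (even) element \<open>x\<close> of \<open>g\<^sub>0\<close>: the derivation extending \<open>[x, -]\<close>.\<close>

definition grassmann_act ::
    "'g lie_super \<Rightarrow> (int \<Rightarrow> 'g set) \<Rightarrow> 'g \<Rightarrow> ('g list \<Rightarrow>\<^sub>0 complex) set \<Rightarrow>
     ('g list \<Rightarrow>\<^sub>0 complex) set" where
  "grassmann_act L G x X =
     (\<Union>f\<in>X. env_ideal (sub_super L (G (- 1))) +>\<^bsub>free_algebra (G (- 1))\<^esub>
        (\<Sum>w\<in>Poly_Mapping.keys f. \<Sum>i<length w. Poly_Mapping.single (w[i := bracket L x (w ! i)]) (Poly_Mapping.lookup f w)))"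


section \<open>Superdimensions and characters\<close>

definition sdim :: "(complex, 'v) module \<Rightarrow> (bit \<Rightarrow> 'v set) \<Rightarrow> int" where
  "sdim M P = int (sub_dim M (P 0)) - int (sub_dim M (P 1))"

definition weight_space ::
    "(complex, 'v) module \<Rightarrow> ('g \<Rightarrow> 'v \<Rightarrow> 'v) \<Rightarrow> 'g set \<Rightarrow> ('g \<Rightarrow> complex) \<Rightarrow> 'v set" where
  "weight_space M \<alpha> H \<mu> = {v \<in> carrier M. \<forall>x \<in> H. \<alpha> x v = \<mu> x \<odot>\<^bsub>M\<^esub> v}"

text \<open>Characters live in the group ring \<open>\<int>[H\<^sup>*]\<close>, realised inside \<^typ>\<open>('g \<Rightarrow> complex) \<Rightarrow>\<^sub>0 int\<close> with the
  convolution product over pointwise addition of functionals (see \<^const>\<open>dual_space\<close>). The use of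
  \<^const>\<open>Abs_poly_mapping\<close> is meaningful for finite-dimensional \<open>M\<close>.\<close>

definition ch ::
    "'g lie_super \<Rightarrow> 'g set \<Rightarrow> (complex, 'v) module \<Rightarrow> ('g \<Rightarrow> 'v \<Rightarrow> 'v) \<Rightarrow>
     (('g \<Rightarrow> complex) \<Rightarrow>\<^sub>0 int)" where
  "ch L H M \<alpha> = Abs_poly_mapping (\<lambda>\<mu>.
     if \<mu> \<in> dual_space L H then int (sub_dim M (weight_space M \<alpha> H \<mu>)) else 0)"

definition sch ::
    "'g lie_super \<Rightarrow> 'g set \<Rightarrow> (complex, 'v) module \<Rightarrow> (bit \<Rightarrow> 'v set) \<Rightarrow> ('g \<Rightarrow> 'v \<Rightarrow> 'v) \<Rightarrow>
     (('g \<Rightarrow> complex) \<Rightarrow>\<^sub>0 int)" where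
  "sch L H M P \<alpha> = Abs_poly_mapping (\<lambda>\<mu>.
     if \<mu> \<in> dual_space L H then sdim M (\<lambda>p. weight_space M \<alpha> H \<mu> \<inter> P p) else 0)"

end

(*
The Kac-like module is induced from g_+[B] with B = A/k, so it should be the exterior algebra of
g_{-1}[B] tensored with N. Spanning is the easy half: the words in a basis of g_{-1}[B] anticommute.
For independence no PBW theorem is used. Instead g[B] acts on a Fock space: g_{-1}[B] by creation
operators, g_0[B] by derivations plus its action on N, and g_1[B] by a term quadratic in the
annihilation operators; the commutation relations follow from the Jacobi identity, and the module
maps onto this space. The same Fock space identifies the Grassmann algebra of g_{-1}.

With a weight basis e_i of g_{-1}, the vectors e_i (x) b_j, b_j a basis of B, are weight vectors
with the weight of e_i, so every character factors as a product over i of (1 +- e^{wt e_i})^{dim B}.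
That B is finite-dimensional and A/m = C is the Nullstellensatz for algebras of countable dimension
over C: the elements 1/(a - c), c in C, would otherwise be too many to be linearly independent.
The weight basis exists since the eigenvectors of h in H span a g_0-submodule of g_{-1}.
*)

theory Submission
  imports Defs "HOL-Computational_Algebra.Fundamental_Theorem_Algebra" "HOL-Analysis.Continuum_Not_Denumerable" "Jordan_Normal_Form.Char_Poly"
begin

text \<open>The induced module is a quotient by generated relations, so a lower bound for its size
  can only come from maps out of it. The map to Fock space provides them in a usable form: reading
  off the amplitude at a set T of creation indices is a projection onto a copy of N, and increasing
  words in the basis of g_{-1}[B] are exact sections of these projections. Dimension, parity
  components and weight spaces are then all computed from this one family of projections. N is never
  resolved into weight vectors. An element h of H acts on the copy of index T as it does on N,
  shifted by the sum of the weights in T; weight spaces of the module are therefore sums of shifted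
  weight spaces of N, and each copy contributes one translate of the character of N. That \<Theta>
  \<boxtimes> V becomes a module over g_0[A/k] at all rests on two vanishing facts: \<Theta> kills z
  \<otimes> k, and evaluation at the maximal ideal kills k because k lies inside it. The
  superdimension vanishes because g_{-1} and A/k are nonzero, so that a nonempty index set has as
  many even as odd subsets.\<close>

abbreviation (input) "ptn \<equiv> pure_tensor"
abbreviation (input) "sgl \<equiv> Poly_Mapping.single"
abbreviation (input) "lkp \<equiv> Poly_Mapping.lookup"
abbreviation (input) "supp \<equiv> Poly_Mapping.keys"
abbreviation "csub W V \<equiv> VectorSpace.subspace CC W V"
abbreviation "findim \<equiv> vectorspace.fin_dim CC"


section \<open>Linear algebra over the complex numbers\<close>

text \<open>The library laws over \<open>class_ring\<close> come with the operations of that ring;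
  the locale restates them with ordinary complex arithmetic. The record scheme is left open so that
  Lie superalgebras and their subspaces are covered too.\<close>

locale cspace =
 fixes V :: "(complex, 'v, 'x) module_scheme" (structure)
 assumes vs: "vectorspace CC V"

sublocale cspace \<subseteq> abelian_group V
 using vs by (simp add: vectorspace_def Module.module_def)

context cspace
begin

lemma md: "Module.module CC V"
 using vs by (simp add: vectorspace_def)

lemma sm_closed [simp, intro]: "x : carrier V ==> c \<odot> x : carrier V"
 using module.smult_closed[OF md, of c x] by simp

lemma sm_add_left: "x : carrier V ==> (a + b) \<odot> x = a \<odot> x \<oplus> b \<odot> x"
 using module.smult_l_distr[OF md, of a b x] by simp

lemma sm_add_right: "x : carrier V ==> y : carrier V ==> a \<odot> (x \<oplus> y) = a \<odot> x \<oplus> a \<odot> y"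
 using module.smult_r_distr[OF md, of a x y] by simp

lemma sm_assoc [simp]: "x : carrier V ==> a \<odot> (b \<odot> x) = (a * b) \<odot> x"
 using module.smult_assoc1[OF md, of a b x] by simp

lemma sm_one [simp]: "x : carrier V ==> 1 \<odot> x = x"
 using module.smult_one[OF md, of x] by simp

lemma sm_zero_left [simp]: "x : carrier V ==> 0 \<odot> x = \<zero>"
 using module.smult_l_null[OF md, of x] by simp

lemma sm_zero_right [simp]: "c \<odot> \<zero> = \<zero>"
 using module.smult_r_null[OF md, of c] by simp

lemma neg_sm: "x : carrier V ==> \<ominus> x = (- 1) \<odot> x"
 using module.smult_minus_1[OF md, of x] by (simp add: class_ring_simps)

lemma minus_sm: "x : carrier V ==> y : carrier V ==> x \<ominus> y = x \<oplus> (- 1) \<odot> y"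
 by (simp add: a_minus_def neg_sm)

lemma sm_minus_right: "x : carrier V ==> y : carrier V ==> c \<odot> (x \<ominus> y) = c \<odot> x \<ominus> c \<odot> y"
 by (simp add: minus_sm sm_add_right)

lemma finsum_sm:
 assumes "f : I \<rightarrow> carrier V"
 shows "c \<odot> (\<Oplus>i\<in>I. f i) = (\<Oplus>i\<in>I. c \<odot> f i)"
 using assms by (induction I rule: infinite_finite_induct) (auto simp: sm_add_right Pi_def)

lemma minus_eq_zero_iff: "x : carrier V ==> y : carrier V ==> x \<ominus> y = \<zero> \<longleftrightarrow> x = y"
 by simp

lemma minus_eq_iff:
 assumes "x : carrier V" "y : carrier V" "z : carrier V"
 shows "x \<ominus> y = z \<longleftrightarrow> x = z \<oplus> y"
proof
 assume "x \<ominus> y = z"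
 then show "x = z \<oplus> y" using assms by (auto simp: a_minus_def a_assoc l_neg)
next
 assume "x = z \<oplus> y"
 then show "x \<ominus> y = z" using assms by (auto simp: a_minus_def a_assoc r_neg)
qed

lemma smult_cancel: "c ~= 0 ==> x : carrier V ==> c \<odot> x = \<zero> ==> x = \<zero>"
 using sm_assoc[of x "1/c" c] by simp

lemma subspace_iff: "csub W V \<longleftrightarrow> W <= carrier V & \<zero> : W &
  (\<forall>x\<in>W. \<forall>y\<in>W. x \<oplus> y : W) & (\<forall>c. \<forall>x\<in>W. c \<odot> x : W)"
 using vs md unfolding VectorSpace.subspace_def submodule_def by auto

lemma subspaceI:
 assumes "W <= carrier V" "\<zero> : W" "!!x y. x : W ==> y : W ==> x \<oplus> y : W"
  "!!c x. x : W ==> c \<odot> x : W"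
 shows "csub W V"
 using assms by (auto simp: subspace_iff)

lemma subspaceD:
 assumes "csub W V"
 shows "W <= carrier V" "x : W ==> x : carrier V" "\<zero> : W" "x : W ==> y : W ==> x \<oplus> y : W"
  "x : W ==> c \<odot> x : W"
 using assms by (auto simp: subspace_iff)

lemma subspace_minus:
 assumes "csub W V" "x : W" "y : W"
 shows "x \<ominus> y : W"
 using assms subspaceD[OF assms(1)] by (simp add: minus_sm)

lemma subspace_finsum:
 assumes "csub W V" "!!i. i : I ==> f i : W"
 shows "(\<Oplus>i\<in>I. f i) : W"
 using assms(2)
proof (induction I rule: infinite_finite_induct)
 case (insert x F)
 then have "(\<Oplus>i\<in>insert x F. f i) = f x \<oplus> (\<Oplus>i\<in>F. f i)"
  using subspaceD(1)[OF assms(1)] by (intro finsum_insert) auto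
 then show ?case using insert subspaceD(4)[OF assms(1)] by simp
qed (use subspaceD[OF assms(1)] in auto)

lemma subspace_carrier: "csub (carrier V) V"
 by (auto simp: subspace_iff)

lemma subspace_zero: "csub {\<zero>} V"
 by (auto simp: subspace_iff)

lemma subspace_cspace:
 assumes "csub W V"
 shows "cspace (V\<lparr>carrier := W\<rparr>)"
 using vectorspace.subspace_is_vs[OF vs assms] by (rule cspace.intro)

lemma span_subspace: "S <= carrier V ==> csub (vspan V S) V"
 using module.span_is_submodule[OF md] vs by (simp add: VectorSpace.subspace_def)

lemma span_incl: "S <= carrier V ==> x : S ==> x : vspan V S"
 using module.in_own_span[OF md] by blast

lemma span_least: "csub W V ==> S <= W ==> vspan V S <= W"
 using module.span_is_subset[OF md] by (simp add: VectorSpace.subspace_def)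

lemma span_mono: "S <= T ==> vspan V S <= vspan V T"
 using module.span_is_monotone[OF md] by simp

lemma span_closed: "S <= carrier V ==> x : vspan V S ==> x : carrier V"
 using subspaceD(1)[OF span_subspace] by blast

lemma span_of_subspace: "csub W V ==> vspan V W = W"
 by (meson dual_order.antisym order_refl span_incl span_least subsetI subspaceD(1))

lemma span_induct [consumes 2, case_names zero add smult base]:
 assumes "x : vspan V S" "S <= carrier V" "P \<zero>"
  "!!x y. x : carrier V ==> y : carrier V ==> P x ==> P y ==> P (x \<oplus> y)"
  "!!c x. x : carrier V ==> P x ==> P (c \<odot> x)" "!!x. x : S ==> P x"
 shows "P x"
proof -
 have "csub {x : carrier V. P x} V"
  using assms(3-5) by (auto simp: subspace_iff)
 from span_least[OF this, of S] assms(1,2,6) show ?thesis by auto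
qed

end

text \<open>Tensor products and current superalgebras, free spaces and free algebras, subspaces and
  subsuperalgebras carry the same linear structure under different records. This lemma and the two
  congruences after it move subspaces and spans between them.\<close>

lemma cspace_cong:
 assumes "carrier V = carrier V'" "add V = add V'" "zero V = zero V'" "module.smult V = module.smult V'" "cspace V"
 shows "cspace V'"
proof -
 interpret cspace V by fact
 note e = assms(1-4)[symmetric]
 have "Module.module CC V'"
 proof (rule module_criteria)
  show "cring CC" by (rule class_cring.cring_axioms)
  show "\<forall>v\<in>carrier V'. \<exists>w\<in>carrier V'. v \<oplus>\<^bsub>V'\<^esub> w = \<zero>\<^bsub>V'\<^esub>"
   unfolding e using r_neg a_inv_closed by blast
  show "\<forall>v w. v : carrier V' & w : carrier V' --> v \<oplus>\<^bsub>V'\<^esub> w = w \<oplus>\<^bsub>V'\<^esub> v"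
   unfolding e using a_comm by blast
  show "\<forall>v w x. v : carrier V' & w : carrier V' & x : carrier V' -->
    v \<oplus>\<^bsub>V'\<^esub> w \<oplus>\<^bsub>V'\<^esub> x = v \<oplus>\<^bsub>V'\<^esub> (w \<oplus>\<^bsub>V'\<^esub> x)"
   unfolding e using a_assoc by blast
 qed (unfold e, simp_all add: sm_add_left sm_add_right)
 then show ?thesis
  by (intro cspace.intro) (simp add: vectorspace_def class_field)
qed

lemma subspace_cong:
 assumes "carrier V = carrier V'" "add V = add V'" "zero V = zero V'" "module.smult V = module.smult V'" "cspace V"
 shows "csub W V = csub W V'"
 using cspace.subspace_iff[OF assms(5)] cspace.subspace_iff[OF cspace_cong[OF assms]] assms(1-4) by simp

lemma vspan_cong:
 assumes "carrier V = carrier V'" "add V = add V'" "zero V = zero V'" "module.smult V = module.smult V'" "cspace V"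
  and "S <= carrier V"
 shows "vspan V S = vspan V' S"
proof -
 note sc = subspace_cong[OF assms(1-5)]
 have S': "S <= carrier V'" using assms by simp
 interpret V: cspace V by fact
 interpret V': cspace V' by (rule cspace_cong[OF assms(1-5)])
 show ?thesis
  using V.span_least[of "vspan V' S" S] V'.span_least[of "vspan V S" S]
   V.span_subspace[OF assms(6)] V'.span_subspace[OF S']
   V.span_incl[OF assms(6)] V'.span_incl[OF S'] sc by blast
qed

lemma lin_mapI:
 assumes "!!x. x : carrier V ==> f x : carrier W"
  "!!x y. x : carrier V ==> y : carrier V ==> f (x \<oplus>\<^bsub>V\<^esub> y) = f x \<oplus>\<^bsub>W\<^esub> f y"
  "!!c x. x : carrier V ==> f (c \<odot>\<^bsub>V\<^esub> x) = c \<odot>\<^bsub>W\<^esub> f x"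
 shows "f : lin_maps V W"
 using assms by (auto simp: LinearCombinations.module_hom_def)

lemma lin_mapD:
 assumes "f : lin_maps V W"
 shows "x : carrier V ==> f x : carrier W"
  "x : carrier V ==> y : carrier V ==> f (x \<oplus>\<^bsub>V\<^esub> y) = f x \<oplus>\<^bsub>W\<^esub> f y"
  "x : carrier V ==> f (c \<odot>\<^bsub>V\<^esub> x) = c \<odot>\<^bsub>W\<^esub> f x"
 using assms by (auto simp: LinearCombinations.module_hom_def)

section \<open>Linear maps between complex vector spaces\<close>

locale clin = V: cspace V + W: cspace W
 for V :: "(complex, 'v, 'x) module_scheme" and W :: "(complex, 'w, 'y) module_scheme" +
 fixes f
 assumes lin: "f : lin_maps V W"
begin

lemma closed [simp, intro]: "x : carrier V ==> f x : carrier W"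
 and add: "x : carrier V ==> y : carrier V ==> f (x \<oplus>\<^bsub>V\<^esub> y) = f x \<oplus>\<^bsub>W\<^esub> f y"
 and sm: "x : carrier V ==> f (c \<odot>\<^bsub>V\<^esub> x) = c \<odot>\<^bsub>W\<^esub> f x"
 using lin_mapD[OF lin] by auto

lemma zero [simp]: "f \<zero>\<^bsub>V\<^esub> = \<zero>\<^bsub>W\<^esub>"
 using sm[of "\<zero>\<^bsub>V\<^esub>" 0] by simp

lemma minus: "x : carrier V ==> y : carrier V ==> f (x \<ominus>\<^bsub>V\<^esub> y) = f x \<ominus>\<^bsub>W\<^esub> f y"
 by (simp add: V.minus_sm W.minus_sm add sm)

lemma finsum: "g : I \<rightarrow> carrier V ==> f (\<Oplus>\<^bsub>V\<^esub>i\<in>I. g i) = (\<Oplus>\<^bsub>W\<^esub>i\<in>I. f (g i))"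
 by (induction I rule: infinite_finite_induct) (auto simp: add Pi_def)

lemma subspace_vimage:
 assumes "csub U W"
 shows "csub {x : carrier V. f x : U} V"
 using W.subspaceD[OF assms] by (auto intro!: V.subspaceI simp: add sm)

lemma subspace_image:
 assumes "csub U V"
 shows "csub (f ` U) W"
proof (rule W.subspaceI)
 note U = V.subspaceD[OF assms]
 show "f ` U <= carrier W" using U by blast
 show "\<zero>\<^bsub>W\<^esub> : f ` U" using U(3) zero by force
 show "x \<oplus>\<^bsub>W\<^esub> y : f ` U" if xy: "x : f ` U" "y : f ` U" for x y
 proof -
  obtain a b where "a : U" "b : U" "x = f a" "y = f b" using xy by blast
  then show ?thesis using U add[of a b] by (metis image_eqI)
 qed
 show "c \<odot>\<^bsub>W\<^esub> x : f ` U" if xy: "x : f ` U" for c x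
 proof -
  obtain a where "a : U" "x = f a" using xy by blast
  then show ?thesis using U sm[of a c] by (metis image_eqI)
 qed
qed

lemma span_into:
 assumes "S <= carrier V" "csub U W" "!!x. x : S ==> f x : U" "x : vspan V S"
 shows "f x : U"
 using V.span_least[OF subspace_vimage[OF assms(2)], of S] assms by blast

end

lemma clin_eq_on_span:
 assumes "clin V W f" "clin V W g" "S <= carrier V" "!!x. x : S ==> f x = g x" "x : vspan V S"
 shows "f x = g x"
proof -
 interpret f: clin V W f by fact
 interpret g: clin V W g by fact
 from assms(5,3) show ?thesis
  by (induction rule: f.V.span_induct) (auto simp: f.add g.add f.sm g.sm assms(4))
qed

section \<open>Linear functionals and dual bases\<close>

definition linear_functional :: "(complex, 'v, 'x) module_scheme => ('v => complex) => bool" where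
 "linear_functional V ph \<longleftrightarrow>
   (\<forall>x\<in>carrier V. \<forall>y\<in>carrier V. ph (x \<oplus>\<^bsub>V\<^esub> y) = ph x + ph y) &
   (\<forall>c. \<forall>x\<in>carrier V. ph (c \<odot>\<^bsub>V\<^esub> x) = c * ph x)"

lemma linear_functionalD:
 assumes "linear_functional V ph"
 shows "x : carrier V ==> y : carrier V ==> ph (x \<oplus>\<^bsub>V\<^esub> y) = ph x + ph y"
  "x : carrier V ==> ph (c \<odot>\<^bsub>V\<^esub> x) = c * ph x"
 using assms by (auto simp: linear_functional_def)

lemma (in cspace) linear_functional_zero: "linear_functional V ph ==> ph \<zero> = 0"
 using linear_functionalD(2)[of V ph \<zero> 0] by simp

lemma (in cspace) linear_functional_minus:
 "linear_functional V ph ==> x : carrier V ==> y : carrier V ==> ph (x \<ominus> y) = ph x - ph y"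
 by (simp add: minus_sm linear_functionalD)

lemma (in cspace) linear_functional_finsum:
 assumes "linear_functional V ph" "g : I \<rightarrow> carrier V"
 shows "ph (\<Oplus>i\<in>I. g i) = (\<Sum>i\<in>I. ph (g i))"
 using assms(2)
proof (induction I rule: infinite_finite_induct)
 case (insert i I)
 then have "ph (\<Oplus>j\<in>insert i I. g j) = ph (g i \<oplus> (\<Oplus>j\<in>I. g j))"
  by (subst finsum_insert) auto
 also have "... = ph (g i) + ph (\<Oplus>j\<in>I. g j)"
  using insert by (intro linear_functionalD[OF assms(1)]) auto
 finally show ?case using insert by simp
qed (auto simp: linear_functional_zero[OF assms(1)])

text \<open>A finite basis is stored with its dual functionals: independence becomes an evaluation
  instead of a statement about linear combinations, and coordinates are available as linear maps.
  The index set is free, since a basis indexed by pairs occurs.\<close>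

definition cbasis ::
  "(complex, 'v, 'x) module_scheme => 'i set => ('i => 'v) => ('i => 'v => complex) => bool" where
 "cbasis V I b ph \<longleftrightarrow> finite I & b ` I <= carrier V & (\<forall>i\<in>I. linear_functional V (ph i)) &
   (\<forall>i\<in>I. \<forall>j\<in>I. ph i (b j) = (if i = j then 1 else 0)) & vspan V (b ` I) = carrier V"

context cspace
begin

lemma cbasis_expand:
 assumes "cbasis V I b ph" "v : carrier V"
 shows "v = (\<Oplus>i\<in>I. ph i v \<odot> b i)"
proof -
 have fin: "finite I" and bc: "!!i. i : I ==> b i : carrier V"
  and lf: "!!i. i : I ==> linear_functional V (ph i)"
  and d: "!!i j. i : I ==> j : I ==> ph i (b j) = (if i = j then 1 else 0)"
  using assms(1) by (auto simp: cbasis_def)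
 have v: "v : vspan V (b ` I)" using assms by (simp add: cbasis_def)
 have "b ` I <= carrier V" using bc by blast
 from v this show ?thesis
 proof (induction rule: span_induct)
  case zero
  have "(\<Oplus>i\<in>I. ph i \<zero> \<odot> b i) = (\<Oplus>i\<in>I. \<zero>)"
   using bc linear_functional_zero[OF lf] by (intro finsum_cong') auto
  then show ?case by simp
 next
  case (add x y)
  have "(\<Oplus>i\<in>I. ph i (x \<oplus> y) \<odot> b i) = (\<Oplus>i\<in>I. ph i x \<odot> b i \<oplus> ph i y \<odot> b i)"
   using bc add linear_functionalD[OF lf] by (intro finsum_cong') (auto simp: sm_add_left)
  also have "... = (\<Oplus>i\<in>I. ph i x \<odot> b i) \<oplus> (\<Oplus>i\<in>I. ph i y \<odot> b i)"
   using bc by (intro finsum_addf) auto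
  finally show ?case using add by simp
 next
  case (smult c x)
  have "(\<Oplus>i\<in>I. ph i (c \<odot> x) \<odot> b i) = (\<Oplus>i\<in>I. c \<odot> (ph i x \<odot> b i))"
   using bc smult linear_functionalD[OF lf] by (intro finsum_cong') auto
  also have "... = c \<odot> (\<Oplus>i\<in>I. ph i x \<odot> b i)"
   using bc by (intro finsum_sm[symmetric]) auto
  finally show ?case using smult by simp
 next
  case (base x)
  then obtain j where j: "j : I" "x = b j" by blast
  have "(\<Oplus>i\<in>I. ph i x \<odot> b i) = (\<Oplus>i\<in>I. if j = i then b i else \<zero>)"
   using bc j d by (intro finsum_cong') auto
  also have "... = b j" using finsum_singleton[OF j(1) fin, of b] bc by auto
  finally show ?case using j by simp
 qed
qed

text \<open>Applying the j-th functional to a vanishing combination isolates its j-th coefficient,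
  so the basis vectors are independent; the functionals also tell the vectors apart, so none is
  counted twice.\<close>

lemma cbasis_dim:
 assumes "cbasis V I b ph"
 shows "findim V" "vectorspace.dim CC V = card I"
proof -
 have fin: "finite I" and bc: "b ` I <= carrier V" and sp: "vspan V (b ` I) = carrier V"
  and lf: "!!i. i : I ==> linear_functional V (ph i)"
  and d: "!!i j. i : I ==> j : I ==> ph i (b j) = (if i = j then 1 else 0)"
  using assms(1) by (auto simp: cbasis_def)
 show "findim V"
  unfolding vectorspace.fin_dim_def[OF vs] using fin bc sp by (intro exI[of _ "b ` I"]) auto
 have inj: "inj_on b I"
  by (rule inj_onI) (metis d one_neq_zero)
 have li: "\<not> LinearCombinations.module.lin_dep CC V (b ` I)"
 proof (rule module.finite_lin_indpt2[OF md])
  show "finite (b ` I)" using fin by simp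
  show "b ` I <= carrier V" by fact
  fix a assume "LinearCombinations.module.lincomb V a (b ` I) = \<zero>"
  then have z: "(\<Oplus>v\<in>b ` I. a v \<odot> v) = \<zero>" by (simp add: module.lincomb_def[OF md])
  show "\<forall>v\<in>b ` I. a v = \<zero>\<^bsub>CC\<^esub>"
  proof
   fix v assume "v : b ` I"
   then obtain j where j: "j : I" "v = b j" by blast
   have "ph j (\<Oplus>v\<in>b ` I. a v \<odot> v) = (\<Sum>v\<in>b ` I. ph j (a v \<odot> v))"
    using bc by (intro linear_functional_finsum[OF lf[OF j(1)]]) auto
   also have "... = (\<Sum>v\<in>b ` I. a v * ph j v)"
    using bc linear_functionalD[OF lf[OF j(1)]] by (intro sum.cong) auto
   also have "... = (\<Sum>i\<in>I. a (b i) * ph j (b i))"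
    by (subst sum.reindex[OF inj]) simp
   also have "... = (\<Sum>i\<in>I. if j = i then a (b i) else 0)"
    using d j by (intro sum.cong) auto
   also have "... = a v" using j fin by simp
   finally show "a v = \<zero>\<^bsub>CC\<^esub>" using z linear_functional_zero[OF lf[OF j(1)]] by simp
  qed
 qed
 have "vectorspace.dim CC V = card (b ` I)"
  using vectorspace.dim_basis[OF vs] fin li sp bc by (simp add: vectorspace.basis_def[OF vs])
 then show "vectorspace.dim CC V = card I" by (simp add: card_image inj)
qed

text \<open>The dual functionals are the coefficients of the unique combination that represents a
  vector; uniqueness is what makes them additive and homogeneous.\<close>

lemma cbasis_of_basis:
 assumes fin: "finite be" and bas: "vectorspace.basis CC V be"
 shows "\<exists>b ph. cbasis V {..<card be} b ph & b ` {..<card be} = be"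
proof -
 obtain b where b: "bij_betw b {..<card be} be"
  using ex_bij_betw_nat_finite[OF fin] by (auto simp: atLeast0LessThan)
 have bc: "be <= carrier V" and sp: "vspan V be = carrier V"
  using bas by (auto simp: vectorspace.basis_def[OF vs])
 have ex1: "\<exists>!a. a : be \<rightarrow>\<^sub>E UNIV & LinearCombinations.module.lincomb V a be = v" if "v : carrier V" for v
  using vectorspace.basis_criterion[OF vs fin bc] bas that by simp
 define psx where "psx v = (THE a. a : be \<rightarrow>\<^sub>E (UNIV :: complex set) & LinearCombinations.module.lincomb V a be = v)" for v
 have psx: "psx v : be \<rightarrow>\<^sub>E UNIV" "(\<Oplus>x\<in>be. psx v x \<odot> x) = v" if "v : carrier V" for v
  using theI'[OF ex1[OF that]] unfolding psx_def module.lincomb_def[OF md] by auto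
 have psxu: "psx v x = a x" if "v = (\<Oplus>x\<in>be. a x \<odot> x)" "x : be" for a v x
 proof -
  have "restrict a be : be \<rightarrow>\<^sub>E UNIV" by auto
  moreover have "(\<Oplus>x\<in>be. restrict a be x \<odot> x) = v"
   unfolding that(1) using bc by (intro finsum_cong') auto
  moreover have vc: "v : carrier V" unfolding that(1) using bc by (intro finsum_closed) auto
  ultimately have "psx v = restrict a be" using ex1[OF vc] psx[OF vc]
   unfolding module.lincomb_def[OF md] by blast
  then show ?thesis using that by simp
 qed
 have lf: "linear_functional V (%v. psx v x)" if x: "x : be" for x
  unfolding linear_functional_def
 proof (intro conjI ballI allI)
  fix u v assume uv: "u : carrier V" "v : carrier V"
  show "psx (u \<oplus> v) x = psx u x + psx v x"
  proof (rule psxu[OF _ x])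
   have "(\<Oplus>x\<in>be. (psx u x + psx v x) \<odot> x) = (\<Oplus>x\<in>be. psx u x \<odot> x \<oplus> psx v x \<odot> x)"
    using bc by (intro finsum_cong') (auto simp: sm_add_left)
   also have "... = u \<oplus> v" using bc psx(2)[OF uv(1)] psx(2)[OF uv(2)] by (subst finsum_addf) auto
   finally show "u \<oplus> v = (\<Oplus>x\<in>be. (psx u x + psx v x) \<odot> x)" by simp
  qed
 next
  fix c v assume v: "v : carrier V"
  show "psx (c \<odot> v) x = c * psx v x"
  proof (rule psxu[OF _ x])
   have "(\<Oplus>x\<in>be. (c * psx v x) \<odot> x) = (\<Oplus>x\<in>be. c \<odot> (psx v x \<odot> x))"
    using bc by (intro finsum_cong') auto
   also have "... = c \<odot> v" using bc psx(2)[OF v] by (subst finsum_sm[symmetric]) auto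
   finally show "c \<odot> v = (\<Oplus>x\<in>be. (c * psx v x) \<odot> x)" by simp
  qed
 qed
 have d: "psx y x = (if x = y then 1 else 0)" if "x : be" "y : be" for x y
 proof (rule psxu[OF _ that(1)])
  have "(\<Oplus>x\<in>be. (if x = y then 1 else 0) \<odot> x) = (\<Oplus>x\<in>be. if y = x then x else \<zero>)"
   using bc by (intro finsum_cong') auto
  also have "... = y" using finsum_singleton[OF that(2) fin, of "%x. x"] bc by auto
  finally show "y = (\<Oplus>x\<in>be. (if x = y then 1 else 0) \<odot> x)" by simp
 qed
 have bi: "b i : be" if "i < card be" for i using b that by (auto simp: bij_betw_def)
 have "cbasis V {..<card be} b (%i v. psx v (b i))"
  unfolding cbasis_def
 proof (intro conjI ballI)
  show "b ` {..<card be} <= carrier V" using b bc by (simp add: bij_betw_def)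
  show "vspan V (b ` {..<card be}) = carrier V" using b sp by (simp add: bij_betw_def)
  show "linear_functional V (%v. psx v (b i))" if "i : {..<card be}" for i using lf bi that by auto
  show "psx (b j) (b i) = (if i = j then 1 else 0)" if "i : {..<card be}" "j : {..<card be}" for i j
   using d[OF bi bi, of i j] that b by (auto simp: bij_betw_def inj_on_def)
 qed auto
 moreover have "b ` {..<card be} = be" using b by (simp add: bij_betw_def)
 ultimately show ?thesis by blast
qed

lemma ex_cbasis:
 assumes "findim V"
 shows "\<exists>b ph. cbasis V {..<vectorspace.dim CC V} b ph"
proof -
 obtain be where be: "finite be" "vectorspace.basis CC V be"
  using vectorspace.finite_basis_exists[OF vs assms] by blast
 then show ?thesis using cbasis_of_basis[OF be] vectorspace.dim_basis[OF vs be] by auto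
qed

lemma cbasis_zero:
 assumes "cbasis V I b ph" "v : carrier V" "!!i. i : I ==> ph i v = 0"
 shows "v = \<zero>"
proof -
 have "v = (\<Oplus>i\<in>I. ph i v \<odot> b i)" by (rule cbasis_expand[OF assms(1,2)])
 also have "... = (\<Oplus>i\<in>I. \<zero>)"
  using assms by (intro finsum_cong') (auto simp: cbasis_def image_subset_iff)
 finally show ?thesis by simp
qed

lemma fin_dimI: "finite S ==> S <= carrier V ==> vspan V S = carrier V ==> findim V"
 unfolding vectorspace.fin_dim_def[OF vs] by auto

text \<open>Induction on the functionals: on the kernel of one of them the others still separate
  points, and a single vector outside that kernel generates the rest. This yields finite dimension
  wherever finitely many coordinates determine a vector, in subspaces as well as in matrix
  superalgebras.\<close>

lemma subspace_generated_if_functionals: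
 assumes "finite F" "!!ph. ph : F ==> linear_functional V ph" "csub W V"
  "!!v. v : W ==> (!!ph. ph : F ==> ph v = 0) ==> v = \<zero>"
 shows "\<exists>S. finite S & S <= W & vspan V S = W"
 using assms
proof (induction F arbitrary: W rule: finite_induct)
 case empty
 have "W = {\<zero>}" using subspaceD(3)[OF empty(2)] empty(3) by blast
 then show ?case using span_of_subspace[OF subspace_zero] by (intro exI[of _ "{\<zero>}"]) auto
next
 case (insert ph F)
 note W = subspaceD[OF insert.prems(2)]
 define U where "U = {v : W. ph v = 0}"
 have lf: "linear_functional V ph" using insert.prems by simp
 have U: "csub U V"
  unfolding U_def using W linear_functionalD[OF lf] linear_functional_zero[OF lf]
  by (auto simp: subspace_iff)
 have "\<exists>S. finite S & S <= U & vspan V S = U"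
 proof (rule insert.IH[OF _ U])
  show "linear_functional V psx" if "psx : F" for psx using insert.prems(1) that by blast
  show "v = \<zero>" if "v : U" "!!psx. psx : F ==> psx v = 0" for v
   using insert.prems(3)[of v] that by (auto simp: U_def)
 qed
 then obtain S where S: "finite S" "S <= U" "vspan V S = U" by blast
 show ?case
 proof (cases "\<exists>v\<in>W. ph v ~= 0")
  case False
  then have "U = W" by (auto simp: U_def)
  then show ?thesis using S by blast
 next
  case True
  then obtain v where v: "v : W" "ph v ~= 0" by blast
  have SW: "insert v S <= W" using v S by (auto simp: U_def)
  have SV: "insert v S <= carrier V" using SW W by blast
  note T = subspaceD[OF span_subspace[OF SV]]
  have "W <= vspan V (insert v S)"
  proof
   fix w assume w: "w : W"
   \<comment> \<open>With this multiple of v subtracted, w falls into the kernel U, for which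
     generators are known.\<close>
   define c where "c = ph w / ph v"
   have "w \<ominus> c \<odot> v : U" using w v W subspace_minus[OF insert.prems(2)]
    by (simp add: U_def linear_functional_minus[OF lf] linear_functionalD[OF lf] c_def)
   then have 1: "w \<ominus> c \<odot> v : vspan V (insert v S)" using S span_mono[of S "insert v S"] by blast
   have 2: "c \<odot> v : vspan V (insert v S)" using T span_incl[OF SV, of v] by blast
   have "w = (w \<ominus> c \<odot> v) \<oplus> c \<odot> v" using w v W by (simp add: a_minus_def a_assoc l_neg)
   then show "w : vspan V (insert v S)" using T(4)[OF 1 2] by simp
  qed
  moreover have "vspan V (insert v S) <= W" by (rule span_least[OF insert.prems(2) SW])
  ultimately show ?thesis using S SW by (intro exI[of _ "insert v S"]) auto
 qed
qed

lemma span_restrict: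
 assumes "csub W V" "S <= W"
 shows "vspan (V\<lparr>carrier := W\<rparr>) S = vspan V S"
 using module.span_li_not_depend(1)[OF md assms(2)] assms(1) by (simp add: VectorSpace.subspace_def)

lemma subspace_fin_dim:
 assumes "findim V" "csub W V"
 shows "findim (V\<lparr>carrier := W\<rparr>)"
proof -
 obtain b ph where b: "cbasis V {..<vectorspace.dim CC V} b ph" using ex_cbasis[OF assms(1)] by blast
 have "\<exists>S. finite S & S <= W & vspan V S = W"
 proof (rule subspace_generated_if_functionals[OF _ _ assms(2), of "ph ` {..<vectorspace.dim CC V}"])
  show "linear_functional V psx" if "psx : ph ` {..<vectorspace.dim CC V}" for psx
   using b that by (auto simp: cbasis_def)
  show "v = \<zero>" if "v : W" "!!psx. psx : ph ` {..<vectorspace.dim CC V} ==> psx v = 0" for v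
   by (rule cbasis_zero[OF b]) (use subspaceD(2)[OF assms(2)] that in auto)
 qed simp
 then obtain S where "finite S" "S <= W" "vspan V S = W" by blast
 then show ?thesis
  using cspace.fin_dimI[OF subspace_cspace[OF assms(2)], of S] span_restrict[OF assms(2)] by simp
qed

lemma subspace_fin_dim_iff_span:
 assumes "csub W V" "finite S" "S <= W" "vspan V S = W"
 shows "findim (V\<lparr>carrier := W\<rparr>)"
 using cspace.fin_dimI[OF subspace_cspace[OF assms(1)], of S] span_restrict[OF assms(1)] assms by simp

end


section \<open>Quotients\<close>

context cspace
begin

context
 fixes W
 assumes W: "csub W V"
begin

lemma subspace_additive_subgroup: "additive_subgroup W V"
proof (rule additive_subgroupI)
 show "subgroup W (add_monoid V)"
 proof (rule add.subgroupI)
  show "\<ominus> a : W" if "a : W" for a using subspaceD(5)[OF W that, of "-1"] subspaceD(2)[OF W that] by (simp add: neg_sm)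
 qed (use subspaceD[OF W] in auto)
qed

lemma subspace_abelian_subgroup: "abelian_subgroup W V"
 by (intro abelian_subgroupI3 subspace_additive_subgroup abelian_group_axioms)

lemma coset_def: "W +> x = {w \<oplus> x | w. w : W}"
 by (auto simp: a_r_coset_def')

lemma coset_self: "x : carrier V ==> x : W +> x"
 using subspaceD(3)[OF W] by (force simp: coset_def)

lemma coset_memD: "x : carrier V ==> y : W +> x ==> y : carrier V & y \<ominus> x : W"
 using subspaceD(2)[OF W] by (auto simp: coset_def a_minus_def a_assoc r_neg)

lemma coset_eq_iff:
 assumes "x : carrier V" "y : carrier V"
 shows "W +> x = W +> y \<longleftrightarrow> x \<ominus> y : W"
proof
 assume "W +> x = W +> y"
 then show "x \<ominus> y : W" using coset_self[OF assms(1)] coset_memD[OF assms(2)] by blast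
next
 assume d: "x \<ominus> y : W"
 have sub: "W +> x <= W +> y" if "x \<ominus> y : W" "x : carrier V" "y : carrier V" for x y
 proof
  fix z assume "z : W +> x"
  then obtain w where w: "w : W" "z = w \<oplus> x" by (auto simp: coset_def)
  have "z = (w \<oplus> (x \<ominus> y)) \<oplus> y"
   using w that subspaceD(2)[OF W w(1)] by (simp add: a_minus_def a_assoc l_neg)
  then show "z : W +> y" using subspaceD(4)[OF W w(1) that(1)] by (auto simp: coset_def)
 qed
 have "y \<ominus> x = (-1) \<odot> (x \<ominus> y)"
  using assms by (simp add: minus_sm sm_add_right a_comm)
 then have "y \<ominus> x : W" using subspaceD(5)[OF W d] by simp
 then show "W +> x = W +> y" using sub[OF d assms] sub[of y x] assms by blast
qed

text \<open>Operations on quotients are defined as unions over all representatives. Such a union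
  collapses to one term once the term is the same for every representative; most well-definedness
  arguments end here.\<close>

lemma coset_UN:
 assumes "x : carrier V" "!!y. y : carrier V ==> y \<ominus> x : W ==> g y = g x"
 shows "(\<Union>y\<in>W +> x. g y) = g x"
 using coset_self[OF assms(1)] coset_memD[OF assms(1)] assms(2) by blast

lemma quot_carrier: "carrier (quot V W) = {W +> x | x. x : carrier V}"
 by (auto simp: quot_def FactRing_def A_RCOSETS_def')

lemma quot_carrierE:
 assumes "X : carrier (quot V W)"
 obtains x where "x : carrier V" "X = W +> x"
 using assms by (auto simp: quot_carrier)

lemma quot_closed [simp]: "x : carrier V ==> W +> x : carrier (quot V W)"
 by (auto simp: quot_carrier)

lemma quot_add: "x : carrier V ==> y : carrier V ==> (W +> x) \<oplus>\<^bsub>quot V W\<^esub> (W +> y) = W +> (x \<oplus> y)"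
 using abelian_subgroup.a_rcos_sum[OF subspace_abelian_subgroup, of x y]
 by (simp add: quot_def FactRing_def)

lemma coset_zero: "W +> \<zero> = W"
 using subspaceD(1)[OF W] by (rule a_coset_add_zero)

lemma quot_zero: "\<zero>\<^bsub>quot V W\<^esub> = W +> \<zero>"
 by (simp add: quot_def FactRing_def coset_zero)

lemma quot_smult:
 assumes "x : carrier V"
 shows "c \<odot>\<^bsub>quot V W\<^esub> (W +> x) = W +> (c \<odot> x)"
proof -
 have "(\<Union>y\<in>W +> x. W +> (c \<odot> y)) = W +> (c \<odot> x)"
 proof (rule coset_UN[OF assms])
  fix y assume y: "y : carrier V" "y \<ominus> x : W"
  have "c \<odot> y \<ominus> c \<odot> x = c \<odot> (y \<ominus> x)" using y assms by (simp add: sm_minus_right)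
  then show "W +> (c \<odot> y) = W +> (c \<odot> x)" using y assms subspaceD(5)[OF W] by (simp add: coset_eq_iff)
 qed
 then show ?thesis by (simp add: quot_def)
qed

lemma quot_cspace: "cspace (quot V W)"
proof -
 have "Module.module CC (quot V W)"
 proof (rule module_criteria)
  show "cring CC" by (rule class_cring.cring_axioms)
  show "\<zero>\<^bsub>quot V W\<^esub> : carrier (quot V W)" by (simp add: quot_zero)
  show "\<forall>v\<in>carrier (quot V W). \<exists>w\<in>carrier (quot V W). v \<oplus>\<^bsub>quot V W\<^esub> w = \<zero>\<^bsub>quot V W\<^esub>"
  proof
   fix v assume "v : carrier (quot V W)"
   then obtain x where x: "x : carrier V" "v = W +> x" by (rule quot_carrierE)
   then have "v \<oplus>\<^bsub>quot V W\<^esub> (W +> (\<ominus> x)) = \<zero>\<^bsub>quot V W\<^esub>" by (simp add: quot_add quot_zero r_neg)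
   then show "\<exists>w\<in>carrier (quot V W). v \<oplus>\<^bsub>quot V W\<^esub> w = \<zero>\<^bsub>quot V W\<^esub>" using x by (metis quot_closed a_inv_closed)
  qed
 qed (auto elim!: quot_carrierE simp: quot_add quot_smult quot_zero a_ac sm_add_left sm_add_right)
 then show ?thesis by (intro cspace.intro) (simp add: vectorspace_def class_field)
qed

lemma quot_proj_clin: "clin V (quot V W) (%x. W +> x)"
 by (intro clin.intro clin_axioms.intro cspace_axioms quot_cspace lin_mapI)
  (auto simp: quot_add quot_smult)

text \<open>The induced map evaluates f at an arbitrarily chosen representative; as f vanishes on W,
  the choice does not show.\<close>

lemma quot_lift:
 assumes "clin V U f" "!!w. w : W ==> f w = \<zero>\<^bsub>U\<^esub>"
 obtains g where "clin (quot V W) U g" "!!x. x : carrier V ==> g (W +> x) = f x"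
proof -
 interpret f: clin V U f by fact
 define g where "g X = f (SOME x. x : X)" for X
 have g: "g (W +> x) = f x" if x: "x : carrier V" for x
 proof -
  define y where "y = (SOME y. y : W +> x)"
  have "y : W +> x" unfolding y_def using coset_self[OF x] by (rule someI)
  then have y: "y : carrier V" "y \<ominus> x : W" using coset_memD[OF x] by auto
  have "f y \<ominus>\<^bsub>U\<^esub> f x = \<zero>\<^bsub>U\<^esub>" using assms(2)[OF y(2)] y x by (simp add: f.minus)
  then show ?thesis using y x by (simp add: g_def y_def)
 qed
 have "clin (quot V W) U g"
  by (intro clin.intro clin_axioms.intro f.W.cspace_axioms quot_cspace lin_mapI)
   (auto elim!: quot_carrierE simp: g quot_add quot_smult f.add f.sm)
 then show ?thesis using g by (rule that)
qed

end

end

lemma (in clin) span_image: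
 assumes "S <= carrier V"
 shows "f ` vspan V S = vspan W (f ` S)"
proof
 have fS: "f ` S <= carrier W" using assms by auto
 show "f ` vspan V S <= vspan W (f ` S)"
  using span_into[OF assms W.span_subspace[OF fS]] W.span_incl[OF fS] by blast
 show "vspan W (f ` S) <= f ` vspan V S"
  using V.span_incl[OF assms] by (intro W.span_least subspace_image V.span_subspace assms) auto
qed

lemma clin_comp: "clin V W f ==> clin W U g ==> clin V U (%x. g (f x))"
 unfolding clin_def clin_axioms_def
 by (auto intro!: lin_mapI dest: lin_mapD(1) simp: lin_mapD(2,3) lin_mapD(1))

lemma clin_cong:
 assumes "clin V W f" "!!x. x : carrier V ==> f x = g x"
 shows "clin V W g"
proof -
 interpret clin V W f by fact
 show ?thesis
 proof (intro clin.intro clin_axioms.intro lin_mapI V.cspace_axioms W.cspace_axioms)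
  show "g x : carrier W" if "x : carrier V" for x using assms(2)[OF that] closed[OF that] by simp
  show "g (x \<oplus>\<^bsub>V\<^esub> y) = g x \<oplus>\<^bsub>W\<^esub> g y" if "x : carrier V" "y : carrier V" for x y
   using that add by (simp flip: assms(2))
  show "g (c \<odot>\<^bsub>V\<^esub> x) = c \<odot>\<^bsub>W\<^esub> g x" if "x : carrier V" for c x
   using that sm by (simp flip: assms(2))
 qed
qed


section \<open>Free vector spaces\<close>

abbreviation pscale :: "complex => ('x \<Rightarrow>\<^sub>0 complex) => ('x \<Rightarrow>\<^sub>0 complex)" where
 "pscale c \<equiv> Poly_Mapping.map ((*) c)"

lemma lookup_pscale [simp]: "lkp (pscale c f) k = c * lkp f k"
 by (simp add: Poly_Mapping.map.rep_eq when_def)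

lemma pscale_single [simp]: "pscale c (sgl k a) = sgl k (c * a)"
 by (rule poly_mapping_eqI) (simp add: lookup_single when_def)

lemma pscale_zero [simp]: "pscale c 0 = 0"
 by (rule poly_mapping_eqI) simp

lemma pscale_add: "pscale c (f + g) = pscale c f + pscale c g"
 by (rule poly_mapping_eqI) (simp add: lookup_add algebra_simps)

lemma pscale_sum: "pscale c (\<Sum>i\<in>I. f i) = (\<Sum>i\<in>I. pscale c (f i))"
 by (rule poly_mapping_eqI) (simp add: lookup_sum sum_distrib_left)

lemma keys_pscale: "supp (pscale c f) <= supp f"
 by (auto simp: in_keys_iff)

lemma free_space_simps [simp]:
 "carrier (free_space X) = {f. supp f <= X}" "\<zero>\<^bsub>free_space X\<^esub> = 0"
 "f \<oplus>\<^bsub>free_space X\<^esub> g = f + g" "c \<odot>\<^bsub>free_space X\<^esub> f = pscale c f"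
 by (simp_all add: free_space_def)

lemma free_space_cspace: "cspace (free_space X)"
proof -
 have "Module.module CC (free_space X)"
 proof (rule module_criteria)
  show "cring CC" by (rule class_cring.cring_axioms)
  show "\<forall>v\<in>carrier (free_space X). \<exists>w\<in>carrier (free_space X).
    v \<oplus>\<^bsub>free_space X\<^esub> w = \<zero>\<^bsub>free_space X\<^esub>"
   by (auto simp: in_keys_iff subset_iff intro!: exI[of _ "- _"])
 qed (auto intro!: poly_mapping_eqI simp: lookup_add algebra_simps in_keys_iff lookup_one
   dest!: subsetD[OF Poly_Mapping.keys_add])
 then show ?thesis by (intro cspace.intro) (simp add: vectorspace_def class_field)
qed

lemma free_space_minus [simp]:
 assumes "supp f <= X" "supp g <= X"
 shows "f \<ominus>\<^bsub>free_space X\<^esub> g = f - g"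
proof -
 interpret cspace "free_space X" by (rule free_space_cspace)
 have "pscale (-1) g = - g" by (rule poly_mapping_eqI) simp
 then show ?thesis using assms minus_sm[of f g] by simp
qed

lemma pm_sum_superset:
 assumes "finite K" "supp f <= K" "!!k. k : K ==> h k 0 = (0 :: 'b :: comm_monoid_add)"
 shows "(\<Sum>k\<in>supp f. h k (lkp f k)) = (\<Sum>k\<in>K. h k (lkp f k))"
 using assms by (intro sum.mono_neutral_left) (auto simp: in_keys_iff)

text \<open>The support of f + g may shrink by cancellation, so the sums are compared over the union
  of both supports. The extensions \<open>lin_ext\<close>, \<open>bilin_ext\<close> and
  \<open>gact\<close> get their additivity from here.\<close>

lemma pm_sum_add:
 assumes "!!k. h k 0 = (0 :: 'b :: comm_monoid_add)" "!!k a b. h k (a + b) = h k a + h k b"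
 shows "(\<Sum>k\<in>supp (f + g). h k (lkp (f + g) k)) =
  (\<Sum>k\<in>supp f. h k (lkp f k)) +
  (\<Sum>k\<in>supp g. h k (lkp g k))"
proof -
 let ?K = "supp f \<union> supp g"
 have K: "finite ?K" "supp (f + g) <= ?K" using Poly_Mapping.keys_add[of f g] by auto
 show ?thesis
  unfolding pm_sum_superset[OF K(1) K(2), of h, OF assms(1)]
   pm_sum_superset[OF K(1) Un_upper1, of h, OF assms(1)] pm_sum_superset[OF K(1) Un_upper2, of h, OF assms(1)]
  by (simp add: lookup_add assms(2) sum.distrib)
qed

lemma pm_sum_scale:
 assumes "!!k. h k 0 = (0 :: 'b :: comm_monoid_add)" "!!k a. h k (c * a) = s (h k a)"
  "s 0 = 0" "!!x y. s (x + y) = s x + s y"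
 shows "(\<Sum>k\<in>supp (pscale c f). h k (lkp (pscale c f) k)) =
  s (\<Sum>k\<in>supp f. h k (lkp f k))"
proof -
 have "(\<Sum>k\<in>supp (pscale c f). h k (lkp (pscale c f) k)) =
   (\<Sum>k\<in>supp f. h k (c * lkp f k))"
  using pm_sum_superset[OF finite_keys keys_pscale[of c f], of h] assms(1) by simp
 also have "... = (\<Sum>k\<in>supp f. s (h k (lkp f k)))"
  by (simp add: assms(2))
 also have "... = s (\<Sum>k\<in>supp f. h k (lkp f k))"
 proof -
  have "(\<Sum>k\<in>K. s (F k)) = s (\<Sum>k\<in>K. F k)" for K :: "'a set" and F
   by (induction K rule: infinite_finite_induct) (simp_all add: assms(3,4))
  then show ?thesis by simp
 qed
 finally show ?thesis .
qed

lemma pm_expand: "f = (\<Sum>k\<in>supp f. sgl k (lkp f k))"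
 by (rule poly_mapping_eqI) (simp add: lookup_sum lookup_single when_def in_keys_iff)

lemma free_space_span: "carrier (free_space X) = vspan (free_space X) {sgl x 1 | x. x : X}"
proof -
 interpret cspace "free_space X" by (rule free_space_cspace)
 let ?S = "{sgl x (1::complex) | x. x : X}"
 have S: "?S <= carrier (free_space X)" by auto
 note sp = subspaceD[OF span_subspace[OF S]]
 have "f : vspan (free_space X) ?S" if f: "supp f <= X" for f
 proof -
  have 1: "sgl k c : vspan (free_space X) ?S" if "k : X" for k c
   using sp(5)[OF span_incl[OF S], of "sgl k 1" c] that by auto
  have "(\<Sum>k\<in>K. sgl k (lkp f k)) : vspan (free_space X) ?S"
   if "finite K" "K <= X" for K
   using that by (induction K rule: finite_induct) (use sp(3,4) 1 in auto)
  from this[OF finite_keys f] show ?thesis by (subst pm_expand)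
 qed
 then show ?thesis using sp(1) by auto
qed

text \<open>The linear extension of \<open>ph\<close> to the free space; it carries the universal
  properties of tensor products, induced modules and free algebras.\<close>

definition pm_eval :: "(complex, 'w, 'y) module_scheme => ('x => 'w) => ('x \<Rightarrow>\<^sub>0 complex) => 'w" where
 "pm_eval U ph f = (\<Oplus>\<^bsub>U\<^esub>k\<in>supp f. lkp f k \<odot>\<^bsub>U\<^esub> ph k)"

context cspace
begin

lemma pm_eval_superset:
 assumes "finite K" "supp f <= K" "!!k. k : K ==> ph k : carrier V"
 shows "pm_eval V ph f = (\<Oplus>k\<in>K. lkp f k \<odot> ph k)"
 unfolding pm_eval_def
 by (intro add.finprod_mono_neutral_cong_left) (use assms in \<open>auto simp: in_keys_iff Pi_def\<close>)

lemma pm_eval_single: "ph k : carrier V ==> pm_eval V ph (sgl k c) = c \<odot> ph k"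
 by (subst pm_eval_superset[of "{k}"]) auto

lemma pm_eval_clin:
 assumes "!!x. x : X ==> ph x : carrier V"
 shows "clin (free_space X) V (pm_eval V ph)"
proof (intro clin.intro clin_axioms.intro free_space_cspace cspace_axioms lin_mapI)
 fix f assume f: "f : carrier (free_space X)"
 have ph: "ph k : carrier V" if "k : supp f" for k using f that assms by auto
 show "pm_eval V ph f : carrier V" unfolding pm_eval_def using ph by (intro finsum_closed) auto
 fix c
 have "pm_eval V ph (pscale c f) = (\<Oplus>k\<in>supp f. c \<odot> (lkp f k \<odot> ph k))"
  using ph by (subst pm_eval_superset[OF finite_keys keys_pscale]) (auto intro!: finsum_cong')
 also have "... = c \<odot> pm_eval V ph f"
  unfolding pm_eval_def using ph by (intro finsum_sm[symmetric]) auto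
 finally show "pm_eval V ph (c \<odot>\<^bsub>free_space X\<^esub> f) = c \<odot> pm_eval V ph f" by simp
next
 fix f g assume fg: "f : carrier (free_space X)" "g : carrier (free_space X)"
 let ?K = "supp f \<union> supp g"
 have ph: "ph k : carrier V" if "k : ?K" for k using fg that assms by auto
 have "pm_eval V ph (f + g) = (\<Oplus>k\<in>?K. lkp f k \<odot> ph k \<oplus> lkp g k \<odot> ph k)"
 proof -
  have "pm_eval V ph (f + g) = (\<Oplus>k\<in>?K. lkp (f + g) k \<odot> ph k)"
   by (rule pm_eval_superset) (use ph Poly_Mapping.keys_add[of f g] in auto)
  also have "... = (\<Oplus>k\<in>?K. lkp f k \<odot> ph k \<oplus> lkp g k \<odot> ph k)"
   using ph by (intro finsum_cong') (auto simp: lookup_add sm_add_left)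
  finally show ?thesis .
 qed
 also have "... = (\<Oplus>k\<in>?K. lkp f k \<odot> ph k) \<oplus> (\<Oplus>k\<in>?K. lkp g k \<odot> ph k)"
  using ph by (intro finsum_addf) auto
 also have "... = pm_eval V ph f \<oplus> pm_eval V ph g"
 proof -
  have "pm_eval V ph f = (\<Oplus>k\<in>?K. lkp f k \<odot> ph k)"
   "pm_eval V ph g = (\<Oplus>k\<in>?K. lkp g k \<odot> ph k)"
   by (rule pm_eval_superset; use ph in auto)+
  then show ?thesis by simp
 qed
 finally show "pm_eval V ph (f \<oplus>\<^bsub>free_space X\<^esub> g) = pm_eval V ph f \<oplus> pm_eval V ph g" by simp
qed

end

lemma lin_ext_single [simp]: "lin_ext ph (sgl k c) = sgl (ph k) c"
 by (cases "c = 0") (simp_all add: lin_ext_def)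

lemma lin_ext_add: "lin_ext ph (f + g) = lin_ext ph f + lin_ext ph g"
 unfolding lin_ext_def by (rule pm_sum_add) (simp_all add: single_add)

lemma lin_ext_scale: "lin_ext ph (pscale c f) = pscale c (lin_ext ph f)"
 unfolding lin_ext_def by (rule pm_sum_scale) (simp_all add: pscale_add)

lemma keys_sum_subset: "(!!i. i : I ==> supp (f i) <= X) ==> supp (\<Sum>i\<in>I. f i) <= X"
 by (induction I rule: infinite_finite_induct) (auto dest!: subsetD[OF Poly_Mapping.keys_add])

lemma keys_lin_ext: "(!!x. x : supp f ==> ph x : Y) ==> supp (lin_ext ph f) <= Y"
 unfolding lin_ext_def by (rule keys_sum_subset) (auto split: if_splits)

lemma lin_ext_clin:
 assumes "!!x. x : X ==> ph x : Y"
 shows "clin (free_space X) (free_space Y) (lin_ext ph)"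
proof (intro clin.intro clin_axioms.intro free_space_cspace lin_mapI)
 show "lin_ext ph x : carrier (free_space Y)" if "x : carrier (free_space X)" for x
  using that assms keys_lin_ext[of x ph Y] by auto
qed (simp_all add: lin_ext_add lin_ext_scale)

lemma bilin_ext_single_right:
 "bilin_ext ph f (sgl l 1) = lin_ext (%k. ph k l) f"
 by (simp add: bilin_ext_def lin_ext_def)

lemma bilin_ext_single_left:
 "bilin_ext ph (sgl k 1) g = lin_ext (ph k) g"
 by (simp add: bilin_ext_def lin_ext_def)

lemma bilin_ext_add_left: "bilin_ext ph (f + f') g = bilin_ext ph f g + bilin_ext ph f' g"
 unfolding bilin_ext_def
 by (rule pm_sum_add[where h = "%k a. \<Sum>l\<in>supp g. sgl (ph k l) (a * lkp g l)"])
  (simp_all add: single_add sum.distrib algebra_simps)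

lemma bilin_ext_scale_left: "bilin_ext ph (pscale c f) g = pscale c (bilin_ext ph f g)"
 unfolding bilin_ext_def
 by (rule pm_sum_scale[where h = "%k a. \<Sum>l\<in>supp g. sgl (ph k l) (a * lkp g l)"])
  (simp_all add: pscale_add pscale_sum mult.assoc)

lemma bilin_ext_swap: "bilin_ext ph f g = bilin_ext (%l k. ph k l) g f"
 unfolding bilin_ext_def by (subst sum.swap) (simp add: mult.commute)

lemma bilin_ext_clin:
 assumes "!!x y. x : X ==> y : Y ==> ph x y : Z" "g : carrier (free_space Y)"
 shows "clin (free_space X) (free_space Z) (%f. bilin_ext ph f g)"
proof (intro clin.intro clin_axioms.intro free_space_cspace lin_mapI)
 show "bilin_ext ph f g : carrier (free_space Z)" if "f : carrier (free_space X)" for f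
  unfolding bilin_ext_def free_space_simps mem_Collect_eq
  by (intro keys_sum_subset) (use that assms in \<open>force split: if_splits\<close>)
qed (simp_all add: bilin_ext_add_left bilin_ext_scale_left)

lemma bilin_ext_clin_right:
 assumes "!!x y. x : X ==> y : Y ==> ph x y : Z" "f : carrier (free_space X)"
 shows "clin (free_space Y) (free_space Z) (%g. bilin_ext ph f g)"
 using bilin_ext_clin[of Y X "%l k. ph k l" Z f] assms by (simp add: bilin_ext_swap[of ph f])


section \<open>Tensor products\<close>

locale ctensor = L: cspace L + B: cspace B
 for L :: "(complex, 'g, 'x) module_scheme" and B :: "(complex, 'b, 'y) module_scheme"
begin

sublocale F: cspace "free_space (carrier L \<times> carrier B)"
 by (rule free_space_cspace)

lemma tensor_rels_carrier: "tensor_rels L B <= carrier (free_space (carrier L \<times> carrier B))"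
 unfolding tensor_rels_def
 by (auto dest!: subsetD[OF Poly_Mapping.keys_diff] split: if_splits)

lemma tensor_null_subspace: "csub (tensor_null L B) (free_space (carrier L \<times> carrier B))"
 unfolding tensor_null_def by (rule F.span_subspace[OF tensor_rels_carrier])

sublocale T: cspace "tensor L B"
 unfolding tensor_def by (rule F.quot_cspace[OF tensor_null_subspace])

abbreviation cls where "cls f \<equiv> tensor_null L B +>\<^bsub>free_space (carrier L \<times> carrier B)\<^esub> f"

lemma cls_clin: "clin (free_space (carrier L \<times> carrier B)) (tensor L B) cls"
 unfolding tensor_def by (rule F.quot_proj_clin[OF tensor_null_subspace])

lemma tensor_carrier: "carrier (tensor L B) = cls ` carrier (free_space (carrier L \<times> carrier B))"
 unfolding tensor_def using F.quot_carrier[OF tensor_null_subspace] by auto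

lemma pure_tensor_closed [simp]: "x : carrier L ==> b : carrier B ==> ptn L B x b : carrier (tensor L B)"
 unfolding pure_tensor_def tensor_def by (rule F.quot_closed[OF tensor_null_subspace]) auto

text \<open>F is prescribed and has to agree with \<open>be\<close> on generators only. This covers
  the maps underlying the coset-wise definitions of the current bracket and of
  \<open>current_proj\<close>, besides the universal property itself.\<close>

lemma kills_tensor_null:
 assumes "clin (free_space (carrier L \<times> carrier B)) U F" "bilinear_map L B U be"
  "!!x b. x : carrier L ==> b : carrier B ==> F (sgl (x, b) 1) = be x b"
  "n : tensor_null L B"
 shows "F n = \<zero>\<^bsub>U\<^esub>"
proof -
 interpret f: clin "free_space (carrier L \<times> carrier B)" U F by fact
 have l: "!!x. x : carrier L ==> be x : lin_maps B U" and r: "!!b. b : carrier B ==> (%x. be x b) : lin_maps L U"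
  using assms(2) by (auto simp: bilinear_map_def)
 have be: "be x b : carrier U" if "x : carrier L" "b : carrier B" for x b
  using lin_mapD(1)[OF l] that by auto
 have sc: "F (sgl (x, b) c) = c \<odot>\<^bsub>U\<^esub> be x b" if "x : carrier L" "b : carrier B" for x b c
  using f.sm[of "sgl (x, b) 1" c] assms(3) that by simp
 have mn: "F (f - g) = F f \<ominus>\<^bsub>U\<^esub> F g" if "supp f <= carrier L \<times> carrier B"
  "supp g <= carrier L \<times> carrier B" for f g
  using f.minus[of f g] that by simp
 have kd: "supp (sgl p a - sgl q b) <= Y" if "p : Y" "q : Y"
  for p q :: "'g \<times> 'b" and a b :: complex and Y
  using that by (auto dest!: subsetD[OF Poly_Mapping.keys_diff] split: if_splits)
 have sub: "tensor_rels L B <= {x : carrier (free_space (carrier L \<times> carrier B)). F x : {\<zero>\<^bsub>U\<^esub>}}"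
 proof
  fix t assume t: "t : tensor_rels L B"
  have "F t = \<zero>\<^bsub>U\<^esub>"
   using t unfolding tensor_rels_def
  proof (elim UnE CollectE exE conjE)
   fix x x' b assume h: "t = sgl (x \<oplus>\<^bsub>L\<^esub> x', b) 1 - sgl (x, b) 1 - sgl (x', b) 1"
    "x : carrier L" "x' : carrier L" "b : carrier B"
   have "F t = (be x b \<oplus>\<^bsub>U\<^esub> be x' b) \<ominus>\<^bsub>U\<^esub> be x b \<ominus>\<^bsub>U\<^esub> be x' b"
    unfolding h(1) using h(2-) lin_mapD(2)[OF r[OF h(4)] h(2,3)] by (simp add: mn kd sc be)
   also have "... = \<zero>\<^bsub>U\<^esub>" using be h(2-)
    by (metis f.W.a_comm f.W.add.m_closed f.W.minus_eq_iff f.W.minus_eq_zero_iff)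
   finally show ?thesis .
  next
   fix x b b' assume h: "t = sgl (x, b \<oplus>\<^bsub>B\<^esub> b') 1 - sgl (x, b) 1 - sgl (x, b') 1"
    "x : carrier L" "b : carrier B" "b' : carrier B"
   have "F t = (be x b \<oplus>\<^bsub>U\<^esub> be x b') \<ominus>\<^bsub>U\<^esub> be x b \<ominus>\<^bsub>U\<^esub> be x b'"
    unfolding h(1) using h(2-) lin_mapD(2)[OF l[OF h(2)] h(3,4)] by (simp add: mn kd sc be)
   also have "... = \<zero>\<^bsub>U\<^esub>" using be h(2-)
    by (metis f.W.a_comm f.W.add.m_closed f.W.minus_eq_iff f.W.minus_eq_zero_iff)
   finally show ?thesis .
  next
   fix c x b assume h: "t = sgl (c \<odot>\<^bsub>L\<^esub> x, b) 1 - sgl (x, b) c"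
    "x : carrier L" "b : carrier B"
   show ?thesis
    unfolding h(1) using h(2-) lin_mapD(3)[OF r[OF h(3)] h(2)] by (simp add: mn kd sc be)
  next
   fix c x b assume h: "t = sgl (x, c \<odot>\<^bsub>B\<^esub> b) 1 - sgl (x, b) c"
    "x : carrier L" "b : carrier B"
   show ?thesis
    unfolding h(1) using h(2-) lin_mapD(3)[OF l[OF h(2)] h(3)] by (simp add: mn kd sc be)
  qed
  then show "t : {x : carrier (free_space (carrier L \<times> carrier B)). F x : {\<zero>\<^bsub>U\<^esub>}}"
   using t tensor_rels_carrier by auto
 qed
 then show ?thesis using F.span_least[OF f.subspace_vimage[OF f.W.subspace_zero] sub] assms(4)
  by (auto simp: tensor_null_def)
qed

text \<open>Each of the four families of relations is one of the four laws, read modulo the null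
  space.\<close>

lemma pure_tensor_bilinear: "bilinear_map L B (tensor L B) (ptn L B)"
proof -
 interpret c: clin "free_space (carrier L \<times> carrier B)" "tensor L B" cls by (rule cls_clin)
 have rel: "cls f = cls g" if "f - g : tensor_rels L B"
  "supp f <= carrier L \<times> carrier B" "supp g <= carrier L \<times> carrier B" for f g
  using F.coset_eq_iff[OF tensor_null_subspace, of f g] that F.span_incl[OF tensor_rels_carrier that(1)]
  by (simp add: tensor_null_def)
 have ka: "supp (sgl p a + sgl q b) <= Y" if "p : Y" "q : Y"
  for p q :: "'g \<times> 'b" and a b :: complex and Y
  using that by (auto dest!: subsetD[OF Poly_Mapping.keys_add] split: if_splits)
 have ad: "cls (sgl p 1 + sgl q 1) = cls (sgl p 1) \<oplus>\<^bsub>tensor L B\<^esub> cls (sgl q 1)"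
  if "p : carrier L \<times> carrier B" "q : carrier L \<times> carrier B" for p q
  using c.add[of "sgl p 1" "sgl q 1"] that by simp
 have sc: "cls (sgl p c) = c \<odot>\<^bsub>tensor L B\<^esub> cls (sgl p 1)" if "p : carrier L \<times> carrier B" for p c
  using c.sm[of "sgl p 1" c] that by simp
 have 1: "cls (sgl (x \<oplus>\<^bsub>L\<^esub> x', b) 1) = cls (sgl (x, b) 1 + sgl (x', b) 1)"
  if "x : carrier L" "x' : carrier L" "b : carrier B" for x x' b
  by (rule rel) (use that in \<open>auto simp: ka tensor_rels_def diff_diff_eq split: if_splits\<close>)
 have 2: "cls (sgl (x, b \<oplus>\<^bsub>B\<^esub> b') 1) = cls (sgl (x, b) 1 + sgl (x, b') 1)"
  if "x : carrier L" "b : carrier B" "b' : carrier B" for x b b'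
  by (rule rel) (use that in \<open>auto simp: ka tensor_rels_def diff_diff_eq split: if_splits\<close>)
 have 3: "cls (sgl (c \<odot>\<^bsub>L\<^esub> x, b) 1) = cls (sgl (x, b) c)"
  if "x : carrier L" "b : carrier B" for x b c
  by (rule rel) (use that in \<open>auto simp: tensor_rels_def split: if_splits\<close>)
 have 4: "cls (sgl (x, c \<odot>\<^bsub>B\<^esub> b) 1) = cls (sgl (x, b) c)"
  if "x : carrier L" "b : carrier B" for x b c
  by (rule rel) (use that in \<open>auto simp: tensor_rels_def split: if_splits\<close>)
 show ?thesis
  unfolding bilinear_map_def
 proof (intro conjI ballI)
  fix x assume x: "x : carrier L"
  show "ptn L B x : lin_maps B (tensor L B)"
  proof (rule lin_mapI)
   show "ptn L B x (b \<oplus>\<^bsub>B\<^esub> b') = ptn L B x b \<oplus>\<^bsub>tensor L B\<^esub> ptn L B x b'"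
    if "b : carrier B" "b' : carrier B" for b b'
    unfolding pure_tensor_def using 2[OF x that] ad[of "(x, b)" "(x, b')"] x that by simp
   show "ptn L B x (c \<odot>\<^bsub>B\<^esub> b) = c \<odot>\<^bsub>tensor L B\<^esub> ptn L B x b" if "b : carrier B" for b c
    unfolding pure_tensor_def 4[OF x that] by (rule sc) (use x that in simp)
  qed (use x in simp)
 next
  fix b assume b: "b : carrier B"
  show "(%x. ptn L B x b) : lin_maps L (tensor L B)"
  proof (rule lin_mapI)
   show "ptn L B (x \<oplus>\<^bsub>L\<^esub> x') b = ptn L B x b \<oplus>\<^bsub>tensor L B\<^esub> ptn L B x' b"
    if "x : carrier L" "x' : carrier L" for x x'
    unfolding pure_tensor_def using 1[OF that b] ad[of "(x, b)" "(x', b)"] b that by simp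
   show "ptn L B (c \<odot>\<^bsub>L\<^esub> x) b = c \<odot>\<^bsub>tensor L B\<^esub> ptn L B x b" if "x : carrier L" for x c
    unfolding pure_tensor_def 3[OF that b] by (rule sc) (use b that in simp)
  qed (use b in simp)
 qed
qed

lemma pure_tensor_add_left: "x : carrier L ==> y : carrier L ==> b : carrier B ==>
  ptn L B (x \<oplus>\<^bsub>L\<^esub> y) b = ptn L B x b \<oplus>\<^bsub>tensor L B\<^esub> ptn L B y b"
 and pure_tensor_add_right: "x : carrier L ==> b : carrier B ==> c : carrier B ==>
  ptn L B x (b \<oplus>\<^bsub>B\<^esub> c) = ptn L B x b \<oplus>\<^bsub>tensor L B\<^esub> ptn L B x c"
 and pure_tensor_smult_left: "x : carrier L ==> b : carrier B ==>
  ptn L B (a \<odot>\<^bsub>L\<^esub> x) b = a \<odot>\<^bsub>tensor L B\<^esub> ptn L B x b"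
 and pure_tensor_smult_right: "x : carrier L ==> b : carrier B ==>
  ptn L B x (a \<odot>\<^bsub>B\<^esub> b) = a \<odot>\<^bsub>tensor L B\<^esub> ptn L B x b"
 using pure_tensor_bilinear by (auto simp: bilinear_map_def LinearCombinations.module_hom_def)

lemma tensor_span:
 "carrier (tensor L B) = vspan (tensor L B) {ptn L B x b | x b. x : carrier L & b : carrier B}"
proof -
 interpret c: clin "free_space (carrier L \<times> carrier B)" "tensor L B" cls by (rule cls_clin)
 let ?S = "{sgl p (1 :: complex) | p. p : carrier L \<times> carrier B}"
 have "carrier (tensor L B) = cls ` vspan (free_space (carrier L \<times> carrier B)) ?S"
  unfolding tensor_carrier using free_space_span[of "carrier L \<times> carrier B"] by simp
 also have "... = vspan (tensor L B) (cls ` ?S)" by (rule c.span_image) auto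
 also have "cls ` ?S = {ptn L B x b | x b. x : carrier L & b : carrier B}"
  by (auto simp: pure_tensor_def)
 finally show ?thesis .
qed

lemma tensor_lift:
 assumes "cspace U" "bilinear_map L B U be"
 obtains g where "clin (tensor L B) U g"
  "!!x b. x : carrier L ==> b : carrier B ==> g (ptn L B x b) = be x b"
proof -
 interpret U: cspace U by fact
 have be: "be x b : carrier U" if "x : carrier L" "b : carrier B" for x b
  using assms(2) that by (auto simp: bilinear_map_def LinearCombinations.module_hom_def)
 let ?F = "pm_eval U (%(x, b). be x b)"
 have F: "clin (free_space (carrier L \<times> carrier B)) U ?F"
  by (rule U.pm_eval_clin) (auto simp: be)
 have Fs: "?F (sgl (x, b) 1) = be x b" if "x : carrier L" "b : carrier B" for x b
  using be[OF that] by (subst U.pm_eval_single) auto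
 obtain g where "clin (tensor L B) U g" "!!f. f : carrier (free_space (carrier L \<times> carrier B)) ==> g (cls f) = ?F f"
  unfolding tensor_def by (rule F.quot_lift[OF tensor_null_subspace F kills_tensor_null[OF F assms(2) Fs]]) auto
 then show ?thesis using that[of g] Fs by (simp add: pure_tensor_def)
qed

end


section \<open>Direct sum decompositions\<close>

context cspace
begin

lemma dsdD:
 assumes "direct_sum_decomp V U A C"
 shows "csub A V" "csub C V" "U = {a \<oplus> c | a c. a : A & c : C}"
  "A \<inter> C = {\<zero>}"
 using assms by (auto simp: direct_sum_decomp_def set_add_def')

lemma dsdI:
 assumes "csub A V" "csub C V"
  "!!u. u : U ==> \<exists>a\<in>A. \<exists>c\<in>C. u = a \<oplus> c" "!!a c. a : A ==> c : C ==> a \<oplus> c : U"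
  "!!x. x : A ==> x : C ==> x = \<zero>"
 shows "direct_sum_decomp V U A C"
proof -
 have "U = A <+> C" unfolding set_add_def' using assms(3,4) by blast
 moreover have "A \<inter> C = {\<zero>}" using assms(5) subspaceD(3)[OF assms(1)] subspaceD(3)[OF assms(2)] by blast
 ultimately show ?thesis using assms(1,2) by (simp add: direct_sum_decomp_def)
qed

lemma dsd_obtain:
 assumes "direct_sum_decomp V U A C" "u : U"
 obtains a c where "a : A" "c : C" "u = a \<oplus> c"
 using dsdD[OF assms(1)] assms(2) by blast

lemma dsd_mem:
 assumes "direct_sum_decomp V U A C"
 shows "a : A ==> c : C ==> a \<oplus> c : U" "a : A ==> a : U" "c : C ==> c : U"
proof -
 note d = dsdD[OF assms]
 show *: "a \<oplus> c : U" if "a : A" "c : C" for a c using d(3) that by blast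
 show "a : U" if "a : A" using *[OF that subspaceD(3)[OF d(2)]] subspaceD(2)[OF d(1) that] by simp
 show "c : U" if "c : C" using *[OF subspaceD(3)[OF d(1)] that] subspaceD(2)[OF d(2) that] by simp
qed

lemma dsd_unique:
 assumes "direct_sum_decomp V U A C" "a : A" "a' : A" "c : C" "c' : C" "a \<oplus> c = a' \<oplus> c'"
 shows "a = a'" "c = c'"
proof -
 note d = dsdD[OF assms(1)]
 have cl: "a : carrier V" "a' : carrier V" "c : carrier V" "c' : carrier V"
  using assms subspaceD(2)[OF d(1)] subspaceD(2)[OF d(2)] by auto
 have "a \<ominus> a' = c' \<ominus> c"
 proof -
  have "a \<ominus> a' = (a \<oplus> c) \<oplus> (\<ominus> c \<oplus> \<ominus> a')" using cl by (simp add: a_minus_def a_assoc r_neg2)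
  also have "... = (c' \<oplus> a') \<oplus> (\<ominus> a' \<oplus> \<ominus> c)" using cl unfolding assms(6) by (simp add: a_comm)
  also have "... = c' \<ominus> c" using cl by (simp add: a_minus_def a_assoc r_neg2)
  finally show ?thesis .
 qed
 then have "a \<ominus> a' : A \<inter> C"
  using subspace_minus[OF d(1) assms(2,3)] subspace_minus[OF d(2) assms(5,4)] by simp
 then show "a = a'" using d(4) cl by simp
 then show "c = c'" using assms(6) cl by simp
qed

lemma dsd_swap:
 assumes "direct_sum_decomp V U A C"
 shows "direct_sum_decomp V U C A"
proof -
 note d = dsdD[OF assms]
 have "a \<oplus> c = c \<oplus> a" if "a : A" "c : C" for a c
  using that subspaceD(2)[OF d(1)] subspaceD(2)[OF d(2)] a_comm by simp
 note cm = this
 show ?thesis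
 proof (rule dsdI[OF d(2,1)])
  show "\<exists>a\<in>C. \<exists>c\<in>A. u = a \<oplus> c" if "u : U" for u using dsd_obtain[OF assms that] cm by metis
  show "a \<oplus> c : U" if "a : C" "c : A" for a c using dsd_mem(1)[OF assms that(2,1)] cm[OF that(2,1)] by simp
  show "x = \<zero>" if "x : C" "x : A" for x using d(4) that by blast
 qed
qed

lemma dsd_subspace:
 assumes "direct_sum_decomp V U A C"
 shows "csub U V"
proof (rule subspaceI)
 note d = dsdD[OF assms]
 note A = subspaceD[OF d(1)] and C = subspaceD[OF d(2)]
 show "U <= carrier V" using d(3) A C by auto
 show "\<zero> : U" using dsd_mem(2)[OF assms A(3)] .
 fix x assume x: "x : U"
 then obtain a c where ac: "a : A" "c : C" "x = a \<oplus> c" by (rule dsd_obtain[OF assms])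
 show "k \<odot> x : U" for k
  using dsd_mem(1)[OF assms A(5)[OF ac(1)] C(5)[OF ac(2)], of k k] ac A C by (simp add: sm_add_right)
 fix y assume "y : U"
 then obtain a' c' where ac': "a' : A" "c' : C" "y = a' \<oplus> c'" by (rule dsd_obtain[OF assms])
 have "x \<oplus> y = (a \<oplus> a') \<oplus> (c \<oplus> c')" using ac ac' A(2) C(2) by (simp add: a_ac)
 then show "x \<oplus> y : U" using dsd_mem(1)[OF assms A(4) C(4)] ac ac' by simp
qed

lemma dsd_proj:
 assumes "direct_sum_decomp V U A C"
 obtains p where "clin (V\<lparr>carrier := U\<rparr>) V p" "!!u. u : U ==> p u : A" "!!a. a : A ==> p a = a"
  "!!c. c : C ==> p c = \<zero>"
proof -
 note d = dsdD[OF assms]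
 note A = subspaceD[OF d(1)] and C = subspaceD[OF d(2)]
 define p where "p u = (THE a. a : A & (\<exists>c\<in>C. u = a \<oplus> c))" for u
 have p: "p (a \<oplus> c) = a" if "a : A" "c : C" for a c
  unfolding p_def using that dsd_unique(1)[OF assms] by (intro the_equality) blast+
 have pA: "p a = a" if "a : A" for a using p[OF that C(3)] A(2)[OF that] by simp
 have pC: "p c = \<zero>" if "c : C" for c using p[OF A(3) that] C(2)[OF that] by simp
 have pU: "p u : A" if "u : U" for u using dsd_obtain[OF assms that] p by metis
 have "clin (V\<lparr>carrier := U\<rparr>) V p"
 proof (intro clin.intro clin_axioms.intro subspace_cspace[OF dsd_subspace[OF assms]] cspace_axioms lin_mapI)
  fix x assume "x : carrier (V\<lparr>carrier := U\<rparr>)"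
  then have x: "x : U" by simp
  then show "p x : carrier V" using pU A(2) by blast
  obtain a c where ac: "a : A" "c : C" "x = a \<oplus> c" using x by (rule dsd_obtain[OF assms])
  have "k \<odot> x = k \<odot> a \<oplus> k \<odot> c" for k using ac A(2) C(2) by (simp add: sm_add_right)
  then show "p (k \<odot>\<^bsub>V\<lparr>carrier := U\<rparr>\<^esub> x) = k \<odot> p x" for k using p ac A(5) C(5) by simp
  fix y assume "y : carrier (V\<lparr>carrier := U\<rparr>)"
  then have y: "y : U" by simp
  obtain a' c' where ac': "a' : A" "c' : C" "y = a' \<oplus> c'" using y by (rule dsd_obtain[OF assms])
  have "x \<oplus> y = (a \<oplus> a') \<oplus> (c \<oplus> c')" using ac ac' A(2) C(2) by (simp add: a_ac)
  then show "p (x \<oplus>\<^bsub>V\<lparr>carrier := U\<rparr>\<^esub> y) = p x \<oplus> p y" using p ac ac' A(4) C(4) by simp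
 qed
 then show ?thesis using that pA pC pU by blast
qed

text \<open>Tensoring with the identity of B takes an endomorphism of all of L, so the projection
  onto A must be defined on the whole space; D is a further complement on which it is made to
  vanish.\<close>

lemma dsd_proj_total:
 assumes "direct_sum_decomp V (carrier V) U D" "direct_sum_decomp V U A C"
 obtains p where "clin V V p" "!!u. u : carrier V ==> p u : A" "!!a. a : A ==> p a = a"
  "!!c. c : C ==> p c = \<zero>" "!!x. x : D ==> p x = \<zero>"
proof -
 obtain q where q: "clin V V q" "!!u. u : carrier V ==> q u : U" "!!a. a : U ==> q a = a"
  "!!c. c : D ==> q c = \<zero>"
  by (rule dsd_proj[OF assms(1)]) auto
 obtain p where p: "clin (V\<lparr>carrier := U\<rparr>) V p" "!!u. u : U ==> p u : A" "!!a. a : A ==> p a = a"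
  "!!c. c : C ==> p c = \<zero>"
  by (rule dsd_proj[OF assms(2)]) auto
 interpret q: clin V V q by fact
 interpret p: clin "V\<lparr>carrier := U\<rparr>" V p by fact
 have "clin V (V\<lparr>carrier := U\<rparr>) q"
  using q(2) q.add q.sm
  by (intro clin.intro clin_axioms.intro lin_mapI cspace_axioms p.V.cspace_axioms) auto
 from clin_comp[OF this p(1)] show ?thesis
  using that[of "%x. p (q x)"] q(2-4) p(2-4) dsd_mem(2,3)[OF assms(2)] p.zero by simp
qed

end


section \<open>Lie superalgebras\<close>

locale lsa = fixes L :: "'g lie_super" (structure)
 assumes lie: "lie_superalgebra L"

sublocale lsa \<subseteq> cspace L
 using lie by (intro cspace.intro) (simp add: lie_superalgebra_def)

context lsa
begin

lemma br_lin: "x : carrier L ==> clin L L (bracket L x)" "y : carrier L ==> clin L L (%x. bracket L x y)"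
 using lie by (auto intro!: clin.intro clin_axioms.intro cspace_axioms simp: lie_superalgebra_def bilinear_map_def)

lemma br_closed [simp]: "x : carrier L ==> y : carrier L ==> bracket L x y : carrier L"
 using clin.closed[OF br_lin(1)] .

lemmas br_add_right = clin.add[OF br_lin(1)] and br_smult_right = clin.sm[OF br_lin(1)]
 and br_zero_right = clin.zero[OF br_lin(1)]
 and br_add_left = clin.add[OF br_lin(2)] and br_smult_left = clin.sm[OF br_lin(2)]
 and br_zero_left = clin.zero[OF br_lin(2)]

lemma hpart_dsd: "direct_sum_decomp L (carrier L) (hpart L 0) (hpart L 1)"
 using lie by (simp add: lie_superalgebra_def)

lemma hpart_subspace: "csub (hpart L p) L"
 using dsdD[OF hpart_dsd] by (cases p) auto

lemma hpart_closed: "x : hpart L p ==> x : carrier L"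
 using subspaceD(2)[OF hpart_subspace] .

lemma br_hpart: "x : hpart L p ==> y : hpart L q ==> bracket L x y : hpart L (p + q)"
 using lie unfolding lie_superalgebra_def by blast

lemma br_antisym: "x : hpart L p ==> y : hpart L q ==> bracket L x y = (- ssign p q) \<odot> bracket L y x"
 using lie unfolding lie_superalgebra_def by blast

lemma br_jacobi: "x : hpart L p ==> y : hpart L q ==> z : carrier L ==> bracket L x (bracket L y z) =
  bracket L (bracket L x y) z \<oplus> ssign p q \<odot> bracket L y (bracket L x z)"
 using lie unfolding lie_superalgebra_def by blast

end

lemma bilinear_mapI:
 assumes "cspace U" "cspace V" "cspace W" "!!u. u : carrier U ==> clin V W (f u)"
  "!!v. v : carrier V ==> clin U W (%u. f u v)"
 shows "bilinear_map U V W f"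
 using assms by (auto simp: bilinear_map_def clin_def clin_axioms_def)

lemma bilinear_mapD:
 assumes "cspace U" "cspace V" "cspace W" "bilinear_map U V W f"
 shows "u : carrier U ==> clin V W (f u)" "v : carrier V ==> clin U W (%u. f u v)"
 using assms by (auto simp: bilinear_map_def clin_def clin_axioms_def)

lemma tensor_map:
 assumes "clin L L' f" "clin B B' g"
 obtains h where "clin (tensor L B) (tensor L' B') h"
  "!!x b. x : carrier L ==> b : carrier B ==> h (ptn L B x b) = ptn L' B' (f x) (g b)"
proof -
 interpret f: clin L L' f by fact
 interpret g: clin B B' g by fact
 interpret T: ctensor L B by unfold_locales
 interpret T': ctensor L' B' by unfold_locales
 have "bilinear_map L B (tensor L' B') (%x b. ptn L' B' (f x) (g b))"
  unfolding bilinear_map_def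
  by (auto intro!: lin_mapI simp: f.add f.sm g.add g.sm T'.pure_tensor_add_left
    T'.pure_tensor_add_right T'.pure_tensor_smult_left T'.pure_tensor_smult_right)
 from T.tensor_lift[OF T'.T.cspace_axioms this] that show ?thesis by blast
qed


section \<open>Current superalgebras\<close>

lemma current_simps:
 "carrier (current L B) = carrier (tensor L B)" "add (current L B) = add (tensor L B)"
 "zero (current L B) = zero (tensor L B)" "module.smult (current L B) = module.smult (tensor L B)"
 by (simp_all add: current_def module.defs lie_super.defs)

lemma current_hpart_raw:
 "hpart (current L B) p = vspan (tensor L B) {ptn L B x b | x b. x : hpart L p & b : carrier B}"
 by (simp_all add: current_def module.defs lie_super.defs)

lemma current_bracket_raw:
 "bracket (current L B) X Y = (\<Union>f\<in>X. \<Union>g\<in>Y.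
    tensor_null L B +>\<^bsub>free_space (carrier L \<times> carrier B)\<^esub>
     bilin_ext (%(x, a) (y, b). (bracket L x y, a \<otimes>\<^bsub>B\<^esub> b)) f g)"
 by (simp_all add: current_def module.defs lie_super.defs)

lemma algebra_cspace: "algebra CC B ==> cspace B"
 by (intro cspace.intro) (simp add: vectorspace_def class_field algebra.module)

locale clie_current = lsa L + al: algebra CC B for L :: "'g lie_super" and B :: "(complex, 'b) module"
begin

sublocale ctensor L B
 by (intro ctensor.intro cspace_axioms algebra_cspace al.algebra_axioms)

lemma current_cspace: "cspace (current L B)"
 by (rule cspace_cong[OF _ _ _ _ T.cspace_axioms]) (simp_all add: current_simps)

sublocale C: cspace "current L B"
 by (rule current_cspace)

lemma current_sub_tensor: "S <= carrier L ==>
  current_sub L B S = vspan (tensor L B) {ptn L B x b | x b. x : S & b : carrier B}"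
 unfolding current_sub_def
 by (rule vspan_cong[OF _ _ _ _ current_cspace]) (auto simp: current_simps)

lemma pures_closed: "S <= carrier L ==>
  {ptn L B x b | x b. x : S & b : carrier B} <= carrier (current L B)"
 by (auto simp: current_simps)

lemma current_sub_subspace: "S <= carrier L ==> csub (current_sub L B S) (current L B)"
 unfolding current_sub_def by (rule C.span_subspace[OF pures_closed])

lemma current_sub_closed: "S <= carrier L ==> x : current_sub L B S ==> x : carrier (current L B)"
 using C.subspaceD(2)[OF current_sub_subspace] .

lemma current_sub_pure: "S <= carrier L ==> x : S ==> b : carrier B ==> ptn L B x b : current_sub L B S"
 unfolding current_sub_def by (rule C.span_incl[OF pures_closed]) auto

lemma current_sub_induct [consumes 2, case_names zero add smult base]:
 assumes "x : current_sub L B S" "S <= carrier L" "P \<zero>\<^bsub>current L B\<^esub>"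
  "!!x y. x : carrier (current L B) ==> y : carrier (current L B) ==> P x ==> P y ==> P (x \<oplus>\<^bsub>current L B\<^esub> y)"
  "!!c x. x : carrier (current L B) ==> P x ==> P (c \<odot>\<^bsub>current L B\<^esub> x)"
  "!!x b. x : S ==> b : carrier B ==> P (ptn L B x b)"
 shows "P x"
 using assms(1)[unfolded current_sub_def] pures_closed[OF assms(2)]
 by (induction rule: C.span_induct) (use assms(3-) in auto)

lemma current_sub_least:
 assumes "S <= carrier L" "csub U (current L B)"
  "!!x b. x : S ==> b : carrier B ==> ptn L B x b : U"
 shows "current_sub L B S <= U"
 unfolding current_sub_def using assms by (intro C.span_least) auto

lemma current_sub_carrier: "current_sub L B (carrier L) = carrier (current L B)"
 using current_sub_tensor[of "carrier L"] tensor_span by (simp add: current_simps)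

lemma current_hpart: "hpart (current L B) p = current_sub L B (hpart L p)"
 using current_sub_tensor[of "hpart L p"] hpart_closed by (auto simp: current_hpart_raw)

lemma current_sub_mono: "S <= T ==> current_sub L B S <= current_sub L B T"
 unfolding current_sub_def by (rule C.span_mono) auto

lemma clin_tensor_current: "clin (tensor L B) U f \<longleftrightarrow> clin (current L B) U f"
 using T.cspace_axioms C.cspace_axioms
 by (auto simp: clin_def clin_axioms_def LinearCombinations.module_hom_def current_simps)

lemma clin_tensor_current': "clin U (tensor L B) f \<longleftrightarrow> clin U (current L B) f"
 using T.cspace_axioms C.cspace_axioms
 by (auto simp: clin_def clin_axioms_def LinearCombinations.module_hom_def current_simps)

abbreviation br_words where
 "br_words \<equiv> bilin_ext (%(x, a) (y, b). (bracket L x y, a \<otimes>\<^bsub>B\<^esub> b))"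

abbreviation FS where "FS \<equiv> free_space (carrier L \<times> carrier B)"

lemma br_words_clin: "g : carrier FS ==> clin FS (tensor L B) (%f. cls (br_words f g))"
 by (rule clin_comp[OF _ cls_clin], rule bilin_ext_clin) auto

lemma br_words_clin_right: "f : carrier FS ==> clin FS (tensor L B) (%g. cls (br_words f g))"
 by (rule clin_comp[OF _ cls_clin], rule bilin_ext_clin_right) auto

text \<open>For g a single pair (y, b), the map in the first argument comes from the bilinear map
  sending (x, a) to [x, y] \<otimes> ab, so it kills the null space; general g follow by linearity
  in g.\<close>

lemma br_words_null_left:
 assumes "n : tensor_null L B" "g : carrier FS"
 shows "cls (br_words n g) = \<zero>\<^bsub>tensor L B\<^esub>"
proof -
 have n: "n : carrier FS" using assms F.subspaceD(2)[OF tensor_null_subspace] by blast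
 interpret r: clin FS "tensor L B" "%g. cls (br_words n g)" by (rule br_words_clin_right[OF n])
 have sp: "g : vspan FS {sgl x 1 | x. x : carrier L \<times> carrier B}"
  using assms free_space_span by blast
  have "cls (br_words n (sgl (y, b) 1)) = \<zero>\<^bsub>tensor L B\<^esub>"
   if "y : carrier L" "b : carrier B" for y b
  proof (rule kills_tensor_null[OF br_words_clin _ _ assms(1)])
   show "bilinear_map L B (tensor L B) (%x a. ptn L B (bracket L x y) (a \<otimes>\<^bsub>B\<^esub> b))"
    unfolding bilinear_map_def using that
    by (auto intro!: lin_mapI simp: br_add_left br_smult_left al.l_distr al.smult_assoc2
     pure_tensor_add_left pure_tensor_add_right pure_tensor_smult_left pure_tensor_smult_right)
  qed (use that in \<open>auto simp: bilin_ext_single_right pure_tensor_def\<close>)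
 then have base: "cls (br_words n x) : {\<zero>\<^bsub>tensor L B\<^esub>}"
  if "x : {sgl x 1 | x. x : carrier L \<times> carrier B}" for x
  using that by auto
 have sub: "{sgl x 1 | x. x : carrier L \<times> carrier B} <= carrier FS" by auto
 show ?thesis using r.span_into[OF sub T.subspace_zero base sp] by simp
qed

lemma br_words_null_right:
 assumes "n : tensor_null L B" "f : carrier FS"
 shows "cls (br_words f n) = \<zero>\<^bsub>tensor L B\<^esub>"
proof -
 have n: "n : carrier FS" using assms F.subspaceD(2)[OF tensor_null_subspace] by blast
 interpret r: clin FS "tensor L B" "%f. cls (br_words f n)" by (rule br_words_clin[OF n])
 have sp: "f : vspan FS {sgl x 1 | x. x : carrier L \<times> carrier B}"
  using assms free_space_span by blast
  have "cls (br_words (sgl (y, b) 1) n) = \<zero>\<^bsub>tensor L B\<^esub>"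
   if "y : carrier L" "b : carrier B" for y b
  proof (rule kills_tensor_null[OF br_words_clin_right _ _ assms(1)])
   have a2: "b \<otimes>\<^bsub>B\<^esub> (c \<odot>\<^bsub>B\<^esub> a) = c \<odot>\<^bsub>B\<^esub> (b \<otimes>\<^bsub>B\<^esub> a)" if "a : carrier B" for a c
    using al.smult_assoc2[of c a b] \<open>b : carrier B\<close> that by (simp add: al.m_comm)
   show "bilinear_map L B (tensor L B) (%x a. ptn L B (bracket L y x) (b \<otimes>\<^bsub>B\<^esub> a))"
    unfolding bilinear_map_def using that
    by (auto intro!: lin_mapI simp: br_add_right br_smult_right al.r_distr a2
     pure_tensor_add_left pure_tensor_add_right pure_tensor_smult_left pure_tensor_smult_right)
  qed (use that in \<open>auto simp: bilin_ext_single_left pure_tensor_def\<close>)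
 then have base: "cls (br_words x n) : {\<zero>\<^bsub>tensor L B\<^esub>}"
  if "x : {sgl x 1 | x. x : carrier L \<times> carrier B}" for x
  using that by auto
 have sub: "{sgl x 1 | x. x : carrier L \<times> carrier B} <= carrier FS" by auto
 show ?thesis using r.span_into[OF sub T.subspace_zero base sp] by simp
qed

text \<open>The definition runs over representatives of both cosets. The two vanishing lemmas make
  the value independent of the second representative and then of the first.\<close>

lemma current_bracket_cls:
 assumes f: "f : carrier FS" and g: "g : carrier FS"
 shows "bracket (current L B) (cls f) (cls g) = cls (br_words f g)"
proof -
 have g': "(\<Union>g'\<in>cls g. cls (br_words f' g')) = cls (br_words f' g)" if f': "f' : carrier FS" for f'
 proof (rule F.coset_UN[OF tensor_null_subspace g])
  fix y assume y: "y : carrier FS" "y \<ominus>\<^bsub>FS\<^esub> g : tensor_null L B"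
  interpret r: clin FS "tensor L B" "%g. cls (br_words f' g)" by (rule br_words_clin_right[OF f'])
  have "cls (br_words f' y) \<ominus>\<^bsub>tensor L B\<^esub> cls (br_words f' g) = \<zero>\<^bsub>tensor L B\<^esub>"
   using r.minus[OF y(1) g] br_words_null_right[OF y(2) f'] by simp
  then show "cls (br_words f' y) = cls (br_words f' g)"
   using T.minus_eq_zero_iff r.closed[OF y(1)] r.closed[OF g] by blast
 qed
 have "(\<Union>f'\<in>cls f. \<Union>g'\<in>cls g. cls (br_words f' g')) = (\<Union>g'\<in>cls g. cls (br_words f g'))"
 proof (rule F.coset_UN[OF tensor_null_subspace f])
  fix y assume y: "y : carrier FS" "y \<ominus>\<^bsub>FS\<^esub> f : tensor_null L B"
  interpret r: clin FS "tensor L B" "%f. cls (br_words f g)" by (rule br_words_clin[OF g])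
  have "cls (br_words y g) \<ominus>\<^bsub>tensor L B\<^esub> cls (br_words f g) = \<zero>\<^bsub>tensor L B\<^esub>"
   using r.minus[OF y(1) f] br_words_null_left[OF y(2) g] by simp
  then have "cls (br_words y g) = cls (br_words f g)"
   using T.minus_eq_zero_iff r.closed[OF y(1)] r.closed[OF f] by blast
  then show "(\<Union>g'\<in>cls g. cls (br_words y g')) = (\<Union>g'\<in>cls g. cls (br_words f g'))"
   unfolding g'[OF y(1)] g'[OF f] .
 qed
 then show ?thesis unfolding current_bracket_raw g'[OF f] .
qed

lemma current_bracket_pure:
 assumes "x : carrier L" "y : carrier L" "a : carrier B" "b : carrier B"
 shows "bracket (current L B) (ptn L B x a) (ptn L B y b) =
  ptn L B (bracket L x y) (a \<otimes>\<^bsub>B\<^esub> b)"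
 unfolding pure_tensor_def using assms
 by (subst current_bracket_cls) (auto simp: bilin_ext_single_left)

lemma current_bracket_bilinear:
 "X : carrier (current L B) ==> clin (current L B) (current L B) (bracket (current L B) X)"
 "Y : carrier (current L B) ==> clin (current L B) (current L B) (%X. bracket (current L B) X Y)"
proof -
 interpret c: clin FS "tensor L B" cls by (rule cls_clin)
 { fix X assume "X : carrier (current L B)"
  then obtain f where f: "f : carrier FS" "X = cls f" unfolding current_simps tensor_carrier by blast
  interpret r: clin FS "tensor L B" "%g. cls (br_words f g)" by (rule br_words_clin_right[OF f(1)])
  have "clin (tensor L B) (tensor L B) (bracket (current L B) X)"
  proof (intro clin.intro clin_axioms.intro lin_mapI T.cspace_axioms)
   fix x assume "x : carrier (tensor L B)"
   then obtain g where g: "g : carrier FS" "x = cls g" unfolding tensor_carrier by blast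
   show "bracket (current L B) X x : carrier (tensor L B)"
    using r.closed[OF g(1)] by (simp only: f(2) g(2) current_bracket_cls[OF f(1) g(1)])
   have "bracket (current L B) X (k \<odot>\<^bsub>tensor L B\<^esub> x) = k \<odot>\<^bsub>tensor L B\<^esub> bracket (current L B) X x" for k
    using r.sm[OF g(1), of k] c.sm[OF g(1), of k] current_bracket_cls[OF f(1) g(1)]
     current_bracket_cls[OF f(1) F.sm_closed[OF g(1)], of k] f g by metis
   then show "bracket (current L B) X (k \<odot>\<^bsub>tensor L B\<^esub> x) = k \<odot>\<^bsub>tensor L B\<^esub> bracket (current L B) X x" for k .
   fix y assume "y : carrier (tensor L B)"
   then obtain g' where g': "g' : carrier FS" "y = cls g'" unfolding tensor_carrier by blast
   show "bracket (current L B) X (x \<oplus>\<^bsub>tensor L B\<^esub> y) = bracket (current L B) X x \<oplus>\<^bsub>tensor L B\<^esub> bracket (current L B) X y"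
    using r.add[OF g(1) g'(1)] c.add[OF g(1) g'(1)] current_bracket_cls[OF f(1) g(1)] current_bracket_cls[OF f(1) g'(1)]
     current_bracket_cls[OF f(1) F.add.m_closed[OF g(1) g'(1)]] f(2) g(2) g'(2) by metis
  qed
  then show "clin (current L B) (current L B) (bracket (current L B) X)"
   by (simp flip: clin_tensor_current clin_tensor_current') }
 { fix Y assume "Y : carrier (current L B)"
  then obtain f where f: "f : carrier FS" "Y = cls f" unfolding current_simps tensor_carrier by blast
  interpret r: clin FS "tensor L B" "%g. cls (br_words g f)" by (rule br_words_clin[OF f(1)])
  have "clin (tensor L B) (tensor L B) (%X. bracket (current L B) X Y)"
  proof (intro clin.intro clin_axioms.intro lin_mapI T.cspace_axioms)
   fix x assume "x : carrier (tensor L B)"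
   then obtain g where g: "g : carrier FS" "x = cls g" unfolding tensor_carrier by blast
   show "bracket (current L B) x Y : carrier (tensor L B)"
    using r.closed[OF g(1)] by (simp only: f(2) g(2) current_bracket_cls[OF g(1) f(1)])
   show "bracket (current L B) (k \<odot>\<^bsub>tensor L B\<^esub> x) Y = k \<odot>\<^bsub>tensor L B\<^esub> bracket (current L B) x Y" for k
    using r.sm[OF g(1), of k] c.sm[OF g(1), of k] current_bracket_cls[OF g(1) f(1)]
     current_bracket_cls[OF F.sm_closed[OF g(1)] f(1), of k] f g by metis
   fix y assume "y : carrier (tensor L B)"
   then obtain g' where g': "g' : carrier FS" "y = cls g'" unfolding tensor_carrier by blast
   show "bracket (current L B) (x \<oplus>\<^bsub>tensor L B\<^esub> y) Y = bracket (current L B) x Y \<oplus>\<^bsub>tensor L B\<^esub> bracket (current L B) y Y"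
    using r.add[OF g(1) g'(1)] c.add[OF g(1) g'(1)] current_bracket_cls[OF g(1) f(1)] current_bracket_cls[OF g'(1) f(1)]
     current_bracket_cls[OF F.add.m_closed[OF g(1) g'(1)] f(1)] f(2) g(2) g'(2) by metis
  qed
  then show "clin (current L B) (current L B) (%X. bracket (current L B) X Y)"
   by (simp flip: clin_tensor_current clin_tensor_current') }
qed

text \<open>Bilinearity in two stages: for a pure first argument, the second arguments with bracket
  in U[B] form a subspace containing the pure tensors over T; then the same in the first
  argument.\<close>

lemma current_sub_bracket:
 assumes S: "S <= carrier L" and T: "T <= carrier L" and U: "U <= carrier L"
  and br: "!!x y. x : S ==> y : T ==> bracket L x y : U"
  and X: "X : current_sub L B S" and Y: "Y : current_sub L B T"
 shows "bracket (current L B) X Y : current_sub L B U"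
proof -
 note Us = current_sub_subspace[OF U]
 have 1: "bracket (current L B) (ptn L B x a) Y : current_sub L B U" if "x : S" "a : carrier B" for x a
 proof -
  have p: "ptn L B x a : carrier (current L B)" using that S by (auto simp: current_simps)
  have "current_sub L B T <= {Y : carrier (current L B). bracket (current L B) (ptn L B x a) Y : current_sub L B U}"
   by (rule current_sub_least[OF T clin.subspace_vimage[OF current_bracket_bilinear(1)[OF p] Us]])
    (use that S T U br current_sub_pure[OF U] in \<open>auto simp: current_bracket_pure subset_iff current_simps\<close>)
  then show ?thesis using Y by blast
 qed
 have Yc: "Y : carrier (current L B)" using current_sub_closed[OF T Y] .
 have "current_sub L B S <= {X : carrier (current L B). bracket (current L B) X Y : current_sub L B U}"
  by (rule current_sub_least[OF S clin.subspace_vimage[OF current_bracket_bilinear(2)[OF Yc] Us]])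
   (use 1 S in \<open>auto simp: current_simps\<close>)
 then show ?thesis using X by blast
qed

lemma current_sub_sum:
 assumes "csub S L" "csub T L"
  "!!u. u : U ==> \<exists>s\<in>S. \<exists>t\<in>T. u = s \<oplus>\<^bsub>L\<^esub> t" "U <= carrier L" "X : current_sub L B U"
 shows "\<exists>Y\<in>current_sub L B S. \<exists>Z\<in>current_sub L B T. X = Y \<oplus>\<^bsub>current L B\<^esub> Z"
proof -
 have S: "S <= carrier L" and T: "T <= carrier L" using assms(1,2) subspaceD by blast+
 note Ss = C.subspaceD[OF current_sub_subspace[OF S]] and Ts = C.subspaceD[OF current_sub_subspace[OF T]]
 from assms(5,4) show ?thesis
 proof (induction rule: current_sub_induct)
  case zero
  then show ?case using Ss(3) Ts(3) by (intro bexI[of _ "\<zero>\<^bsub>current L B\<^esub>"]) auto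
 next
  case (add x y)
  then obtain a b a' b' where h: "a : current_sub L B S" "b : current_sub L B T" "x = a \<oplus>\<^bsub>current L B\<^esub> b"
   "a' : current_sub L B S" "b' : current_sub L B T" "y = a' \<oplus>\<^bsub>current L B\<^esub> b'" by blast
  have "x \<oplus>\<^bsub>current L B\<^esub> y = (a \<oplus>\<^bsub>current L B\<^esub> a') \<oplus>\<^bsub>current L B\<^esub> (b \<oplus>\<^bsub>current L B\<^esub> b')"
   using h Ss(2) Ts(2) by (simp add: C.a_ac)
  then show ?case using h Ss(4) Ts(4) by blast
 next
  case (smult c x)
  then obtain a b where h: "a : current_sub L B S" "b : current_sub L B T" "x = a \<oplus>\<^bsub>current L B\<^esub> b" by blast
  then have "c \<odot>\<^bsub>current L B\<^esub> x = c \<odot>\<^bsub>current L B\<^esub> a \<oplus>\<^bsub>current L B\<^esub> c \<odot>\<^bsub>current L B\<^esub> b"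
   using Ss(2) Ts(2) by (simp add: C.sm_add_right)
  then show ?case using h Ss(5) Ts(5) by blast
 next
  case (base x b)
  then obtain s t where st: "s : S" "t : T" "x = s \<oplus>\<^bsub>L\<^esub> t" using assms(3) by blast
  then have "ptn L B x b = ptn L B s b \<oplus>\<^bsub>current L B\<^esub> ptn L B t b"
   using base S T by (auto simp: current_simps pure_tensor_add_left subset_iff)
  then show ?case using st base current_sub_pure[OF S] current_sub_pure[OF T] by blast
 qed
qed

text \<open>Tensoring q with the identity of B gives a map that is the identity on S[B] and zero on
  T[B], so an element of both vanishes. No basis of B has to be chosen.\<close>

lemma current_sub_disjoint:
 assumes "clin L L q" "!!x. x : S ==> q x = x" "!!x. x : T ==> q x = \<zero>\<^bsub>L\<^esub>"
  "S <= carrier L" "T <= carrier L" "X : current_sub L B S" "X : current_sub L B T"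
 shows "X = \<zero>\<^bsub>current L B\<^esub>"
proof -
 have "clin B B (%b. b)" by (intro clin.intro clin_axioms.intro lin_mapI B.cspace_axioms) auto
 then obtain h where h: "clin (tensor L B) (tensor L B) h"
  "!!x b. x : carrier L ==> b : carrier B ==> h (ptn L B x b) = ptn L B (q x) b"
  by (rule tensor_map[OF assms(1)]) auto
 have hc: "clin (current L B) (current L B) h"
  using h(1) by (simp add: clin_tensor_current clin_tensor_current')
 interpret h: clin "current L B" "current L B" h by fact
 have "h X = X"
  using assms(6,4)
  by (induction rule: current_sub_induct)
   (use assms h(2) in \<open>auto simp: h.add h.sm subset_iff\<close>)
 moreover have "h X = \<zero>\<^bsub>current L B\<^esub>"
  using assms(7,5)
 proof (induction rule: current_sub_induct)
  case (base x b)
  have "ptn L B \<zero>\<^bsub>L\<^esub> b = 0 \<odot>\<^bsub>tensor L B\<^esub> ptn L B \<zero>\<^bsub>L\<^esub> b"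
   using pure_tensor_smult_left[of "\<zero>\<^bsub>L\<^esub>" b 0] base by simp
  then show ?case using base assms(3,5) h(2) by (auto simp: current_simps)
 qed (auto simp: h.add h.sm)
 ultimately show ?thesis by simp
qed

lemma current_sub_dsd:
 assumes "direct_sum_decomp L (carrier L) U D" "direct_sum_decomp L U S T"
 shows "direct_sum_decomp (current L B) (current_sub L B U) (current_sub L B S) (current_sub L B T)"
proof -
 obtain q where q: "clin L L q" "!!a. a : S ==> q a = a" "!!c. c : T ==> q c = \<zero>\<^bsub>L\<^esub>"
  by (rule dsd_proj_total[OF assms]) auto
 note d = dsdD[OF assms(2)]
 have sub: "S <= carrier L" "T <= carrier L" "U <= carrier L" using subspaceD(1)[OF d(1)] subspaceD(1)[OF d(2)]
   subspaceD(1)[OF dsd_subspace[OF assms(2)]] by auto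
 show ?thesis
 proof (rule C.dsdI)
  show "\<exists>a\<in>current_sub L B S. \<exists>c\<in>current_sub L B T. u = a \<oplus>\<^bsub>current L B\<^esub> c" if "u : current_sub L B U" for u
   by (rule current_sub_sum[OF d(1,2) _ sub(3) that]) (use d(3) in blast)
  show "a \<oplus>\<^bsub>current L B\<^esub> c : current_sub L B U" if "a : current_sub L B S" "c : current_sub L B T" for a c
   using current_sub_mono[of S U] current_sub_mono[of T U] dsd_mem(2,3)[OF assms(2)] that
    C.subspaceD(4)[OF current_sub_subspace[OF sub(3)]] by blast
  show "x = \<zero>\<^bsub>current L B\<^esub>" if "x : current_sub L B S" "x : current_sub L B T" for x
   by (rule current_sub_disjoint[OF q sub(1,2) that])
 qed (intro current_sub_subspace sub)+
qed

text \<open>The trivial complement lets \<open>current_sub_dsd\<close> be applied to a decomposition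
  of the whole of L.\<close>

lemma dsd_carrier_zero: "direct_sum_decomp L (carrier L) (carrier L) {\<zero>\<^bsub>L\<^esub>}"
 by (rule dsdI) (auto simp: subspace_carrier subspace_zero intro!: bexI[of _ "\<zero>\<^bsub>L\<^esub>"])

text \<open>Both sides of antisymmetry and of the Jacobi identity are linear in each argument, so
  the solutions in one argument form a subspace and pure tensors suffice. There the identities are
  those of L, with equal coefficients in B because B is commutative and associative.\<close>

theorem current_lie_superalgebra: "lie_superalgebra (current L B)"
 unfolding lie_superalgebra_def
proof (intro conjI allI ballI)
 let ?br = "bracket (current L B)"
 note bl = current_bracket_bilinear
 have hc: "hpart L p <= carrier L" for p using hpart_closed by blast
 show "vectorspace CC (current L B)" by (rule C.vs)
 show "direct_sum_decomp (current L B) (carrier (current L B)) (hpart (current L B) 0) (hpart (current L B) 1)"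
  using current_sub_dsd[OF dsd_carrier_zero hpart_dsd] by (simp add: current_sub_carrier current_hpart)
 show "bilinear_map (current L B) (current L B) (current L B) ?br"
  by (intro bilinear_mapI bl C.cspace_axioms)
 fix p q X Y assume X: "X : hpart (current L B) p" and Y: "Y : hpart (current L B) q"
 note X' = X[unfolded current_hpart] and Y' = Y[unfolded current_hpart]
 have Xc: "X : carrier (current L B)" and Yc: "Y : carrier (current L B)"
  using X' Y' current_sub_closed[OF hc] by auto
 have brc: "?br A B' : carrier (current L B)" if "A : carrier (current L B)" "B' : carrier (current L B)" for A B'
  using clin.closed[OF bl(1)] that by blast
 show "?br X Y : hpart (current L B) (p + q)"
  unfolding current_hpart by (rule current_sub_bracket[OF hc hc hc br_hpart X' Y'])
 have pc: "ptn L B x b : carrier (current L B)" if "x : carrier L" "b : carrier B" for x b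
  using that by (simp add: current_simps)
 let ?s = "ssign p q"
 show "?br X Y = (- ssign p q) \<odot>\<^bsub>current L B\<^esub> ?br Y X"
 proof -
  have "csub {Y : carrier (current L B). ?br X Y = (- ?s) \<odot>\<^bsub>current L B\<^esub> ?br Y X} (current L B)"
   if "X : carrier (current L B)" for X
   using clin.add[OF bl(1)] clin.add[OF bl(2)] clin.sm[OF bl(1)] clin.sm[OF bl(2)] clin.zero[OF bl(1)] clin.zero[OF bl(2)] that brc
   by (intro C.subspaceI) (auto simp: C.sm_add_right mult.commute)
  note R = this
  have "csub {X : carrier (current L B). ?br X Y = (- ?s) \<odot>\<^bsub>current L B\<^esub> ?br Y X} (current L B)"
   if "Y : carrier (current L B)" for Y
   using clin.add[OF bl(1)] clin.add[OF bl(2)] clin.sm[OF bl(1)] clin.sm[OF bl(2)] clin.zero[OF bl(1)] clin.zero[OF bl(2)] that brc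
   by (intro C.subspaceI) (auto simp: C.sm_add_right mult.commute)
  note Le = this
  have pp: "?br (ptn L B x a) (ptn L B y b) = (- ?s) \<odot>\<^bsub>current L B\<^esub> ?br (ptn L B y b) (ptn L B x a)"
   if h: "x : hpart L p" "a : carrier B" "y : hpart L q" "b : carrier B" for x a y b
  proof -
   have c: "x : carrier L" "y : carrier L" using h hc by auto
   have "ptn L B (bracket L x y) (a \<otimes>\<^bsub>B\<^esub> b) = ptn L B ((- ?s) \<odot>\<^bsub>L\<^esub> bracket L y x) (b \<otimes>\<^bsub>B\<^esub> a)"
    using br_antisym[OF h(1,3)] al.m_comm[OF h(2,4)] by simp
   also have "... = (- ?s) \<odot>\<^bsub>current L B\<^esub> ptn L B (bracket L y x) (b \<otimes>\<^bsub>B\<^esub> a)"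
    unfolding current_simps using c h by (intro pure_tensor_smult_left) auto
   finally show ?thesis using c h by (simp add: current_bracket_pure)
  qed
  have "current_sub L B (hpart L q) <= {Y : carrier (current L B). ?br (ptn L B x a) Y = (- ?s) \<odot>\<^bsub>current L B\<^esub> ?br Y (ptn L B x a)}"
   if "x : hpart L p" "a : carrier B" for x a
   by (rule current_sub_least[OF hc R]) (use that pp pc in \<open>auto dest: hpart_closed\<close>)
  then have "current_sub L B (hpart L p) <= {X : carrier (current L B). ?br X Y = (- ?s) \<odot>\<^bsub>current L B\<^esub> ?br Y X}"
   using Y' Yc pc by (intro current_sub_least[OF hc Le]) (auto dest: hpart_closed)
  then show ?thesis using X' by blast
 qed
 fix Z assume Z: "Z : carrier (current L B)"
 show "?br X (?br Y Z) = ?br (?br X Y) Z \<oplus>\<^bsub>current L B\<^esub> ?s \<odot>\<^bsub>current L B\<^esub> ?br Y (?br X Z)"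
 proof -
  define J where "J X Y Z \<longleftrightarrow> ?br X (?br Y Z) = ?br (?br X Y) Z \<oplus>\<^bsub>current L B\<^esub> ?s \<odot>\<^bsub>current L B\<^esub> ?br Y (?br X Z)" for X Y Z
  note bs = clin.add[OF bl(1)] clin.add[OF bl(2)] clin.sm[OF bl(1)] clin.sm[OF bl(2)] clin.zero[OF bl(1)] clin.zero[OF bl(2)]
  \<comment> \<open>Solutions of the Jacobi identity in the third, second and first argument; pure
    tensors are replaced by general elements in this order.\<close>
  have S1: "csub {Z : carrier (current L B). J X Y Z} (current L B)"
   if "X : carrier (current L B)" "Y : carrier (current L B)" for X Y
   using bs that brc by (intro C.subspaceI) (auto simp: J_def C.sm_add_right C.a_ac mult.commute)
  have S2: "csub {Y : carrier (current L B). J X Y Z} (current L B)"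
   if "X : carrier (current L B)" "Z : carrier (current L B)" for X Z
   using bs that brc by (intro C.subspaceI) (auto simp: J_def C.sm_add_right C.a_ac mult.commute)
  have S3: "csub {X : carrier (current L B). J X Y Z} (current L B)"
   if "Y : carrier (current L B)" "Z : carrier (current L B)" for Y Z
   using bs that brc by (intro C.subspaceI) (auto simp: J_def C.sm_add_right C.a_ac mult.commute)
  have J0: "J (ptn L B x a) (ptn L B y b) (ptn L B z c)"
   if h: "x : hpart L p" "a : carrier B" "y : hpart L q" "b : carrier B" "z : carrier L" "c : carrier B" for x a y b z c
  proof -
   have e: "x : carrier L" "y : carrier L" using h hc by auto
   have "b \<otimes>\<^bsub>B\<^esub> (a \<otimes>\<^bsub>B\<^esub> c) = a \<otimes>\<^bsub>B\<^esub> (b \<otimes>\<^bsub>B\<^esub> c)" "a \<otimes>\<^bsub>B\<^esub> b \<otimes>\<^bsub>B\<^esub> c = a \<otimes>\<^bsub>B\<^esub> (b \<otimes>\<^bsub>B\<^esub> c)"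
    using h by (simp_all add: al.m_lcomm al.m_assoc)
   then show ?thesis
    using h e br_jacobi[OF h(1,3,5)]
    by (simp add: J_def current_bracket_pure) (simp add: current_simps pure_tensor_add_left pure_tensor_smult_left)
  qed
  have "current_sub L B (carrier L) <= {Z : carrier (current L B). J (ptn L B x a) (ptn L B y b) Z}"
   if "x : hpart L p" "a : carrier B" "y : hpart L q" "b : carrier B" for x a y b
   using J0 that pc by (intro current_sub_least[OF _ S1]) (auto dest: hpart_closed)
  then have J1: "J (ptn L B x a) (ptn L B y b) Z"
   if "x : hpart L p" "a : carrier B" "y : hpart L q" "b : carrier B" for x a y b
   using that Z unfolding current_sub_carrier by blast
  have "current_sub L B (hpart L q) <= {Y : carrier (current L B). J (ptn L B x a) Y Z}"
   if "x : hpart L p" "a : carrier B" for x a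
   using J1 that pc Z by (intro current_sub_least[OF hc S2]) (auto dest: hpart_closed)
  then have J2: "J (ptn L B x a) Y Z" if "x : hpart L p" "a : carrier B" for x a
   using that Y' by blast
  have "current_sub L B (hpart L p) <= {X : carrier (current L B). J X Y Z}"
   using J2 pc Z Yc by (intro current_sub_least[OF hc S3]) (auto dest: hpart_closed)
  then show ?thesis using X' unfolding J_def by blast
 qed
qed

end


section \<open>Creation and annihilation operators\<close>

text \<open>\<open>amp m T j\<close> is the coefficient of e_T \<otimes> n_j, where e_T is the
  product of the e_i with i in T in increasing order and n_j the j-th basis vector of N. All
  functions are allowed here; the bound on T is imposed by \<open>fock_supp\<close>.\<close>

datatype fock = Fock (amp: "nat set => nat => complex")

instantiation fock :: ab_group_add
begin
definition "0 = Fock (%T j. 0)"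
definition "m + m' = Fock (%T j. amp m T j + amp m' T j)"
definition "- m = Fock (%T j. - amp m T j)"
definition "m - m' = Fock (%T j. amp m T j - amp m' T j)"
instance
 by standard (simp_all add: zero_fock_def plus_fock_def uminus_fock_def minus_fock_def algebra_simps)
end

lemma amp_simps [simp]: "amp 0 T j = 0" "amp (m + m') T j = amp m T j + amp m' T j"
 "amp (- m) T j = - amp m T j" "amp (m - m') T j = amp m T j - amp m' T j"
 by (simp_all add: zero_fock_def plus_fock_def uminus_fock_def minus_fock_def)

lemma amp_sum [simp]: "amp (\<Sum>i\<in>I. f i) T j = (\<Sum>i\<in>I. amp (f i) T j)"
 by (induction I rule: infinite_finite_induct) auto

lemma amp_fun: "amp (m + m') T = (%j. amp m T j + amp m' T j)"
 by (simp add: fun_eq_iff)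

lemma fock_eqI: "(!!T j. amp m T j = amp m' T j) ==> m = m'"
 by (rule fock.expand) (simp add: fun_eq_iff)

definition scl :: "complex => fock => fock" where
 "scl c m = Fock (%T j. c * amp m T j)"

text \<open>The sign of moving e_i from the front to its place in the increasing product
  e_T.\<close>

definition shuffle_sign :: "nat => nat set => complex" where
 "shuffle_sign i T = (-1) ^ card {j : T. j < i}"

text \<open>Exterior multiplication by e_i from the left and, in the definition after it,
  contraction with the dual vector, both written on coefficients.\<close>

definition cre :: "nat => fock => fock" where
 "cre i m = Fock (%T j. if i : T then shuffle_sign i T * amp m (T - {i}) j else 0)"

definition ann :: "nat => fock => fock" where
 "ann i m = Fock (%T j. if i \<notin> T then shuffle_sign i T * amp m (insert i T) j else 0)"

definition vac :: "(nat => complex) => fock" where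
 "vac w = Fock (%T j. if T = {} then w j else 0)"

definition flin :: "(fock => fock) => bool" where
 "flin F \<longleftrightarrow> (\<forall>m m'. F (m + m') = F m + F m') & (\<forall>c m. F (scl c m) = scl c (F m))"

lemma amp_scl [simp]: "amp (scl c m) T j = c * amp m T j"
 by (simp add: scl_def)

lemma amp_scl_fun: "amp (scl c m) T = (%j. c * amp m T j)"
 by (simp add: fun_eq_iff)

lemma scl_simps [simp]: "scl 0 m = 0" "scl c 0 = 0" "scl 1 m = m" "scl a (scl b m) = scl (a * b) m"
 "scl (- c) m = - scl c m" "scl c (- m) = - scl c m"
 by (auto intro!: fock_eqI)

lemma scl_add_right: "scl c (m + m') = scl c m + scl c m'"
 and scl_add_left: "scl (a + b) m = scl a m + scl b m"
 and scl_diff_right: "scl c (m - m') = scl c m - scl c m'"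
 and scl_sum_right: "scl c (\<Sum>i\<in>I. f i) = (\<Sum>i\<in>I. scl c (f i))"
 by (auto intro!: fock_eqI simp: algebra_simps sum_distrib_left)

lemma flinD:
 assumes "flin F"
 shows "F (m + m') = F m + F m'" "F (scl c m) = scl c (F m)" "F 0 = 0" "F (- m) = - F m" "F (m - m') = F m - F m'"
  "F (\<Sum>i\<in>I. f i) = (\<Sum>i\<in>I. F (f i))"
proof -
 show a: "F (m + m') = F m + F m'" and s: "F (scl c m) = scl c (F m)" for c m m'
  using assms by (auto simp: flin_def)
 show z: "F 0 = 0" using s[of 0 0] by simp
 show n: "F (- m) = - F m" for m using s[of "-1" m] by simp
 show "F (m - m') = F m - F m'" using a[of m "- m'"] n by simp
 show "F (\<Sum>i\<in>I. f i) = (\<Sum>i\<in>I. F (f i))"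
  by (induction I rule: infinite_finite_induct) (auto simp: z a)
qed

lemma flinI: "(!!m m'. F (m + m') = F m + F m') ==> (!!c m. F (scl c m) = scl c (F m)) ==> flin F"
 by (simp add: flin_def)

lemma flin_cre: "flin (cre i)" and flin_ann: "flin (ann i)"
 by (auto intro!: flinI fock_eqI simp: cre_def ann_def algebra_simps)

lemma flin_scl: "flin F ==> flin (%m. scl c (F m))"
 by (simp add: flin_def scl_add_right mult.commute)

lemma flin_comp: "flin F ==> flin G ==> flin (%m. F (G m))"
 by (simp add: flin_def)

lemma flin_add: "flin F ==> flin G ==> flin (%m. F m + G m)"
 by (simp add: flin_def scl_add_right)

lemma flin_sum: "(!!i. i : I ==> flin (F i)) ==> flin (%m. \<Sum>i\<in>I. F i m)"
 by (simp add: flin_def sum.distrib scl_sum_right)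

lemma shuffle_sign_square [simp]: "shuffle_sign i T * shuffle_sign i T = 1" "shuffle_sign i T * (shuffle_sign i T * x) = x"
 by (simp_all add: shuffle_sign_def mult.assoc[symmetric] power_add[symmetric] flip: mult_2)

text \<open>T may be infinite: only its members below i are counted, and these are finitely
  many.\<close>

lemma shuffle_sign_insert:
 assumes "k \<notin> T"
 shows "shuffle_sign i (insert k T) = (if k < i then - shuffle_sign i T else shuffle_sign i T)"
proof (cases "k < i")
 case True
 then have "{j : insert k T. j < i} = insert k {j : T. j < i}" by auto
 moreover have "finite {j : T. j < i}" by (rule finite_subset[of _ "{..<i}"]) auto
 ultimately show ?thesis using True assms by (simp add: shuffle_sign_def)
next
 case False
 then have "{j : insert k T. j < i} = {j : T. j < i}" by auto
 then show ?thesis using False by (simp add: shuffle_sign_def)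
qed

lemma shuffle_sign_remove:
 assumes "k : T"
 shows "shuffle_sign i (T - {k}) = (if k < i then - shuffle_sign i T else shuffle_sign i T)"
 using shuffle_sign_insert[of k "T - {k}" i] assms by (simp add: insert_absorb split: if_splits)

lemma cre_cre: "cre i (cre k m) = - cre k (cre i m)"
proof (cases "i = k")
 case True
 then show ?thesis by (auto intro!: fock_eqI simp: cre_def)
next
 case False
 have d: "T - {i} - {k} = T - {i, k}" "T - {k} - {i} = T - {i, k}" for T :: "nat set" by auto
 show ?thesis
  by (rule fock_eqI) (use False in \<open>auto simp: cre_def shuffle_sign_remove d\<close>)
qed

text \<open>The canonical anticommutation relation. For i = k the two products live on complementary
  families of sets, those without and those with i. For distinct indices exactly one of the two
  shuffle signs changes when the operators are exchanged.\<close>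

lemma ann_cre: "ann i (cre k m) = (if i = k then m else 0) - cre k (ann i m)"
proof (cases "i = k")
 case True
 have "insert k (T - {k}) = T" if "k : T" for T using that by auto
 moreover have "shuffle_sign k (insert k T) = shuffle_sign k T" if "k \<notin> T" for T
  using shuffle_sign_insert[OF that, of k] by simp
 moreover have "shuffle_sign k (T - {k}) = shuffle_sign k T" if "k : T" for T
  using shuffle_sign_remove[OF that, of k] by simp
 ultimately show ?thesis using True by (intro fock_eqI) (auto simp: cre_def ann_def)
next
 case False
 then have "insert i T - {k} = insert i (T - {k})" for T by auto
 then show ?thesis using False
  by (intro fock_eqI) (auto simp: cre_def ann_def shuffle_sign_insert shuffle_sign_remove)
qed

lemma ann_vac [simp]: "ann i (vac w) = 0"
 by (auto intro!: fock_eqI simp: ann_def vac_def)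

definition fock_supp :: "nat => fock set" where
 "fock_supp r = {m. \<forall>T j. \<not> T <= {..<r} --> amp m T j = 0}"

lemma fock_supp_intros:
 "vac w : fock_supp r" "m : fock_supp r ==> scl c m : fock_supp r"
 "m : fock_supp r ==> m' : fock_supp r ==> m + m' : fock_supp r" "0 : fock_supp r"
 by (auto simp: fock_supp_def vac_def)

lemma fock_supp_cre: "i < r ==> m : fock_supp r ==> cre i m : fock_supp r"
proof -
 assume "i < r" "m : fock_supp r"
 moreover have "\<not> T - {i} <= {..<r}" if "\<not> T <= {..<r}" for T using that \<open>i < r\<close> by auto
 ultimately show ?thesis by (auto simp: fock_supp_def cre_def)
qed

lemma fock_supp_ann: "m : fock_supp r ==> ann i m : fock_supp r"
 by (auto simp: fock_supp_def ann_def)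

lemma fock_supp_sum: "(!!i. i : I ==> f i : fock_supp r) ==> (\<Sum>i\<in>I. f i) : fock_supp r"
 by (induction I rule: infinite_finite_induct) (auto intro: fock_supp_intros)

definition fdelta :: "nat set => (nat => complex) => fock" where
 "fdelta T w = Fock (%U j. if U = T then w j else 0)"

text \<open>An index below all of T has shuffle sign 1. Hence an increasing word applied to a vacuum
  is concentrated at one set without any sign, which is why amplitudes can be read off as
  projections later.\<close>

lemma cre_fdelta:
 assumes "i \<notin> T" "!!j. j : T ==> i < j"
 shows "cre i (fdelta T w) = fdelta (insert i T) w"
proof -
 have "{j : insert i T. j < i} = {}" using assms(2) by force
 then have "shuffle_sign i (insert i T) = 1" unfolding shuffle_sign_def by (simp only: card.empty power_0)
 moreover have "U - {i} = T \<longleftrightarrow> U = insert i T" if "i : U" for U using that assms(1) by auto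
 ultimately show ?thesis by (intro fock_eqI) (auto simp: cre_def fdelta_def)
qed

lemma fock_words: "foldr cre (sorted_list_of_set T) (vac w) = fdelta T w" if "finite T"
proof -
 have "foldr cre xs (vac w) = fdelta (set xs) w" if "sorted_wrt (<) xs" for xs
  using that
 proof (induction xs)
  case Nil
  then show ?case by (auto simp: vac_def fdelta_def)
 next
  case (Cons x xs)
  have "cre x (fdelta (set xs) w) = fdelta (insert x (set xs)) w"
   by (rule cre_fdelta) (use Cons.prems in auto)
  then show ?case using Cons by simp
 qed
 from this[of "sorted_list_of_set T"] show ?thesis using that by simp
qed

text \<open>Everything supported on subsets of \<open>{..<r}\<close> is a finite sum of words of
  creation operators applied to vacua. A linear operator identity is thus checked on vacua and
  carried through one creation operator, with the identity at m as hypothesis.\<close>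

lemma fock_supp_induct [consumes 1, case_names vac cre add]:
 assumes "m : fock_supp r" "!!w. P (vac w)" "!!i m. i < r ==> m : fock_supp r ==> P m ==> P (cre i m)"
  "!!m m'. P m ==> P m' ==> P (m + m')"
 shows "P m"
proof -
 have "foldr cre xs (vac w) : fock_supp r & P (foldr cre xs (vac w))" if "set xs <= {..<r}" for xs w
  using that by (induction xs) (auto intro: assms fock_supp_intros fock_supp_cre)
 then have d: "P (fdelta T w)" if "T <= {..<r}" for T w
  using fock_words[of T w] that finite_subset[OF that] by (metis finite_lessThan set_sorted_list_of_set)
 have "vac (%_. 0) = 0" by (auto intro!: fock_eqI simp: vac_def)
 then have P0: "P 0" using assms(2)[of "%_. 0"] by simp
 have "P (\<Sum>T\<in>K. fdelta T (amp m T))" if "finite K" "K <= Pow {..<r}" for K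
  using that by (induction K rule: finite_induct) (auto intro: P0 d assms(4))
 moreover have "m = (\<Sum>T\<in>Pow {..<r}. fdelta T (amp m T))"
  using assms(1) by (intro fock_eqI) (simp add: fdelta_def fock_supp_def)
 ultimately show ?thesis by (metis finite_Pow_iff finite_lessThan order_refl)
qed


section \<open>The Fock representation of a graded Lie superalgebra\<close>

text \<open>The part of the grading that passes from L to L[B]; irreducibility of the outer pieces
  and a one-dimensional centre do not pass in general. The locale is used for both.\<close>

locale graded_lsa = lsa L for L :: "'g lie_super" (structure) +
 fixes Lm L0 Lp :: "'g set"
 assumes even: "hpart L 0 = L0" and odd: "direct_sum_decomp L (hpart L 1) Lm Lp"
  and br_mm: "x : Lm ==> y : Lm ==> bracket L x y = \<zero>"
  and br_pp: "x : Lp ==> y : Lp ==> bracket L x y = \<zero>"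
  and br_0m: "x : L0 ==> y : Lm ==> bracket L x y : Lm"
  and br_0p: "x : L0 ==> y : Lp ==> bracket L x y : Lp"
begin

lemma Lm_sub: "csub Lm L" and Lp_sub: "csub Lp L"
 and L0_sub: "csub L0 L"
 using dsdD[OF odd] hpart_subspace[of 0] even by auto

lemmas Lm = subspaceD[OF Lm_sub] and Lp = subspaceD[OF Lp_sub] and L0 = subspaceD[OF L0_sub]

lemma Lm_odd: "x : Lm ==> x : hpart L 1" and Lp_odd: "x : Lp ==> x : hpart L 1"
 using dsd_mem[OF odd] by auto

lemma br_pm: "x : Lp ==> y : Lm ==> bracket L x y : L0"
 using br_hpart[OF Lp_odd Lm_odd] even by simp

lemma br_00: "x : L0 ==> y : L0 ==> bracket L x y : L0"
 using br_hpart[of x 0 y 0] even by simp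

end

text \<open>\<sigma> is the action of L0 on N in coordinates. It acts on arbitrary coordinate
  functions, matching the unrestricted second index of the Fock space.\<close>

locale fock_rep = graded_lsa L Lm L0 Lp for L :: "'g lie_super" (structure) and Lm L0 Lp +
 fixes r :: nat and e :: "nat => 'g" and c :: "nat => 'g => complex"
  and \<sigma> :: "'g => (nat => complex) => (nat => complex)"
 assumes bas: "cbasis (L\<lparr>carrier := Lm\<rparr>) {..<r} e c"
  and \<sigma>_add: "h : L0 ==> \<sigma> h (%j. v j + w j) = (%j. \<sigma> h v j + \<sigma> h w j)"
  and \<sigma>_scale: "h : L0 ==> \<sigma> h (%j. a * w j) = (%j. a * \<sigma> h w j)"
  and \<sigma>_add_left: "h : L0 ==> h' : L0 ==> \<sigma> (h \<oplus> h') w = (%j. \<sigma> h w j + \<sigma> h' w j)"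
  and \<sigma>_scale_left: "h : L0 ==> \<sigma> (a \<odot> h) w = (%j. a * \<sigma> h w j)"
  and \<sigma>_bracket: "h : L0 ==> h' : L0 ==> \<sigma> (bracket L h h') w = (%j. \<sigma> h (\<sigma> h' w) j - \<sigma> h' (\<sigma> h w) j)"
begin

lemma e_mem: "i < r ==> e i : Lm"
 using bas by (auto simp: cbasis_def)

lemma e_closed [simp]: "i < r ==> e i : carrier L"
 using e_mem Lm(2) by blast

lemma c_lin: "i < r ==> x : Lm ==> y : Lm ==> c i (x \<oplus> y) = c i x + c i y"
 "i < r ==> x : Lm ==> c i (a \<odot> x) = a * c i x"
 using bas by (auto simp: cbasis_def linear_functional_def)

lemma c_e: "i < r ==> j < r ==> c i (e j) = (if i = j then 1 else 0)"
 using bas by (auto simp: cbasis_def)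

section \<open>Operators for the pieces of degree -1, 0 and 1\<close>

definition Xop :: "'g => fock => fock" where
 "Xop x m = (\<Sum>i<r. scl (c i x) (cre i m))"

definition Sop :: "'g => fock => fock" where
 "Sop h m = Fock (%T. \<sigma> h (amp m T))"

definition Dop :: "'g => fock => fock" where
 "Dop h m = (\<Sum>i<r. Xop (bracket L h (e i)) (ann i m)) + Sop h m"

text \<open>Obtained by moving y to the right through a product of the e_i. Meeting e_i leaves
  [y, e_i] in L0, which either travels on to N (first sum) or meets a later e_j and leaves
  [[y, e_i], e_j] in Lm (second sum). Double bracket and product of annihilators both change sign
  under i <-> j, so the double sum counts every pair twice; hence the factor 1/2.\<close>

definition Eop :: "'g => fock => fock" where
 "Eop y m = (\<Sum>i<r. Sop (bracket L y (e i)) (ann i m)) +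
   scl (1/2) (\<Sum>i<r. \<Sum>j<r. Xop (bracket L (bracket L y (e i)) (e j)) (ann j (ann i m)))"

lemma flin_Xop: "flin (Xop x)"
 unfolding Xop_def by (intro flin_sum flin_scl flin_cre)

lemma flin_Sop: "h : L0 ==> flin (Sop h)"
 unfolding Sop_def
 by (rule flinI) (auto intro!: fock_eqI simp: \<sigma>_add \<sigma>_scale amp_fun amp_scl_fun)

lemma flin_Dop: "h : L0 ==> flin (Dop h)"
 unfolding Dop_def by (intro flin_add flin_sum flin_comp[OF flin_Xop] flin_ann flin_Sop)

lemma flin_Eop: "y : Lp ==> flin (Eop y)"
 unfolding Eop_def
 by (intro flin_add flin_sum flin_scl flin_comp[OF flin_Xop] flin_comp[OF flin_Sop] flin_comp[OF flin_ann] flin_ann)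
  (auto intro: br_pm e_mem)

lemma Xop_add: "x : Lm ==> y : Lm ==> Xop (x \<oplus> y) m = Xop x m + Xop y m"
 unfolding Xop_def by (simp add: c_lin scl_add_left sum.distrib)

lemma Xop_scale: "x : Lm ==> Xop (a \<odot> x) m = scl a (Xop x m)"
 unfolding Xop_def by (simp add: c_lin scl_sum_right)

lemma Xop_zero: "Xop \<zero> m = 0"
 using Xop_scale[OF Lm(3), of 0 m] by simp

lemma Xop_e: "i < r ==> Xop (e i) m = cre i m"
proof -
 assume i: "i < r"
 have "Xop (e i) m = (\<Sum>j<r. if j = i then cre i m else 0)"
  unfolding Xop_def using i by (intro sum.cong) (auto simp: c_e)
 also have "... = cre i m" using i by simp
 finally show ?thesis .
qed

lemma Sop_add: "h : L0 ==> h' : L0 ==> Sop (h \<oplus> h') m = Sop h m + Sop h' m"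
 unfolding Sop_def by (auto intro!: fock_eqI simp: \<sigma>_add_left)

lemma Sop_scale: "h : L0 ==> Sop (a \<odot> h) m = scl a (Sop h m)"
 unfolding Sop_def by (auto intro!: fock_eqI simp: \<sigma>_scale_left)

lemma Dop_add: "h : L0 ==> h' : L0 ==> Dop (h \<oplus> h') m = Dop h m + Dop h' m"
 unfolding Dop_def using L0(2) by (simp add: br_add_left Xop_add br_0m e_mem Sop_add sum.distrib)

lemma Dop_scale: "h : L0 ==> Dop (a \<odot> h) m = scl a (Dop h m)"
 unfolding Dop_def using L0(2) by (simp add: br_smult_left Xop_scale br_0m e_mem Sop_scale scl_add_right scl_sum_right)

lemma Dop_zero: "Dop \<zero> m = 0"
 using Dop_scale[OF L0(3), of 0 m] by simp

lemma Eop_add: "y : Lp ==> y' : Lp ==> Eop (y \<oplus> y') m = Eop y m + Eop y' m"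
 unfolding Eop_def using Lp(2)
 by (simp add: br_add_left Xop_add br_0m e_mem br_pm Sop_add sum.distrib scl_add_right algebra_simps)

lemma Eop_scale: "y : Lp ==> Eop (a \<odot> y) m = scl a (Eop y m)"
 unfolding Eop_def using Lp(2)
 by (simp add: br_smult_left Xop_scale br_0m e_mem br_pm Sop_scale scl_add_right scl_sum_right mult.commute)

lemma Eop_zero: "Eop \<zero> m = 0"
 using Eop_scale[OF Lp(3), of 0 m] by simp

lemma Sop_cre: "h : L0 ==> Sop h (cre k m) = cre k (Sop h m)"
proof -
 assume h: "h : L0"
 have "\<sigma> h (%j. 0) = (%j. 0)" using \<sigma>_scale[OF h, of 0 "%_. 0"] by simp
 note z = this
 show ?thesis
 proof (rule fock_eqI)
  show "amp (Sop h (cre k m)) T j = amp (cre k (Sop h m)) T j" for T j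
   by (cases "k : T") (simp_all add: Sop_def cre_def \<sigma>_scale[OF h] z)
 qed
qed

lemma Sop_vac: "h : L0 ==> Sop h (vac w) = vac (\<sigma> h w)"
proof -
 assume h: "h : L0"
 have "\<sigma> h (%j. 0) = (%j. 0)" using \<sigma>_scale[OF h, of 0 "%_. 0"] by simp
 note z = this
 show ?thesis
 proof (rule fock_eqI)
  show "amp (Sop h (vac w)) T j = amp (vac (\<sigma> h w)) T j" for T j
   by (cases "T = {}") (simp_all add: Sop_def vac_def z)
 qed
qed

lemma Xop_cre: "Xop x (cre k m) = - cre k (Xop x m)"
proof -
 have "Xop x (cre k m) = (\<Sum>i<r. - cre k (scl (c i x) (cre i m)))"
  unfolding Xop_def by (intro sum.cong refl) (subst cre_cre, simp add: flinD[OF flin_cre])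
 also have "... = - cre k (Xop x m)" by (simp add: sum_negf Xop_def flinD[OF flin_cre])
 finally show ?thesis .
qed

lemma Xop_Xop: "Xop x (Xop y m) = - Xop y (Xop x m)"
proof -
 have "Xop x (Xop y m) = (\<Sum>k<r. scl (c k y) (Xop x (cre k m)))"
  by (simp add: Xop_def[of y] flinD[OF flin_Xop])
 also have "... = - (\<Sum>k<r. scl (c k y) (cre k (Xop x m)))" by (simp add: Xop_cre sum_negf)
 finally show ?thesis by (simp add: Xop_def[of y])
qed

text \<open>The Kronecker delta of \<open>ann_cre\<close> ends up inside an operator; this extracts
  the one surviving term.\<close>

lemma sum_delta_fock: "k < r ==> (\<Sum>i<r. F i (if i = k then m else (0 :: fock))) = F k m" if "!!i. i < r ==> flin (F i)"
proof -
 assume k: "k < r"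
 have "(\<Sum>i<r. F i (if i = k then m else 0)) = (\<Sum>i<r. if i = k then F k m else 0)"
  using flinD(3)[OF that] by (intro sum.cong) auto
 then show ?thesis using k by simp
qed

text \<open>The delta in \<open>ann_cre\<close> yields the bracket. The other term passes
  \<open>cre k\<close> twice, once with \<open>ann\<close> and once with \<open>Xop\<close>, and the
  two signs cancel.\<close>

lemma Dop_cre:
 assumes h: "h : L0" and k: "k < r"
 shows "Dop h (cre k m) = cre k (Dop h m) + Xop (bracket L h (e k)) m"
proof -
 have "(\<Sum>i<r. Xop (bracket L h (e i)) (ann i (cre k m))) =
   (\<Sum>i<r. Xop (bracket L h (e i)) (if i = k then m else 0) + cre k (Xop (bracket L h (e i)) (ann i m)))"
  by (simp add: ann_cre flinD[OF flin_Xop] Xop_cre)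
 also have "... = Xop (bracket L h (e k)) m + cre k (\<Sum>i<r. Xop (bracket L h (e i)) (ann i m))"
  using sum_delta_fock[of "%i. Xop (bracket L h (e i))", OF flin_Xop k]
  by (simp add: sum.distrib flinD[OF flin_cre])
 finally show ?thesis by (simp add: Dop_def Sop_cre[OF h] flinD[OF flin_cre])
qed

text \<open>Jacobi with [x, z] = 0 makes the double bracket antisymmetric in its two arguments from
  Lm. This is the antisymmetry behind the factor 1/2 in \<open>Eop\<close>.\<close>

lemma jac_pmm:
 assumes "y : Lp" "x : Lm" "z : Lm"
 shows "bracket L (bracket L y x) z = (-1) \<odot> bracket L (bracket L y z) x"
proof -
 have c: "x : carrier L" "y : carrier L" "z : carrier L" using assms Lm(2) Lp(2) by auto
 have "bracket L y (bracket L x z) = bracket L (bracket L y x) z \<oplus> (-1) \<odot> bracket L x (bracket L y z)"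
  using br_jacobi[OF Lp_odd[OF assms(1)] Lm_odd[OF assms(2)] c(3)] by (simp add: ssign_def)
 then have "\<zero> = bracket L (bracket L y x) z \<oplus> (-1) \<odot> bracket L x (bracket L y z)"
  using br_mm[OF assms(2,3)] c by (simp add: br_zero_right)
 moreover have "bracket L x (bracket L y z) = (-1) \<odot> bracket L (bracket L y z) x"
  using br_antisym[OF Lm_odd[OF assms(2)], of "bracket L y z" 0] br_pm[OF assms(1,3)] even by (simp add: ssign_def)
 ultimately have "\<zero> = bracket L (bracket L y x) z \<oplus> bracket L (bracket L y z) x" using c by simp
 then have "bracket L (bracket L y x) z = \<ominus> bracket L (bracket L y z) x"
  using c by (metis br_closed minus_equality)
 then show ?thesis using c by (simp add: neg_sm)
qed

text \<open>\<open>cre k\<close> is contracted with either of the two annihilators. By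
  \<open>jac_pmm\<close> both contractions give the same sum, the resulting 2 cancels 1/2, and
  together with the contraction in the first sum they form \<open>Dop\<close> of [y, e_k].\<close>

lemma Eop_cre:
 assumes y: "y : Lp" and k: "k < r"
 shows "Eop y (cre k m) = Dop (bracket L y (e k)) m - cre k (Eop y m)"
proof -
 let ?b = "%i. bracket L y (e i)"
 let ?X = "%i j. Xop (bracket L (?b i) (e j))"
 have b0: "?b i : L0" if "i < r" for i using br_pm[OF y e_mem[OF that]] .
 have "(\<Sum>i<r. Sop (?b i) (ann i (cre k m))) =
   (\<Sum>i<r. Sop (?b i) (if i = k then m else 0) - cre k (Sop (?b i) (ann i m)))"
  using b0 by (intro sum.cong) (auto simp: ann_cre flinD[OF flin_Sop] Sop_cre)
 also have "... = Sop (?b k) m - cre k (\<Sum>i<r. Sop (?b i) (ann i m))"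
  using sum_delta_fock[of "%i. Sop (?b i)", OF flin_Sop k] b0
  by (simp add: sum_subtractf flinD[OF flin_cre])
 finally have 1: "(\<Sum>i<r. Sop (?b i) (ann i (cre k m))) = Sop (?b k) m - cre k (\<Sum>i<r. Sop (?b i) (ann i m))" .
 have aa: "ann j (ann i (cre k m)) = ann j (if i = k then m else 0) - (if j = k then ann i m else 0) + cre k (ann j (ann i m))" for i j
  by (simp add: ann_cre flinD[OF flin_ann])
 have "(\<Sum>i<r. \<Sum>j<r. ?X i j (ann j (ann i (cre k m)))) =
   (\<Sum>i<r. \<Sum>j<r. ?X i j (ann j (if i = k then m else 0)) - ?X i j (if j = k then ann i m else 0) - cre k (?X i j (ann j (ann i m))))"
  by (simp add: aa flinD[OF flin_Xop] Xop_cre algebra_simps)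
 also have "... = (\<Sum>i<r. \<Sum>j<r. ?X i j (ann j (if i = k then m else 0))) -
   (\<Sum>i<r. \<Sum>j<r. ?X i j (if j = k then ann i m else 0)) - cre k (\<Sum>i<r. \<Sum>j<r. ?X i j (ann j (ann i m)))"
  by (simp add: sum_subtractf flinD[OF flin_cre])
 also have "(\<Sum>i<r. \<Sum>j<r. ?X i j (ann j (if i = k then m else 0))) = (\<Sum>j<r. ?X k j (ann j m))"
  by (rule sum_delta_fock[of "%i m. \<Sum>j<r. ?X i j (ann j m)", OF _ k])
   (intro flin_sum flin_comp[OF flin_Xop] flin_ann)
 also have "(\<Sum>i<r. \<Sum>j<r. ?X i j (if j = k then ann i m else 0)) = (\<Sum>i<r. ?X i k (ann i m))"
  by (intro sum.cong refl sum_delta_fock[OF flin_Xop k])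
 \<comment> \<open>Antisymmetry turns the contraction with one annihilator into the contraction with
   the other; the minus sign already present makes the two add up.\<close>
 also have "(\<Sum>i<r. ?X i k (ann i m)) = - (\<Sum>i<r. ?X k i (ann i m))"
 proof -
  have "?X i k m' = - ?X k i m'" if "i < r" for i m'
   using jac_pmm[OF y e_mem[OF that] e_mem[OF k]] Xop_scale[OF br_0m[OF b0[OF k] e_mem[OF that]], of "-1" m'] by simp
  then show ?thesis by (simp add: sum_negf)
 qed
 finally have 2: "(\<Sum>i<r. \<Sum>j<r. ?X i j (ann j (ann i (cre k m)))) =
   scl 2 (\<Sum>j<r. ?X k j (ann j m)) - cre k (\<Sum>i<r. \<Sum>j<r. ?X i j (ann j (ann i m)))"
  using scl_add_left[of 1 1] by simp
 show ?thesis
  unfolding Eop_def 1 2 by (simp add: Dop_def scl_diff_right flinD[OF flin_cre])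
qed

lemma Xop_expand: "flin F ==> F (Xop x m) = (\<Sum>i<r. scl (c i x) (F (cre i m)))"
 by (simp add: Xop_def flinD)

lemma Lm_expand: "x : Lm ==> x = (\<Oplus>i\<in>{..<r}. c i x \<odot> e i)"
proof -
 assume x: "x : Lm"
 interpret M: cspace "L\<lparr>carrier := Lm\<rparr>" by (rule subspace_cspace[OF Lm_sub])
 have "x = (\<Oplus>\<^bsub>L\<lparr>carrier := Lm\<rparr>\<^esub>i\<in>{..<r}. c i x \<odot> e i)" using M.cbasis_expand[OF bas] x by simp
 also have "... = (\<Oplus>i\<in>{..<r}. c i x \<odot> e i)"
 proof -
  \<comment> \<open>\<open>finsum\<close> depends on the record, so the sum inside Lm and the sum in
    L are compared by induction.\<close>
  have "finite K ==> K <= {..<r} ==> (\<Oplus>\<^bsub>L\<lparr>carrier := Lm\<rparr>\<^esub>i\<in>K. c i x \<odot> e i) = (\<Oplus>i\<in>K. c i x \<odot> e i)" for K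
  proof (induction K rule: finite_induct)
   case (insert k K)
   have "(\<Oplus>\<^bsub>L\<lparr>carrier := Lm\<rparr>\<^esub>i\<in>insert k K. c i x \<odot> e i) = c k x \<odot> e k \<oplus> (\<Oplus>\<^bsub>L\<lparr>carrier := Lm\<rparr>\<^esub>i\<in>K. c i x \<odot> e i)"
    using insert Lm(5) e_mem by (subst M.finsum_insert) auto
   moreover have "(\<Oplus>i\<in>insert k K. c i x \<odot> e i) = c k x \<odot> e k \<oplus> (\<Oplus>i\<in>K. c i x \<odot> e i)"
    using insert by (intro finsum_insert) auto
   ultimately show ?case using insert by simp
  qed simp
  then show ?thesis by blast
 qed
 finally show ?thesis .
qed

lemma Xop_finsum: "g : I \<rightarrow> Lm ==> Xop (\<Oplus>i\<in>I. g i) m = (\<Sum>i\<in>I. Xop (g i) m)"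
proof (induction I rule: infinite_finite_induct)
 case (insert i I)
 then have "(\<Oplus>i\<in>insert i I. g i) = g i \<oplus> (\<Oplus>i\<in>I. g i)" using Lm(2) by (intro finsum_insert) auto
 moreover have "(\<Oplus>i\<in>I. g i) : Lm" using insert by (intro subspace_finsum[OF Lm_sub]) auto
 ultimately show ?case using insert by (simp add: Xop_add)
qed (auto simp: Xop_zero)

lemma Dop_finsum: "g : I \<rightarrow> L0 ==> Dop (\<Oplus>i\<in>I. g i) m = (\<Sum>i\<in>I. Dop (g i) m)"
proof (induction I rule: infinite_finite_induct)
 case (insert i I)
 then have "(\<Oplus>i\<in>insert i I. g i) = g i \<oplus> (\<Oplus>i\<in>I. g i)" using L0(2) by (intro finsum_insert) auto
 moreover have "(\<Oplus>i\<in>I. g i) : L0" using insert by (intro subspace_finsum[OF L0_sub]) auto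
 ultimately show ?case using insert by (simp add: Dop_add)
qed (auto simp: Dop_zero)

lemma Dop_Xop:
 assumes h: "h : L0" and x: "x : Lm"
 shows "Dop h (Xop x m) = Xop x (Dop h m) + Xop (bracket L h x) m"
proof -
 have hc: "h : carrier L" using h L0 by blast
 have "Dop h (Xop x m) = (\<Sum>i<r. scl (c i x) (cre i (Dop h m))) + (\<Sum>i<r. scl (c i x) (Xop (bracket L h (e i)) m))"
  by (simp add: Xop_expand[OF flin_Dop[OF h]] Dop_cre[OF h] scl_add_right sum.distrib)
 also have "(\<Sum>i<r. scl (c i x) (Xop (bracket L h (e i)) m)) = Xop (\<Oplus>i\<in>{..<r}. c i x \<odot> bracket L h (e i)) m"
  using br_0m[OF h e_mem] Lm(5) by (subst Xop_finsum) (auto simp: Xop_scale)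
 also have "(\<Oplus>i\<in>{..<r}. c i x \<odot> bracket L h (e i)) = bracket L h (\<Oplus>i\<in>{..<r}. c i x \<odot> e i)"
  using hc by (subst clin.finsum[OF br_lin(1)[OF hc]]) (auto intro!: finsum_cong' simp: br_smult_right)
 also have "... = bracket L h x" using Lm_expand[OF x] by simp
 finally show ?thesis by (simp add: Xop_def[of x])
qed

lemma Eop_Xop:
 assumes y: "y : Lp" and x: "x : Lm"
 shows "Eop y (Xop x m) = Dop (bracket L y x) m - Xop x (Eop y m)"
proof -
 have yc: "y : carrier L" using y Lp by blast
 have "Eop y (Xop x m) = (\<Sum>i<r. scl (c i x) (Dop (bracket L y (e i)) m)) - (\<Sum>i<r. scl (c i x) (cre i (Eop y m)))"
  by (simp add: Xop_expand[OF flin_Eop[OF y]] Eop_cre[OF y] scl_diff_right sum_subtractf)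
 also have "(\<Sum>i<r. scl (c i x) (Dop (bracket L y (e i)) m)) = Dop (\<Oplus>i\<in>{..<r}. c i x \<odot> bracket L y (e i)) m"
  using br_pm[OF y e_mem] L0(5) by (subst Dop_finsum) (auto simp: Dop_scale)
 also have "(\<Oplus>i\<in>{..<r}. c i x \<odot> bracket L y (e i)) = bracket L y (\<Oplus>i\<in>{..<r}. c i x \<odot> e i)"
  using yc by (subst clin.finsum[OF br_lin(1)[OF yc]]) (auto intro!: finsum_cong' simp: br_smult_right)
 also have "... = bracket L y x" using Lm_expand[OF x] by simp
 finally show ?thesis by (simp add: Xop_def[of x])
qed

lemma Dop_vac: "h : L0 ==> Dop h (vac w) = vac (\<sigma> h w)"
 by (simp add: Dop_def Sop_vac flinD[OF flin_Xop])

lemma Eop_vac: "y : Lp ==> Eop y (vac w) = 0"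
proof -
 assume y: "y : Lp"
 have "Sop (bracket L y (e i)) 0 = 0" if "i < r" for i
  using flinD(3)[OF flin_Sop[OF br_pm[OF y e_mem[OF that]]]] .
 then show ?thesis by (simp add: Eop_def flinD[OF flin_Xop] flinD[OF flin_ann])
qed

text \<open>On a vacuum this is the module law of \<sigma>. Carrying all operators past
  \<open>cre k\<close> leaves, besides the induction hypothesis, the terms of the Jacobi identity
  for h, h' and e_k.\<close>

lemma Dop_Dop:
 assumes h: "h : L0" and h': "h' : L0" and m: "m : fock_supp r"
 shows "Dop (bracket L h h') m = Dop h (Dop h' m) - Dop h' (Dop h m)"
 using m
proof (induction rule: fock_supp_induct)
 case (vac w)
 have "vac (%j. a j - b j) = vac a - vac b" for a b by (auto intro!: fock_eqI simp: vac_def)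
 then show ?case by (simp add: Dop_vac h h' br_00 \<sigma>_bracket)
next
 case (add m m')
 then show ?case using h h' br_00[OF h h'] by (simp add: flinD[OF flin_Dop] algebra_simps)
next
 case (cre k m)
 note b = br_00[OF h h']
 have c: "h : carrier L" "h' : carrier L" "e k : carrier L" using h h' L0 cre by auto
 have hk: "bracket L h (e k) : Lm" "bracket L h' (e k) : Lm" using br_0m e_mem h h' cre by auto
 have hhk: "bracket L h' (bracket L h (e k)) : Lm" "bracket L (bracket L h h') (e k) : Lm"
  using br_0m h' hk b e_mem cre by auto
 have "bracket L h (bracket L h' (e k)) = bracket L (bracket L h h') (e k) \<oplus> bracket L h' (bracket L h (e k))"
  using br_jacobi[of h 0 h' 0 "e k"] h h' c even by (simp add: ssign_def)
 then have J: "Xop (bracket L h (bracket L h' (e k))) m =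
   Xop (bracket L (bracket L h h') (e k)) m + Xop (bracket L h' (bracket L h (e k))) m"
  using Xop_add[OF hhk(2,1)] by simp
 have "cre k (Dop (bracket L h h') m) = cre k (Dop h (Dop h' m)) - cre k (Dop h' (Dop h m))"
  using cre(3) by (simp add: flinD[OF flin_cre])
 then show ?case
  using cre(1) J by (simp add: Dop_cre h h' b flinD[OF flin_Dop] flinD[OF flin_cre] Dop_Xop hk algebra_simps)
qed

text \<open>Both sides vanish on a vacuum. Past \<open>cre k\<close> the operator of y turns into
  that of [y, e_k] in L0, to which \<open>Dop_Dop\<close> applies; what remains is the Jacobi
  identity for h, y and e_k.\<close>

lemma Dop_Eop:
 assumes h: "h : L0" and y: "y : Lp" and m: "m : fock_supp r"
 shows "Eop (bracket L h y) m = Dop h (Eop y m) - Eop y (Dop h m)"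
 using m
proof (induction rule: fock_supp_induct)
 case (vac w)
 then show ?case by (simp add: Dop_vac Eop_vac h y br_0p flinD[OF flin_Dop])
next
 case (add m m')
 then show ?case using h y br_0p[OF h y] by (simp add: flinD[OF flin_Dop] flinD[OF flin_Eop] algebra_simps)
next
 case (cre k m)
 note b = br_0p[OF h y]
 have c: "h : carrier L" "y : carrier L" "e k : carrier L" using h y L0 Lp cre by auto
 have hk: "bracket L h (e k) : Lm" "bracket L y (e k) : L0" using br_0m br_pm e_mem h y cre by auto
 have hhk: "bracket L (bracket L h y) (e k) : L0" "bracket L y (bracket L h (e k)) : L0"
  using br_pm y b hk e_mem cre by auto
 have "bracket L h (bracket L y (e k)) = bracket L (bracket L h y) (e k) \<oplus> bracket L y (bracket L h (e k))"
  using br_jacobi[of h 0 y 1 "e k"] h Lp_odd[OF y] c even by (simp add: ssign_def)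
 then have J: "Dop (bracket L h (bracket L y (e k))) m =
   Dop (bracket L (bracket L h y) (e k)) m + Dop (bracket L y (bracket L h (e k))) m"
  using Dop_add[OF hhk] by simp
 have D: "Dop h (Dop (bracket L y (e k)) m) = Dop (bracket L h (bracket L y (e k))) m + Dop (bracket L y (e k)) (Dop h m)"
  using Dop_Dop[OF h hk(2) cre(2)] by simp
 have "cre k (Eop (bracket L h y) m) = cre k (Dop h (Eop y m)) - cre k (Eop y (Dop h m))"
  using cre(3) by (simp add: flinD[OF flin_cre])
 then show ?case
  using cre(1) J D
  by (simp add: Dop_cre Eop_cre h y b flinD[OF flin_Dop] flinD[OF flin_Eop] flinD[OF flin_cre] Dop_Xop Eop_Xop hk algebra_simps)
qed

lemma fock_supp_Xop: "m : fock_supp r ==> Xop x m : fock_supp r"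
 unfolding Xop_def by (intro fock_supp_sum fock_supp_intros fock_supp_cre) auto

lemma fock_supp_Sop: "h : L0 ==> m : fock_supp r ==> Sop h m : fock_supp r"
proof -
 assume h: "h : L0" and m: "m : fock_supp r"
 have z: "\<sigma> h (%j. 0) = (%j. 0)" using \<sigma>_scale[OF h, of 0 "%_. 0"] by simp
 have "amp m T = (%j. 0)" if "\<not> T <= {..<r}" for T
  using m that unfolding fock_supp_def by blast
 then show ?thesis using z by (auto simp: fock_supp_def Sop_def)
qed

lemma fock_supp_Dop: "h : L0 ==> m : fock_supp r ==> Dop h m : fock_supp r"
 unfolding Dop_def by (intro fock_supp_sum fock_supp_Xop fock_supp_Sop fock_supp_intros fock_supp_ann)

lemma fock_supp_Eop: "y : Lp ==> m : fock_supp r ==> Eop y m : fock_supp r"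
 unfolding Eop_def by (intro fock_supp_sum fock_supp_Xop fock_supp_Sop fock_supp_intros fock_supp_ann) (auto intro: br_pm e_mem)

text \<open>Past \<open>cre k\<close> the two products reduce, by \<open>Dop_Eop\<close>, to the
  operators of [[y', e_k], y] and [[y, e_k], y'], whose sum is zero by Jacobi and [y, y'] =
  0.\<close>

lemma Eop_Eop:
 assumes y: "y : Lp" and y': "y' : Lp" and m: "m : fock_supp r"
 shows "Eop y (Eop y' m) + Eop y' (Eop y m) = 0"
 using m
proof (induction rule: fock_supp_induct)
 case (vac w)
 then show ?case by (simp add: Eop_vac y y' flinD[OF flin_Eop])
next
 case (add m m')
 have "Eop y (Eop y' (m + m')) + Eop y' (Eop y (m + m')) =
   (Eop y (Eop y' m) + Eop y' (Eop y m)) + (Eop y (Eop y' m') + Eop y' (Eop y m'))"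
  using y y' by (simp add: flinD[OF flin_Eop] algebra_simps)
 then show ?case using add by simp
next
 case (cre k m)
 have c: "y : carrier L" "y' : carrier L" "e k : carrier L" using y y' Lp cre by auto
 have k0: "bracket L y (e k) : L0" "bracket L y' (e k) : L0" using br_pm e_mem y y' cre by auto
 have kp: "bracket L (bracket L y (e k)) y' : Lp" "bracket L (bracket L y' (e k)) y : Lp"
  using br_0p k0 y y' by auto
 have "\<zero> = bracket L y (bracket L y' (e k)) \<oplus> bracket L y' (bracket L y (e k))"
 proof -
  have "bracket L y (bracket L y' (e k)) = (-1) \<odot> bracket L y' (bracket L y (e k))"
   using br_jacobi[OF Lp_odd[OF y] Lp_odd[OF y'] c(3)] br_pp[OF y y'] c by (simp add: ssign_def br_zero_left)
  then show ?thesis using c by (simp add: neg_sm[symmetric] l_neg)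
 qed
 moreover have "bracket L y (bracket L y' (e k)) = (-1) \<odot> bracket L (bracket L y' (e k)) y"
  using br_antisym[OF Lp_odd[OF y], of "bracket L y' (e k)" 0] k0 even by (simp add: ssign_def)
 moreover have "bracket L y' (bracket L y (e k)) = (-1) \<odot> bracket L (bracket L y (e k)) y'"
  using br_antisym[OF Lp_odd[OF y'], of "bracket L y (e k)" 0] k0 even by (simp add: ssign_def)
 ultimately have "(-1) \<odot> (bracket L (bracket L y' (e k)) y \<oplus> bracket L (bracket L y (e k)) y') = \<zero>"
  using c by (simp add: sm_add_right)
 then have "bracket L (bracket L y' (e k)) y \<oplus> bracket L (bracket L y (e k)) y' = \<zero>"
  using smult_cancel[of "-1"] c by simp
 then have J: "Eop (bracket L (bracket L y' (e k)) y) m + Eop (bracket L (bracket L y (e k)) y') m = 0"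
  using Eop_add[OF kp(2,1), of m] Eop_zero by simp
 have D: "Dop (bracket L y' (e k)) (Eop y m) = Eop (bracket L (bracket L y' (e k)) y) m + Eop y (Dop (bracket L y' (e k)) m)"
  "Dop (bracket L y (e k)) (Eop y' m) = Eop (bracket L (bracket L y (e k)) y') m + Eop y' (Dop (bracket L y (e k)) m)"
  using Dop_Eop[OF k0(2) y cre(2)] Dop_Eop[OF k0(1) y' cre(2)] by simp_all
 have C: "cre k (Eop y (Eop y' m)) + cre k (Eop y' (Eop y m)) = 0"
  using cre(3) flinD(1)[OF flin_cre, symmetric] flinD(3)[OF flin_cre] by simp
 have "Eop y (Eop y' (cre k m)) + Eop y' (Eop y (cre k m)) =
   - (Eop (bracket L (bracket L y' (e k)) y) m + Eop (bracket L (bracket L y (e k)) y') m)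
   + (cre k (Eop y (Eop y' m)) + cre k (Eop y' (Eop y m)))"
  using cre(1) D by (simp add: Eop_cre y y' flinD[OF flin_Eop] algebra_simps)
 then show ?case unfolding J C by simp
qed

end


section \<open>Free algebras and enveloping algebras\<close>

lemma free_algebra_simps [simp]:
 "carrier (free_algebra X) = {f. supp f <= lists X}" "\<zero>\<^bsub>free_algebra X\<^esub> = 0"
 "f \<oplus>\<^bsub>free_algebra X\<^esub> g = f + g" "c \<odot>\<^bsub>free_algebra X\<^esub> f = pscale c f"
 "f \<otimes>\<^bsub>free_algebra X\<^esub> g = f * g" "\<one>\<^bsub>free_algebra X\<^esub> = 1"
 by (simp_all add: free_algebra_def)

lemma free_algebra_cspace: "cspace (free_algebra X)"
 by (rule cspace_cong[OF _ _ _ _ free_space_cspace[of "lists X"]])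
  (simp_all add: free_algebra_def free_space_def)

lemma free_algebra_clin: "clin (free_algebra X) U f \<longleftrightarrow> clin (free_space (lists X)) U f"
 using free_algebra_cspace free_space_cspace
 by (auto simp: clin_def clin_axioms_def LinearCombinations.module_hom_def)

lemma free_algebra_minus [simp]:
 "supp f <= lists X ==> supp g <= lists X ==> f \<ominus>\<^bsub>free_algebra X\<^esub> g = f - g"
 using cspace.minus_sm[OF free_algebra_cspace, of f X g] cspace.minus_sm[OF free_space_cspace, of f "lists X" g]
  free_space_minus[of f "lists X" g] by simp

lemma keys_times_lists:
 assumes "supp f <= lists X" "supp g <= lists X"
 shows "supp (f * g) <= lists X"
proof
 fix w assume "w : supp (f * g)"
 then obtain a b where "w = a + b" "a : supp f" "b : supp g"
  using Poly_Mapping.keys_mult[of f g] by blast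
 then show "w : lists X" using assms by (auto simp: plus_list_def)
qed

lemma keys_one_list: "supp (1 :: 'a list \<Rightarrow>\<^sub>0 complex) = {[]}"
 unfolding single_one[symmetric] by (simp add: zero_list_def)

lemma free_algebra_ring: "ring (free_algebra X)"
proof (rule ringI)
 interpret cspace "free_algebra X" by (rule free_algebra_cspace)
 show "abelian_group (free_algebra X)" by (rule abelian_group_axioms)
 show "Group.monoid (free_algebra X)"
  by (rule Group.monoidI) (simp_all add: keys_times_lists keys_one_list mult.assoc zero_list_def)
qed (simp_all add: algebra_simps)

lemma single_mult_list: "sgl u a * sgl v b = sgl (u @ v) (a * b :: complex)"
 by (simp add: mult_single plus_list_def)

text \<open>A scalar is the corresponding multiple of the empty word. Hence ring ideals of the free
  algebra are subspaces, and its ring quotients are quotients of vector spaces.\<close>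

lemma pscale_mult: "pscale c f = sgl [] c * (f :: 'a list \<Rightarrow>\<^sub>0 complex)"
proof -
 have "sgl [] c * (\<Sum>k\<in>K. sgl k (lkp f k)) =
   (\<Sum>k\<in>K. pscale c (sgl k (lkp f k)))" for K
  by (simp add: sum_distrib_left single_mult_list)
 from this[of "supp f"] show ?thesis
  by (simp only: pm_expand[of f, symmetric] pscale_sum[symmetric])
qed

lemma pscale_mult_left: "pscale c f * g = pscale c (f * (g :: 'a list \<Rightarrow>\<^sub>0 complex))"
 by (simp add: pscale_mult mult.assoc)

lemma pscale_mult_right: "f * pscale c g = pscale c (f * (g :: 'a list \<Rightarrow>\<^sub>0 complex))"
proof -
 have 1: "sgl k a * pscale c g = pscale c (sgl k a * g)" for k a
 proof -
  have "sgl k a * sgl [] c = sgl [] c * sgl k a"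
   by (simp add: single_mult_list mult.commute)
  then show ?thesis by (simp add: pscale_mult flip: mult.assoc)
 qed
 have "(\<Sum>k\<in>K. sgl k (lkp f k)) * pscale c g =
   pscale c ((\<Sum>k\<in>K. sgl k (lkp f k)) * g)" for K
  by (simp add: sum_distrib_right 1 pscale_sum)
 from this[of "supp f"] show ?thesis by (simp only: pm_expand[of f, symmetric])
qed

lemma free_algebra_span: "carrier (free_algebra X) = vspan (free_algebra X) {sgl w 1 | w. w : lists X}"
proof -
 have "vspan (free_space (lists X)) {sgl w 1 | w. w : lists X} =
   vspan (free_algebra X) {sgl w 1 | w. w : lists X}"
  by (rule vspan_cong[OF _ _ _ _ free_space_cspace]) (auto simp: free_algebra_def free_space_def)
 then show ?thesis using free_space_span[of "lists X"] by simp
qed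

lemma left_mult_clin: "supp f <= lists X ==> clin (free_algebra X) (free_algebra X) (%g. f * g)"
 by (intro clin.intro clin_axioms.intro lin_mapI free_algebra_cspace)
  (simp_all add: keys_times_lists distrib_left pscale_mult_right)

lemma right_mult_clin: "supp g <= lists X ==> clin (free_algebra X) (free_algebra X) (%f. f * g)"
 by (intro clin.intro clin_axioms.intro lin_mapI free_algebra_cspace)
  (simp_all add: keys_times_lists distrib_right pscale_mult_left)

lemma free_algebra_idealI:
 assumes "csub I (free_algebra X)"
  "!!f g. f : I ==> g : carrier (free_algebra X) ==> g * f : I"
  "!!f g. f : I ==> g : carrier (free_algebra X) ==> f * g : I"
 shows "ideal I (free_algebra X)"
proof (rule idealI[OF free_algebra_ring])
 interpret cspace "free_algebra X" by (rule free_algebra_cspace)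
 show "subgroup I (add_monoid (free_algebra X))"
  using subspace_additive_subgroup[OF assms(1)] by (rule additive_subgroup.a_subgroup)
 show "a \<otimes>\<^bsub>free_algebra X\<^esub> x : I" "x \<otimes>\<^bsub>free_algebra X\<^esub> a : I"
  if "x : I" "a : carrier (free_algebra X)" for x a
  using assms(2,3)[OF that] by simp_all
qed

lemma free_algebra_ideal_subspace:
 assumes "ideal I (free_algebra X)"
 shows "csub I (free_algebra X)"
proof -
 interpret cspace "free_algebra X" by (rule free_algebra_cspace)
 interpret ideal I "free_algebra X" by fact
 show ?thesis
 proof (rule subspaceI)
  show "I <= carrier (free_algebra X)" by (rule a_subset)
  show "c \<odot>\<^bsub>free_algebra X\<^esub> x : I" if "x : I" for c x
   using I_l_closed[OF that, of "sgl [] c"] by (simp add: pscale_mult)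
  show "\<zero>\<^bsub>free_algebra X\<^esub> : I" by (rule zero_closed)
  show "x \<oplus>\<^bsub>free_algebra X\<^esub> y : I" if "x : I" "y : I" for x y using that by (rule a_closed)
 qed
qed

section \<open>Enveloping superalgebras by generators and relations\<close>

definition env_rels :: "'l lie_super => ('l list \<Rightarrow>\<^sub>0 complex) set" where
 "env_rels L = {sgl [x \<oplus>\<^bsub>L\<^esub> y] 1 - sgl [x] 1 - sgl [y] 1
    | x y. x : carrier L & y : carrier L} \<union>
   {sgl [c \<odot>\<^bsub>L\<^esub> x] 1 - sgl [x] c | c x. x : carrier L} \<union>
   {sgl [x, y] 1 - sgl [y, x] (ssign p q)
    - sgl [bracket L x y] 1 | x y p q. x : hpart L p & y : hpart L q}"

lemma env_rels_cases:
 assumes "t : env_rels L"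
  "!!x y. x : carrier L ==> y : carrier L ==>
   P (sgl [x \<oplus>\<^bsub>L\<^esub> y] 1 - sgl [x] 1 - sgl [y] 1)"
  "!!c x. x : carrier L ==> P (sgl [c \<odot>\<^bsub>L\<^esub> x] 1 - sgl [x] c)"
  "!!x y p q. x : hpart L p ==> y : hpart L q ==> P (sgl [x, y] 1
   - sgl [y, x] (ssign p q) - sgl [bracket L x y] 1)"
 shows "P t"
 using assms unfolding env_rels_def by blast

lemma keys_single_diff: "p : Y ==> supp g <= Y ==> supp (sgl p a - g) <= Y"
 "supp g <= Y ==> q : Y ==> supp (g - sgl q b) <= Y"
 by (auto dest!: subsetD[OF Poly_Mapping.keys_diff] split: if_splits)

text \<open>Weaker than a Lie superalgebra, so that it applies directly to
  \<open>sub_super L W\<close>, whose parts are mere intersections with W.\<close>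

locale envl = cspace L for L :: "'l lie_super" (structure) +
 assumes hsub: "x : hpart L p ==> x : carrier L"
  and brc: "x : hpart L p ==> y : hpart L q ==> bracket L x y : carrier L"
begin

abbreviation FA where "FA \<equiv> free_algebra (carrier L)"

sublocale FA: cspace FA by (rule free_algebra_cspace)
sublocale FR: ring FA by (rule free_algebra_ring)

lemma env_rels_carrier: "env_rels L <= carrier FA"
proof
 show "t : carrier FA" if "t : env_rels L" for t
  using that
 proof (rule env_rels_cases)
  fix x y p q assume "x : hpart L p" "y : hpart L q"
  then have "x : carrier L" "y : carrier L" "bracket L x y : carrier L" using hsub brc by auto
  then show "sgl [x, y] 1 - sgl [y, x] (ssign p q) - sgl [bracket L x y] 1 : carrier FA"
   by (simp add: keys_single_diff)
 qed (simp_all add: keys_single_diff)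
qed

lemma env_ideal_eq: "env_ideal L = genideal FA (env_rels L)"
 by (simp add: env_ideal_def env_rels_def)

lemma env_ideal_ideal: "ideal (env_ideal L) FA"
 unfolding env_ideal_eq by (rule FR.genideal_ideal[OF env_rels_carrier])

lemma env_rels_mem: "t : env_rels L ==> t : env_ideal L"
 unfolding env_ideal_eq using FR.genideal_self[OF env_rels_carrier] by blast

lemma env_ideal_least: "ideal I FA ==> env_rels L <= I ==> env_ideal L <= I"
 unfolding env_ideal_eq by (rule FR.genideal_minimal)

lemma env_ideal_subspace: "csub (env_ideal L) FA"
 by (rule free_algebra_ideal_subspace[OF env_ideal_ideal])

sublocale UE: cspace "env_alg L"
 unfolding env_alg_def by (rule FA.quot_cspace[OF env_ideal_subspace])

abbreviation ecls where "ecls f \<equiv> env_ideal L +>\<^bsub>FA\<^esub> f"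

lemma ecls_clin: "clin FA (env_alg L) ecls"
 unfolding env_alg_def by (rule FA.quot_proj_clin[OF env_ideal_subspace])

lemma env_carrier: "carrier (env_alg L) = ecls ` carrier FA"
 unfolding env_alg_def using FA.quot_carrier[OF env_ideal_subspace] by auto

lemma ecls_eq_iff: "f : carrier FA ==> g : carrier FA ==> ecls f = ecls g \<longleftrightarrow> f - g : env_ideal L"
 using FA.coset_eq_iff[OF env_ideal_subspace, of f g] by simp

lemma env_mult: "f : carrier FA ==> g : carrier FA ==> ecls f \<otimes>\<^bsub>env_alg L\<^esub> ecls g = ecls (f * g)"
 using ideal.rcoset_mult_add[OF env_ideal_ideal, of f g] by (simp add: env_alg_def quot_def FactRing_def)

lemma env_mult_closed: "u : carrier (env_alg L) ==> v : carrier (env_alg L) ==> u \<otimes>\<^bsub>env_alg L\<^esub> v : carrier (env_alg L)"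
proof -
 assume "u : carrier (env_alg L)" "v : carrier (env_alg L)"
 then obtain f g where "f : carrier FA" "u = ecls f" "g : carrier FA" "v = ecls g" unfolding env_carrier by blast
 then show ?thesis using env_mult[of f g] keys_times_lists[of f "carrier L" g] by (auto simp: env_carrier)
qed

lemma env_mult_assoc: "u : carrier (env_alg L) ==> v : carrier (env_alg L) ==> w : carrier (env_alg L) ==>
  u \<otimes>\<^bsub>env_alg L\<^esub> (v \<otimes>\<^bsub>env_alg L\<^esub> w) = u \<otimes>\<^bsub>env_alg L\<^esub> v \<otimes>\<^bsub>env_alg L\<^esub> w"
proof -
 assume "u : carrier (env_alg L)" "v : carrier (env_alg L)" "w : carrier (env_alg L)"
 then obtain f g h where "f : carrier FA" "u = ecls f" "g : carrier FA" "v = ecls g" "h : carrier FA" "w = ecls h"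
  unfolding env_carrier by blast
 then show ?thesis by (simp add: env_mult keys_times_lists mult.assoc)
qed

lemma env_word_closed [simp]: "w : lists (carrier L) ==> env_word L w : carrier (env_alg L)"
 unfolding env_word_def env_carrier by auto

lemma env_word_mult: "u : lists (carrier L) ==> v : lists (carrier L) ==>
  env_word L u \<otimes>\<^bsub>env_alg L\<^esub> env_word L v = env_word L (u @ v)"
 unfolding env_word_def by (subst env_mult) (auto simp: single_mult_list)

lemma env_span: "carrier (env_alg L) = vspan (env_alg L) {env_word L w | w. w : lists (carrier L)}"
proof -
 interpret c: clin FA "env_alg L" ecls by (rule ecls_clin)
 have "carrier (env_alg L) = ecls ` vspan FA {sgl w 1 | w. w : lists (carrier L)}"
  unfolding env_carrier using free_algebra_span[of "carrier L"] by simp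
 also have "... = vspan (env_alg L) (ecls ` {sgl w 1 | w. w : lists (carrier L)})"
  by (rule c.span_image) auto
 also have "ecls ` {sgl w 1 | w. w : lists (carrier L)} = {env_word L w | w. w : lists (carrier L)}"
  by (auto simp: env_word_def)
 finally show ?thesis .
qed

lemma left_env_mult_clin:
 assumes "u : carrier (env_alg L)"
 shows "clin (env_alg L) (env_alg L) (%v. u \<otimes>\<^bsub>env_alg L\<^esub> v)"
proof -
 interpret c: clin FA "env_alg L" ecls by (rule ecls_clin)
 obtain f where f: "f : carrier FA" "u = ecls f" using assms unfolding env_carrier by blast
 show ?thesis
 proof (intro clin.intro clin_axioms.intro lin_mapI UE.cspace_axioms)
  fix v assume v: "v : carrier (env_alg L)"
  then obtain g where g: "g : carrier FA" "v = ecls g" unfolding env_carrier by blast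
  show "u \<otimes>\<^bsub>env_alg L\<^esub> v : carrier (env_alg L)" using assms v by (rule env_mult_closed)
  have fg: "f * g : carrier FA" using f g by (simp add: keys_times_lists)
  show "u \<otimes>\<^bsub>env_alg L\<^esub> (c \<odot>\<^bsub>env_alg L\<^esub> v) = c \<odot>\<^bsub>env_alg L\<^esub> (u \<otimes>\<^bsub>env_alg L\<^esub> v)" for c
   using c.sm[OF fg, of c] c.sm[OF g(1), of c] env_mult[OF f(1) g(1)]
    env_mult[OF f(1) FA.sm_closed[OF g(1)], of c] f(2) g(2) by (simp add: pscale_mult_right)
  fix v' assume v: "v' : carrier (env_alg L)"
  then obtain h where h: "h : carrier FA" "v' = ecls h" unfolding env_carrier by blast
  have fh: "f * h : carrier FA" using f h by (simp add: keys_times_lists)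
  show "u \<otimes>\<^bsub>env_alg L\<^esub> (v \<oplus>\<^bsub>env_alg L\<^esub> v') = u \<otimes>\<^bsub>env_alg L\<^esub> v \<oplus>\<^bsub>env_alg L\<^esub> u \<otimes>\<^bsub>env_alg L\<^esub> v'"
   using c.add[OF fg fh] c.add[OF g(1) h(1)] env_mult[OF f(1) g(1)] env_mult[OF f(1) h(1)]
    env_mult[OF f(1) FA.add.m_closed[OF g(1) h(1)]] f(2) g(2) h(2) by (simp add: distrib_left)
 qed
qed

lemma env_rel_word:
 assumes "t : env_rels L" "u : lists (carrier L)" "v : lists (carrier L)"
 shows "sgl u 1 * t * sgl v 1 : env_ideal L"
proof -
 interpret ideal "env_ideal L" FA by (rule env_ideal_ideal)
 show ?thesis
  using I_r_closed[OF I_l_closed[OF env_rels_mem[OF assms(1)], of "sgl u 1"], of "sgl v 1"]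
   assms(2,3) by simp
qed

text \<open>The additive and the scalar relations, multiplied by u on the left and by v on the
  right, make every position of a word linear.\<close>

lemma env_word_linear:
 assumes u: "u : lists (carrier L)" and v: "v : lists (carrier L)"
 shows "clin L (env_alg L) (%x. env_word L (u @ x # v))"
proof -
 interpret c: clin FA "env_alg L" ecls by (rule ecls_clin)
 show ?thesis
 proof (intro clin.intro clin_axioms.intro lin_mapI UE.cspace_axioms cspace_axioms)
  fix x assume x: "x : carrier L"
  show "env_word L (u @ x # v) : carrier (env_alg L)" using x u v by simp
  show "env_word L (u @ (a \<odot> x) # v) = a \<odot>\<^bsub>env_alg L\<^esub> env_word L (u @ x # v)" for a
  proof -
   have "sgl [a \<odot> x] 1 - sgl [x] a : env_rels L"
    using x unfolding env_rels_def by blast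
   from env_rel_word[OF this u v]
   have "sgl (u @ (a \<odot> x) # v) 1 - pscale a (sgl (u @ x # v) 1) : env_ideal L"
    by (simp add: algebra_simps single_mult_list)
   then have "ecls (sgl (u @ (a \<odot> x) # v) 1) = ecls (pscale a (sgl (u @ x # v) 1))"
    using u v x by (subst ecls_eq_iff) auto
   then show ?thesis using c.sm[of "sgl (u @ x # v) 1" a] u v x by (simp add: env_word_def)
  qed
  fix y assume y: "y : carrier L"
  show "env_word L (u @ (x \<oplus> y) # v) = env_word L (u @ x # v) \<oplus>\<^bsub>env_alg L\<^esub> env_word L (u @ y # v)"
  proof -
   have "sgl [x \<oplus> y] 1 - sgl [x] 1 - sgl [y] 1 : env_rels L"
    using x y unfolding env_rels_def by blast
   from env_rel_word[OF this u v]
   have "sgl (u @ (x \<oplus> y) # v) 1 -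
     (sgl (u @ x # v) 1 + sgl (u @ y # v) 1) : env_ideal L"
    by (simp add: algebra_simps single_mult_list)
   moreover have "supp (sgl (u @ x # v) (1::complex) + sgl (u @ y # v) 1)
     <= lists (carrier L)"
    using u v x y by (auto dest!: subsetD[OF Poly_Mapping.keys_add] split: if_splits)
   ultimately have "ecls (sgl (u @ (x \<oplus> y) # v) 1) =
     ecls (sgl (u @ x # v) 1 + sgl (u @ y # v) 1)"
    using u v x y by (subst ecls_eq_iff) auto
   then show ?thesis using c.add[of "sgl (u @ x # v) 1" "sgl (u @ y # v) 1"] u v x y
    by (simp add: env_word_def)
  qed
 qed
qed

lemma env_word_bracket:
 assumes u: "u : lists (carrier L)" and v: "v : lists (carrier L)" and x: "x : hpart L p" and y: "y : hpart L q"
 shows "env_word L (u @ x # y # v) = ssign p q \<odot>\<^bsub>env_alg L\<^esub> env_word L (u @ y # x # v)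
  \<oplus>\<^bsub>env_alg L\<^esub> env_word L (u @ bracket L x y # v)"
proof -
 interpret c: clin FA "env_alg L" ecls by (rule ecls_clin)
 let ?a = "sgl (u @ y # x # v) (1::complex)"
 let ?b = "sgl (u @ bracket L x y # v) (1::complex)"
 have cl: "x : carrier L" "y : carrier L" "bracket L x y : carrier L" using x y hsub brc by auto
 have "sgl [x, y] 1 - sgl [y, x] (ssign p q)
    - sgl [bracket L x y] 1 : env_rels L"
  using x y unfolding env_rels_def by blast
 from env_rel_word[OF this u v]
 have "sgl (u @ x # y # v) 1 - (pscale (ssign p q) ?a + ?b) : env_ideal L"
  by (simp add: algebra_simps single_mult_list)
 moreover have "supp (pscale (ssign p q) ?a + ?b) <= lists (carrier L)"
  using u v cl by (auto dest!: subsetD[OF Poly_Mapping.keys_add] split: if_splits)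
 ultimately have "ecls (sgl (u @ x # y # v) 1) = ecls (pscale (ssign p q) ?a + ?b)"
  using u v cl by (subst ecls_eq_iff) auto
 also have "... = ssign p q \<odot>\<^bsub>env_alg L\<^esub> ecls ?a \<oplus>\<^bsub>env_alg L\<^esub> ecls ?b"
  using c.add[of "pscale (ssign p q) ?a" ?b] c.sm[of ?a "ssign p q"] u v cl by simp
 finally show ?thesis by (simp add: env_word_def)
qed

end

section \<open>Representations of enveloping superalgebras\<close>

locale envl_rep = envl L + U: cspace U for L :: "'l lie_super" and U :: "(complex, 'u, 'y) module_scheme" +
 fixes r :: "'l => 'u => 'u"
 assumes r_clin: "x : carrier L ==> clin U U (r x)"
  and r_clin_left: "m : carrier U ==> clin L U (%x. r x m)"
  and r_bracket: "x : hpart L p ==> y : hpart L q ==> m : carrier U ==>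
   r (bracket L x y) m = r x (r y m) \<ominus>\<^bsub>U\<^esub> ssign p q \<odot>\<^bsub>U\<^esub> r y (r x m)"
begin

lemma foldr_r_clin: "w : lists (carrier L) ==> clin U U (foldr r w)"
proof (induction w)
 case Nil
 show ?case by (intro clin.intro clin_axioms.intro lin_mapI U.cspace_axioms) auto
next
 case (Cons x w)
 then show ?case using clin_comp[of U U "foldr r w" U "r x"] r_clin by (auto simp: comp_def)
qed

lemma foldr_r_closed: "w : lists (carrier L) ==> m : carrier U ==> foldr r w m : carrier U"
 using clin.closed[OF foldr_r_clin] by blast

definition ev :: "('l list \<Rightarrow>\<^sub>0 complex) => 'u => 'u" where
 "ev f m = pm_eval U (%w. foldr r w m) f"

lemma ev_clin: "m : carrier U ==> clin FA U (%f. ev f m)"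
 unfolding ev_def free_algebra_clin by (rule U.pm_eval_clin) (rule foldr_r_closed)

lemma ev_single: "w : lists (carrier L) ==> m : carrier U ==> ev (sgl w c) m = c \<odot>\<^bsub>U\<^esub> foldr r w m"
 unfolding ev_def by (rule U.pm_eval_single) (rule foldr_r_closed)

lemma singles_sub: "{sgl w 1 | w. w : lists (carrier L)} <= carrier FA"
 by auto

lemma ev_clin_right:
 assumes "f : carrier FA"
 shows "clin U U (ev f)"
proof (intro clin.intro clin_axioms.intro lin_mapI U.cspace_axioms)
 have fs: "f : vspan FA {sgl w 1 | w. w : lists (carrier L)}"
  using assms free_algebra_span by blast
 show "ev f m : carrier U" if "m : carrier U" for m using clin.closed[OF ev_clin[OF that] assms] .
 show "ev f (m \<oplus>\<^bsub>U\<^esub> m') = ev f m \<oplus>\<^bsub>U\<^esub> ev f m'" if m: "m : carrier U" "m' : carrier U" for m m'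
  using fs singles_sub
 proof (induction rule: FA.span_induct)
  case (base x)
  then obtain w where w: "w : lists (carrier L)" "x = sgl w 1" by blast
  then show ?case using m clin.add[OF foldr_r_clin[OF w(1)]] by (simp add: ev_single foldr_r_closed)
 next
  case (add f g)
  then show ?case
   using m clin.add[OF ev_clin, of _ f g] clin.closed[OF ev_clin]
   by (simp add: U.a_ac)
 next
  case (smult c f)
  then show ?case
   using m clin.sm[OF ev_clin, of _ f c] clin.closed[OF ev_clin]
   by (simp add: U.sm_add_right)
 qed (use m clin.zero[OF ev_clin] in simp)
 show "ev f (c \<odot>\<^bsub>U\<^esub> m) = c \<odot>\<^bsub>U\<^esub> ev f m" if m: "m : carrier U" for m c
  using fs singles_sub
 proof (induction rule: FA.span_induct)
  case (base x)
  then obtain w where w: "w : lists (carrier L)" "x = sgl w 1" by blast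
  then show ?case using m clin.sm[OF foldr_r_clin[OF w(1)]] by (simp add: ev_single foldr_r_closed)
 next
  case (add f g)
  then show ?case
   using m clin.add[OF ev_clin, of _ f g] clin.closed[OF ev_clin]
   by (simp add: U.sm_add_right)
 next
  case (smult d f)
  then show ?case
   using m clin.sm[OF ev_clin, of _ f d] clin.closed[OF ev_clin]
   by (simp add: mult.commute)
 qed (use m clin.zero[OF ev_clin] in simp)
qed

lemma ev_closed: "f : carrier FA ==> m : carrier U ==> ev f m : carrier U"
 using clin.closed[OF ev_clin] by blast

text \<open>For a single word on the left both sides are linear in g, which reduces to concatenation
  of words; then linearity in f.\<close>

lemma ev_mult:
 assumes "f : carrier FA" "g : carrier FA" "m : carrier U"
 shows "ev (f * g) m = ev f (ev g m)"
proof -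
 have 1: "ev (sgl u 1 * g) m = foldr r u (ev g m)" if u: "u : lists (carrier L)" for u
 proof (rule clin_eq_on_span[OF clin_comp[OF left_mult_clin ev_clin] clin_comp[OF ev_clin foldr_r_clin] singles_sub])
  show "g : vspan FA {sgl w 1 | w. w : lists (carrier L)}" using assms free_algebra_span by blast
  fix x assume "x : {sgl w (1::complex) | w. w : lists (carrier L)}"
  then obtain w where w: "w : lists (carrier L)" "x = sgl w 1" by blast
  moreover have "u @ w : lists (carrier L)" using u w by simp
  ultimately show "ev (sgl u 1 * x) m = foldr r u (ev x m)"
   using u assms by (simp add: single_mult_list ev_single foldr_r_closed del: append_in_lists_conv)
 qed (use u assms in auto)
 show ?thesis
 proof (rule clin_eq_on_span[OF clin_comp[OF right_mult_clin ev_clin] ev_clin singles_sub])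
  show "f : vspan FA {sgl w 1 | w. w : lists (carrier L)}" using assms free_algebra_span by blast
  fix x assume "x : {sgl w (1::complex) | w. w : lists (carrier L)}"
  then obtain w where w: "w : lists (carrier L)" "x = sgl w 1" by blast
  show "ev (x * g) m = ev x (ev g m)"
   unfolding w(2) 1[OF w(1)] using ev_single[OF w(1) ev_closed[OF assms(2,3)], of 1]
    foldr_r_closed[OF w(1) ev_closed[OF assms(2,3)]] by simp
 qed (use assms in \<open>auto intro: ev_closed\<close>)
qed

text \<open>The annihilator of the whole module is a two-sided ideal containing the relations, hence
  contains the ideal they generate. The annihilator of one vector would only be a left
  ideal.\<close>

lemma ev_ideal:
 assumes "f : env_ideal L" "m : carrier U"
 shows "ev f m = \<zero>\<^bsub>U\<^esub>"
proof -
 define I where "I = {f : carrier FA. \<forall>m\<in>carrier U. ev f m = \<zero>\<^bsub>U\<^esub>}"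
 have ev0: "ev f \<zero>\<^bsub>U\<^esub> = \<zero>\<^bsub>U\<^esub>" if "f : carrier FA" for f using clin.zero[OF ev_clin_right[OF that]] .
 have "csub I FA"
 proof (rule FA.subspaceI)
  show "\<zero>\<^bsub>FA\<^esub> : I" using clin.zero[OF ev_clin] by (simp add: I_def)
  show "x \<oplus>\<^bsub>FA\<^esub> y : I" if h: "x : I" "y : I" for x y
  proof -
   have "x \<oplus>\<^bsub>FA\<^esub> y : carrier FA" using h unfolding I_def by (intro FA.add.m_closed) auto
   moreover have "ev (x \<oplus>\<^bsub>FA\<^esub> y) m = \<zero>\<^bsub>U\<^esub>" if "m : carrier U" for m
    using clin.add[OF ev_clin[OF that], of x y] h that unfolding I_def by simp
   ultimately show ?thesis unfolding I_def by blast
  qed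
  show "c \<odot>\<^bsub>FA\<^esub> x : I" if h: "x : I" for c x
  proof -
   have "c \<odot>\<^bsub>FA\<^esub> x : carrier FA" using h unfolding I_def by (intro FA.sm_closed) auto
   moreover have "ev (c \<odot>\<^bsub>FA\<^esub> x) m = \<zero>\<^bsub>U\<^esub>" if "m : carrier U" for m
    using clin.sm[OF ev_clin[OF that], of x c] h that unfolding I_def by simp
   ultimately show ?thesis unfolding I_def by blast
  qed
 qed (auto simp: I_def)
 then have "ideal I FA"
  by (rule free_algebra_idealI)
   (simp_all add: I_def ev_mult ev_closed ev0 keys_times_lists)
 moreover have "env_rels L <= I"
 proof
  fix t assume t: "t : env_rels L"
  then have tc: "t : carrier FA" using env_rels_carrier by blast
  have mn: "ev (f - g) m = ev f m \<ominus>\<^bsub>U\<^esub> ev g m" if "f : carrier FA" "g : carrier FA" "m : carrier U" for f g m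
   using clin.minus[OF ev_clin[OF that(3)], of f g] that by simp
  have rc: "r x m : carrier U" if "x : carrier L" "m : carrier U" for x m using clin.closed[OF r_clin] that by blast
  have "\<forall>m\<in>carrier U. ev t m = \<zero>\<^bsub>U\<^esub>"
   using t
  proof (rule env_rels_cases; intro ballI)
   fix x y m assume h: "x : carrier L" "y : carrier L" "m : carrier U"
   show "ev (sgl [x \<oplus>\<^bsub>L\<^esub> y] 1 - sgl [x] 1 - sgl [y] 1) m = \<zero>\<^bsub>U\<^esub>"
    using h clin.add[OF r_clin_left[OF h(3)] h(1,2)] rc
    by (simp add: mn ev_single keys_single_diff)
     (metis U.a_comm U.add.m_closed U.minus_eq_iff U.minus_eq_zero_iff)
  next
   fix c x m assume h: "x : carrier L" "m : carrier U"
   show "ev (sgl [c \<odot>\<^bsub>L\<^esub> x] 1 - sgl [x] c) m = \<zero>\<^bsub>U\<^esub>"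
    using h clin.sm[OF r_clin_left[OF h(2)] h(1)] rc by (simp add: mn ev_single)
  next
   fix x y p q m assume h: "x : hpart L p" "y : hpart L q" "m : carrier U"
   have c: "x : carrier L" "y : carrier L" "bracket L x y : carrier L" using h hsub brc by auto
   show "ev (sgl [x, y] 1 - sgl [y, x] (ssign p q) - sgl [bracket L x y] 1) m = \<zero>\<^bsub>U\<^esub>"
    using h c r_bracket[OF h] rc by (simp add: mn ev_single keys_single_diff)
  qed
  then show "t : I" using tc by (simp add: I_def)
 qed
 ultimately have "env_ideal L <= I" by (rule env_ideal_least)
 then show ?thesis using assms by (auto simp: I_def)
qed

lemma ev_ecls:
 assumes "m : carrier U"
 obtains g where "clin (env_alg L) U g" "!!f. f : carrier FA ==> g (ecls f) = ev f m"
 unfolding env_alg_def using FA.quot_lift[OF env_ideal_subspace ev_clin[OF assms] ev_ideal[OF _ assms]] by blast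

end


section \<open>Induced modules\<close>

lemma sub_super_simps [simp]:
 "carrier (sub_super L W) = W" "add (sub_super L W) = add L" "zero (sub_super L W) = zero L"
 "module.smult (sub_super L W) = module.smult L" "hpart (sub_super L W) p = hpart L p \<inter> W"
 "bracket (sub_super L W) = bracket L"
 by (simp_all add: sub_super_def)

lemma (in cspace) carrier_update_clin:
 assumes "csub W V" "clin V U f"
 shows "clin (V\<lparr>carrier := W\<rparr>) U f"
 using assms(2) subspaceD(2)[OF assms(1)] subspace_cspace[OF assms(1)]
 unfolding clin_def clin_axioms_def by (auto simp: LinearCombinations.module_hom_def Pi_def)

lemma the_elem_image_const:
 assumes "x : X" "!!y. y : X ==> f y = f x"
 shows "the_elem (f ` X) = f x"
proof -
 have "f ` X = {f x}" using assms(1) assms(2) by blast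
 then show ?thesis by simp
qed

locale ind = envl L + P: envl_rep "sub_super L W" N \<rho>
 for L :: "'l lie_super" (structure) and W :: "'l set" and N :: "(complex, 'v) module" and \<rho> +
 assumes W_sub: "csub W L"
begin

sublocale T: ctensor "env_alg L" N
 by (intro ctensor.intro UE.cspace_axioms P.U.cspace_axioms)

lemmas WD = subspaceD[OF W_sub]

lemma FA_incl: "f : carrier P.FA ==> f : carrier FA"
 using WD(1) lists_mono[OF WD(1)] by auto

text \<open>The elements of the big ideal supported on words over W form an ideal of the small free
  algebra that contains its relations. This makes the map between the enveloping algebras well
  defined; injectivity, which belongs to PBW, is not claimed.\<close>

lemma env_ideal_incl: "env_ideal (sub_super L W) <= env_ideal L"
proof -
 interpret I: ideal "env_ideal L" FA by (rule env_ideal_ideal)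
 note s = FA.subspaceD[OF env_ideal_subspace]
 have "ideal {f : carrier P.FA. f : env_ideal L} P.FA"
 proof (rule free_algebra_idealI)
  show "csub {f : carrier P.FA. f : env_ideal L} P.FA"
  proof (rule P.FA.subspaceI)
   show "x \<oplus>\<^bsub>P.FA\<^esub> y : {f : carrier P.FA. f : env_ideal L}"
    if "x : {f : carrier P.FA. f : env_ideal L}" "y : {f : carrier P.FA. f : env_ideal L}" for x y
    using P.FA.add.m_closed[of x y] s(4)[of x y] that by simp
   show "c \<odot>\<^bsub>P.FA\<^esub> x : {f : carrier P.FA. f : env_ideal L}"
    if "x : {f : carrier P.FA. f : env_ideal L}" for c x
    using P.FA.sm_closed[of x c] s(5)[of x c] that by simp
  qed (use s(3) in auto)
  fix f g assume h: "f : {f : carrier P.FA. f : env_ideal L}" "g : carrier P.FA"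
  then have g: "g : carrier FA" using FA_incl by blast
  show "g * f : {f : carrier P.FA. f : env_ideal L}"
   using h I.I_l_closed[of f g] g by (simp add: keys_times_lists)
  show "f * g : {f : carrier P.FA. f : env_ideal L}"
   using h I.I_r_closed[of f g] g by (simp add: keys_times_lists)
 qed
 moreover have "env_rels (sub_super L W) <= {f : carrier P.FA. f : env_ideal L}"
 proof -
  have "env_rels (sub_super L W) <= env_rels L"
   unfolding env_rels_def sub_super_simps using WD(1) by blast
  then show ?thesis using P.env_rels_carrier env_rels_mem by blast
 qed
 ultimately show ?thesis using P.env_ideal_least by blast
qed

lemma env_incl_cls:
 assumes "f : carrier P.FA"
 shows "env_incl L (P.ecls f) = ecls f"
proof -
 have "(\<Union>g\<in>P.ecls f. ecls g) = ecls f"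
 proof (rule P.FA.coset_UN[OF P.env_ideal_subspace assms])
  fix y assume y: "y : carrier P.FA" "y \<ominus>\<^bsub>P.FA\<^esub> f : env_ideal (sub_super L W)"
  then have "y - f : env_ideal L" using assms env_ideal_incl by auto
  then show "ecls y = ecls f" using ecls_eq_iff FA_incl y assms by blast
 qed
 then show ?thesis by (simp add: env_incl_def)
qed

lemma env_act_cls:
 assumes f: "f : carrier P.FA" and v: "v : carrier N"
 shows "env_act N \<rho> (P.ecls f) v = P.ev f v"
proof -
 have "the_elem ((%f. P.ev f v) ` P.ecls f) = P.ev f v"
 proof (rule the_elem_image_const)
  show "f : P.ecls f" by (rule P.FA.coset_self[OF P.env_ideal_subspace f])
  fix g assume "g : P.ecls f"
  then have g: "g : carrier P.FA" "g \<ominus>\<^bsub>P.FA\<^esub> f : env_ideal (sub_super L W)"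
   using P.FA.coset_memD[OF P.env_ideal_subspace f] by auto
  have "P.ev g v \<ominus>\<^bsub>N\<^esub> P.ev f v = \<zero>\<^bsub>N\<^esub>"
   using clin.minus[OF P.ev_clin[OF v] g(1) f] P.ev_ideal[OF g(2) v] by simp
  then show "P.ev g v = P.ev f v" using P.U.minus_eq_zero_iff P.ev_closed v f g(1) by blast
 qed
 then show ?thesis by (simp add: env_act_def P.ev_def pm_eval_def)
qed

abbreviation FSK where "FSK \<equiv> free_space (carrier (env_alg L) \<times> carrier N)"

definition ind_rels where
 "ind_rels = {sgl (u \<otimes>\<^bsub>env_alg L\<^esub> env_incl L a, v) 1
      - sgl (u, env_act N \<rho> a v) (1 :: complex) | u a v.
      u : carrier (env_alg L) & a : carrier (env_alg (sub_super L W)) & v : carrier N}"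

lemma env_incl_closed: "a : carrier (env_alg (sub_super L W)) ==> env_incl L a : carrier (env_alg L)"
 using env_incl_cls FA_incl unfolding P.env_carrier env_carrier by auto

lemma env_act_closed: "a : carrier (env_alg (sub_super L W)) ==> v : carrier N ==> env_act N \<rho> a v : carrier N"
 using env_act_cls P.ev_closed unfolding P.env_carrier by auto

lemma induced_null_eq: "induced_null L W N \<rho> = vspan FSK (tensor_rels (env_alg L) N \<union> ind_rels)"
 by (simp add: induced_null_def ind_rels_def)

lemma rels_carrier: "tensor_rels (env_alg L) N \<union> ind_rels <= carrier FSK"
proof -
 have "ind_rels <= carrier FSK"
 proof
  fix t assume "t : ind_rels"
  then obtain u a v where t: "t = sgl (u \<otimes>\<^bsub>env_alg L\<^esub> env_incl L a, v) 1
      - sgl (u, env_act N \<rho> a v) 1" and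
   h: "u : carrier (env_alg L)" "a : carrier (env_alg (sub_super L W))" "v : carrier N" unfolding ind_rels_def by blast
  have "(u \<otimes>\<^bsub>env_alg L\<^esub> env_incl L a, v) : carrier (env_alg L) \<times> carrier N"
   "(u, env_act N \<rho> a v) : carrier (env_alg L) \<times> carrier N"
   using h env_mult_closed env_incl_closed env_act_closed by auto
  then show "t : carrier FSK" unfolding t by (simp add: keys_single_diff)
 qed
 then show ?thesis using T.tensor_rels_carrier by blast
qed

lemma induced_null_subspace: "csub (induced_null L W N \<rho>) FSK"
 unfolding induced_null_eq by (rule T.F.span_subspace[OF rels_carrier])

sublocale K: cspace "induced L W N \<rho>"
 unfolding induced_def by (rule T.F.quot_cspace[OF induced_null_subspace])

abbreviation kcls where "kcls f \<equiv> induced_null L W N \<rho> +>\<^bsub>FSK\<^esub> f"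

abbreviation IK where "IK \<equiv> induced L W N \<rho>"

definition kap where "kap u v = kcls (sgl (u, v) 1)"

lemma kcls_clin: "clin FSK IK kcls"
 unfolding induced_def by (rule T.F.quot_proj_clin[OF induced_null_subspace])

lemma kap_closed: "u : carrier (env_alg L) ==> v : carrier N ==> kap u v : carrier IK"
 unfolding kap_def by (rule clin.closed[OF kcls_clin]) simp

lemma IK_carrier: "carrier IK = kcls ` carrier FSK"
 unfolding induced_def using T.F.quot_carrier[OF induced_null_subspace] by auto

text \<open>The counterpart of \<open>kills_tensor_null\<close> over the smaller enveloping algebra,
  with balancedness of \<open>be\<close> as the additional condition.\<close>

lemma kills_induced_null:
 assumes F: "clin FSK U F" and b: "bilinear_map (env_alg L) N U be"
  and Fs: "!!u v. u : carrier (env_alg L) ==> v : carrier N ==> F (sgl (u, v) 1) = be u v"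
  and P: "!!u a v. u : carrier (env_alg L) ==> a : carrier (env_alg (sub_super L W)) ==> v : carrier N ==>
   be (u \<otimes>\<^bsub>env_alg L\<^esub> env_incl L a) v = be u (env_act N \<rho> a v)"
  and n: "n : induced_null L W N \<rho>"
 shows "F n = \<zero>\<^bsub>U\<^esub>"
proof -
 interpret f: clin FSK U F by fact
 have "tensor_rels (env_alg L) N \<union> ind_rels <= {x : carrier FSK. F x : {\<zero>\<^bsub>U\<^esub>}}"
 proof
  fix t assume t: "t : tensor_rels (env_alg L) N \<union> ind_rels"
  then have tc: "t : carrier FSK" using rels_carrier by blast
  have "F t = \<zero>\<^bsub>U\<^esub>"
  proof (cases "t : tensor_rels (env_alg L) N")
   case True
   then have tn: "t : tensor_null (env_alg L) N"
    unfolding tensor_null_def by (rule T.F.span_incl[OF T.tensor_rels_carrier])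
   show ?thesis by (rule T.kills_tensor_null[OF F b _ tn]) (rule Fs)
  next
   case False
   then have "t : ind_rels" using t by blast
   then obtain u a v where t: "t = sgl (u \<otimes>\<^bsub>env_alg L\<^esub> env_incl L a, v) 1
       - sgl (u, env_act N \<rho> a v) 1" and
    h: "u : carrier (env_alg L)" "a : carrier (env_alg (sub_super L W))" "v : carrier N" unfolding ind_rels_def by blast
   have c: "u \<otimes>\<^bsub>env_alg L\<^esub> env_incl L a : carrier (env_alg L)" "env_act N \<rho> a v : carrier N"
    using h env_mult_closed env_incl_closed env_act_closed by auto
   have "F t = be (u \<otimes>\<^bsub>env_alg L\<^esub> env_incl L a) v \<ominus>\<^bsub>U\<^esub> be u (env_act N \<rho> a v)"
    unfolding t using f.minus[of "sgl (u \<otimes>\<^bsub>env_alg L\<^esub> env_incl L a, v) 1" "sgl (u, env_act N \<rho> a v) 1"]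
     h c Fs by simp
   also have "... = \<zero>\<^bsub>U\<^esub>"
    using P[OF h] f.closed[of "sgl (u, env_act N \<rho> a v) 1"] h c Fs by simp
   finally show ?thesis .
  qed
  then show "t : {x : carrier FSK. F x : {\<zero>\<^bsub>U\<^esub>}}" using tc by simp
 qed
 from T.F.span_least[OF f.subspace_vimage[OF f.W.subspace_zero] this] n
 show ?thesis unfolding induced_null_eq by blast
qed

text \<open>The induced module is a further quotient of the tensor product over the complex numbers,
  so bilinearity and generation by pure tensors are inherited.\<close>

lemma kap_tensor:
 "\<exists>g. clin (tensor (env_alg L) N) IK g &
  (\<forall>u\<in>carrier (env_alg L). \<forall>v\<in>carrier N. kap u v = g (ptn (env_alg L) N u v)) &
  carrier IK = g ` carrier (tensor (env_alg L) N)"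
proof -
 have sub: "tensor_null (env_alg L) N <= induced_null L W N \<rho>"
  unfolding tensor_null_def induced_null_eq by (rule T.F.span_mono) blast
 have "kcls n = \<zero>\<^bsub>IK\<^esub>" if "n : tensor_null (env_alg L) N" for n
 proof -
  have n: "n : induced_null L W N \<rho>" "n : carrier FSK"
   using that sub T.F.subspaceD(2)[OF induced_null_subspace] by auto
  then have "kcls n = kcls \<zero>\<^bsub>FSK\<^esub>" using T.F.coset_eq_iff[OF induced_null_subspace, of n "\<zero>\<^bsub>FSK\<^esub>"] by simp
  then show ?thesis using clin.zero[OF kcls_clin] by simp
 qed
 then obtain g where g: "clin (tensor (env_alg L) N) IK g" "!!f. f : carrier FSK ==> g (T.cls f) = kcls f"
  using T.F.quot_lift[OF T.tensor_null_subspace kcls_clin] unfolding tensor_def by blast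
 have "carrier IK = g ` carrier (tensor (env_alg L) N)"
  unfolding IK_carrier T.tensor_carrier image_image using g(2) by (intro image_cong) auto
 then show ?thesis using g by (intro exI[of _ g]) (simp add: kap_def pure_tensor_def)
qed

lemma kap_clin_left: "v : carrier N ==> clin (env_alg L) IK (%u. kap u v)"
 and kap_clin_right: "u : carrier (env_alg L) ==> clin N IK (kap u)"
proof -
 obtain g where g: "clin (tensor (env_alg L) N) IK g"
  "!!u v. u : carrier (env_alg L) ==> v : carrier N ==> kap u v = g (ptn (env_alg L) N u v)"
  "carrier IK = g ` carrier (tensor (env_alg L) N)"
  using kap_tensor by (elim exE conjE) (rule that, auto)
 note bd = bilinear_mapD[OF UE.cspace_axioms P.U.cspace_axioms T.T.cspace_axioms T.pure_tensor_bilinear]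
 show "clin (env_alg L) IK (%u. kap u v)" if "v : carrier N"
  by (rule clin_cong[OF clin_comp[OF bd(2)[OF that] g(1)]]) (use g(2) that in simp)
 show "clin N IK (kap u)" if "u : carrier (env_alg L)"
  by (rule clin_cong[OF clin_comp[OF bd(1)[OF that] g(1)]]) (use g(2) that in simp)
qed

lemma kap_span: "carrier IK = vspan IK {kap u v | u v. u : carrier (env_alg L) & v : carrier N}"
proof -
 obtain g where g: "clin (tensor (env_alg L) N) IK g"
  "!!u v. u : carrier (env_alg L) ==> v : carrier N ==> kap u v = g (ptn (env_alg L) N u v)"
  "carrier IK = g ` carrier (tensor (env_alg L) N)"
  using kap_tensor by (elim exE conjE) (rule that, auto)
 let ?S = "{ptn (env_alg L) N u v | u v. u : carrier (env_alg L) & v : carrier N}"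
 have "carrier IK = g ` vspan (tensor (env_alg L) N) ?S" using g(3) T.tensor_span by simp
 also have "... = vspan IK (g ` ?S)" by (rule clin.span_image[OF g(1)]) auto
 also have "g ` ?S = {kap u v | u v. u : carrier (env_alg L) & v : carrier N}"
  using g(2) by (auto simp: image_def) metis+
 finally show ?thesis .
qed

lemma kap_balanced:
 assumes h: "u : carrier (env_alg L)" "a : carrier (env_alg (sub_super L W))" "v : carrier N"
 shows "kap (u \<otimes>\<^bsub>env_alg L\<^esub> env_incl L a) v = kap u (env_act N \<rho> a v)"
proof -
 have c: "u \<otimes>\<^bsub>env_alg L\<^esub> env_incl L a : carrier (env_alg L)" "env_act N \<rho> a v : carrier N"
  using h env_mult_closed env_incl_closed env_act_closed by auto
 have "sgl (u \<otimes>\<^bsub>env_alg L\<^esub> env_incl L a, v) 1 - sgl (u, env_act N \<rho> a v) 1 : induced_null L W N \<rho>"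
  unfolding induced_null_eq by (rule T.F.span_incl[OF rels_carrier]) (use h in \<open>auto simp: ind_rels_def\<close>)
 then show ?thesis unfolding kap_def using c h by (subst T.F.coset_eq_iff[OF induced_null_subspace]) auto
qed

lemma kap_P:
 assumes "u : carrier (env_alg L)" "x : W" "v : carrier N"
 shows "kap (u \<otimes>\<^bsub>env_alg L\<^esub> env_word L [x]) v = kap u (\<rho> x v)"
proof -
 let ?f = "sgl [x] (1::complex)"
 have f: "?f : carrier P.FA" using assms by simp
 have "P.ecls ?f : carrier (env_alg (sub_super L W))" unfolding P.env_carrier using f by blast
 moreover have "P.ev ?f v = \<rho> x v"
  using assms P.ev_single[of "[x]" v 1] clin.closed[OF P.r_clin, of x v] by simp
 ultimately show ?thesis
  using kap_balanced[of u "P.ecls ?f" v] env_incl_cls[OF f] env_act_cls[OF f assms(3)] assms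
  by (simp add: env_word_def)
qed

text \<open>The class of a word tensored with v. Computation in the induced module takes place on
  these: brackets rewrite neighbouring letters (\<open>kw_bracket\<close>), and a last letter from W
  is absorbed into v (\<open>kw_P\<close>).\<close>

definition kw where "kw w v = kap (env_word L w) v"

lemma kw_closed: "w : lists (carrier L) ==> v : carrier N ==> kw w v : carrier IK"
 by (simp add: kw_def kap_closed)

lemma kw_clin_right: "w : lists (carrier L) ==> clin N IK (kw w)"
 unfolding kw_def by (rule kap_clin_right) simp

lemma kw_span: "carrier IK = vspan IK {kw w v | w v. w : lists (carrier L) & v : carrier N}"
proof -
 let ?S = "{kw w v | w v. w : lists (carrier L) & v : carrier N}"
 have S: "?S <= carrier IK" using kw_closed by blast
 have "kap u v : vspan IK ?S" if "u : carrier (env_alg L)" and v: "v : carrier N" for u v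
 proof (rule clin.span_into[OF kap_clin_left[OF v] _ K.span_subspace[OF S]])
  show "u : vspan (env_alg L) {env_word L w | w. w : lists (carrier L)}" using that env_span by simp
  show "kap x v : vspan IK ?S" if "x : {env_word L w | w. w : lists (carrier L)}" for x
   by (rule K.span_incl[OF S]) (use that v in \<open>auto simp: kw_def\<close>)
 qed (use env_word_closed in blast)
 then have "vspan IK {kap u v | u v. u : carrier (env_alg L) & v : carrier N} <= vspan IK ?S"
  by (intro K.span_least K.span_subspace S) auto
 then show ?thesis using kap_span K.span_closed[OF S] by blast
qed

lemma kw_bracket:
 assumes u: "u : lists (carrier L)" and w: "w : lists (carrier L)" and x: "x : hpart L p" and y: "y : hpart L q"
  and v: "v : carrier N"
 shows "kw (u @ x # y # w) v = ssign p q \<odot>\<^bsub>IK\<^esub> kw (u @ y # x # w) v \<oplus>\<^bsub>IK\<^esub> kw (u @ bracket L x y # w) v"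
proof -
 interpret k: clin "env_alg L" IK "%u. kap u v" by (rule kap_clin_left[OF v])
 have "env_word L (u @ y # x # w) : carrier (env_alg L)" "env_word L (u @ bracket L x y # w) : carrier (env_alg L)"
  using u w x y hsub brc by auto
 then show ?thesis unfolding kw_def env_word_bracket[OF u w x y] by (simp add: k.add k.sm)
qed

lemma kw_P:
 assumes "w : lists (carrier L)" "x : W" "v : carrier N"
 shows "kw (w @ [x]) v = kw w (\<rho> x v)"
 using kap_P[of "env_word L w" x v] env_word_mult[of w "[x]"] assms WD(2) by (simp add: kw_def)

text \<open>Multiplication by y happens on the left of u, the balancing relations on its right;
  associativity makes the two compatible.\<close>

lemma induced_act_clin:
 assumes y: "y : carrier L"
 shows "clin IK IK (induced_act L W N \<rho> y)"
  and "u : carrier (env_alg L) ==> v : carrier N ==> induced_act L W N \<rho> y (kap u v) = kap (env_word L [y] \<otimes>\<^bsub>env_alg L\<^esub> u) v"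
proof -
 let ?y = "env_word L [y]"
 let ?le = "lin_ext (%(u, v). (?y \<otimes>\<^bsub>env_alg L\<^esub> u, v))"
 have yc: "?y : carrier (env_alg L)" using y by simp
 note lm = left_env_mult_clin[OF yc]
 have le: "clin FSK FSK ?le" by (rule lin_ext_clin) (use env_mult_closed[OF yc] in auto)
 have F: "clin FSK IK (%f. kcls (?le f))" by (rule clin_comp[OF le kcls_clin])
 have b: "bilinear_map (env_alg L) N IK (%u v. kap (?y \<otimes>\<^bsub>env_alg L\<^esub> u) v)"
  by (intro bilinear_mapI UE.cspace_axioms P.U.cspace_axioms K.cspace_axioms kap_clin_right
    env_mult_closed yc clin_comp[OF lm kap_clin_left])
 have kill: "kcls (?le n) = \<zero>\<^bsub>IK\<^esub>" if "n : induced_null L W N \<rho>" for n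
 proof (rule kills_induced_null[OF F b _ _ that])
  show "kap (?y \<otimes>\<^bsub>env_alg L\<^esub> (u \<otimes>\<^bsub>env_alg L\<^esub> env_incl L a)) v = kap (?y \<otimes>\<^bsub>env_alg L\<^esub> u) (env_act N \<rho> a v)"
   if "u : carrier (env_alg L)" "a : carrier (env_alg (sub_super L W))" "v : carrier N" for u a v
   using that kap_balanced[of "?y \<otimes>\<^bsub>env_alg L\<^esub> u" a v] env_mult_closed[OF yc] env_incl_closed env_mult_assoc[OF yc]
   by simp
 qed (simp add: kap_def)
 have act: "induced_act L W N \<rho> y (kcls f) = kcls (?le f)" if f: "f : carrier FSK" for f
 proof -
  have "(\<Union>g\<in>kcls f. kcls (?le g)) = kcls (?le f)"
  proof (rule T.F.coset_UN[OF induced_null_subspace f])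
   fix g assume g: "g : carrier FSK" "g \<ominus>\<^bsub>FSK\<^esub> f : induced_null L W N \<rho>"
   have "kcls (?le g) \<ominus>\<^bsub>IK\<^esub> kcls (?le f) = \<zero>\<^bsub>IK\<^esub>" using clin.minus[OF F g(1) f] kill[OF g(2)] by simp
   then show "kcls (?le g) = kcls (?le f)" using K.minus_eq_zero_iff clin.closed[OF F] f g(1) by blast
  qed
  then show ?thesis by (simp add: induced_act_def)
 qed
 obtain h where h: "clin IK IK h" "!!f. f : carrier FSK ==> h (kcls f) = kcls (?le f)"
  using T.F.quot_lift[OF induced_null_subspace F kill] unfolding induced_def by blast
 show "clin IK IK (induced_act L W N \<rho> y)"
  by (rule clin_cong[OF h(1)]) (auto simp: IK_carrier h(2) act)
 show "induced_act L W N \<rho> y (kap u v) = kap (?y \<otimes>\<^bsub>env_alg L\<^esub> u) v" if "u : carrier (env_alg L)" "v : carrier N"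
  unfolding kap_def using act[of "sgl (u, v) 1"] that by simp
qed

abbreviation act where "act \<equiv> induced_act L W N \<rho>"

lemma act_kw: "y : carrier L ==> w : lists (carrier L) ==> v : carrier N ==> act y (kw w v) = kw (y # w) v"
 using induced_act_clin(2)[of y "env_word L w" v] env_word_mult[of "[y]" w] by (simp add: kw_def)

lemma act_closed: "y : carrier L ==> k : carrier IK ==> act y k : carrier IK"
 using clin.closed[OF induced_act_clin(1)] by blast

lemma kw_set_closed: "{kw w v | w v. w : lists (carrier L) & v : carrier N} <= carrier IK"
 using kw_closed by blast

lemma kw_clin_head:
 assumes "w : lists (carrier L)" "v : carrier N"
 shows "clin L IK (%x. kw (x # w) v)"
 using clin_comp[OF env_word_linear[of "[]" w] kap_clin_left[OF assms(2)]] assms by (simp add: kw_def)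

lemma act_clin_left:
 assumes "k : carrier IK"
 shows "clin L IK (%x. act x k)"
proof (intro clin.intro clin_axioms.intro lin_mapI cspace_axioms K.cspace_axioms)
 have ks: "k : vspan IK {kw w v | w v. w : lists (carrier L) & v : carrier N}" using assms kw_span by simp
 show "act x k : carrier IK" if "x : carrier L" for x using act_closed that assms by blast
 show "act (x \<oplus> y) k = act x k \<oplus>\<^bsub>IK\<^esub> act y k" if "x : carrier L" "y : carrier L" for x y
  using ks kw_set_closed
 proof (induction rule: K.span_induct)
  case (base z)
  then obtain w v where wv: "w : lists (carrier L)" "v : carrier N" "z = kw w v" by blast
  then show ?case using that clin.add[OF kw_clin_head[OF wv(1,2)] that] by (simp add: act_kw[OF _ wv(1,2)])
 next
  case (add a b)
  then show ?case using that clin.add[OF induced_act_clin(1), of _ a b] act_closed by (simp add: K.a_ac)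
 next
  case (smult c a)
  then show ?case using that clin.sm[OF induced_act_clin(1), of _ a c] act_closed by (simp add: K.sm_add_right)
 qed (use that clin.zero[OF induced_act_clin(1)] in simp)
 show "act (a \<odot> x) k = a \<odot>\<^bsub>IK\<^esub> act x k" if "x : carrier L" for x a
  using ks kw_set_closed
 proof (induction rule: K.span_induct)
  case (base z)
  then obtain w v where wv: "w : lists (carrier L)" "v : carrier N" "z = kw w v" by blast
  then show ?case using that clin.sm[OF kw_clin_head[OF wv(1,2)] that] by (simp add: act_kw[OF _ wv(1,2)])
 next
  case (add b d)
  then show ?case using that clin.add[OF induced_act_clin(1), of _ b d] act_closed by (simp add: K.sm_add_right)
 next
  case (smult c b)
  then show ?case using that clin.sm[OF induced_act_clin(1), of _ b c] act_closed by (simp add: mult.commute)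
 qed (use that clin.zero[OF induced_act_clin(1)] in simp)
qed

text \<open>Both sides are linear in k, and on a word the identity is the defining relation at the
  front.\<close>

lemma act_bracket:
 assumes x: "x : hpart L p" and y: "y : hpart L q" and k: "k : carrier IK"
 shows "act x (act y k) = ssign p q \<odot>\<^bsub>IK\<^esub> act y (act x k) \<oplus>\<^bsub>IK\<^esub> act (bracket L x y) k"
proof -
 have c: "x : carrier L" "y : carrier L" "bracket L x y : carrier L" using x y hsub brc by auto
 have "k : vspan IK {kw w v | w v. w : lists (carrier L) & v : carrier N}" using k kw_span by simp
 from this kw_set_closed show ?thesis
 proof (induction rule: K.span_induct)
  case (base z)
  then obtain w v where wv: "w : lists (carrier L)" "v : carrier N" "z = kw w v" by blast
  then show ?case using c kw_bracket[of "[]" w x p y q v] x y by (simp add: act_kw)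
 next
  case (add a b)
  then show ?case using c clin.add[OF induced_act_clin(1)] act_closed by (simp add: K.sm_add_right K.a_ac)
 next
  case (smult d a)
  then show ?case using c clin.sm[OF induced_act_clin(1)] act_closed by (simp add: K.sm_add_right mult.commute)
 qed (use c clin.zero[OF induced_act_clin(1)] in simp)
qed

text \<open>A relation rather than a parity function: the zero vector is homogeneous of both
  parities, so a word may have more than one.\<close>

definition hom_word :: "'l list => bit => bool" where
 "hom_word w p \<longleftrightarrow> (\<exists>ps. list_all2 (%x q. x : hpart L q) w ps & sum_list ps = p)"

lemma hom_word_Nil: "hom_word [] p \<longleftrightarrow> p = 0"
 by (auto simp: hom_word_def)

lemma hom_word_Cons: "hom_word (x # w) p \<longleftrightarrow> (\<exists>q q'. x : hpart L q & hom_word w q' & p = q + q')"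
proof
 assume "hom_word (x # w) p"
 then obtain q qs where "x : hpart L q" "list_all2 (%x q. x : hpart L q) w qs" "q + sum_list qs = p"
  unfolding hom_word_def list_all2_Cons1 by auto
 then show "\<exists>q q'. x : hpart L q & hom_word w q' & p = q + q'" unfolding hom_word_def by blast
next
 assume "\<exists>q q'. x : hpart L q & hom_word w q' & p = q + q'"
 then obtain q qs where "x : hpart L q" "list_all2 (%x q. x : hpart L q) w qs" "p = q + sum_list qs"
  unfolding hom_word_def by blast
 then show "hom_word (x # w) p" unfolding hom_word_def by (intro exI[of _ "q # qs"]) simp
qed

lemma hom_word_carrier: "hom_word w p ==> w : lists (carrier L)"
proof (induction w arbitrary: p)
 case (Cons x w)
 then show ?case using hsub by (auto simp: hom_word_Cons)
qed simp

lemma induced_part_eq: "induced_part L W N \<rho> p = vspan IK {kw w v | w v. hom_word w p & v : carrier N}"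
proof -
 let ?S = "{kw w v | w v. hom_word w p & v : carrier N}"
 let ?E = "{env_word L w | w. hom_word w p}"
 have E: "?E <= carrier (env_alg L)" using hom_word_carrier by auto
 have ep: "env_part L p = vspan (env_alg L) ?E" by (simp add: env_part_def hom_word_def)
 let ?T = "{kap u v | u v. u : env_part L p & v : carrier N}"
 have S: "?S <= carrier IK" using kw_closed hom_word_carrier by blast
 have T: "?T <= carrier IK" using kap_closed UE.span_closed[OF E] unfolding ep by blast
 have "?T <= vspan IK ?S"
 proof
  fix t assume "t : ?T"
  then obtain u v where uv: "u : vspan (env_alg L) ?E" "v : carrier N" "t = kap u v" unfolding ep by blast
  show "t : vspan IK ?S"
   unfolding uv(3)
  proof (rule clin.span_into[OF kap_clin_left[OF uv(2)] E K.span_subspace[OF S] _ uv(1)])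
   show "kap x v : vspan IK ?S" if "x : ?E" for x
    by (rule K.span_incl[OF S]) (use that uv(2) in \<open>auto simp: kw_def\<close>)
  qed
 qed
 moreover have "?S <= ?T" using UE.span_incl[OF E] unfolding ep kw_def by blast
 ultimately have "vspan IK ?T = vspan IK ?S"
  using K.span_least[OF K.span_subspace[OF S]] K.span_mono[of ?S ?T] by blast
 moreover have "induced_part L W N \<rho> p = vspan IK ?T" by (simp add: induced_part_def kap_def)
 ultimately show ?thesis by simp
qed

text \<open>Frobenius reciprocity: u \<otimes> v goes to u applied to \<iota> v, and equivariance of
  \<iota> under W makes this balanced.\<close>

lemma induced_lift:
 assumes r: "envl_rep L U r" and \<iota>: "clin N U \<iota>"
  and eq: "!!x v. x : W ==> v : carrier N ==> r x (\<iota> v) = \<iota> (\<rho> x v)"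
 obtains Ph where "clin IK U Ph" "!!w v. w : lists (carrier L) ==> v : carrier N ==> Ph (kw w v) = foldr r w (\<iota> v)"
proof -
 interpret R: envl_rep L U r by fact
 interpret i: clin N U \<iota> by fact
 have "\<forall>m\<in>carrier U. \<exists>g. clin (env_alg L) U g & (\<forall>f\<in>carrier FA. g (ecls f) = R.ev f m)"
 proof
  fix m assume "m : carrier U"
  then show "\<exists>g. clin (env_alg L) U g & (\<forall>f\<in>carrier FA. g (ecls f) = R.ev f m)"
   by (rule R.ev_ecls) (intro exI conjI ballI, assumption)
 qed
 then obtain G where G: "!!m. m : carrier U ==> clin (env_alg L) U (G m)"
  "!!m f. m : carrier U ==> f : carrier FA ==> G m (ecls f) = R.ev f m" by metis
 define be where "be u v = G (\<iota> v) u" for u v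
 have be: "be (ecls f) v = R.ev f (\<iota> v)" if "f : carrier FA" "v : carrier N" for f v
  using G(2) that by (simp add: be_def)
 have b: "bilinear_map (env_alg L) N U be"
 proof (intro bilinear_mapI UE.cspace_axioms P.U.cspace_axioms R.U.cspace_axioms)
  show "clin (env_alg L) U (%u. be u v)" if "v : carrier N" for v using G(1) that by (simp add: be_def)
  show "clin N U (be u)" if u: "u : carrier (env_alg L)" for u
  proof -
   obtain f where f: "f : carrier FA" "u = ecls f" using u unfolding env_carrier by blast
   show ?thesis
    by (rule clin_cong[OF clin_comp[OF \<iota> R.ev_clin_right[OF f(1)]]]) (simp add: f(2) be[OF f(1)])
  qed
 qed
 \<comment> \<open>Equivariance for single elements of W extends to words and, by linearity, to the
   free algebra over W.\<close>
 have evP: "R.ev g (\<iota> v) = \<iota> (P.ev g v)" if g: "g : carrier P.FA" and v: "v : carrier N" for g v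
 proof (rule clin_eq_on_span[OF _ clin_comp[OF P.ev_clin[OF v] \<iota>] P.singles_sub])
  show "g : vspan P.FA {sgl w 1 |w. w : lists (carrier (sub_super L W))}"
   using g free_algebra_span by blast
  have e: "clin FA U (%f. R.ev f (\<iota> v))" using v by (intro R.ev_clin) auto
  show "clin P.FA U (%f. R.ev f (\<iota> v))"
   by (intro clin.intro clin_axioms.intro lin_mapI P.FA.cspace_axioms R.U.cspace_axioms)
    (use clin.closed[OF e FA_incl] clin.add[OF e FA_incl FA_incl] clin.sm[OF e FA_incl] in simp_all)
  fix x assume "x : {sgl w (1::complex) |w. w : lists (carrier (sub_super L W))}"
  then obtain w where w: "w : lists W" "x = sgl w 1" by auto
  have wL: "w : lists (carrier L)" using w WD(2) by auto
  have "foldr r w (\<iota> v) = \<iota> (foldr \<rho> w v)"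
   using w(1)
  proof (induction w)
   case (Cons x w)
   then show ?case using eq[of x "foldr \<rho> w v"] P.foldr_r_closed[of w v] v by simp
  qed simp
  then show "R.ev x (\<iota> v) = \<iota> (P.ev x v)"
   using w v wL R.ev_single[OF wL, of "\<iota> v" 1] P.ev_single[of w v 1] P.foldr_r_closed[of w v] by simp
 qed
 have bal: "be (u \<otimes>\<^bsub>env_alg L\<^esub> env_incl L a) v = be u (env_act N \<rho> a v)"
  if u: "u : carrier (env_alg L)" and a: "a : carrier (env_alg (sub_super L W))" and v: "v : carrier N" for u a v
 proof -
  obtain f where f: "f : carrier FA" "u = ecls f" using u unfolding env_carrier by blast
  obtain g where g: "g : carrier P.FA" "a = P.ecls g" using a unfolding P.env_carrier by blast
  have fg: "f * g : carrier FA" using f FA_incl[OF g(1)] by (simp add: keys_times_lists)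
  show ?thesis
   unfolding f(2) g(2) env_incl_cls[OF g(1)] env_act_cls[OF g(1) v] env_mult[OF f(1) FA_incl[OF g(1)]]
    be[OF fg v] be[OF f(1) P.ev_closed[OF g(1) v]] R.ev_mult[OF f(1) FA_incl[OF g(1)] i.closed[OF v]]
    evP[OF g(1) v] ..
 qed
 have bc: "be u v : carrier U" if "u : carrier (env_alg L)" "v : carrier N" for u v
  using clin.closed[OF G(1)] that by (simp add: be_def)
 let ?F = "pm_eval U (%(u, v). be u v)"
 have F: "clin FSK U ?F" by (rule R.U.pm_eval_clin) (auto simp: bc)
 have Fs: "?F (sgl (u, v) 1) = be u v" if "u : carrier (env_alg L)" "v : carrier N" for u v
  using bc[OF that] by (subst R.U.pm_eval_single) auto
 obtain Ph where Ph: "clin IK U Ph" "!!f. f : carrier FSK ==> Ph (kcls f) = ?F f"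
  unfolding induced_def by (rule T.F.quot_lift[OF induced_null_subspace F kills_induced_null[OF F b Fs bal]]) auto
 have "Ph (kw w v) = foldr r w (\<iota> v)" if w: "w : lists (carrier L)" and v: "v : carrier N" for w v
 proof -
  have "Ph (kw w v) = be (env_word L w) v" using Ph(2)[of "sgl (env_word L w, v) 1"] w v Fs
   by (simp add: kw_def kap_def)
  also have "... = foldr r w (\<iota> v)"
   using be[of "sgl w 1" v] R.ev_single[OF w, of "\<iota> v" 1] R.foldr_r_closed[OF w] w v
   by (simp add: env_word_def)
  finally show ?thesis .
 qed
 then show ?thesis using that Ph(1) by blast
qed

end


section \<open>Finite direct sums of copies of a module\<close>

lemma (in cspace) carrier_update_self: "V\<lparr>carrier := carrier V\<rparr> = V"
 by simp

text \<open>K as a direct sum of copies of N, presented by inclusions and projections: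
  \<open>span\<close> says that the copies exhaust K, \<open>pj_kk\<close> that the sum is
  direct.\<close>

locale fin_decomp = N: cspace N + K: cspace K
 for N :: "(complex, 'v, 'x) module_scheme" and K :: "(complex, 'k, 'y) module_scheme" +
 fixes TT :: "'t set" and kk :: "'t => 'v => 'k" and pj :: "'t => 'k => 'v"
 assumes fin: "finite TT" and finN: "findim N"
  and kk_clin: "T : TT ==> clin N K (kk T)" and pj_clin: "T : TT ==> clin K N (pj T)"
  and pj_kk: "T : TT ==> T' : TT ==> v : carrier N ==> pj T (kk T' v) = (if T = T' then v else \<zero>\<^bsub>N\<^esub>)"
  and span: "carrier K = vspan K {kk T v | T v. T : TT & v : carrier N}"
begin

lemma kk_closed: "T : TT ==> v : carrier N ==> kk T v : carrier K"
 using clin.closed[OF kk_clin] by blast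

lemma pj_closed: "T : TT ==> k : carrier K ==> pj T k : carrier N"
 using clin.closed[OF pj_clin] by blast

lemma expand: "k : carrier K ==> k = (\<Oplus>\<^bsub>K\<^esub>T\<in>TT. kk T (pj T k))"
proof -
 assume "k : carrier K"
 then have k: "k : vspan K {kk T v | T v. T : TT & v : carrier N}" using span by simp
 have S: "{kk T v | T v. T : TT & v : carrier N} <= carrier K" using kk_closed by blast
 note c = kk_closed pj_closed
 from k S show ?thesis
 proof (induction rule: K.span_induct)
  case zero
  have "(\<Oplus>\<^bsub>K\<^esub>T\<in>TT. kk T (pj T \<zero>\<^bsub>K\<^esub>)) = (\<Oplus>\<^bsub>K\<^esub>T\<in>TT. \<zero>\<^bsub>K\<^esub>)"
   using clin.zero[OF kk_clin] clin.zero[OF pj_clin] by (intro K.finsum_cong') auto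
  then show ?case by simp
 next
  case (add x y)
  have "(\<Oplus>\<^bsub>K\<^esub>T\<in>TT. kk T (pj T (x \<oplus>\<^bsub>K\<^esub> y))) = (\<Oplus>\<^bsub>K\<^esub>T\<in>TT. kk T (pj T x) \<oplus>\<^bsub>K\<^esub> kk T (pj T y))"
   using add c clin.add[OF kk_clin] clin.add[OF pj_clin] by (intro K.finsum_cong') auto
  also have "... = (\<Oplus>\<^bsub>K\<^esub>T\<in>TT. kk T (pj T x)) \<oplus>\<^bsub>K\<^esub> (\<Oplus>\<^bsub>K\<^esub>T\<in>TT. kk T (pj T y))"
   using add c by (intro K.finsum_addf) auto
  finally show ?case using add by simp
 next
  case (smult a x)
  have "(\<Oplus>\<^bsub>K\<^esub>T\<in>TT. kk T (pj T (a \<odot>\<^bsub>K\<^esub> x))) = (\<Oplus>\<^bsub>K\<^esub>T\<in>TT. a \<odot>\<^bsub>K\<^esub> kk T (pj T x))"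
   using smult c clin.sm[OF kk_clin] clin.sm[OF pj_clin] by (intro K.finsum_cong') auto
  also have "... = a \<odot>\<^bsub>K\<^esub> (\<Oplus>\<^bsub>K\<^esub>T\<in>TT. kk T (pj T x))"
   using smult c by (intro K.finsum_sm[symmetric]) auto
  finally show ?case using smult by simp
 next
  case (base x)
  then obtain T v where Tv: "T : TT" "v : carrier N" "x = kk T v" by blast
  have "(\<Oplus>\<^bsub>K\<^esub>T'\<in>TT. kk T' (pj T' x)) = (\<Oplus>\<^bsub>K\<^esub>T'\<in>TT. if T = T' then kk T' v else \<zero>\<^bsub>K\<^esub>)"
   using Tv c pj_kk clin.zero[OF kk_clin] by (intro K.finsum_cong') auto
  also have "... = kk T v" using K.finsum_singleton[OF Tv(1) fin, of "%T'. kk T' v"] c Tv by auto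
  finally show ?case using Tv by simp
 qed
qed

lemma ext: "k : carrier K ==> k' : carrier K ==> (!!T. T : TT ==> pj T k = pj T k') ==> k = k'"
proof -
 assume h: "k : carrier K" "k' : carrier K" "!!T. T : TT ==> pj T k = pj T k'"
 have "(\<Oplus>\<^bsub>K\<^esub>T\<in>TT. kk T (pj T k)) = (\<Oplus>\<^bsub>K\<^esub>T\<in>TT. kk T (pj T k'))"
  by (intro K.finsum_cong') (use h kk_closed pj_closed in auto)
 then show "k = k'" using expand[OF h(1)] expand[OF h(2)] by simp
qed

text \<open>Sums of one subspace of N per copy. Weight spaces, parity components and their
  intersections all have this shape, so a single dimension formula serves them all.\<close>

definition part :: "('t => 'v set) => 'k set" where
 "part U = vspan K {kk T v | T v. T : TT & v : U T}"

context
 fixes U :: "'t => 'v set"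
 assumes U: "!!T. T : TT ==> csub (U T) N"
begin

lemma part_gens: "{kk T v | T v. T : TT & v : U T} <= carrier K"
 using N.subspaceD(2)[OF U] kk_closed by blast

lemma part_subspace: "csub (part U) K"
 unfolding part_def by (rule K.span_subspace[OF part_gens])

lemma part_iff: "k : part U \<longleftrightarrow> k : carrier K & (\<forall>T\<in>TT. pj T k : U T)"
proof
 assume k: "k : part U"
 have "pj T k : U T" if T: "T : TT" for T
 proof (rule clin.span_into[OF pj_clin[OF T] part_gens U[OF T] _ k[unfolded part_def]])
  fix x assume "x : {kk T v | T v. T : TT & v : U T}"
  then obtain T' v where "T' : TT" "v : U T'" "x = kk T' v" by blast
  then show "pj T x : U T" using pj_kk[OF T] N.subspaceD[OF U] T by simp
 qed
 then show "k : carrier K & (\<forall>T\<in>TT. pj T k : U T)" using k K.subspaceD(2)[OF part_subspace] by blast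
next
 assume k: "k : carrier K & (\<forall>T\<in>TT. pj T k : U T)"
 have "(\<Oplus>\<^bsub>K\<^esub>T\<in>TT. kk T (pj T k)) : part U"
  using k K.span_incl[OF part_gens] by (intro K.subspace_finsum[OF part_subspace]) (auto simp: part_def)
 then show "k : part U" using expand k by simp
qed

text \<open>Bases of the spaces U T, carried into their copies, form a basis indexed by pairs (T,
  i); its dual functionals are those of U T after projection.\<close>

lemma part_dim:
 "findim (K\<lparr>carrier := part U\<rparr>)" "sub_dim K (part U) = (\<Sum>T\<in>TT. sub_dim N (U T))"
proof -
 let ?d = "%T. sub_dim N (U T)"
 have "\<forall>T\<in>TT. \<exists>b ph. cbasis (N\<lparr>carrier := U T\<rparr>) {..<?d T} b ph"
  using cspace.ex_cbasis[OF N.subspace_cspace[OF U] N.subspace_fin_dim[OF finN U]] by blast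
 then obtain b ph where b: "!!T. T : TT ==> cbasis (N\<lparr>carrier := U T\<rparr>) {..<?d T} (b T) (ph T)" by metis
 have bU: "b T i : U T" if "T : TT" "i < ?d T" for T i using b[OF that(1)] that(2) by (auto simp: cbasis_def)
 have lf: "linear_functional (N\<lparr>carrier := U T\<rparr>) (ph T i)" if "T : TT" "i < ?d T" for T i
  using b[OF that(1)] that(2) by (auto simp: cbasis_def)
 have \<delta>: "ph T i (b T j) = (if i = j then 1 else 0)" if "T : TT" "i < ?d T" "j < ?d T" for T i j
  using b[OF that(1)] that by (auto simp: cbasis_def)
 have bsp: "vspan N (b T ` {..<?d T}) = U T" if "T : TT" for T
  using b[OF that] N.span_restrict[OF U[OF that], of "b T ` {..<?d T}"] bU[OF that] by (auto simp: cbasis_def)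
 let ?I = "Sigma TT (%T. {..<?d T})"
 let ?b = "%(T, i). kk T (b T i)" and ?ph = "%(T, i) k. ph T i (pj T k)"
 have bI: "?b ` ?I <= {kk T v | T v. T : TT & v : U T}" using bU by auto
 have UN: "v : carrier N" if "T : TT" "v : U T" for T v using N.subspaceD(2)[OF U] that by blast
 have sub: "?b ` ?I <= part U" using bI K.span_incl[OF part_gens] unfolding part_def by blast
 have subK: "?b ` ?I <= carrier K" using bI part_gens by blast
 have gens: "kk T v : vspan K (?b ` ?I)" if T: "T : TT" and v: "v : U T" for T v
 proof (rule clin.span_into[OF kk_clin[OF T] _ K.span_subspace[OF subK]])
  show "b T ` {..<?d T} <= carrier N" using bU[OF T] UN[OF T] by auto
  show "v : vspan N (b T ` {..<?d T})" using bsp[OF T] v by simp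
  show "kk T x : vspan K (?b ` ?I)" if x: "x : b T ` {..<?d T}" for x
  proof -
   obtain i where "i < ?d T" "x = b T i" using x by blast
   then have "kk T x : ?b ` ?I" using T by force
   then show ?thesis by (rule K.span_incl[OF subK])
  qed
 qed
 have sp: "vspan K (?b ` ?I) = part U"
 proof
  show "vspan K (?b ` ?I) <= part U" by (rule K.span_least[OF part_subspace sub])
  show "part U <= vspan K (?b ` ?I)" unfolding part_def
   by (rule K.span_least[OF K.span_subspace[OF subK]]) (use gens in blast)
 qed
 have cb: "cbasis (K\<lparr>carrier := part U\<rparr>) ?I ?b ?ph"
  unfolding cbasis_def
 proof (intro conjI ballI)
  show "finite ?I" using fin by auto
  show "?b ` ?I <= carrier (K\<lparr>carrier := part U\<rparr>)" using sub by simp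
  show "vspan (K\<lparr>carrier := part U\<rparr>) (?b ` ?I) = carrier (K\<lparr>carrier := part U\<rparr>)"
   using K.span_restrict[OF part_subspace sub] sp by simp
  fix p assume p: "p : ?I"
  then obtain T i where Ti: "p = (T, i)" "T : TT" "i < ?d T" by auto
  have "pj T k : U T" "k : carrier K" if "k : part U" for k using part_iff[of k] that Ti by auto
  then show "linear_functional (K\<lparr>carrier := part U\<rparr>) (?ph p)"
   using lf[OF Ti(2,3)] clin.add[OF pj_clin[OF Ti(2)]] clin.sm[OF pj_clin[OF Ti(2)]] Ti(1)
   by (simp add: linear_functional_def)
  fix q assume q: "q : ?I"
  then obtain T' j where Tj: "q = (T', j)" "T' : TT" "j < ?d T'" by auto
  have "ph T i \<zero>\<^bsub>N\<^esub> = 0"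
   using cspace.linear_functional_zero[OF N.subspace_cspace[OF U[OF Ti(2)]] lf[OF Ti(2,3)]] by simp
  then show "?ph p (?b q) = (if p = q then 1 else 0)"
   using Ti Tj pj_kk[OF Ti(2) Tj(2)] UN[OF Tj(2) bU[OF Tj(2,3)]] \<delta>[OF Ti(2,3)] by auto
 qed
 note cd = cspace.cbasis_dim[OF K.subspace_cspace[OF part_subspace] cb]
 show "findim (K\<lparr>carrier := part U\<rparr>)" by (rule cd(1))
 show "sub_dim K (part U) = (\<Sum>T\<in>TT. sub_dim N (U T))" using cd(2) fin by simp
qed

end

lemma part_total: "part (%_. carrier N) = carrier K"
 using span by (simp add: part_def)

lemma total_dim: "findim K" "vectorspace.dim CC K = card TT * vectorspace.dim CC N"
 using part_dim[of "%_. carrier N"] N.subspace_carrier unfolding part_total by simp_all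

end

lemma (in cspace) sub_dim_zero: "sub_dim V {\<zero>} = 0"
proof -
 have "cbasis (V\<lparr>carrier := {\<zero>}\<rparr>) {} undefined undefined"
  using span_restrict[OF subspace_zero, of "{}"] span_of_subspace[OF subspace_zero] span_mono[of "{}" "{\<zero>}"]
   subspaceD(3)[OF span_subspace[of "{}"]] by (auto simp: cbasis_def)
 from cspace.cbasis_dim(2)[OF subspace_cspace[OF subspace_zero] this] show ?thesis by simp
qed


section \<open>Weights\<close>

lemma weight_space_subspace:
 assumes "cspace M" "!!h. h : H ==> clin M M (alp h)"
 shows "csub (weight_space M alp H mu) M"
proof -
 interpret cspace M by fact
 show ?thesis
  using clin.add[OF assms(2)] clin.sm[OF assms(2)] clin.zero[OF assms(2)]
  by (intro subspaceI) (auto simp: weight_space_def sm_add_right mult.commute)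
qed

text \<open>Classical elimination: for a weight nu, the operator of h minus nu(h) removes the vector
  of weight nu from the sum, and induction handles the rest. The fourth premise lets weights be
  compared on H alone.\<close>

lemma weight_vectors_independent:
 assumes "cspace M" "!!h. h : H ==> clin M M (alp h)" "finite F"
  "!!mu nu. mu : F ==> nu : F ==> (!!h. h : H ==> mu h = nu h) ==> mu = nu"
  "!!mu. mu : F ==> v mu : weight_space M alp H mu" "(\<Oplus>\<^bsub>M\<^esub>mu\<in>F. v mu) = \<zero>\<^bsub>M\<^esub>" "mu : F"
 shows "v mu = \<zero>\<^bsub>M\<^esub>"
proof -
 interpret cspace M by fact
 show ?thesis
  using assms(3-7)
 proof (induction F arbitrary: v mu rule: finite_induct)
  case (insert nu F)
  have wsub: "csub (weight_space M alp H mu) M" for mu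
   by (rule weight_space_subspace[OF assms(1,2)])
  note ws = subspaceD[OF wsub]
  have vc: "v mu : carrier M" if "mu : insert nu F" for mu using insert.prems(2)[OF that] by (simp add: weight_space_def)
  have s: "v nu \<oplus>\<^bsub>M\<^esub> (\<Oplus>\<^bsub>M\<^esub>mu\<in>F. v mu) = \<zero>\<^bsub>M\<^esub>"
   using insert.prems(3) insert.hyps vc by (subst (asm) finsum_insert) auto
  have Fc: "(\<Oplus>\<^bsub>M\<^esub>mu\<in>F. v mu) : carrier M" using vc by (intro finsum_closed) auto
  have z: "v mu = \<zero>\<^bsub>M\<^esub>" if mu: "mu : F" for mu
  proof -
   have "mu ~= nu" using mu insert.hyps by blast
   then obtain h where h: "h : H" "mu h ~= nu h" using insert.prems(1)[of mu nu] mu by blast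
   interpret a: clin M M "alp h" by (rule assms(2)[OF h(1)])
   \<comment> \<open>The vectors left after applying the operator of h minus nu(h). The choice of h
     makes the factor nonzero at the weight under consideration; at other weights it may
     vanish.\<close>
   define w where "w mu = (mu h - nu h) \<odot>\<^bsub>M\<^esub> v mu" for mu
   have "alp h (v nu \<oplus>\<^bsub>M\<^esub> (\<Oplus>\<^bsub>M\<^esub>mu\<in>F. v mu)) \<oplus>\<^bsub>M\<^esub> (- nu h) \<odot>\<^bsub>M\<^esub> (v nu \<oplus>\<^bsub>M\<^esub> (\<Oplus>\<^bsub>M\<^esub>mu\<in>F. v mu)) = \<zero>\<^bsub>M\<^esub>"
    unfolding s by simp
   moreover have "alp h (\<Oplus>\<^bsub>M\<^esub>mu\<in>F. v mu) = (\<Oplus>\<^bsub>M\<^esub>mu\<in>F. mu h \<odot>\<^bsub>M\<^esub> v mu)"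
    using vc insert.prems(2) h by (subst a.finsum) (auto intro!: finsum_cong' simp: weight_space_def)
   moreover have "(- nu h) \<odot>\<^bsub>M\<^esub> (\<Oplus>\<^bsub>M\<^esub>mu\<in>F. v mu) = (\<Oplus>\<^bsub>M\<^esub>mu\<in>F. (- nu h) \<odot>\<^bsub>M\<^esub> v mu)"
    using vc by (intro finsum_sm) auto
   moreover have "alp h (v nu) = nu h \<odot>\<^bsub>M\<^esub> v nu" using insert.prems(2)[of nu] h by (simp add: weight_space_def)
   ultimately have e: "(nu h \<odot>\<^bsub>M\<^esub> v nu \<oplus>\<^bsub>M\<^esub> (\<Oplus>\<^bsub>M\<^esub>mu\<in>F. mu h \<odot>\<^bsub>M\<^esub> v mu)) \<oplus>\<^bsub>M\<^esub>
     ((- nu h) \<odot>\<^bsub>M\<^esub> v nu \<oplus>\<^bsub>M\<^esub> (\<Oplus>\<^bsub>M\<^esub>mu\<in>F. (- nu h) \<odot>\<^bsub>M\<^esub> v mu)) = \<zero>\<^bsub>M\<^esub>"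
    using Fc vc by (simp add: a.add sm_add_right)
   have "(\<Oplus>\<^bsub>M\<^esub>mu\<in>F. w mu) = (\<Oplus>\<^bsub>M\<^esub>mu\<in>F. mu h \<odot>\<^bsub>M\<^esub> v mu \<oplus>\<^bsub>M\<^esub> (- nu h) \<odot>\<^bsub>M\<^esub> v mu)"
    using vc by (intro finsum_cong') (auto simp: w_def simp flip: sm_add_left)
   also have "... = (\<Oplus>\<^bsub>M\<^esub>mu\<in>F. mu h \<odot>\<^bsub>M\<^esub> v mu) \<oplus>\<^bsub>M\<^esub> (\<Oplus>\<^bsub>M\<^esub>mu\<in>F. (- nu h) \<odot>\<^bsub>M\<^esub> v mu)"
    using vc by (intro finsum_addf) auto
   also have "... = \<zero>\<^bsub>M\<^esub>"
   proof -
    have c: "(\<Oplus>\<^bsub>M\<^esub>mu\<in>F. mu h \<odot>\<^bsub>M\<^esub> v mu) : carrier M" "(\<Oplus>\<^bsub>M\<^esub>mu\<in>F. (- nu h) \<odot>\<^bsub>M\<^esub> v mu) : carrier M" "v nu : carrier M"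
     using vc by (auto intro!: finsum_closed)
    have "nu h \<odot>\<^bsub>M\<^esub> v nu \<oplus>\<^bsub>M\<^esub> (- nu h) \<odot>\<^bsub>M\<^esub> v nu = \<zero>\<^bsub>M\<^esub>" using c by (simp flip: sm_add_left)
    moreover have "(nu h \<odot>\<^bsub>M\<^esub> v nu \<oplus>\<^bsub>M\<^esub> (- nu h) \<odot>\<^bsub>M\<^esub> v nu) \<oplus>\<^bsub>M\<^esub> ((\<Oplus>\<^bsub>M\<^esub>mu\<in>F. mu h \<odot>\<^bsub>M\<^esub> v mu) \<oplus>\<^bsub>M\<^esub> (\<Oplus>\<^bsub>M\<^esub>mu\<in>F. (- nu h) \<odot>\<^bsub>M\<^esub> v mu)) = \<zero>\<^bsub>M\<^esub>"
     using e c by (simp add: a_ac)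
    ultimately show ?thesis using c by simp
   qed
   finally have "w mu = \<zero>\<^bsub>M\<^esub>"
    using insert.IH[of w mu] insert.prems(1,2) mu ws(5) by (simp add: w_def)
   then show ?thesis using smult_cancel[of "mu h - nu h"] h vc mu by (simp add: w_def)
  qed
  have "(\<Oplus>\<^bsub>M\<^esub>mu\<in>F. v mu) = (\<Oplus>\<^bsub>M\<^esub>mu\<in>F. \<zero>\<^bsub>M\<^esub>)" by (intro finsum_cong') (auto simp: z)
  then have "v nu = \<zero>\<^bsub>M\<^esub>" using s vc by simp
  then show ?case using z insert.prems(4) by blast
 qed simp
qed

lemma dual_space_ext:
 assumes "mu : dual_space L H" "nu : dual_space L H" "!!h. h : H ==> mu h = nu h"
 shows "mu = nu"
proof
 fix h show "mu h = nu h" using assms by (cases "h : H") (auto simp: dual_space_def)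
qed

text \<open>Vectors of distinct weights are independent, so there are at most as many weights as the
  dimension. This secures the intended value of \<open>ch\<close>, which passes through
  \<open>Abs_poly_mapping\<close>.\<close>

lemma finite_weights:
 assumes "cspace M" "findim M" "!!h. h : H ==> clin M M (alp h)"
 shows "finite {mu : dual_space L H. weight_space M alp H mu ~= {\<zero>\<^bsub>M\<^esub>}}" (is "finite ?W")
proof (rule ccontr)
 interpret cspace M by fact
 assume inf: "infinite ?W"
 obtain F where "finite F & card F = Suc (vectorspace.dim CC M) & F <= ?W"
  using infinite_arbitrarily_large[OF inf, of "Suc (vectorspace.dim CC M)"] by (elim exE)
 then have F: "F <= ?W" "finite F" "card F = Suc (vectorspace.dim CC M)" by simp_all
 have wsub: "csub (weight_space M alp H mu) M" for mu
  by (rule weight_space_subspace[OF assms(1,3)])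
 have "\<forall>mu\<in>F. \<exists>v. v : weight_space M alp H mu & v ~= \<zero>\<^bsub>M\<^esub>"
 proof
  fix mu assume "mu : F"
  then have "weight_space M alp H mu ~= {\<zero>\<^bsub>M\<^esub>}" using F by blast
  moreover have "\<zero>\<^bsub>M\<^esub> : weight_space M alp H mu" by (rule subspaceD(3)[OF wsub])
  ultimately show "\<exists>v. v : weight_space M alp H mu & v ~= \<zero>\<^bsub>M\<^esub>" by blast
 qed
 then obtain v where v: "!!mu. mu : F ==> v mu : weight_space M alp H mu" "!!mu. mu : F ==> v mu ~= \<zero>\<^bsub>M\<^esub>" by metis
 have vc: "v mu : carrier M" if "mu : F" for mu using v(1)[OF that] by (simp add: weight_space_def)
 have ex: "mu = nu" if "mu : F" "nu : F" "!!h. h : H ==> mu h = nu h" for mu nu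
  using dual_space_ext[of mu L H nu] F that by blast
 note ws = subspaceD[OF wsub]
 have inj: "inj_on v F"
 proof (rule inj_onI, rule ex)
  fix mu nu h assume h: "mu : F" "nu : F" "v mu = v nu" "h : H"
  have "mu h \<odot>\<^bsub>M\<^esub> v mu = nu h \<odot>\<^bsub>M\<^esub> v mu" using v(1)[OF h(1)] v(1)[OF h(2)] h by (simp add: weight_space_def)
  then have "(mu h - nu h) \<odot>\<^bsub>M\<^esub> v mu = \<zero>\<^bsub>M\<^esub>"
   using vc[OF h(1)] sm_add_left[of "v mu" "nu h" "- nu h"] sm_add_left[of "v mu" "mu h" "- nu h"] by simp
  then show "mu h = nu h" using smult_cancel[of "mu h - nu h"] vc v(2) h by auto
 qed
 have "\<not> LinearCombinations.module.lin_dep CC M (v ` F)"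
 proof (rule module.finite_lin_indpt2[OF md])
  show "finite (v ` F)" using F by simp
  show "v ` F <= carrier M" using vc by blast
  fix a assume "LinearCombinations.module.lincomb M a (v ` F) = \<zero>\<^bsub>M\<^esub>"
  then have "(\<Oplus>\<^bsub>M\<^esub>x\<in>v ` F. a x \<odot>\<^bsub>M\<^esub> x) = \<zero>\<^bsub>M\<^esub>" by (simp add: module.lincomb_def[OF md])
  moreover have "(\<Oplus>\<^bsub>M\<^esub>x\<in>v ` F. a x \<odot>\<^bsub>M\<^esub> x) = (\<Oplus>\<^bsub>M\<^esub>mu\<in>F. a (v mu) \<odot>\<^bsub>M\<^esub> v mu)"
   using vc by (intro finsum_reindex) (auto simp: inj)
  ultimately have s: "(\<Oplus>\<^bsub>M\<^esub>mu\<in>F. a (v mu) \<odot>\<^bsub>M\<^esub> v mu) = \<zero>\<^bsub>M\<^esub>" by simp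
  have "a (v mu) \<odot>\<^bsub>M\<^esub> v mu = \<zero>\<^bsub>M\<^esub>" if mF: "mu : F" for mu
  proof (rule weight_vectors_independent[where M = M and alp = alp and H = H and F = F and v = "%mu. a (v mu) \<odot>\<^bsub>M\<^esub> v mu"])
   show "clin M M (alp h)" if "h : H" for h by (rule assms(3)[OF that])
   show "mu = nu" if "mu : F" "nu : F" "!!h. h : H ==> mu h = nu h" for mu nu by (rule ex[OF that])
   show "a (v mu) \<odot>\<^bsub>M\<^esub> v mu : weight_space M alp H mu" if "mu : F" for mu by (rule ws(5)[OF v(1)[OF that]])
  qed (fact F(2) s mF cspace_axioms)+
  then have "a (v mu) = 0" if "mu : F" for mu using smult_cancel[of "a (v mu)"] vc v(2) that by blast
  then show "\<forall>x\<in>v ` F. a x = \<zero>\<^bsub>CC\<^esub>" by simp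
 qed
 then have "card (v ` F) \<le> vectorspace.dim CC M"
  using vectorspace.li_le_dim(2)[OF vs assms(2)] vc by blast
 then show False using F(3) by (simp add: card_image inj)
qed

lemma dual_space_add: "mu : dual_space L H ==> nu : dual_space L H ==> mu + nu : dual_space L H"
 and dual_space_diff: "mu : dual_space L H ==> nu : dual_space L H ==> mu - nu : dual_space L H"
 and dual_space_zero: "0 : dual_space L H"
 by (auto simp: dual_space_def algebra_simps)

lemma dual_space_sum: "(!!i. i : I ==> f i : dual_space L H) ==> (\<Sum>i\<in>I. f i) : dual_space L H"
 by (induction I rule: infinite_finite_induct) (auto intro: dual_space_add dual_space_zero)

lemma lookup_ch:
 assumes "cspace M" "findim M" "!!h. h : H ==> clin M M (alp h)"
 shows "lkp (ch L H M alp) mu =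
  (if mu : dual_space L H then int (sub_dim M (weight_space M alp H mu)) else 0)"
proof -
 interpret cspace M by fact
 have "{mu. (if mu : dual_space L H then int (sub_dim M (weight_space M alp H mu)) else 0) ~= 0}
   <= {mu : dual_space L H. weight_space M alp H mu ~= {\<zero>\<^bsub>M\<^esub>}}"
  by (auto simp: sub_dim_zero split: if_splits)
 from finite_subset[OF this finite_weights[OF assms]] show ?thesis
  unfolding ch_def by (subst Abs_poly_mapping_inverse) auto
qed

text \<open>Multiplication by e^a translates a character by a, the form in which products are
  compared with shifted weight spaces.\<close>

lemma lookup_single_times:
 "lkp (sgl a b * f) (mu :: 'a :: ab_group_add) = b * lkp (f :: 'a \<Rightarrow>\<^sub>0 int) (mu - a)"
proof -
 have "sgl a b * f = (\<Sum>k\<in>supp f. sgl (a + k) (b * lkp f k))"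
  by (subst pm_expand[of f]) (simp add: sum_distrib_left mult_single)
 also have "lkp ... mu = (\<Sum>k\<in>supp f. if k = mu - a then b * lkp f k else 0)"
  unfolding lookup_sum by (intro sum.cong) (auto simp: lookup_single when_def algebra_simps)
 also have "... = b * lkp f (mu - a)" by (simp add: in_keys_iff)
 finally show ?thesis .
qed

definition bsign :: "bit => int" where "bsign p = (if p = 0 then 1 else - 1)"

text \<open>On the copy of index T the operator of h is the one on N shifted by the scalar wt T h.
  No basis of weight vectors of N enters, only its weight spaces.\<close>

locale weighted_decomp = fin_decomp N K TT kk pj
 for N :: "(complex, 'v) module" and K :: "(complex, 'k) module" and TT :: "'t set" and kk pj +
 fixes L :: "'g lie_super" and H :: "'g set" and alp :: "'g => 'k => 'k" and be :: "'g => 'v => 'v"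
  and wt :: "'t => 'g => complex" and par :: "'t => bit" and P :: "bit => 'k set"
 assumes alp_clin: "h : H ==> clin K K (alp h)" and be_clin: "h : H ==> clin N N (be h)"
  and alp_kk: "h : H ==> T : TT ==> v : carrier N ==> alp h (kk T v) = kk T (be h v \<oplus>\<^bsub>N\<^esub> wt T h \<odot>\<^bsub>N\<^esub> v)"
  and wt_dual: "T : TT ==> wt T : dual_space L H"
  and P_eq: "P p = vspan K {kk T v | T v. T : TT & par T = p & v : carrier N}"
begin

lemma be_closed: "h : H ==> v : carrier N ==> be h v : carrier N"
 using clin.closed[OF be_clin] by blast

lemma pj_alp:
 assumes h: "h : H" and T: "T : TT" and k: "k : carrier K"
 shows "pj T (alp h k) = be h (pj T k) \<oplus>\<^bsub>N\<^esub> wt T h \<odot>\<^bsub>N\<^esub> pj T k"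
proof (rule clin_eq_on_span[OF clin_comp[OF alp_clin[OF h] pj_clin[OF T]]])
 note b = clin_comp[OF pj_clin[OF T] be_clin[OF h]]
 note p = pj_clin[OF T]
 show "clin K N (%k. be h (pj T k) \<oplus>\<^bsub>N\<^esub> wt T h \<odot>\<^bsub>N\<^esub> pj T k)"
  by (intro clin.intro clin_axioms.intro lin_mapI N.cspace_axioms K.cspace_axioms)
   (use clin.closed[OF b] clin.closed[OF p] clin.add[OF b] clin.add[OF p] clin.sm[OF b] clin.sm[OF p] in
    \<open>simp_all add: N.sm_add_right N.a_ac mult.commute\<close>)
 show "k : vspan K {kk T v | T v. T : TT & v : carrier N}" using k span by simp
 show "{kk T v | T v. T : TT & v : carrier N} <= carrier K" using kk_closed by blast
 fix x assume "x : {kk T v | T v. T : TT & v : carrier N}"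
 then obtain T' v where Tv: "T' : TT" "v : carrier N" "x = kk T' v" by blast
 then show "pj T (alp h x) = be h (pj T x) \<oplus>\<^bsub>N\<^esub> wt T h \<odot>\<^bsub>N\<^esub> pj T x"
  using h T alp_kk[OF h] pj_kk[OF T] be_closed clin.zero[OF be_clin[OF h]] by simp
qed

abbreviation "WN mu \<equiv> weight_space N be H mu"

lemma WN_sub: "csub (WN mu) N"
 by (rule weight_space_subspace[OF N.cspace_axioms be_clin])

text \<open>The projections intertwine the operators up to the shift, so a vector of weight mu has
  its component at T in weight mu - wt T; the converse holds because the projections separate
  points.\<close>

lemma weight_part: "weight_space K alp H mu = part (%T. WN (mu - wt T))"
proof (rule Set.set_eqI)
 fix k
 have "k : weight_space K alp H mu \<longleftrightarrow> k : carrier K & (\<forall>h\<in>H. \<forall>T\<in>TT. pj T (alp h k) = mu h \<odot>\<^bsub>N\<^esub> pj T k)"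
 proof (cases "k : carrier K")
  case True
  have "alp h k = mu h \<odot>\<^bsub>K\<^esub> k \<longleftrightarrow> (\<forall>T\<in>TT. pj T (alp h k) = mu h \<odot>\<^bsub>N\<^esub> pj T k)" if "h : H" for h
   using ext[of "alp h k" "mu h \<odot>\<^bsub>K\<^esub> k"] clin.sm[OF pj_clin] clin.closed[OF alp_clin[OF that]] True by auto
  then show ?thesis using True by (auto simp: weight_space_def)
 qed (auto simp: weight_space_def)
 also have "... \<longleftrightarrow> k : carrier K & (\<forall>T\<in>TT. pj T k : WN (mu - wt T))"
 proof (cases "k : carrier K")
  case True
  have "pj T (alp h k) = mu h \<odot>\<^bsub>N\<^esub> pj T k \<longleftrightarrow> be h (pj T k) = (mu - wt T) h \<odot>\<^bsub>N\<^esub> pj T k" if "h : H" "T : TT" for h T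
  proof -
   have c: "pj T k : carrier N" "be h (pj T k) : carrier N" using pj_closed be_closed that True by auto
   have "(mu - wt T) h \<odot>\<^bsub>N\<^esub> pj T k = mu h \<odot>\<^bsub>N\<^esub> pj T k \<ominus>\<^bsub>N\<^esub> wt T h \<odot>\<^bsub>N\<^esub> pj T k"
    using c N.sm_add_left[of "pj T k" "mu h" "- wt T h"] by (simp add: N.minus_sm)
   note d = this
   have "mu h \<odot>\<^bsub>N\<^esub> pj T k \<ominus>\<^bsub>N\<^esub> wt T h \<odot>\<^bsub>N\<^esub> pj T k = be h (pj T k) \<longleftrightarrow>
     mu h \<odot>\<^bsub>N\<^esub> pj T k = be h (pj T k) \<oplus>\<^bsub>N\<^esub> wt T h \<odot>\<^bsub>N\<^esub> pj T k"
    by (rule N.minus_eq_iff) (use c in auto)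
   then show ?thesis unfolding d pj_alp[OF that True] by metis
  qed
  then show ?thesis using True pj_closed by (auto simp: weight_space_def)
 qed simp
 also have "... \<longleftrightarrow> k : part (%T. WN (mu - wt T))" by (subst part_iff) (auto intro: WN_sub)
 finally show "k : weight_space K alp H mu \<longleftrightarrow> k : part (%T. WN (mu - wt T))" .
qed

lemma P_part: "P p = part (%T. if par T = p then carrier N else {\<zero>\<^bsub>N\<^esub>})"
proof
 let ?U = "%T. if par T = p then carrier N else {\<zero>\<^bsub>N\<^esub>}"
 have U: "csub (?U T) N" for T using N.subspace_carrier N.subspace_zero by simp
 show "P p <= part ?U" unfolding P_eq part_def by (rule K.span_mono) auto
 have S: "{kk T v | T v. T : TT & par T = p & v : carrier N} <= carrier K" using kk_closed by blast
 show "part ?U <= P p"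
  unfolding P_eq part_def
 proof (rule K.span_least[OF K.span_subspace[OF S]], rule subsetI)
  fix x assume "x : {kk T v | T v. T : TT & v : ?U T}"
  then obtain T v where Tv: "T : TT" "v : ?U T" "x = kk T v" by blast
  show "x : vspan K {kk T v | T v. T : TT & par T = p & v : carrier N}"
  proof (cases "par T = p")
   case True
   then show ?thesis using Tv by (intro K.span_incl[OF S]) auto
  next
   case False
   then show ?thesis using Tv clin.zero[OF kk_clin] K.subspaceD(3)[OF K.span_subspace[OF S]] by simp
  qed
 qed
qed

lemma P_dim: "sub_dim K (P p) = card {T : TT. par T = p} * vectorspace.dim CC N"
proof -
 have "sub_dim K (P p) = (\<Sum>T\<in>TT. sub_dim N (if par T = p then carrier N else {\<zero>\<^bsub>N\<^esub>}))"
  unfolding P_part by (rule part_dim) (simp add: N.subspace_carrier N.subspace_zero)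
 also have "... = (\<Sum>T\<in>TT. if par T = p then vectorspace.dim CC N else 0)"
  by (intro sum.cong) (auto simp: N.sub_dim_zero)
 finally show ?thesis using fin by (simp add: sum.If_cases Int_def)
qed

lemma weight_P_part: "weight_space K alp H mu \<inter> P p = part (%T. if par T = p then WN (mu - wt T) else {\<zero>\<^bsub>N\<^esub>})"
proof (rule Set.set_eqI)
 fix k
 have "k : part (%T. WN (mu - wt T)) \<longleftrightarrow> k : carrier K & (\<forall>T\<in>TT. pj T k : WN (mu - wt T))"
  by (rule part_iff) (rule WN_sub)
 moreover have "k : part (%T. if par T = p then carrier N else {\<zero>\<^bsub>N\<^esub>}) \<longleftrightarrow>
   k : carrier K & (\<forall>T\<in>TT. pj T k : (if par T = p then carrier N else {\<zero>\<^bsub>N\<^esub>}))"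
  by (rule part_iff) (simp add: N.subspace_carrier N.subspace_zero)
 moreover have "k : part (%T. if par T = p then WN (mu - wt T) else {\<zero>\<^bsub>N\<^esub>}) \<longleftrightarrow>
   k : carrier K & (\<forall>T\<in>TT. pj T k : (if par T = p then WN (mu - wt T) else {\<zero>\<^bsub>N\<^esub>}))"
  by (rule part_iff) (simp add: WN_sub N.subspace_zero)
 moreover have "\<zero>\<^bsub>N\<^esub> : WN nu" "WN nu <= carrier N" for nu using N.subspaceD[OF WN_sub] by blast+
 ultimately show "k : weight_space K alp H mu \<inter> P p \<longleftrightarrow> k : part (%T. if par T = p then WN (mu - wt T) else {\<zero>\<^bsub>N\<^esub>})"
  unfolding Int_iff weight_part P_part by (auto split: if_splits)
qed

text \<open>Characters are set to zero outside the dual space of H. Shifting by a weight respects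
  that boundary, so both sides of the character formulas vanish at the same places.\<close>

lemma wt_dual_iff: "T : TT ==> mu - wt T : dual_space L H \<longleftrightarrow> mu : dual_space L H"
 using dual_space_add[OF _ wt_dual, of "mu - wt T" T] dual_space_diff[OF _ wt_dual] by auto

lemma lookup_ch_N: "lkp (ch L H N be) mu =
  (if mu : dual_space L H then int (sub_dim N (WN mu)) else 0)"
 by (rule lookup_ch[OF N.cspace_axioms finN]) (rule be_clin)

lemma lookup_ch_K: "lkp (ch L H K alp) mu =
  (if mu : dual_space L H then int (sub_dim K (weight_space K alp H mu)) else 0)"
 by (rule lookup_ch[OF K.cspace_axioms total_dim(1)]) (rule alp_clin)

lemma lookup_wt_sum: "lkp ((\<Sum>T\<in>TT. sgl (wt T) (s T)) * ch L H N be) mu =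
  (if mu : dual_space L H then (\<Sum>T\<in>TT. s T * int (sub_dim N (WN (mu - wt T)))) else 0)"
 unfolding sum_distrib_right lookup_sum lookup_single_times
  lookup_ch_N
 by (simp add: wt_dual_iff cong: sum.cong)

lemma ch_eq: "ch L H K alp = (\<Sum>T\<in>TT. sgl (wt T) 1) * ch L H N be"
proof (rule poly_mapping_eqI)
 fix mu
 have "sub_dim K (weight_space K alp H mu) = (\<Sum>T\<in>TT. sub_dim N (WN (mu - wt T)))"
  unfolding weight_part by (rule part_dim) (rule WN_sub)
 then show "lkp (ch L H K alp) mu = lkp ((\<Sum>T\<in>TT. sgl (wt T) 1) * ch L H N be) mu"
  unfolding lookup_wt_sum lookup_ch_K by simp
qed

lemma sdim_weight: "sdim K (%p. weight_space K alp H mu \<inter> P p) = (\<Sum>T\<in>TT. bsign (par T) * int (sub_dim N (WN (mu - wt T))))"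
proof -
 have "sub_dim K (weight_space K alp H mu \<inter> P p) = (\<Sum>T\<in>TT. sub_dim N (if par T = p then WN (mu - wt T) else {\<zero>\<^bsub>N\<^esub>}))" for p
  unfolding weight_P_part by (rule part_dim) (simp add: WN_sub N.subspace_zero)
 also have "...p = (\<Sum>T\<in>TT. if par T = p then sub_dim N (WN (mu - wt T)) else 0)" for p
  by (intro sum.cong) (auto simp: N.sub_dim_zero)
 finally have d: "int (sub_dim K (weight_space K alp H mu \<inter> P p)) = (\<Sum>T\<in>TT. if par T = p then int (sub_dim N (WN (mu - wt T))) else 0)" for p
  by (simp add: if_distrib[of int] cong: if_cong)
 have b: "par T = 0 \<or> par T = 1" for T by (cases "par T") auto
 show ?thesis
  unfolding sdim_def d sum_subtractf[symmetric]
  by (intro sum.cong) (use b in \<open>auto simp: bsign_def\<close>)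
qed

lemma sch_eq: "sch L H K P alp = (\<Sum>T\<in>TT. sgl (wt T) (bsign (par T))) * ch L H N be"
proof -
 \<comment> \<open>The function inside \<open>sch\<close> is recognised as the coefficient function
   of a polynomial mapping, which settles its finite support at the same time.\<close>
 have "(%mu. if mu : dual_space L H then sdim K (%p. weight_space K alp H mu \<inter> P p) else 0) =
   lkp ((\<Sum>T\<in>TT. sgl (wt T) (bsign (par T))) * ch L H N be)"
  unfolding lookup_wt_sum sdim_weight by (rule refl)
 then show ?thesis unfolding sch_def by (simp add: lookup_inverse)
qed

end


section \<open>Modules generated by anticommuting operators\<close>

definition FM :: "nat => (complex, fock) module" where
 "FM r = module.make (fock_supp r) undefined undefined 0 (+) scl"

lemma FM_simps [simp]: "carrier (FM r) = fock_supp r" "\<zero>\<^bsub>FM r\<^esub> = 0" "m \<oplus>\<^bsub>FM r\<^esub> m' = m + m'" "c \<odot>\<^bsub>FM r\<^esub> m = scl c m"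
 by (simp_all add: FM_def module.make_def)

lemma FM_cspace: "cspace (FM r)"
proof -
 have "Module.module CC (FM r)"
 proof (rule module_criteria)
  show "cring CC" by (rule class_cring.cring_axioms)
  show "\<forall>v\<in>carrier (FM r). \<exists>w\<in>carrier (FM r). v \<oplus>\<^bsub>FM r\<^esub> w = \<zero>\<^bsub>FM r\<^esub>"
  proof
   fix v assume "v : carrier (FM r)"
   then show "\<exists>w\<in>carrier (FM r). v \<oplus>\<^bsub>FM r\<^esub> w = \<zero>\<^bsub>FM r\<^esub>"
    using fock_supp_intros(2)[of v r "-1"] by (intro bexI[of _ "scl (-1) v"]) auto
  qed
 qed (auto intro: fock_supp_intros simp: scl_add_left scl_add_right algebra_simps)
 then show ?thesis by (intro cspace.intro) (simp add: vectorspace_def class_field)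
qed

lemma FM_minus [simp]: "m : fock_supp r ==> m' : fock_supp r ==> m \<ominus>\<^bsub>FM r\<^esub> m' = m - m'"
 using cspace.minus_sm[OF FM_cspace, of m r m'] by simp

text \<open>Common frame for the Kac-like module and, with N the scalars, for the Grassmann algebra:
  K is generated from N by anticommuting operators, and a linear map to Fock space turns those of
  the basis into creation operators. The first property gives spanning, the second
  independence.\<close>

locale fermi = M: cspace M + K: cspace K + N: cspace N
 for M :: "(complex, 'l, 'x) module_scheme" and K :: "(complex, 'k) module" and N :: "(complex, 'v) module" +
 fixes r dN :: nat and e :: "nat => 'l" and c :: "nat => 'l => complex" and act :: "'l => 'k => 'k"
  and kk0 :: "'v => 'k" and Ph :: "'k => fock" and nb :: "nat => 'v" and ph :: "nat => 'v => complex"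
 assumes bas: "cbasis M {..<r} e c" and basN: "cbasis N {..<dN} nb ph"
  and act_clin: "x : carrier M ==> clin K K (act x)"
  and act_left: "k : carrier K ==> clin M K (%x. act x k)"
  and anti: "x : carrier M ==> y : carrier M ==> k : carrier K ==> act x (act y k) = (-1) \<odot>\<^bsub>K\<^esub> act y (act x k)"
  and kk0: "clin N K kk0"
  and span: "carrier K = vspan K {foldr act xs (kk0 v) | xs v. xs : lists (carrier M) & v : carrier N}"
  and Ph: "clin K (FM r) Ph"
  and Ph_kk0: "v : carrier N ==> Ph (kk0 v) = vac (%j. if j < dN then ph j v else 0)"
  and Ph_act: "i < r ==> k : carrier K ==> Ph (act (e i) k) = cre i (Ph k)"
begin

abbreviation ea where "ea i \<equiv> act (e i)"

definition kk :: "nat set => 'v => 'k" where "kk T v = foldr ea (sorted_list_of_set T) (kk0 v)"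

text \<open>The amplitudes at T turned back into a vector of N by its basis; the projections of the
  direct sum come from the Fock map in this way.\<close>

definition pj :: "nat set => 'k => 'v" where
 "pj T k = (\<Oplus>\<^bsub>N\<^esub>j\<in>{..<dN}. amp (Ph k) T j \<odot>\<^bsub>N\<^esub> nb j)"

lemma e_closed: "i < r ==> e i : carrier M" using bas by (auto simp: cbasis_def)

lemma nb_closed: "j < dN ==> nb j : carrier N" using basN by (auto simp: cbasis_def)

lemma id_clin: "clin K K (%k. k)"
 by (intro clin.intro clin_axioms.intro lin_mapI K.cspace_axioms) auto

lemma foldr_act_clin: "xs : lists (carrier M) ==> clin K K (foldr act xs)"
proof (induction xs)
 case (Cons x xs)
 then show ?case using clin_comp[of K K "foldr act xs" K "act x"] act_clin by (auto simp: comp_def)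
qed (use id_clin in \<open>simp add: id_def\<close>)

lemma foldr_ea: "foldr ea is k = foldr act (map e is) k"
 by (induction "is") auto

lemma foldr_ea_clin: "set is <= {..<r} ==> clin K K (foldr ea is)"
 unfolding foldr_ea using e_closed by (intro foldr_act_clin) (auto simp: subset_iff)

lemma kk0_closed: "v : carrier N ==> kk0 v : carrier K"
 using clin.closed[OF kk0] .

lemma word_closed: "xs : lists (carrier M) ==> v : carrier N ==> foldr act xs (kk0 v) : carrier K"
 using clin.closed[OF foldr_act_clin] kk0_closed by blast

lemma ea_closed: "set is <= {..<r} ==> v : carrier N ==> foldr ea is (kk0 v) : carrier K"
 using clin.closed[OF foldr_ea_clin] kk0_closed by blast

lemma sorted_T: "T <= {..<r} ==> set (sorted_list_of_set T) <= {..<r}"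
 using finite_subset[of T "{..<r}"] by simp

lemma kk_clin: "T <= {..<r} ==> clin N K (kk T)"
 unfolding kk_def by (rule clin_comp[OF kk0 foldr_ea_clin[OF sorted_T]])

lemma pj_clin: "clin K N (pj T)"
proof -
 interpret P: clin K "FM r" Ph by (rule Ph)
 show ?thesis
 proof (intro clin.intro clin_axioms.intro lin_mapI K.cspace_axioms N.cspace_axioms)
  show "pj T k : carrier N" for k unfolding pj_def using nb_closed by (intro N.finsum_closed) auto
  show "pj T (k \<oplus>\<^bsub>K\<^esub> k') = pj T k \<oplus>\<^bsub>N\<^esub> pj T k'" if "k : carrier K" "k' : carrier K" for k k'
  proof -
   have "pj T (k \<oplus>\<^bsub>K\<^esub> k') = (\<Oplus>\<^bsub>N\<^esub>j\<in>{..<dN}. amp (Ph k) T j \<odot>\<^bsub>N\<^esub> nb j \<oplus>\<^bsub>N\<^esub> amp (Ph k') T j \<odot>\<^bsub>N\<^esub> nb j)"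
    unfolding pj_def using nb_closed that by (intro N.finsum_cong') (auto simp: P.add N.sm_add_left)
   also have "... = pj T k \<oplus>\<^bsub>N\<^esub> pj T k'" unfolding pj_def using nb_closed by (intro N.finsum_addf) auto
   finally show ?thesis .
  qed
  show "pj T (a \<odot>\<^bsub>K\<^esub> k) = a \<odot>\<^bsub>N\<^esub> pj T k" if "k : carrier K" for a k
  proof -
   have "pj T (a \<odot>\<^bsub>K\<^esub> k) = (\<Oplus>\<^bsub>N\<^esub>j\<in>{..<dN}. a \<odot>\<^bsub>N\<^esub> (amp (Ph k) T j \<odot>\<^bsub>N\<^esub> nb j))"
    unfolding pj_def using nb_closed that by (intro N.finsum_cong') (auto simp: P.sm)
   also have "... = a \<odot>\<^bsub>N\<^esub> pj T k" unfolding pj_def using nb_closed by (intro N.finsum_sm[symmetric]) auto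
   finally show ?thesis .
  qed
 qed
qed

lemma Ph_word: "set is <= {..<r} ==> v : carrier N ==>
  Ph (foldr ea is (kk0 v)) = foldr cre is (vac (%j. if j < dN then ph j v else 0))"
proof (induction "is")
 case (Cons i "is")
 then show ?case using Ph_act[of i "foldr ea is (kk0 v)"] ea_closed[of "is" v] by simp
qed (simp add: Ph_kk0)

lemma Ph_kk: "T <= {..<r} ==> v : carrier N ==> Ph (kk T v) = fdelta T (%j. if j < dN then ph j v else 0)"
 unfolding kk_def using Ph_word[OF sorted_T] fock_words[of T] finite_subset[of T "{..<r}"] by simp

lemma pj_kk:
 assumes "T' <= {..<r}" "v : carrier N"
 shows "pj T (kk T' v) = (if T = T' then v else \<zero>\<^bsub>N\<^esub>)"
proof (cases "T = T'")
 case True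
 have "pj T (kk T' v) = (\<Oplus>\<^bsub>N\<^esub>j\<in>{..<dN}. ph j v \<odot>\<^bsub>N\<^esub> nb j)"
  unfolding pj_def using nb_closed True by (intro N.finsum_cong') (auto simp: Ph_kk[OF assms] fdelta_def)
 then show ?thesis using N.cbasis_expand[OF basN assms(2)] True by simp
next
 case False
 have "pj T (kk T' v) = (\<Oplus>\<^bsub>N\<^esub>j\<in>{..<dN}. \<zero>\<^bsub>N\<^esub>)"
  unfolding pj_def using nb_closed False by (intro N.finsum_cong') (auto simp: Ph_kk[OF assms] fdelta_def)
 then show ?thesis using False by simp
qed

text \<open>Anticommuting an operator with itself gives x = -x, and 2 is invertible.\<close>

lemma ea_square: "i < r ==> k : carrier K ==> ea i (ea i k) = \<zero>\<^bsub>K\<^esub>"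
proof -
 assume h: "i < r" "k : carrier K"
 have c: "ea i (ea i k) : carrier K" using h clin.closed[OF act_clin[OF e_closed]] by blast
 have "ea i (ea i k) = (-1) \<odot>\<^bsub>K\<^esub> ea i (ea i k)" using anti e_closed h by blast
 then have "(1 + 1) \<odot>\<^bsub>K\<^esub> ea i (ea i k) = \<zero>\<^bsub>K\<^esub>"
  using c K.sm_add_left[OF c, of 1 1] K.sm_add_left[OF c, of 1 "-1"] by simp
 then show ?thesis using K.smult_cancel[of "1 + 1"] c by simp
qed

text \<open>Insertion sort with signs: the new letter is exchanged with the smaller ones in front,
  and meeting its equal it forms a square, which vanishes. Only the existence of a scalar is
  recorded.\<close>

lemma insert_word:
 assumes "sorted_wrt (<) is" "set is <= {..<r}" "i < r" "k : carrier K"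
 shows "if i : set is then ea i (foldr ea is k) = \<zero>\<^bsub>K\<^esub> else \<exists>s. ea i (foldr ea is k) = s \<odot>\<^bsub>K\<^esub> foldr ea (insort i is) k"
 using assms
proof (induction "is")
 case Nil
 then show ?case using clin.closed[OF act_clin[OF e_closed]] by (auto intro!: exI[of _ 1])
next
 case (Cons j "is")
 have jr: "j < r" and isr: "set is <= {..<r}" using Cons.prems by auto
 have kc: "foldr ea is k : carrier K" using clin.closed[OF foldr_ea_clin[OF isr]] Cons.prems by blast
 note ac = act_clin[OF e_closed]
 have cl: "ea a x : carrier K" if "a < r" "x : carrier K" for a x using clin.closed[OF ac[OF that(1)] that(2)] .
 have sw: "ea i (ea j (foldr ea is k)) = (-1) \<odot>\<^bsub>K\<^esub> ea j (ea i (foldr ea is k))"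
  using anti e_closed jr Cons.prems(3) kc by blast
 have IH: "if i : set is then ea i (foldr ea is k) = \<zero>\<^bsub>K\<^esub> else \<exists>s. ea i (foldr ea is k) = s \<odot>\<^bsub>K\<^esub> foldr ea (insort i is) k"
  using Cons by auto
 consider "i = j" | "i ~= j" "i : set is" | "i < j" "i \<notin> set is" | "j < i" "i \<notin> set is" by fastforce
 then show ?case
 proof cases
  case 1
  then show ?thesis using ea_square[OF jr kc] by simp
 next
  case 2
  then show ?thesis using sw IH clin.zero[OF ac[OF jr]] by simp
 next
  case 3
  then have "insort i (j # is) = i # j # is" by simp
  then show ?thesis using 3 cl[OF Cons.prems(3) cl[OF jr kc]] by (auto intro!: exI[of _ 1])
 next
  case 4
  then obtain s where s: "ea i (foldr ea is k) = s \<odot>\<^bsub>K\<^esub> foldr ea (insort i is) k" using IH by auto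
  have "set (insort i is) <= {..<r}" using isr Cons.prems(3) by (simp add: set_insort_key)
  then have c: "foldr ea (insort i is) k : carrier K"
   using clin.closed[OF foldr_ea_clin] Cons.prems(4) by blast
  have "ea i (foldr ea (j # is) k) = (- s) \<odot>\<^bsub>K\<^esub> foldr ea (insort i (j # is)) k"
   using 4 sw s clin.sm[OF ac[OF jr] c, of s] cl[OF jr c] by simp
  then show ?thesis using 4 by auto
 qed
qed

text \<open>The equality of \<open>card T\<close> and the length of the word is carried along for
  the parity components.\<close>

lemma word_sorted:
 assumes "set is <= {..<r}" "v : carrier N"
 shows "foldr ea is (kk0 v) = \<zero>\<^bsub>K\<^esub> \<or> (\<exists>T s. T <= {..<r} & card T = length is & foldr ea is (kk0 v) = s \<odot>\<^bsub>K\<^esub> kk T v)"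
 using assms(1)
proof (induction "is")
 case Nil
 have "foldr ea [] (kk0 v) = 1 \<odot>\<^bsub>K\<^esub> kk {} v" using kk0_closed[OF assms(2)] by (simp add: kk_def)
 then show ?case by (intro disjI2 exI[of _ "{}"] exI[of _ 1]) auto
next
 case (Cons i "is")
 have ir: "i < r" and isr: "set is <= {..<r}" using Cons.prems by auto
 note ac = act_clin[OF e_closed[OF ir]]
 from Cons.IH[OF isr] show ?case
 proof
  assume "foldr ea is (kk0 v) = \<zero>\<^bsub>K\<^esub>"
  then show ?thesis using clin.zero[OF ac] by simp
 next
  assume "\<exists>T s. T <= {..<r} & card T = length is & foldr ea is (kk0 v) = s \<odot>\<^bsub>K\<^esub> kk T v"
  then obtain T s where T: "T <= {..<r}" "card T = length is" "foldr ea is (kk0 v) = s \<odot>\<^bsub>K\<^esub> kk T v" by blast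
  have fT: "finite T" using T(1) finite_subset by blast
  have kkc: "kk T v : carrier K" using clin.closed[OF kk_clin[OF T(1)] assms(2)] .
  have e: "foldr ea (i # is) (kk0 v) = s \<odot>\<^bsub>K\<^esub> ea i (kk T v)" using T(3) clin.sm[OF ac kkc] by simp
  have iw: "if i : T then ea i (kk T v) = \<zero>\<^bsub>K\<^esub> else \<exists>s. ea i (kk T v) = s \<odot>\<^bsub>K\<^esub> foldr ea (insort i (sorted_list_of_set T)) (kk0 v)"
   using insert_word[OF _ sorted_T[OF T(1)] ir kk0_closed[OF assms(2)]] fT by (simp add: kk_def)
  show ?thesis
  proof (cases "i : T")
   case True
   then show ?thesis using e iw by simp
  next
   case False
   then obtain s' where s': "ea i (kk T v) = s' \<odot>\<^bsub>K\<^esub> kk (insert i T) v"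
    using iw fT by (auto simp: kk_def sorted_list_of_set_insert_remove)
   have iT: "insert i T <= {..<r}" using T ir by auto
   have "foldr ea (i # is) (kk0 v) = (s * s') \<odot>\<^bsub>K\<^esub> kk (insert i T) v"
    using e s' clin.closed[OF kk_clin[OF iT] assms(2)] by simp
   then show ?thesis using iT False T(2) fT by (intro disjI2 exI[of _ "insert i T"] exI[of _ "s * s'"]) auto
  qed
 qed
qed

lemma word_basis:
 assumes "xs : lists (carrier M)" "v : carrier N"
 shows "foldr act xs (kk0 v) : vspan K {foldr ea is (kk0 v) | is. set is <= {..<r} & length is = length xs}"
 using assms(1)
proof (induction xs rule: list.induct)
 case Nil
 have "kk0 v : vspan K {foldr ea is (kk0 v) | is. set is <= {..<r} & length is = 0}"
  by (rule K.span_incl) (use kk0_closed[OF assms(2)] in auto)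
 then show ?case by simp
next
 case (Cons x xs)
 let ?S = "%n. {foldr ea is (kk0 v) | is. set is <= {..<r} & length is = n}"
 have S: "?S n <= carrier K" for n using ea_closed assms(2) by blast
 have x: "x : carrier M" and xs: "xs : lists (carrier M)" using Cons.prems by auto
 have "act x (foldr act xs (kk0 v)) : vspan K (?S (Suc (length xs)))"
 proof (rule clin.span_into[OF act_clin[OF x] S K.span_subspace[OF S] _ Cons.IH[OF xs]])
  fix k assume "k : ?S (length xs)"
  then obtain "is" where "is": "k = foldr ea is (kk0 v)" "set is <= {..<r}" "length is = length xs" by blast
  have kc: "k : carrier K" using "is" ea_closed assms(2) by blast
  show "act x k : vspan K (?S (Suc (length xs)))"
  proof (rule clin.span_into[OF act_left[OF kc] _ K.span_subspace[OF S]])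
   show "e ` {..<r} <= carrier M" using e_closed by auto
   show "x : vspan M (e ` {..<r})" using bas x by (simp add: cbasis_def)
   fix y assume "y : e ` {..<r}"
   then obtain i where i: "i < r" "y = e i" by blast
   have "act y k : ?S (Suc (length xs))" using i "is" by (intro CollectI exI[of _ "i # is"]) auto
   then show "act y k : vspan K (?S (Suc (length xs)))" by (rule K.span_incl[OF S])
  qed
 qed
 then show ?case by simp
qed

text \<open>Expanding letters in the basis and sorting them keeps the length of a word, unless the
  word vanishes. The free predicate Q serves two purposes: constantly true it gives spanning, as a
  parity condition it gives the graded components.\<close>

lemma parity_part:
 "vspan K {foldr act xs (kk0 v) | xs v. xs : lists (carrier M) & Q (length xs) & v : carrier N} =
  vspan K {kk T v | T v. T : Pow {..<r} & Q (card T) & v : carrier N}" (is "vspan K ?A = vspan K ?B")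
proof
 have A: "?A <= carrier K" using word_closed by blast
 have B: "?B <= carrier K" using clin.closed[OF kk_clin] by blast
 note Bs = K.subspaceD[OF K.span_subspace[OF B]]
 show "vspan K ?A <= vspan K ?B"
 proof (rule K.span_least[OF K.span_subspace[OF B]], rule subsetI)
  fix x assume "x : ?A"
  then obtain xs v where xs: "x = foldr act xs (kk0 v)" "xs : lists (carrier M)" "Q (length xs)" "v : carrier N" by blast
  have "{foldr ea is (kk0 v) | is. set is <= {..<r} & length is = length xs} <= vspan K ?B"
  proof
   fix y assume "y : {foldr ea is (kk0 v) | is. set is <= {..<r} & length is = length xs}"
   then obtain "is" where "is": "y = foldr ea is (kk0 v)" "set is <= {..<r}" "length is = length xs" by blast
   from word_sorted[OF "is"(2) xs(4)] show "y : vspan K ?B"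
   proof
    assume "foldr ea is (kk0 v) = \<zero>\<^bsub>K\<^esub>"
    then show ?thesis using "is"(1) Bs(3) by simp
   next
    assume "\<exists>T s. T <= {..<r} & card T = length is & foldr ea is (kk0 v) = s \<odot>\<^bsub>K\<^esub> kk T v"
    then obtain T s where T: "T <= {..<r}" "card T = length is" "y = s \<odot>\<^bsub>K\<^esub> kk T v" using "is"(1) by blast
    have "kk T v : ?B" by (intro CollectI exI[of _ T] exI[of _ v]) (use T xs "is" in simp)
    then show ?thesis using T(3) Bs(5) K.span_incl[OF B] by blast
   qed
  qed
  from K.span_least[OF K.span_subspace[OF B] this] show "x : vspan K ?B" using word_basis[OF xs(2,4)] xs(1) by blast
 qed
 have "?B <= ?A"
 proof
  fix x assume "x : ?B"
  then obtain T v where T: "x = kk T v" "T <= {..<r}" "Q (card T)" "v : carrier N" by blast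
  have fT: "finite T" using T(2) finite_subset by blast
  show "x : ?A"
   by (rule CollectI, rule exI[of _ "map e (sorted_list_of_set T)"], rule exI[of _ v])
    (use T fT sorted_T[OF T(2)] e_closed in \<open>auto simp: kk_def foldr_ea subset_iff\<close>)
 qed
 then show "vspan K ?B <= vspan K ?A" by (rule K.span_mono)
qed

lemma decomp: "fin_decomp N K (Pow {..<r}) kk pj"
proof (intro fin_decomp.intro fin_decomp_axioms.intro)
 show "carrier K = vspan K {kk T v | T v. T : Pow {..<r} & v : carrier N}"
  using span parity_part[of "%_. True"] by simp
qed (use N.cspace_axioms K.cspace_axioms N.cbasis_dim(1)[OF basN] kk_clin pj_clin pj_kk in auto)

end


section \<open>The structure of Kac-like modules\<close>

text \<open>Stated for an abstract graded superalgebra; it is applied with the current superalgebra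
  g[B] in the place of L.\<close>

locale kac = graded_lsa L Lm L0 Lp for L :: "'l lie_super" (structure) and Lm L0 Lp +
 fixes W :: "'l set" and N :: "(complex, 'v) module" and \<rho> :: "'l => 'v => 'v"
  and r :: nat and e :: "nat => 'l" and c :: "nat => 'l => complex"
 assumes ind: "ind L W N \<rho>" and W_dec: "direct_sum_decomp L W L0 Lp"
  and \<rho>_p: "y : Lp ==> v : carrier N ==> \<rho> y v = \<zero>\<^bsub>N\<^esub>"
  and bas: "cbasis (L\<lparr>carrier := Lm\<rparr>) {..<r} e c" and finN: "findim N"
begin

interpretation I: ind L W N \<rho> by (rule ind)

abbreviation IK where "IK \<equiv> induced L W N \<rho>"
abbreviation iact where "iact \<equiv> induced_act L W N \<rho>"
abbreviation kw where "kw \<equiv> ind.kw L W N \<rho>"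

lemma W_mem: "h : L0 ==> h : W" "y : Lp ==> y : W"
 using dsd_mem[OF W_dec] by auto

lemma Lm_list: "xs : lists Lm ==> xs : lists (carrier L)"
 using Lm(2) by auto

text \<open>The candidate for the component of parity p, built from letters in Lm alone. Its
  behaviour under the pieces of L yields both the spanning statement \<open>K_span\<close> and the
  parity statement \<open>part_Q\<close>.\<close>

definition Q :: "bit => (('l list \<Rightarrow>\<^sub>0 complex) set \<times> 'v \<Rightarrow>\<^sub>0 complex) set set" where
 "Q p = vspan IK {kw xs v | xs v. xs : lists Lm & of_nat (length xs) = p & v : carrier N}"

lemma Q_gens: "{kw xs v | xs v. xs : lists Lm & of_nat (length xs) = p & v : carrier N} <= carrier IK"
 using I.kw_closed Lm_list by blast

lemma Q_sub: "csub (Q p) IK"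
 unfolding Q_def by (rule I.K.span_subspace[OF Q_gens])

lemmas QD = I.K.subspaceD[OF Q_sub]

lemma Q_mem: "xs : lists Lm ==> v : carrier N ==> kw xs v : Q (of_nat (length xs))"
 unfolding Q_def by (rule I.K.span_incl[OF Q_gens]) blast

lemma Q_step:
 assumes "z : carrier L" "!!xs v. xs : lists Lm ==> of_nat (length xs) = p ==> v : carrier N ==> kw (z # xs) v : Q q" "k : Q p"
 shows "iact z k : Q q"
proof (rule clin.span_into[OF I.induced_act_clin(1)[OF assms(1)] Q_gens Q_sub _ assms(3)[unfolded Q_def]])
 fix x assume "x : {kw xs v | xs v. xs : lists Lm & of_nat (length xs) = p & v : carrier N}"
 then obtain xs v where xs: "x = kw xs v" "xs : lists Lm" "of_nat (length xs) = p" "v : carrier N" by blast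
 then show "iact z x : Q q" using assms(2)[OF xs(2-4)] I.act_kw[OF assms(1) Lm_list[OF xs(2)] xs(4)] by simp
qed

lemma Q_m: "x : Lm ==> k : Q p ==> iact x k : Q (1 + p)"
proof (rule Q_step)
 show "kw (x # xs) v : Q (1 + p)" if "x : Lm" "xs : lists Lm" "of_nat (length xs) = p" "v : carrier N" for xs v
  using Q_mem[of "x # xs" v] that by simp
qed (use Lm in auto)

text \<open>h is moved to the right. Each letter it passes contributes a word with that letter
  replaced by its bracket with h, and at the end h acts on v; the length stays the same.\<close>

lemma Q_0_word: "xs : lists Lm ==> h : L0 ==> v : carrier N ==> kw (h # xs) v : Q (of_nat (length xs))"
proof (induction xs arbitrary: h v)
 case Nil
 have "\<rho> h v : carrier N" using clin.closed[OF I.P.r_clin] W_mem Nil by simp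
 then show ?case using I.kw_P[of "[]" h v] W_mem Nil Q_mem[of "[]" "\<rho> h v"] by simp
next
 case (Cons x xs)
 have x: "x : Lm" and xs: "xs : lists Lm" using Cons.prems by auto
 have hc: "h : carrier L" "x : carrier L" using L0(2) Lm(2) Cons.prems x by auto
 have xsL: "xs : lists (carrier L)" "h # xs : lists (carrier L)" using Lm_list[OF xs] hc by auto
 have hx: "bracket L h x : Lm" using br_0m Cons.prems x by blast
 have "kw (h # x # xs) v = 1 \<odot>\<^bsub>IK\<^esub> kw (x # h # xs) v \<oplus>\<^bsub>IK\<^esub> kw (bracket L h x # xs) v"
  using I.kw_bracket[of "[]" xs h 0 x 1 v] xsL Cons.prems even Lm_odd[OF x] by (simp add: ssign_def)
 moreover have "kw (x # h # xs) v : Q (1 + of_nat (length xs))"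
  using Q_m[OF x Cons.IH[OF xs Cons.prems(2,3)]] I.act_kw[OF hc(2) xsL(2) Cons.prems(3)] by simp
 moreover have "kw (bracket L h x # xs) v : Q (1 + of_nat (length xs))"
  using Q_mem[of "bracket L h x # xs" v] hx xs Cons.prems by simp
 ultimately show ?case using QD(4,5) by simp
qed

lemma Q_0: "h : L0 ==> k : Q p ==> iact h k : Q p"
 by (rule Q_step) (use Q_0_word L0 in auto)

text \<open>As for degree 0, except that the bracket of y with a letter lies in L0, which shortens
  the word by two and so preserves its parity; at the end y annihilates N.\<close>

lemma Q_p_word: "xs : lists Lm ==> y : Lp ==> v : carrier N ==> kw (y # xs) v : Q (1 + of_nat (length xs))"
proof (induction xs arbitrary: y v)
 case Nil
 have "kw [y] v = kw [] \<zero>\<^bsub>N\<^esub>" using I.kw_P[of "[]" y v] W_mem Nil \<rho>_p by simp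
 then show ?case using clin.zero[OF I.kw_clin_right[of "[]"]] QD(3) by simp
next
 case (Cons x xs)
 have x: "x : Lm" and xs: "xs : lists Lm" using Cons.prems by auto
 have yc: "y : carrier L" "x : carrier L" using Lp(2) Lm(2) Cons.prems x by auto
 have xsL: "xs : lists (carrier L)" "y # xs : lists (carrier L)" using Lm_list[OF xs] yc by auto
 have yx: "bracket L y x : L0" using br_pm Cons.prems x by blast
 have "kw (y # x # xs) v = (-1) \<odot>\<^bsub>IK\<^esub> kw (x # y # xs) v \<oplus>\<^bsub>IK\<^esub> kw (bracket L y x # xs) v"
  using I.kw_bracket[of "[]" xs y 1 x 1 v] xsL Cons.prems Lp_odd Lm_odd[OF x] by (simp add: ssign_def)
 moreover have "kw (x # y # xs) v : Q (1 + (1 + of_nat (length xs)))"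
  using Q_m[OF x Cons.IH[OF xs Cons.prems(2,3)]] I.act_kw[OF yc(2) xsL(2) Cons.prems(3)] by simp
 moreover have "kw (bracket L y x # xs) v : Q (1 + (1 + of_nat (length xs)))"
 proof -
  have "1 + (1 + b) = b" for b :: bit by (cases b) simp_all
  then show ?thesis using Q_0_word[OF xs yx Cons.prems(3)] by presburger
 qed
 ultimately show ?case unfolding length_Cons of_nat_Suc using QD(4,5) by presburger
qed

lemma Q_p: "y : Lp ==> k : Q p ==> iact y k : Q (1 + p)"
proof (rule Q_step)
 show "kw (y # xs) v : Q (1 + p)" if "y : Lp" "xs : lists Lm" "of_nat (length xs) = p" "v : carrier N" for xs v
  using Q_p_word[OF that(2,1,4)] unfolding that(3) .
qed (use Lp in auto)

lemma Q_hom: "z : hpart L q ==> k : Q p ==> iact z k : Q (q + p)"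
proof (cases q)
 case zero
 assume "z : hpart L q" "k : Q p"
 then show "iact z k : Q (q + p)" unfolding zero add_0_left even by (rule Q_0)
next
 case one
 assume z: "z : hpart L q" and k: "k : Q p"
 obtain a b where ab: "a : Lm" "b : Lp" "z = a \<oplus> b" using dsd_obtain[OF odd] z one by metis
 have "iact z k = iact a k \<oplus>\<^bsub>IK\<^esub> iact b k"
  using clin.add[OF I.act_clin_left, of k a b] QD(2)[OF k] ab Lm(2) Lp(2) by simp
 then show "iact z k : Q (q + p)" using Q_m[OF ab(1) k] Q_p[OF ab(2) k] QD(4) unfolding one by presburger
qed

lemma Q_words: "I.hom_word w p ==> v : carrier N ==> kw w v : Q p"
proof (induction w arbitrary: p)
 case Nil
 then show ?case using Q_mem[of "[]" v] by (simp add: I.hom_word_Nil)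
next
 case (Cons x w)
 then obtain q q' where q: "x : hpart L q" "I.hom_word w q'" "p = q + q'" by (auto simp: I.hom_word_Cons)
 then show ?case using Q_hom[OF q(1) Cons.IH[OF q(2) Cons.prems(2)]] I.act_kw[of x w v]
   hpart_closed[OF q(1)] I.hom_word_carrier[OF q(2)] Cons.prems by simp
qed

lemma part_Q: "induced_part L W N \<rho> p = Q p"
proof
 show "induced_part L W N \<rho> p <= Q p"
  unfolding I.induced_part_eq by (rule I.K.span_least[OF Q_sub]) (use Q_words in blast)
 have "I.hom_word xs (of_nat (length xs))" if "xs : lists Lm" for xs
  using that
 proof (induction xs)
  case (Cons x xs)
  show ?case
   unfolding I.hom_word_Cons length_Cons of_nat_Suc
   by (intro exI[of _ 1] exI[of _ "of_nat (length xs)"] conjI refl) (use Cons Lm_odd in auto)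
 qed (simp add: I.hom_word_Nil)
 then show "Q p <= induced_part L W N \<rho> p"
  unfolding I.induced_part_eq Q_def by (intro I.K.span_mono) blast
qed

lemma K_span: "carrier IK = vspan IK {kw xs v | xs v. xs : lists Lm & v : carrier N}"
proof -
 let ?S = "{kw xs v | xs v. xs : lists Lm & v : carrier N}"
 have S: "?S <= carrier IK" using I.kw_closed Lm_list by blast
 note Ss = I.K.subspaceD[OF I.K.span_subspace[OF S]]
 have QS: "Q p <= vspan IK ?S" for p unfolding Q_def by (rule I.K.span_mono) blast
 have st: "iact z k : vspan IK ?S" if z: "z : carrier L" and k: "k : vspan IK ?S" for z k
 proof (rule clin.span_into[OF I.induced_act_clin(1)[OF z] S I.K.span_subspace[OF S] _ k])
  fix x assume "x : ?S"
  then obtain xs v where xs: "x = kw xs v" "xs : lists Lm" "v : carrier N" by blast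
  obtain a b where ab: "a : hpart L 0" "b : hpart L 1" "z = a \<oplus> b" using dsd_obtain[OF hpart_dsd z] by blast
  have xQ: "x : Q (of_nat (length xs))" using Q_mem xs by simp
  have "iact z x = iact a x \<oplus>\<^bsub>IK\<^esub> iact b x"
   using clin.add[OF I.act_clin_left, of x a b] QD(2)[OF xQ] ab hpart_closed by auto
  then show "iact z x : vspan IK ?S"
   using Ss(4)[OF subsetD[OF QS Q_hom[OF ab(1) xQ]] subsetD[OF QS Q_hom[OF ab(2) xQ]]] by presburger
 qed
 have "kw w v : vspan IK ?S" if "w : lists (carrier L)" "v : carrier N" for w v
  using that
 proof (induction w)
  case Nil
  then show ?case by (intro I.K.span_incl[OF S]) auto
 next
  case (Cons x w)
  then show ?case using st[of x "kw w v"] I.act_kw[of x w v] by auto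
 qed
 then have "vspan IK {kw w v | w v. w : lists (carrier L) & v : carrier N} <= vspan IK ?S"
  by (intro I.K.span_least I.K.span_subspace[OF S]) blast
 then show ?thesis using I.kw_span Ss(1) by blast
qed

end

context kac
begin

interpretation I: ind L W N \<rho> by (rule ind)

abbreviation "dN \<equiv> vectorspace.dim CC N"

section \<open>Fock space as a module over the whole superalgebra\<close>

lemma projections:
 obtains pm p0 pp where "clin L L pm" "clin L L p0" "clin L L pp"
  "!!x. x : carrier L ==> pm x : Lm" "!!x. x : carrier L ==> p0 x : L0" "!!x. x : carrier L ==> pp x : Lp"
  "!!x. x : Lm ==> pm x = x" "!!x. x : Lm ==> p0 x = \<zero>" "!!x. x : Lm ==> pp x = \<zero>"
  "!!x. x : L0 ==> pm x = \<zero>" "!!x. x : L0 ==> p0 x = x" "!!x. x : L0 ==> pp x = \<zero>"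
  "!!x. x : Lp ==> pm x = \<zero>" "!!x. x : Lp ==> p0 x = \<zero>" "!!x. x : Lp ==> pp x = x"
proof -
 note d = hpart_dsd[unfolded even]
 obtain p0 where p0: "clin L L p0" "!!x. x : carrier L ==> p0 x : L0" "!!x. x : L0 ==> p0 x = x"
  "!!x. x : hpart L 1 ==> p0 x = \<zero>"
  by (rule dsd_proj[OF d]) (rule that, simp, assumption+)
 obtain pm where pm: "clin L L pm" "!!x. x : carrier L ==> pm x : Lm" "!!x. x : Lm ==> pm x = x"
  "!!x. x : Lp ==> pm x = \<zero>" "!!x. x : L0 ==> pm x = \<zero>"
  by (rule dsd_proj_total[OF dsd_swap[OF d] odd]) (rule that, assumption+)
 obtain pp where pp: "clin L L pp" "!!x. x : carrier L ==> pp x : Lp" "!!x. x : Lp ==> pp x = x"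
  "!!x. x : Lm ==> pp x = \<zero>" "!!x. x : L0 ==> pp x = \<zero>"
  by (rule dsd_proj_total[OF dsd_swap[OF d] dsd_swap[OF odd]]) (rule that, assumption+)
 show ?thesis
  by (rule that[of pm p0 pp]) (use p0 pm pp Lm_odd Lp_odd in simp_all)
qed

text \<open>The action of L0 on N is carried to coordinate functions by \<open>coo\<close> and
  \<open>dec\<close>, and \<open>R\<close> combines the three kinds of operators along the
  projections to Lm, L0 and Lp. Once \<open>R\<close> is a representation and vacua transform like
  N, \<open>induced_lift\<close> supplies the map.\<close>

lemma fock_representation:
 obtains Ph nb ph where "cbasis N {..<dN} nb ph" "clin IK (FM r) Ph"
  "!!v. v : carrier N ==> Ph (kw [] v) = vac (%j. if j < dN then ph j v else 0)"
  "!!i k. i < r ==> k : carrier IK ==> Ph (iact (e i) k) = cre i (Ph k)"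
proof -
 obtain nb ph where basN: "cbasis N {..<dN} nb ph" using I.P.U.ex_cbasis[OF finN] by blast
 have nbc: "nb j : carrier N" if "j < dN" for j using basN that by (auto simp: cbasis_def)
 have phl: "linear_functional N (ph j)" if "j < dN" for j using basN that by (auto simp: cbasis_def)
 define coo where "coo v = (%j. if j < dN then ph j v else 0)" for v
 \<comment> \<open>Defined on all functions by ignoring the entries from dN on; it is a left inverse
   of \<open>coo\<close> on N.\<close>
 define dec where "dec w = (\<Oplus>\<^bsub>N\<^esub>j\<in>{..<dN}. w j \<odot>\<^bsub>N\<^esub> nb j)" for w :: "nat => complex"
 have decc: "dec w : carrier N" for w unfolding dec_def using nbc by (intro I.P.U.finsum_closed) auto
 have dec_add: "dec (%j. v j + w j) = dec v \<oplus>\<^bsub>N\<^esub> dec w" for v w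
 proof -
  have "dec (%j. v j + w j) = (\<Oplus>\<^bsub>N\<^esub>j\<in>{..<dN}. v j \<odot>\<^bsub>N\<^esub> nb j \<oplus>\<^bsub>N\<^esub> w j \<odot>\<^bsub>N\<^esub> nb j)"
   unfolding dec_def using nbc by (intro I.P.U.finsum_cong') (auto simp: I.P.U.sm_add_left)
  also have "... = dec v \<oplus>\<^bsub>N\<^esub> dec w" unfolding dec_def using nbc by (intro I.P.U.finsum_addf) auto
  finally show ?thesis .
 qed
 have dec_scale: "dec (%j. a * w j) = a \<odot>\<^bsub>N\<^esub> dec w" for a w
 proof -
  have "dec (%j. a * w j) = (\<Oplus>\<^bsub>N\<^esub>j\<in>{..<dN}. a \<odot>\<^bsub>N\<^esub> (w j \<odot>\<^bsub>N\<^esub> nb j))"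
   unfolding dec_def using nbc by (intro I.P.U.finsum_cong') auto
  also have "... = a \<odot>\<^bsub>N\<^esub> dec w" unfolding dec_def using nbc by (intro I.P.U.finsum_sm[symmetric]) auto
  finally show ?thesis .
 qed
 have dec_coo: "dec (coo v) = v" if "v : carrier N" for v
 proof -
  have "dec (coo v) = (\<Oplus>\<^bsub>N\<^esub>j\<in>{..<dN}. ph j v \<odot>\<^bsub>N\<^esub> nb j)"
   unfolding dec_def coo_def using nbc by (intro I.P.U.finsum_cong') auto
  then show ?thesis using I.P.U.cbasis_expand[OF basN that] by simp
 qed
 have coo_add: "coo (v \<oplus>\<^bsub>N\<^esub> w) = (%j. coo v j + coo w j)" if "v : carrier N" "w : carrier N" for v w
  using that linear_functionalD(1)[OF phl] by (auto simp: coo_def fun_eq_iff)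
 have coo_scale: "coo (a \<odot>\<^bsub>N\<^esub> v) = (%j. a * coo v j)" if "v : carrier N" for a v
  using that linear_functionalD(2)[OF phl] by (auto simp: coo_def fun_eq_iff)
 have coo_minus: "coo (v \<ominus>\<^bsub>N\<^esub> w) = (%j. coo v j - coo w j)" if "v : carrier N" "w : carrier N" for v w
  using that I.P.U.linear_functional_minus[OF phl] by (auto simp: coo_def fun_eq_iff)
 have \<rho>_clin: "clin N N (\<rho> x)" if "x : W" for x using I.P.r_clin that by simp
 have \<rho>c: "\<rho> x v : carrier N" if "x : W" "v : carrier N" for x v using clin.closed[OF \<rho>_clin] that by blast
 have \<rho>_left: "clin (sub_super L W) N (%x. \<rho> x v)" if "v : carrier N" for v using I.P.r_clin_left[OF that] .
 have \<rho>_add_left: "\<rho> (x \<oplus> y) v = \<rho> x v \<oplus>\<^bsub>N\<^esub> \<rho> y v" if "x : W" "y : W" "v : carrier N" for x y v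
  using clin.add[OF \<rho>_left[OF that(3)], of x y] that by simp
 have \<rho>_scale_left: "\<rho> (a \<odot> x) v = a \<odot>\<^bsub>N\<^esub> \<rho> x v" if "x : W" "v : carrier N" for a x v
  using clin.sm[OF \<rho>_left[OF that(2)], of x a] that by simp
 define \<sigma> where "\<sigma> h w = coo (\<rho> h (dec w))" for h w
 have \<rho>_br: "\<rho> (bracket L h h') v = \<rho> h (\<rho> h' v) \<ominus>\<^bsub>N\<^esub> \<rho> h' (\<rho> h v)" if "h : L0" "h' : L0" "v : carrier N" for h h' v
  using I.P.r_bracket[of h 0 h' 0 v] that even W_mem(1) \<rho>c by (simp add: ssign_def)
 interpret F: fock_rep L Lm L0 Lp r e c \<sigma>
 proof unfold_locales
  fix h assume h: "h : L0"
  note hc = \<rho>_clin[OF W_mem(1)[OF h]]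
  show "\<sigma> h (%j. v j + w j) = (%j. \<sigma> h v j + \<sigma> h w j)" for v w
   unfolding \<sigma>_def dec_add clin.add[OF hc decc decc] by (rule coo_add) (use \<rho>c W_mem(1)[OF h] decc in auto)
  show "\<sigma> h (%j. a * w j) = (%j. a * \<sigma> h w j)" for a w
   unfolding \<sigma>_def dec_scale clin.sm[OF hc decc] by (rule coo_scale) (use \<rho>c W_mem(1)[OF h] decc in auto)
  show "\<sigma> (a \<odot> h) w = (%j. a * \<sigma> h w j)" for a w
   unfolding \<sigma>_def \<rho>_scale_left[OF W_mem(1)[OF h] decc] by (rule coo_scale) (use \<rho>c W_mem(1)[OF h] decc in auto)
  fix h' assume h': "h' : L0"
  show "\<sigma> (h \<oplus> h') w = (%j. \<sigma> h w j + \<sigma> h' w j)" for w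
   unfolding \<sigma>_def \<rho>_add_left[OF W_mem(1)[OF h] W_mem(1)[OF h'] decc]
   by (rule coo_add) (use \<rho>c W_mem(1)[OF h] W_mem(1)[OF h'] decc in auto)
  have rc: "\<rho> h (dec w) : carrier N" "\<rho> h' (dec w) : carrier N" for w
   using \<rho>c W_mem(1)[OF h] W_mem(1)[OF h'] decc by auto
  have rc2: "\<rho> h (\<rho> h' (dec w)) : carrier N" "\<rho> h' (\<rho> h (dec w)) : carrier N" for w
   using \<rho>c W_mem(1)[OF h] W_mem(1)[OF h'] rc by auto
  show "\<sigma> (bracket L h h') w = (%j. \<sigma> h (\<sigma> h' w) j - \<sigma> h' (\<sigma> h w) j)" for w
   unfolding \<sigma>_def dec_coo[OF rc(1)] dec_coo[OF rc(2)] \<rho>_br[OF h h' decc] by (rule coo_minus[OF rc2])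
 qed (rule bas)
 obtain pm p0 pp where pr: "clin L L pm" "clin L L p0" "clin L L pp"
  "!!x. x : carrier L ==> pm x : Lm" "!!x. x : carrier L ==> p0 x : L0" "!!x. x : carrier L ==> pp x : Lp"
  and pmm: "!!x. x : Lm ==> pm x = x" "!!x. x : Lm ==> p0 x = \<zero>" "!!x. x : Lm ==> pp x = \<zero>"
  and p00: "!!x. x : L0 ==> pm x = \<zero>" "!!x. x : L0 ==> p0 x = x" "!!x. x : L0 ==> pp x = \<zero>"
  and ppp: "!!x. x : Lp ==> pm x = \<zero>" "!!x. x : Lp ==> p0 x = \<zero>" "!!x. x : Lp ==> pp x = x"
  by (rule projections) (rule that, assumption+)
 define R where "R x m = F.Xop (pm x) m + F.Dop (p0 x) m + F.Eop (pp x) m" for x m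
 have R_supp: "R x m : fock_supp r" if "x : carrier L" "m : fock_supp r" for x m
  unfolding R_def using that pr(5,6)
  by (intro fock_supp_intros F.fock_supp_Xop F.fock_supp_Dop F.fock_supp_Eop)
 have R_flin: "flin (R x)" if "x : carrier L" for x
  unfolding R_def using that pr(5,6) by (intro flin_add F.flin_Xop F.flin_Dop F.flin_Eop)
 have R_add_left: "R (x \<oplus> y) m = R x m + R y m" if "x : carrier L" "y : carrier L" for x y m
  unfolding R_def clin.add[OF pr(1) that] clin.add[OF pr(2) that] clin.add[OF pr(3) that]
   F.Xop_add[OF pr(4)[OF that(1)] pr(4)[OF that(2)]] F.Dop_add[OF pr(5)[OF that(1)] pr(5)[OF that(2)]]
   F.Eop_add[OF pr(6)[OF that(1)] pr(6)[OF that(2)]] by (simp add: algebra_simps)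
 have R_scale_left: "R (a \<odot> x) m = scl a (R x m)" if "x : carrier L" for x a m
  unfolding R_def clin.sm[OF pr(1) that] clin.sm[OF pr(2) that] clin.sm[OF pr(3) that]
   F.Xop_scale[OF pr(4)[OF that]] F.Dop_scale[OF pr(5)[OF that]] F.Eop_scale[OF pr(6)[OF that]]
  by (simp add: scl_add_right)
 have Rm: "R x m = F.Xop x m" if "x : Lm" for x m using that by (simp add: R_def pmm F.Dop_zero F.Eop_zero)
 have R0: "R x m = F.Dop x m" if "x : L0" for x m using that by (simp add: R_def p00 F.Xop_zero F.Eop_zero)
 have Rp: "R x m = F.Eop x m" if "x : Lp" for x m using that by (simp add: R_def ppp F.Xop_zero F.Dop_zero)
 have R1: "R x m = F.Xop a m + F.Eop b m" if "a : Lm" "b : Lp" "x = a \<oplus> b" for x a b m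
  using R_add_left[of a b m] Rm[OF that(1)] Rp[OF that(2)] that Lm(2) Lp(2) by simp
 have oddE: "\<exists>a\<in>Lm. \<exists>b\<in>Lp. x = a \<oplus> b" if "x : hpart L 1" for x using dsd_obtain[OF odd that] by blast
 \<comment> \<open>The even-odd case is proved once; the odd-even case follows from it by
   antisymmetry of the bracket.\<close>
 have br01: "R (bracket L x y) m = R x (R y m) - R y (R x m)" if br: "x : L0" "y : hpart L 1" "m : fock_supp r" for x y m
 proof -
  obtain a b where ab: "a : Lm" "b : Lp" "y = a \<oplus> b" using oddE[OF br(2)] by blast
  have c: "x : carrier L" "a : carrier L" "b : carrier L" using br(1) ab Lm(2) Lp(2) L0(2) by auto
  have xa: "bracket L x a : Lm" "bracket L x b : Lp" using br_0m br_0p br(1) ab by auto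
  have e: "bracket L x y = bracket L x a \<oplus> bracket L x b" using ab(3) c by (simp add: br_add_right)
  show ?thesis
   unfolding R1[OF xa e] R0[OF br(1)] R1[OF ab] flinD(1)[OF F.flin_Dop[OF br(1)]]
    F.Dop_Xop[OF br(1) ab(1)] F.Dop_Eop[OF br(1) ab(2) br(3)]
   by (simp add: algebra_simps)
 qed
 have ER: "envl_rep L (FM r) R"
 proof (intro envl_rep.intro envl_rep_axioms.intro I.envl_axioms FM_cspace)
  show "clin (FM r) (FM r) (R x)" if "x : carrier L" for x
   by (intro clin.intro clin_axioms.intro lin_mapI FM_cspace) (use that R_supp flinD[OF R_flin] in simp_all)
  show "clin L (FM r) (%x. R x m)" if "m : carrier (FM r)" for m
   by (intro clin.intro clin_axioms.intro lin_mapI FM_cspace cspace_axioms)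
    (use that R_supp R_add_left R_scale_left in simp_all)
  fix x y p q m assume x: "x : hpart L p" and y: "y : hpart L q" and "m : carrier (FM r)"
  then have m: "m : fock_supp r" by simp
  have c: "x : carrier L" "y : carrier L" using hpart_closed x y by auto
  have "R (bracket L x y) m = R x (R y m) - scl (ssign p q) (R y (R x m))"
  proof (cases p; cases q)
   assume pq: "p = 0" "q = 0"
   then have xy: "x : L0" "y : L0" using x y even by auto
   show ?thesis using F.Dop_Dop[OF xy m] pq by (simp add: R0 xy br_00 ssign_def)
  next
   assume pq: "p = 0" "q = 1"
   then show ?thesis using br01[of x y m] x y even m by (simp add: ssign_def)
  next
   assume pq: "p = 1" "q = 0"
   have "bracket L x y = (-1) \<odot> bracket L y x" using br_antisym[OF x y] pq by (simp add: ssign_def)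
   then have "R (bracket L x y) m = - R (bracket L y x) m" using R_scale_left[of "bracket L y x" "-1" m] c by simp
   then show ?thesis using br01[of y x m] x y even m pq by (simp add: ssign_def)
  next
   assume pq: "p = 1" "q = 1"
   obtain a b where ab: "a : Lm" "b : Lp" "x = a \<oplus> b" using oddE[of x] x pq by blast
   obtain a' b' where ab': "a' : Lm" "b' : Lp" "y = a' \<oplus> b'" using oddE[of y] y pq by blast
   have cc: "a : carrier L" "b : carrier L" "a' : carrier L" "b' : carrier L" using ab ab' Lm(2) Lp(2) by auto
   have b0: "bracket L b' a : L0" "bracket L b a' : L0" using br_pm ab ab' by auto
   have "bracket L a b' = bracket L b' a"
    using br_antisym[OF Lm_odd[OF ab(1)] Lp_odd[OF ab'(2)]] cc by (simp add: ssign_def)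
   \<comment> \<open>The brackets inside Lm and inside Lp vanish, and [a, b'] = [b', a] as both are
     odd, so two elements of L0 remain.\<close>
   then have e: "bracket L x y = bracket L b' a \<oplus> bracket L b a'"
    using ab(3) ab'(3) cc br_mm[OF ab(1) ab'(1)] br_pp[OF ab(2) ab'(2)] subsetD[OF L0(1) b0(1)] subsetD[OF L0(1) b0(2)]
    by (simp add: br_add_left br_add_right a_comm)
   have Re: "R (bracket L x y) m = F.Dop (bracket L b' a) m + F.Dop (bracket L b a') m"
    unfolding e using R_add_left[of "bracket L b' a" "bracket L b a'" m] R0 b0 cc by simp
   have E2: "F.Eop b (F.Eop b' m) = - F.Eop b' (F.Eop b m)" using F.Eop_Eop[OF ab(2) ab'(2) m] by (simp add: eq_neg_iff_add_eq_0)
   show ?thesis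
    unfolding Re R1[OF ab] R1[OF ab'] flinD(1)[OF F.flin_Xop] flinD(1)[OF F.flin_Eop[OF ab(2)]] flinD(1)[OF F.flin_Eop[OF ab'(2)]]
     F.Eop_Xop[OF ab(2) ab'(1)] F.Eop_Xop[OF ab'(2) ab(1)] E2 F.Xop_Xop[of a a']
    using pq by (simp add: ssign_def algebra_simps)
  qed
  then show "R (bracket L x y) m = R x (R y m) \<ominus>\<^bsub>FM r\<^esub> ssign p q \<odot>\<^bsub>FM r\<^esub> R y (R x m)"
   using R_supp c m fock_supp_intros(2) by simp
 qed
 have vl: "clin N (FM r) (%v. vac (coo v))"
 proof (intro clin.intro clin_axioms.intro lin_mapI FM_cspace I.P.U.cspace_axioms)
  show "vac (coo (v \<oplus>\<^bsub>N\<^esub> w)) = vac (coo v) \<oplus>\<^bsub>FM r\<^esub> vac (coo w)" if "v : carrier N" "w : carrier N" for v w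
   unfolding coo_add[OF that] by (auto intro!: fock_eqI simp: vac_def)
  show "vac (coo (a \<odot>\<^bsub>N\<^esub> v)) = a \<odot>\<^bsub>FM r\<^esub> vac (coo v)" if "v : carrier N" for a v
   unfolding coo_scale[OF that] by (auto intro!: fock_eqI simp: vac_def)
 qed (simp add: fock_supp_intros)
 \<comment> \<open>Equivariance on vacua: elements of Lp give zero on both sides, elements of L0 act
   through \<sigma>.\<close>
 have vr: "R x (vac (coo v)) = vac (coo (\<rho> x v))" if x: "x : W" and v: "v : carrier N" for x v
 proof -
  obtain h y where hy: "h : L0" "y : Lp" "x = h \<oplus> y" using dsd_obtain[OF W_dec x] by blast
  have c: "h : carrier L" "y : carrier L" using hy L0(2) Lp(2) by auto
  have "R x (vac (coo v)) = F.Dop h (vac (coo v)) + F.Eop y (vac (coo v))"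
   unfolding hy(3) R_add_left[OF c] R0[OF hy(1)] Rp[OF hy(2)] ..
  also have "... = vac (coo (\<rho> h v))" using F.Dop_vac[OF hy(1)] F.Eop_vac[OF hy(2)] dec_coo[OF v] by (simp add: \<sigma>_def)
  also have "\<rho> h v = \<rho> x v"
   unfolding hy(3) using \<rho>_add_left[OF W_mem(1)[OF hy(1)] W_mem(2)[OF hy(2)] v] \<rho>_p[OF hy(2) v] \<rho>c[OF W_mem(1)[OF hy(1)] v] by simp
  finally show ?thesis .
 qed
 obtain Ph where Ph: "clin IK (FM r) Ph"
  "!!w v. w : lists (carrier L) ==> v : carrier N ==> Ph (kw w v) = foldr R w (vac (coo v))"
  by (rule I.induced_lift[OF ER vl vr]) (assumption, assumption, rule that, assumption+)
 have "Ph (iact (e i) k) = cre i (Ph k)" if i: "i < r" and k: "k : carrier IK" for i k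
 proof (rule clin_eq_on_span[OF clin_comp[OF I.induced_act_clin(1) Ph(1)] clin_comp[OF Ph(1)] I.kw_set_closed])
  have ei: "e i : Lm" using i by (rule F.e_mem)
  then show "e i : carrier L" by (rule Lm(2))
  show "clin (FM r) (FM r) (cre i)"
   by (intro clin.intro clin_axioms.intro lin_mapI FM_cspace) (use i fock_supp_cre flinD[OF flin_cre] in simp_all)
  show "k : vspan IK {kw w v | w v. w : lists (carrier L) & v : carrier N}" using k I.kw_span by simp
  fix x assume "x : {kw w v | w v. w : lists (carrier L) & v : carrier N}"
  then obtain w v where wv: "w : lists (carrier L)" "v : carrier N" "x = kw w v" by blast
  have eic: "e i : carrier L" using ei Lm(2) by blast
  have ew: "e i # w : lists (carrier L)" using eic wv(1) by simp
  show "Ph (iact (e i) x) = cre i (Ph x)"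
   unfolding wv(3) I.act_kw[OF eic wv(1,2)] Ph(2)[OF ew wv(2)] Ph(2)[OF wv(1,2)]
   by (simp add: Rm[OF ei] F.Xop_e[OF i])
 qed
 moreover have "Ph (kw [] v) = vac (%j. if j < dN then ph j v else 0)" if "v : carrier N" for v
  using Ph(2)[of "[]" v] that by (simp add: coo_def)
 ultimately show ?thesis using that[OF basN Ph(1)] by blast
qed

section \<open>The induced module as a sum of copies of N\<close>

definition kT :: "nat set => 'v => (('l list \<Rightarrow>\<^sub>0 complex) set \<times> 'v \<Rightarrow>\<^sub>0 complex) set" where
 "kT T v = kw (map e (sorted_list_of_set T)) v"

lemma e_mem: "i < r ==> e i : Lm"
 using bas by (auto simp: cbasis_def)

lemma e_list: "set is <= {..<r} ==> map e is : lists Lm"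
 using e_mem by (auto simp: subset_iff)

lemma foldr_iact_kw: "xs : lists (carrier L) ==> v : carrier N ==> foldr iact xs (kw [] v) = kw xs v"
proof (induction xs)
 case (Cons x xs)
 then show ?case using I.act_kw[of x xs v] by simp
qed simp

theorem kac_decomp:
 obtains pj where "fin_decomp N IK (Pow {..<r}) kT pj"
  "!!p. induced_part L W N \<rho> p = vspan IK {kT T v | T v. T : Pow {..<r} & of_nat (card T) = p & v : carrier N}"
proof -
 obtain Ph nb ph where basN: "cbasis N {..<dN} nb ph" and Ph: "clin IK (FM r) Ph"
  "!!v. v : carrier N ==> Ph (kw [] v) = vac (%j. if j < dN then ph j v else 0)"
  "!!i k. i < r ==> k : carrier IK ==> Ph (iact (e i) k) = cre i (Ph k)"
  by (rule fock_representation) (rule that, assumption+)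
 have K_span': "carrier IK = vspan IK {foldr iact xs (kw [] v) | xs v. xs : lists Lm & v : carrier N}"
  and part': "Q p = vspan IK {foldr iact xs (kw [] v) | xs v. xs : lists Lm & of_nat (length xs) = p & v : carrier N}" for p
  unfolding K_span Q_def using foldr_iact_kw[OF Lm_list] by (metis (mono_tags, lifting))+
 interpret E: fermi "L\<lparr>carrier := Lm\<rparr>" IK N r dN e c iact "kw []" Ph nb ph
 proof (intro fermi.intro fermi_axioms.intro subspace_cspace[OF Lm_sub] I.K.cspace_axioms I.P.U.cspace_axioms bas basN Ph)
  show "clin IK IK (iact x)" if "x : carrier (L\<lparr>carrier := Lm\<rparr>)" for x
   using I.induced_act_clin(1) Lm(2) that by simp
  show "clin (L\<lparr>carrier := Lm\<rparr>) IK (%x. iact x k)" if "k : carrier IK" for k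
   by (rule carrier_update_clin[OF Lm_sub I.act_clin_left[OF that]])
  show "iact x (iact y k) = (-1) \<odot>\<^bsub>IK\<^esub> iact y (iact x k)"
   if "x : carrier (L\<lparr>carrier := Lm\<rparr>)" "y : carrier (L\<lparr>carrier := Lm\<rparr>)" "k : carrier IK" for x y k
  proof -
   have xy: "x : Lm" "y : Lm" using that by auto
   have c: "iact y (iact x k) : carrier IK" using I.act_closed Lm(2) xy that(3) by simp
   have "iact \<zero> k = \<zero>\<^bsub>IK\<^esub>" using clin.zero[OF I.act_clin_left[OF that(3)]] .
   then show ?thesis
    using I.act_bracket[OF Lm_odd[OF xy(1)] Lm_odd[OF xy(2)] that(3)] br_mm[OF xy] c by (simp add: ssign_def)
  qed
  show "clin N IK (kw [])" by (rule I.kw_clin_right) simp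
  show "carrier IK = vspan IK {foldr iact xs (kw [] v) | xs v. xs : lists (carrier (L\<lparr>carrier := Lm\<rparr>)) & v : carrier N}"
   using K_span' by simp
 qed
 have k: "E.kk T v = kT T v" if "T : Pow {..<r}" "v : carrier N" for T v
  unfolding E.kk_def kT_def E.foldr_ea
  using foldr_iact_kw[OF Lm_list[OF e_list[OF E.sorted_T]]] that by simp
 interpret D: fin_decomp N IK "Pow {..<r}" E.kk E.pj by (rule E.decomp)
 have "fin_decomp N IK (Pow {..<r}) kT E.pj"
 proof (intro fin_decomp.intro fin_decomp_axioms.intro I.P.U.cspace_axioms I.K.cspace_axioms D.fin D.finN D.pj_clin)
  show "clin N IK (kT T)" if "T : Pow {..<r}" for T
   by (rule clin_cong[OF D.kk_clin[OF that]]) (rule k[OF that])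
  show "E.pj T (kT T' v) = (if T = T' then v else \<zero>\<^bsub>N\<^esub>)" if "T : Pow {..<r}" "T' : Pow {..<r}" "v : carrier N" for T T' v
   using D.pj_kk[OF that] k[OF that(2,3)] by simp
  show "carrier IK = vspan IK {kT T v | T v. T : Pow {..<r} & v : carrier N}"
   unfolding D.span using k by (metis (mono_tags, lifting))
 qed
 moreover have "induced_part L W N \<rho> p = vspan IK {kT T v | T v. T : Pow {..<r} & of_nat (card T) = p & v : carrier N}" for p
 proof -
  have "induced_part L W N \<rho> p = vspan IK {E.kk T v | T v. T : Pow {..<r} & of_nat (card T) = p & v : carrier N}"
   unfolding part_Q part' using E.parity_part[of "%n. of_nat n = p"] by simp
  also have "{E.kk T v | T v. T : Pow {..<r} & of_nat (card T) = p & v : carrier N} =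
    {kT T v | T v. T : Pow {..<r} & of_nat (card T) = p & v : carrier N}"
   using k by (metis (mono_tags, lifting))
  finally show ?thesis .
 qed
 ultimately show ?thesis by (rule that)
qed

text \<open>Leibniz rule on a word of eigenvectors: each letter passed contributes its eigenvalue,
  and finally h acts on v. This is where the weight attached to a copy of N comes from.\<close>

lemma even_act_kT:
 assumes h: "h : L0" and eig: "!!i. i < r ==> bracket L h (e i) = a i \<odot> e i" and T: "T : Pow {..<r}" and v: "v : carrier N"
 shows "iact h (kT T v) = kT T (\<rho> h v \<oplus>\<^bsub>N\<^esub> (\<Sum>i\<in>T. a i) \<odot>\<^bsub>N\<^esub> v)"
proof -
 have hc: "h : carrier L" using h L0 by blast
 have hv: "\<rho> h v : carrier N" using clin.closed[OF I.P.r_clin] W_mem(1)[OF h] v by simp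
 have el: "map e is : lists (carrier L)" if "set is <= {..<r}" for "is" using Lm_list[OF e_list[OF that]] .
 have "kw (h # map e is) v = kw (map e is) (\<rho> h v \<oplus>\<^bsub>N\<^esub> (sum_list (map a is)) \<odot>\<^bsub>N\<^esub> v)" if "set is <= {..<r}" for "is"
  using that
 proof (induction "is")
  case Nil
  then show ?case using I.kw_P[of "[]" h v] W_mem(1)[OF h] v hv by simp
 next
  case (Cons i "is")
  have i: "i < r" and isr: "set is <= {..<r}" using Cons.prems by auto
  note em = e_mem[OF i]
  have ec: "e i : carrier L" using em Lm by blast
  note ml = el[OF isr]
  let ?s = "sum_list (map a is)"
  have v': "\<rho> h v \<oplus>\<^bsub>N\<^esub> ?s \<odot>\<^bsub>N\<^esub> v : carrier N" using hv v by simp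
  note kr = I.kw_clin_right[OF el[OF Cons.prems]]
  have "kw (h # e i # map e is) v = 1 \<odot>\<^bsub>IK\<^esub> kw (e i # h # map e is) v \<oplus>\<^bsub>IK\<^esub> kw (a i \<odot> e i # map e is) v"
   using I.kw_bracket[of "[]" "map e is" h 0 "e i" 1 v] ml h even Lm_odd[OF em] v eig[OF i] by (simp add: ssign_def)
  also have "kw (e i # h # map e is) v = kw (e i # map e is) (\<rho> h v \<oplus>\<^bsub>N\<^esub> ?s \<odot>\<^bsub>N\<^esub> v)"
   using I.act_kw[OF ec, of "h # map e is" v] I.act_kw[OF ec ml v'] Cons.IH[OF isr] hc ml v by simp
  also have "kw (a i \<odot> e i # map e is) v = a i \<odot>\<^bsub>IK\<^esub> kw (e i # map e is) v"
   using clin.sm[OF I.kw_clin_head[OF ml v] ec] .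
  also have "... = kw (e i # map e is) (a i \<odot>\<^bsub>N\<^esub> v)" using clin.sm[OF kr v, of "a i"] by simp
  also have "1 \<odot>\<^bsub>IK\<^esub> kw (e i # map e is) (\<rho> h v \<oplus>\<^bsub>N\<^esub> ?s \<odot>\<^bsub>N\<^esub> v) \<oplus>\<^bsub>IK\<^esub> kw (e i # map e is) (a i \<odot>\<^bsub>N\<^esub> v) =
    kw (e i # map e is) ((\<rho> h v \<oplus>\<^bsub>N\<^esub> ?s \<odot>\<^bsub>N\<^esub> v) \<oplus>\<^bsub>N\<^esub> a i \<odot>\<^bsub>N\<^esub> v)"
   using clin.add[OF kr v', of "a i \<odot>\<^bsub>N\<^esub> v"] clin.closed[OF kr v'] v by simp
  also have "(\<rho> h v \<oplus>\<^bsub>N\<^esub> ?s \<odot>\<^bsub>N\<^esub> v) \<oplus>\<^bsub>N\<^esub> a i \<odot>\<^bsub>N\<^esub> v = \<rho> h v \<oplus>\<^bsub>N\<^esub> (sum_list (map a (i # is))) \<odot>\<^bsub>N\<^esub> v"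
   using hv v by (simp add: I.P.U.sm_add_left I.P.U.a_ac)
  finally show ?case by simp
 qed
 from this[of "sorted_list_of_set T"] have "kw (h # map e (sorted_list_of_set T)) v =
   kw (map e (sorted_list_of_set T)) (\<rho> h v \<oplus>\<^bsub>N\<^esub> (\<Sum>i\<in>T. a i) \<odot>\<^bsub>N\<^esub> v)"
  using T finite_subset[of T "{..<r}"] by (simp add: sum_list_distinct_conv_sum_set)
 moreover have "iact h (kT T v) = kw (h # map e (sorted_list_of_set T)) v"
  unfolding kT_def using T finite_subset[of T "{..<r}"] by (intro I.act_kw hc el v) auto
 ultimately show ?thesis by (simp add: kT_def)
qed

end


section \<open>The Grassmann algebra\<close>

text \<open>The complex numbers as a vector space record, serving as the coefficient module N of the
  Grassmann algebra in the frame \<open>fermi\<close>.\<close>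

definition scalars :: "(complex, complex) module" where
 "scalars = module.make UNIV (*) 1 0 (+) (*)"

lemma scalars_simps [simp]: "carrier scalars = UNIV" "\<zero>\<^bsub>scalars\<^esub> = 0" "a \<oplus>\<^bsub>scalars\<^esub> b = a + b" "a \<odot>\<^bsub>scalars\<^esub> b = a * b"
 by (simp_all add: scalars_def module.make_def)

lemma scalars_cspace: "cspace scalars"
proof -
 have "Module.module CC scalars"
 proof (rule module_criteria)
  show "\<forall>v\<in>carrier scalars. \<exists>w\<in>carrier scalars. v \<oplus>\<^bsub>scalars\<^esub> w = \<zero>\<^bsub>scalars\<^esub>"
  proof
   fix v :: complex
   show "\<exists>w\<in>carrier scalars. v \<oplus>\<^bsub>scalars\<^esub> w = \<zero>\<^bsub>scalars\<^esub>" by (intro bexI[of _ "- v"]) simp_all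
  qed
 qed (auto simp: class_cring.cring_axioms algebra_simps)
 then show ?thesis by (intro cspace.intro) (simp add: vectorspace_def class_field)
qed

lemma scalars_basis: "cbasis scalars {..<1::nat} (%_. 1) (%_ v. v)"
proof -
 interpret cspace scalars by (rule scalars_cspace)
 have "v : vspan scalars {1}" for v
  using subspaceD(5)[OF span_subspace span_incl, of "{1}" 1 v] by simp
 moreover have "(%_. 1 :: complex) ` {..<1::nat} = {1}" by auto
 ultimately show ?thesis by (auto simp: cbasis_def linear_functional_def)
qed

text \<open>Under the zero action only the weight 0 occurs, so trivial coefficients contribute the
  unit of the group ring and drop out of the product.\<close>

lemma ch_scalars: "ch L H scalars (%_ _. 0) = 1"
proof (rule poly_mapping_eqI)
 fix mu :: "'a => complex"
 interpret cspace scalars by (rule scalars_cspace)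
 have z: "clin scalars scalars (%_. 0)"
  by (intro clin.intro clin_axioms.intro lin_mapI cspace_axioms) auto
 have l: "lkp (ch L H scalars (%_ _. 0)) mu =
   (if mu : dual_space L H then int (sub_dim scalars (weight_space scalars (%_ _. 0) H mu)) else 0)"
  by (rule lookup_ch) (use cspace_axioms cbasis_dim(1)[OF scalars_basis] z in auto)
 show "lkp (ch L H scalars (%_ _. 0)) mu = lkp 1 mu"
 proof (cases "mu = 0")
  case True
  have "weight_space scalars (%_ _. 0) H mu = carrier scalars" by (auto simp: weight_space_def True)
  then show ?thesis using l dual_space_zero[of L H] cbasis_dim(2)[OF scalars_basis] True carrier_update_self
   by (metis lookup_one_zero of_nat_1 card_lessThan)
 next
  case False
  have "sub_dim scalars (weight_space scalars (%_ _. 0) H mu) = 0" if d: "mu : dual_space L H"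
  proof -
   obtain h where "h : H" "mu h ~= 0" using dual_space_ext[OF d dual_space_zero] False by auto
   then have "weight_space scalars (%_ _. 0) H mu = {\<zero>\<^bsub>scalars\<^esub>}" by (auto simp: weight_space_def)
   then show ?thesis using sub_dim_zero by simp
  qed
  then show ?thesis using l False by (simp add: lookup_one)
 qed
qed

lemma sum_list_replicate_one: "sum_list (replicate n 1) = (of_nat n :: 'a :: semiring_1)"
 by (induction n) simp_all

lemma sum_fun_apply: "sum f I x = (\<Sum>i\<in>I. f i x)"
 by (induction I rule: infinite_finite_induct) simp_all

text \<open>The Fock representation with \<sigma> = 0, that is with trivial coefficients; its
  creation part makes Fock space a module over the Grassmann algebra.\<close>

locale grass = graded_lsa L Lm L0 Lp for L :: "'l lie_super" (structure) and Lm L0 Lp +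
 fixes r :: nat and e :: "nat => 'l" and c :: "nat => 'l => complex"
 assumes bas': "cbasis (L\<lparr>carrier := Lm\<rparr>) {..<r} e c"
begin

sublocale F: fock_rep L Lm L0 Lp r e c "%_ _ _. 0"
 by unfold_locales (use bas' in simp_all)

text \<open>Lm is purely odd, so a letter of Lm that is declared even is zero; the bracket relations
  then amount to anticommutation.\<close>

lemma even_part_zero: "x : hpart L 0 ==> x : Lm ==> x = \<zero>"
 using dsdD(4)[OF hpart_dsd] Lm_odd by blast

abbreviation GL where "GL \<equiv> sub_super L Lm"
abbreviation GE where "GE \<equiv> env_alg GL"

sublocale G: envl_rep GL "FM r" F.Xop
proof (intro envl_rep.intro envl_rep_axioms.intro envl.intro envl_axioms.intro FM_cspace)
 show "cspace GL"
  by (rule cspace_cong[OF _ _ _ _ subspace_cspace[OF Lm_sub]]) simp_all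
 show "bracket GL x y : carrier GL" if "x : hpart GL p" "y : hpart GL q" for x y p q
  using that br_mm[of x y] Lm(3) by simp
 show "clin (FM r) (FM r) (F.Xop x)" for x
  by (intro clin.intro clin_axioms.intro lin_mapI FM_cspace) (use F.fock_supp_Xop flinD[OF F.flin_Xop] in simp_all)
 show "clin GL (FM r) (%x. F.Xop x m)" if "m : carrier (FM r)" for m
  using that by (intro clin.intro clin_axioms.intro lin_mapI FM_cspace \<open>cspace GL\<close>)
   (use F.fock_supp_Xop F.Xop_add F.Xop_scale in simp_all)
 fix x y p q m assume h: "x : hpart GL p" "y : hpart GL q" and m: "m : carrier (FM r)"
 have s: "F.Xop a m : fock_supp r" if "m : fock_supp r" for a m using F.fock_supp_Xop[OF that] .
 have b: "F.Xop (bracket L x y) m = 0" using h br_mm[of x y] F.Xop_zero by simp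
 have "F.Xop x (F.Xop y m) = scl (ssign p q) (F.Xop y (F.Xop x m))"
 proof (cases "p = 1 & q = 1")
  case True
  then show ?thesis using F.Xop_Xop[of x y m] by (simp add: ssign_def)
 next
  case False
  have "x = \<zero> \<or> y = \<zero>" using h False even_part_zero by (cases p; cases q) auto
  then show ?thesis using F.Xop_zero flinD(3)[OF F.flin_Xop] by auto
 qed
 then show "F.Xop (bracket GL x y) m = F.Xop x (F.Xop y m) \<ominus>\<^bsub>FM r\<^esub> ssign p q \<odot>\<^bsub>FM r\<^esub> F.Xop y (F.Xop x m)"
  using b m s fock_supp_intros(2) by simp
qed (simp_all add: Lm(2))

definition v0 :: fock where "v0 = vac (%j. if j < (1::nat) then 1 else 0)"

lemma v0: "v0 : carrier (FM r)" by (simp add: v0_def fock_supp_intros)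

text \<open>The derivation of the free algebra extending the bracket with h, as it occurs inside
  \<open>grassmann_act\<close> before passing to cosets.\<close>

definition gact :: "'l => ('l list \<Rightarrow>\<^sub>0 complex) => ('l list \<Rightarrow>\<^sub>0 complex)" where
 "gact h f = (\<Sum>w\<in>supp f. \<Sum>i<length w.
   sgl (w[i := bracket L h (w ! i)]) (lkp f w))"

lemma gact_add: "gact h (f + g) = gact h f + gact h g"
 unfolding gact_def
 by (rule pm_sum_add[where h = "%w a. \<Sum>i<length w. sgl (w[i := bracket L h (w ! i)]) a"])
  (simp_all add: single_add sum.distrib)

lemma gact_scale: "gact h (pscale a f) = pscale a (gact h f)"
 unfolding gact_def
 by (rule pm_sum_scale[where h = "%w a. \<Sum>i<length w. sgl (w[i := bracket L h (w ! i)]) a"])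
  (simp_all add: pscale_sum pscale_add)

lemma gact_word: "gact h (sgl w 1) = (\<Sum>i<length w. sgl (w[i := bracket L h (w ! i)]) 1)"
 by (simp add: gact_def)

lemma gact_Cons: "gact h (sgl (x # w) 1) =
  sgl (bracket L h x # w) 1 + sgl [x] 1 * gact h (sgl w 1)"
 unfolding gact_word list.size add_Suc_right add_0_right
 by (simp add: sum.lessThan_Suc_shift sum_distrib_left single_mult_list del: sum.lessThan_Suc)

lemma gact_clin:
 assumes h: "h : L0"
 shows "clin G.FA G.FA (gact h)"
proof (intro clin.intro clin_axioms.intro lin_mapI G.FA.cspace_axioms)
 fix f assume f: "f : carrier G.FA"
 have "sgl (w[i := bracket L h (w ! i)]) (lkp f w) : carrier G.FA"
  if "w : supp f" "i < length w" for w i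
 proof -
  have w: "set w <= Lm" using f that by auto
  then have "bracket L h (w ! i) : Lm" using br_0m[OF h] that(2) nth_mem by blast
  then have "set (w[i := bracket L h (w ! i)]) <= Lm" using w by (rule set_update_subsetI[rotated])
  then show ?thesis by auto
 qed
 then have "supp (sgl (w[i := bracket L h (w ! i)]) (lkp f w)) <= lists Lm"
  if "w : supp f" "i < length w" for w i using that by simp
 moreover have "supp (sum g I) <= X" if "!!i. i : I ==> supp (g i) <= X"
  for g :: "'i => 'l list \<Rightarrow>\<^sub>0 complex" and I X
  using keys_sum[of g I] that by blast
 ultimately show "gact h f : carrier G.FA"
  unfolding gact_def free_algebra_simps mem_Collect_eq sub_super_simps by (metis (no_types, lifting) lessThan_iff)
qed (simp_all add: gact_add gact_scale)

text \<open>\<open>Dop h\<close> kills the vacuum because \<sigma> = 0 and obeys the Leibniz rule by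
  \<open>Dop_Xop\<close>, so it matches the derivation of words letter by letter.\<close>

lemma ev_gact:
 assumes h: "h : L0" and f: "f : carrier G.FA"
 shows "G.ev (gact h f) v0 = F.Dop h (G.ev f v0)"
proof (rule clin_eq_on_span[OF clin_comp[OF gact_clin[OF h] G.ev_clin[OF v0]] clin_comp[OF G.ev_clin[OF v0]] G.singles_sub])
 show "clin (FM r) (FM r) (F.Dop h)"
  by (intro clin.intro clin_axioms.intro lin_mapI FM_cspace) (use F.fock_supp_Dop[OF h] flinD[OF F.flin_Dop[OF h]] in simp_all)
 show "f : vspan G.FA {sgl w 1 | w. w : lists (carrier GL)}" using f free_algebra_span by blast
 have word: "G.ev (gact h (sgl w 1)) v0 = F.Dop h (foldr F.Xop w v0)" if "w : lists Lm" for w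
  using that
 proof (induction w rule: list.induct)
  case Nil
  have "F.Dop h v0 = 0" unfolding v0_def F.Dop_vac[OF h] by (rule fock_eqI) (simp add: vac_def)
  then show ?case using clin.zero[OF G.ev_clin[OF v0]] by (simp add: gact_word)
 next
  case (Cons x w)
  have x: "x : Lm" and w: "w : lists Lm" using Cons.prems by auto
  have hx: "bracket L h x : Lm" using br_0m[OF h x] .
  have sx: "sgl [x] 1 : carrier G.FA" and sw: "sgl w 1 : carrier G.FA"
   and shx: "sgl (bracket L h x # w) 1 : carrier G.FA" using x w hx by auto
  note gw = clin.closed[OF gact_clin[OF h] sw]
  have xg: "sgl [x] 1 * gact h (sgl w 1) : carrier G.FA"
   unfolding free_algebra_simps mem_Collect_eq sub_super_simps
   by (rule keys_times_lists) (use x gw in auto)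
  have "G.ev (gact h (sgl (x # w) 1)) v0 =
    G.ev (sgl (bracket L h x # w) 1) v0 + G.ev (sgl [x] 1 * gact h (sgl w 1)) v0"
   unfolding gact_Cons using clin.add[OF G.ev_clin[OF v0] shx xg] by simp
  also have "... = F.Xop (bracket L h x) (foldr F.Xop w v0) + F.Xop x (F.Dop h (foldr F.Xop w v0))"
   unfolding G.ev_mult[OF sx gw v0] Cons.IH[OF w]
   using G.ev_single[of "bracket L h x # w" v0 1] G.ev_single[of "[x]" _ 1] hx w x v0
    F.fock_supp_Dop[OF h] G.foldr_r_closed[of w v0] by simp
  finally show ?case using F.Dop_Xop[OF h x] by simp
 qed
 show "G.ev (gact h x) v0 = F.Dop h (G.ev x v0)" if x: "x : {sgl w 1 | w. w : lists (carrier GL)}" for x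
 proof -
  obtain w where w: "x = sgl w 1" "w : lists Lm" using x by auto
  have "G.ev x v0 = foldr F.Xop w v0"
   using G.ev_single[of w v0 1] w v0 G.foldr_r_closed[of w v0] by simp
  then show ?thesis using word w by simp
 qed
qed

lemma right_env_mult_clin:
 assumes "u : carrier GE"
 shows "clin GE GE (%v. v \<otimes>\<^bsub>GE\<^esub> u)"
proof -
 interpret c: clin G.FA GE G.ecls by (rule G.ecls_clin)
 obtain f where f: "f : carrier G.FA" "u = G.ecls f" using assms unfolding G.env_carrier by blast
 show ?thesis
 proof (intro clin.intro clin_axioms.intro lin_mapI G.UE.cspace_axioms)
  show "v \<otimes>\<^bsub>GE\<^esub> u : carrier GE" if "v : carrier GE" for v using G.env_mult_closed that assms by blast
  fix v assume "v : carrier GE"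
  then obtain g where g: "g : carrier G.FA" "v = G.ecls g" unfolding G.env_carrier by blast
  have gf: "g * f : carrier G.FA" using f g by (simp add: keys_times_lists)
  show "(a \<odot>\<^bsub>GE\<^esub> v) \<otimes>\<^bsub>GE\<^esub> u = a \<odot>\<^bsub>GE\<^esub> (v \<otimes>\<^bsub>GE\<^esub> u)" for a
   using c.sm[OF gf, of a] c.sm[OF g(1), of a] G.env_mult[OF g(1) f(1)]
    G.env_mult[OF G.FA.sm_closed[OF g(1)] f(1), of a] f(2) g(2) by (simp add: pscale_mult_left)
  fix v' assume "v' : carrier GE"
  then obtain g' where g': "g' : carrier G.FA" "v' = G.ecls g'" unfolding G.env_carrier by blast
  have gf': "g' * f : carrier G.FA" using f g' by (simp add: keys_times_lists)
  show "(v \<oplus>\<^bsub>GE\<^esub> v') \<otimes>\<^bsub>GE\<^esub> u = v \<otimes>\<^bsub>GE\<^esub> u \<oplus>\<^bsub>GE\<^esub> v' \<otimes>\<^bsub>GE\<^esub> u"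
   using c.add[OF gf gf'] c.add[OF g(1) g'(1)] G.env_mult[OF g(1) f(1)] G.env_mult[OF g'(1) f(1)]
    G.env_mult[OF G.FA.a_closed[OF g(1) g'(1)] f(1)] f(2) g(2) g'(2) by (simp add: ring_distribs)
 qed
qed

abbreviation act where "act x u \<equiv> env_word GL [x] \<otimes>\<^bsub>GE\<^esub> u"
abbreviation kk0 where "kk0 a \<equiv> a \<odot>\<^bsub>GE\<^esub> env_word GL []"

lemma foldr_act: "xs : lists Lm ==> foldr act xs (kk0 a) = a \<odot>\<^bsub>GE\<^esub> env_word GL xs"
proof (induction xs rule: list.induct)
 case (Cons x xs)
 then show ?case
  using clin.sm[OF G.left_env_mult_clin, of "env_word GL [x]" "env_word GL xs" a] G.env_word_mult[of "[x]" xs] by simp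
qed simp

lemma foldr_act_closed: "xs : lists Lm ==> foldr act xs (kk0 a) : carrier GE"
 using foldr_act[of xs a] by simp

lemma word_zero:
 assumes "w : lists Lm" "x : set w" "x = \<zero>"
 shows "env_word GL w = \<zero>\<^bsub>GE\<^esub>"
proof -
 obtain u v where "w = u @ x # v" using assms(2) by (auto dest: split_list)
 then show ?thesis using clin.zero[OF G.env_word_linear[of u v]] assms by simp
qed

lemma grass_parity: "env_part GL p = vspan GE {foldr act xs (kk0 a) | xs a. xs : lists (carrier GL) & of_nat (length xs) = p & a : carrier scalars}"
 (is "_ = vspan GE ?B")
proof
 have B: "?B <= carrier GE" using foldr_act_closed by fastforce
 note Bs = G.UE.subspaceD[OF G.UE.span_subspace[OF B]]
 show "env_part GL p <= vspan GE ?B"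
  unfolding env_part_def
 proof (rule G.UE.span_least[OF G.UE.span_subspace[OF B]], rule subsetI)
  fix u assume "u : {env_word GL w | w. \<exists>ps. list_all2 (%x q. x : hpart GL q) w ps & sum_list ps = p}"
  then obtain w ps where w: "u = env_word GL w" "list_all2 (%x q. x : hpart GL q) w ps" "sum_list ps = p" by blast
  have wL: "w : lists Lm" using w(2) by (auto simp: list_all2_conv_all_nth in_set_conv_nth)
  \<comment> \<open>A zero letter may be declared even or odd, but a word containing one vanishes.
    All other letters are odd, so the declared parity is that of the length.\<close>
  show "u : vspan GE ?B"
  proof (cases "\<zero> : set w")
   case True
   then show ?thesis using word_zero[OF wL] w(1) Bs(3) by simp
  next
   case False
   have "q = 1" if q: "q : set ps" for q
   proof (rule ccontr)
    assume "q ~= 1"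
    then have "q = 0" by (cases q) auto
    then obtain i where i: "i < length ps" "ps ! i = 0" using q by (auto simp: in_set_conv_nth)
    then have "w ! i = \<zero>" "i < length w" using w(2) even_part_zero by (auto simp: list_all2_conv_all_nth)
    then show False using False nth_mem[of i w] by simp
   qed
   then have "ps = replicate (length w) 1" using list_all2_lengthD[OF w(2)] by (intro replicate_eqI) auto
   then have "p = of_nat (length w)" using w(3) by (simp add: sum_list_replicate_one)
   then have "u : ?B" using foldr_act[OF wL, of 1] w(1) wL by (intro CollectI exI[of _ w] exI[of _ 1]) auto
   then show ?thesis by (rule G.UE.span_incl[OF B])
  qed
 qed
 let ?A = "{env_word GL w | w. \<exists>ps. list_all2 (%x q. x : hpart GL q) w ps & sum_list ps = p}"
 have A: "?A <= carrier GE" by (auto simp: list_all2_conv_all_nth in_set_conv_nth intro!: G.env_word_closed)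
 show "vspan GE ?B <= env_part GL p"
  unfolding env_part_def
 proof (rule G.UE.span_least[OF G.UE.span_subspace[OF A]], rule subsetI)
  fix u assume "u : ?B"
  then obtain xs a where xs': "u = foldr act xs (kk0 a)" "xs : lists Lm" "of_nat (length xs) = p" by auto
  have xs: "u = a \<odot>\<^bsub>GE\<^esub> env_word GL xs" "xs : lists Lm" "of_nat (length xs) = p" using foldr_act[OF xs'(2)] xs' by auto
  have "list_all2 (%x q. x : hpart GL q) xs (replicate (length xs) 1)"
   using xs(2) Lm_odd by (auto simp: list_all2_conv_all_nth)
  moreover have "sum_list (replicate (length xs) 1) = p" using xs(3) by (simp add: sum_list_replicate_one)
  ultimately have "env_word GL xs : ?A" by blast
  then show "u : vspan GE ?A" using xs(1) G.UE.span_incl[OF A] G.UE.subspaceD(5)[OF G.UE.span_subspace[OF A]] by simp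
 qed
qed

text \<open>The hypothesis on \<open>alp\<close> keeps the adjoint action in its defining form, a
  union over representatives. That this union is a single coset is established inside, by means of
  the Fock map.\<close>

theorem grassmann_decomp:
 assumes HL: "H <= L0" and eig: "!!h i. h : H ==> i < r ==> bracket L h (e i) = a i h \<odot> e i"
  and dual: "!!i. i < r ==> a i : dual_space L H"
  and alp: "!!h f. alp h (G.ecls f) = (\<Union>f\<in>G.ecls f. env_ideal GL +>\<^bsub>G.FA\<^esub> gact h f)"
 shows "ch L H GE alp = (\<Sum>T\<in>Pow {..<r}. sgl (\<Sum>i\<in>T. a i) 1)"
  "sch L H GE (env_part GL) alp = (\<Sum>T\<in>Pow {..<r}. sgl (\<Sum>i\<in>T. a i) (bsign (of_nat (card T))))"
proof -
 obtain Ph where Ph: "clin GE (FM r) Ph" "!!f. f : carrier G.FA ==> Ph (G.ecls f) = G.ev f v0"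
  by (rule G.ev_ecls[OF v0]) (rule that, assumption+)
 have Phw: "Ph (env_word GL w) = foldr F.Xop w v0" if "w : lists Lm" for w
  unfolding env_word_def using Ph(2)[of "sgl w 1"] G.ev_single[OF _ v0, of w 1] G.foldr_r_closed[OF _ v0, of w] that by simp
 interpret K: fermi "L\<lparr>carrier := Lm\<rparr>" GE scalars r 1 e c act kk0 Ph "%_. 1" "%_ v. v"
 proof (intro fermi.intro fermi_axioms.intro subspace_cspace[OF Lm_sub] G.UE.cspace_axioms scalars_cspace bas' scalars_basis Ph(1))
  show "clin GE GE (act x)" if "x : carrier (L\<lparr>carrier := Lm\<rparr>)" for x
   using that by (intro G.left_env_mult_clin) simp
  show "clin (L\<lparr>carrier := Lm\<rparr>) GE (%x. act x k)" if k: "k : carrier GE" for k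
  proof -
   have "clin GL GE (%x. act x k)" using clin_comp[OF G.env_word_linear[of "[]" "[]"] right_env_mult_clin[OF k]] by simp
   then show ?thesis
    by (intro clin.intro clin_axioms.intro lin_mapI subspace_cspace[OF Lm_sub] G.UE.cspace_axioms)
     (use clin.closed[of GL] clin.add[of GL] clin.sm[of GL] in simp_all)
  qed
  show "act x (act y k) = (-1) \<odot>\<^bsub>GE\<^esub> act y (act x k)"
   if "x : carrier (L\<lparr>carrier := Lm\<rparr>)" "y : carrier (L\<lparr>carrier := Lm\<rparr>)" and k: "k : carrier GE" for x y k
  proof -
   have xy: "x : Lm" "y : Lm" using that by auto
   have w: "env_word GL [x] : carrier GE" "env_word GL [y] : carrier GE" "env_word GL [y, x] : carrier GE" using xy by auto
   have "env_word GL [x, y] = (-1) \<odot>\<^bsub>GE\<^esub> env_word GL [y, x]"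
    using G.env_word_bracket[of "[]" "[]" x 1 y 1] xy Lm_odd br_mm[OF xy] word_zero[of "[\<zero>]" \<zero>] Lm(3) w(3)
    by (simp add: ssign_def)
   then show ?thesis
    using G.env_mult_assoc[OF w(1,2) k] G.env_mult_assoc[OF w(2,1) k] G.env_word_mult[of "[x]" "[y]"] G.env_word_mult[of "[y]" "[x]"]
     clin.sm[OF right_env_mult_clin[OF k] w(3), of "-1"] xy by simp
  qed
  show "clin scalars GE kk0"
   by (intro clin.intro clin_axioms.intro lin_mapI scalars_cspace G.UE.cspace_axioms) (simp_all add: G.UE.sm_add_left)
  have "{env_word GL w | w. w : lists (carrier GL)} <=
    {foldr act xs (kk0 v) | xs v. xs : lists (carrier (L\<lparr>carrier := Lm\<rparr>)) & v : carrier scalars}" (is "_ <= ?S")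
  proof
   fix u assume "u : {env_word GL w | w. w : lists (carrier GL)}"
   then obtain w where "u = env_word GL w" "w : lists Lm" by auto
   then show "u : ?S" using foldr_act[of w 1] by (intro CollectI exI[of _ w] exI[of _ 1]) auto
  qed
  from G.UE.span_mono[OF this] have "carrier GE <= vspan GE ?S" using G.env_span by simp
  moreover have "?S <= carrier GE" using foldr_act_closed by fastforce
  note G.UE.subspaceD(1)[OF G.UE.span_subspace[OF this]]
  ultimately show "carrier GE = vspan GE ?S" by (rule subset_antisym)
  show "Ph (kk0 v) = vac (%j. if j < 1 then v else 0)" for v
  proof -
   have "Ph (kk0 v) = scl v v0" using clin.sm[OF Ph(1), of "env_word GL []" v] Phw[of "[]"] by simp
   then show ?thesis by (auto intro!: fock_eqI simp: v0_def vac_def)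
  qed
  show "Ph (act (e i) k) = cre i (Ph k)" if i: "i < r" and k: "k : carrier GE" for i k
  proof (rule clin_eq_on_span[OF clin_comp[OF G.left_env_mult_clin Ph(1)] clin_comp[OF Ph(1)]])
   show "clin (FM r) (FM r) (cre i)"
    by (intro clin.intro clin_axioms.intro lin_mapI FM_cspace) (use i fock_supp_cre flinD[OF flin_cre] in simp_all)
   show "k : vspan GE {env_word GL w | w. w : lists (carrier GL)}" using k G.env_span by simp
   show "env_word GL [e i] : carrier GE" using F.e_mem[OF i] by simp
   fix u assume "u : {env_word GL w | w. w : lists (carrier GL)}"
   then obtain w where "u = env_word GL w" "w : lists Lm" by auto
   then show "Ph (act (e i) u) = cre i (Ph u)"
    using G.env_word_mult[of "[e i]" w] Phw[of w] Phw[of "e i # w"] F.e_mem[OF i] F.Xop_e[OF i] by simp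
  qed (auto intro!: G.env_word_closed)
 qed
 interpret D: fin_decomp scalars GE "Pow {..<r}" K.kk K.pj by (rule K.decomp)
 \<comment> \<open>\<open>Ph\<close> determines all projections of the decomposition, so it is
   injective and identities in the Grassmann algebra can be checked in Fock space. Stability of the
   defining ideal under the derivation comes out this way, without a direct computation.\<close>
 have inj: "k = k'" if "k : carrier GE" "k' : carrier GE" "Ph k = Ph k'" for k k'
  by (rule D.ext[OF that(1,2)]) (simp only: K.pj_def that(3))
 have alpe: "alp h (G.ecls f) = G.ecls (gact h f)" if h: "h : L0" and f: "f : carrier G.FA" for h f
 proof -
  have "(\<Union>f\<in>G.ecls f. G.ecls (gact h f)) = G.ecls (gact h f)"
  proof (rule G.FA.coset_UN[OF G.env_ideal_subspace f])
   fix g assume g: "g : carrier G.FA" "g \<ominus>\<^bsub>G.FA\<^esub> f : env_ideal GL"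
   have "G.ecls g = G.ecls f" using G.FA.coset_eq_iff[OF G.env_ideal_subspace g(1) f] g(2) by blast
   then have ev: "G.ev g v0 = G.ev f v0" using Ph(2) g(1) f by metis
   note gg = clin.closed[OF gact_clin[OF h]]
   show "G.ecls (gact h g) = G.ecls (gact h f)"
    by (rule inj) (use Ph(2)[OF gg[OF g(1)]] Ph(2)[OF gg[OF f]] ev_gact[OF h g(1)] ev_gact[OF h f] ev
     clin.closed[OF G.ecls_clin] gg g(1) f in auto)
  qed
  then show ?thesis using alp by simp
 qed
 have alpc: "alp h k : carrier GE" and Phalp: "Ph (alp h k) = F.Dop h (Ph k)" if h: "h : L0" and k: "k : carrier GE" for h k
 proof -
  obtain f where f: "f : carrier G.FA" "k = G.ecls f" using k unfolding G.env_carrier by blast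
  note gf = clin.closed[OF gact_clin[OF h] f(1)]
  show "alp h k : carrier GE" using alpe[OF h f(1)] clin.closed[OF G.ecls_clin gf] f(2) by simp
  show "Ph (alp h k) = F.Dop h (Ph k)" using alpe[OF h f(1)] Ph(2)[OF gf] Ph(2)[OF f(1)] ev_gact[OF h f(1)] f(2) by simp
 qed
 interpret W: weighted_decomp scalars GE "Pow {..<r}" K.kk K.pj L H alp "%_ _. 0" "%T. \<Sum>i\<in>T. a i" "%T. of_nat (card T)" "env_part GL"
 proof (intro weighted_decomp.intro weighted_decomp_axioms.intro K.decomp)
  fix h assume hH: "h : H"
  then have h: "h : L0" using HL by blast
  note fl = flinD[OF F.flin_Dop[OF h]] and Phl = clin.add[OF Ph(1)] clin.sm[OF Ph(1)]
  show "clin GE GE (alp h)"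
   by (intro clin.intro clin_axioms.intro lin_mapI G.UE.cspace_axioms, rule alpc[OF h], assumption)
    (rule inj; simp add: alpc[OF h] Phalp[OF h] Phl fl)+
  show "clin scalars scalars (%_. 0)"
   by (intro clin.intro clin_axioms.intro lin_mapI scalars_cspace) auto
  fix T v assume T: "T : Pow {..<r}"
  \<comment> \<open>On a word of eigenvectors the eigenvalues add up, starting from 0 on the
    vacuum.\<close>
  have wd: "F.Dop h (foldr cre is (vac w)) = scl (\<Sum>i\<leftarrow>is. a i h) (foldr cre is (vac w))" if "set is <= {..<r}" for "is" w
   using that
  proof (induction "is")
   case Nil
   have "vac (%_. 0) = 0" by (rule fock_eqI) (simp add: vac_def)
   then show ?case using F.Dop_vac[OF h, of w] by simp
  next
   case (Cons i "is")
   have i: "i < r" and IH: "F.Dop h (foldr cre is (vac w)) = scl (\<Sum>i\<leftarrow>is. a i h) (foldr cre is (vac w))" using Cons by auto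
   show ?case
    using F.Dop_cre[OF h i, of "foldr cre is (vac w)"] IH flinD(2)[OF flin_cre] eig[OF hH i]
     F.Xop_scale[OF F.e_mem[OF i]] F.Xop_e[OF i] by (simp add: scl_add_left add.commute)
  qed
  have Tr: "T <= {..<r}" and fT: "finite T" using T finite_subset[of T "{..<r}"] by auto
  have kkc: "K.kk T v : carrier GE" using D.kk_closed[OF T] by simp
  have s: "(\<Sum>i\<leftarrow>sorted_list_of_set T. a i h) = (\<Sum>i\<in>T. a i) h"
   using fT by (simp add: sum_list_distinct_conv_sum_set sum_fun_apply)
  have "Ph (alp h (K.kk T v)) = scl ((\<Sum>i\<in>T. a i) h) (Ph (K.kk T v))"
   unfolding Phalp[OF h kkc] unfolding K.kk_def using K.Ph_word[OF K.sorted_T[OF Tr], of v] wd[OF K.sorted_T[OF Tr]] s by simp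
  then have "alp h (K.kk T v) = (\<Sum>i\<in>T. a i) h \<odot>\<^bsub>GE\<^esub> K.kk T v"
   by (intro inj) (simp_all add: kkc alpc[OF h] Phl)
  then show "alp h (K.kk T v) = K.kk T (0 \<oplus>\<^bsub>scalars\<^esub> (\<Sum>i\<in>T. a i) h \<odot>\<^bsub>scalars\<^esub> v)"
   using clin.sm[OF D.kk_clin[OF T], of v] by simp
 next
  show "(\<Sum>i\<in>T. a i) : dual_space L H" if "T : Pow {..<r}" for T
   using that dual by (intro dual_space_sum) auto
  show "env_part GL p = vspan GE {K.kk T v | T v. T : Pow {..<r} & of_nat (card T) = p & v : carrier scalars}" for p
   unfolding grass_parity using K.parity_part[of "%n. of_nat n = p"] by simp
 qed
 show "ch L H GE alp = (\<Sum>T\<in>Pow {..<r}. sgl (\<Sum>i\<in>T. a i) 1)"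
  using W.ch_eq ch_scalars[of L H] by simp
 show "sch L H GE (env_part GL) alp = (\<Sum>T\<in>Pow {..<r}. sgl (\<Sum>i\<in>T. a i) (bsign (of_nat (card T))))"
  using W.sch_eq ch_scalars[of L H] by simp
qed

end


section \<open>Products of characters\<close>

lemma prod_single: "finite T ==> (\<Prod>i\<in>T. sgl (a i) (s :: int)) = sgl (\<Sum>i\<in>T. a i :: 'a :: comm_monoid_add) (s ^ card T)"
 by (induction T rule: finite_induct) (simp_all add: mult_single Poly_Mapping.single_one)

text \<open>Expansion of a product over subsets; s = 1 gives characters and s = -1
  supercharacters.\<close>

lemma sum_Pow_single:
 fixes r :: nat
 shows "(\<Sum>T\<in>Pow {..<r}. sgl (\<Sum>i\<in>T. a i :: 'a :: comm_monoid_add) ((s :: int) ^ card T)) =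
  (\<Prod>i<r. sgl (a i) s + 1)"
proof -
 have "(\<Prod>i<r. sgl (a i) s + 1) = (\<Sum>T\<in>Pow {..<r}. \<Prod>i\<in>T. sgl (a i) s)"
  by (subst prod_add) (rule finite_lessThan, simp)
 also have "... = (\<Sum>T\<in>Pow {..<r}. sgl (\<Sum>i\<in>T. a i) (s ^ card T))"
  by (rule sum.cong) (auto simp: prod_single finite_subset[of _ "{..<r}"])
 finally show ?thesis ..
qed

text \<open>As q runs below r * d, the quotient q div d takes each value below r exactly d times.
  For d = 0 both sides are 1.\<close>

lemma prod_blocks: "(\<Prod>q<r * d. f (q div d)) = (\<Prod>i<r. f i :: 'a :: comm_semiring_1) ^ d"
proof (cases "d = 0")
 case False
 have "(\<Prod>q<r * d. f (q div d)) = (\<Prod>i<r. \<Prod>q\<in>{i * d..<i * d + d}. f (q div d))"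
  by (rule prod.nat_group[symmetric])
 also have "... = (\<Prod>i<r. f i ^ d)"
 proof (rule prod.cong[OF refl])
  fix i
  have "(\<Prod>q\<in>{i * d..<i * d + d}. f (q div d)) = (\<Prod>q\<in>{i * d..<i * d + d}. f i)"
  proof (rule prod.cong[OF refl])
   fix q assume "q : {i * d..<i * d + d}"
   then have "q div d = i" using False by (intro div_nat_eqI) (auto simp: algebra_simps)
   then show "f (q div d) = f i" by simp
  qed
  then show "(\<Prod>q\<in>{i * d..<i * d + d}. f (q div d)) = f i ^ d" by simp
 qed
 finally show ?thesis by (simp add: prod_power_distrib)
qed simp

text \<open>The generating sum for g_{-1}[B], whose basis is numbered by q, is thereby the d-th
  power of the one for g_{-1}.\<close>

lemma sum_Pow_blocks:
 "(\<Sum>T\<in>Pow {..<r * d}. sgl (\<Sum>q\<in>T. a (q div d) :: 'a :: comm_monoid_add) ((s :: int) ^ card T)) =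
  (\<Sum>T\<in>Pow {..<r}. sgl (\<Sum>i\<in>T. a i) (s ^ card T)) ^ d"
 using sum_Pow_single[of "%q. a (q div d)" s "r * d"] sum_Pow_single[of a s r]
  prod_blocks[of "%i. sgl (a i) s + 1" d r] by simp

lemma bsign_of_nat: "bsign (of_nat n) = (-1) ^ n"
proof (induction n)
 case (Suc n)
 have "bsign (1 + b) = - bsign b" for b by (cases b) (simp_all add: bsign_def)
 then show ?case unfolding of_nat_Suc using Suc by simp
qed (simp add: bsign_def)

section \<open>Finitely generated commutative algebras\<close>

locale calg = al: algebra CC A for A :: "(complex, 'a) module" (structure)
begin

sublocale cspace A
 by (rule algebra_cspace) (rule al.algebra_axioms)

lemma mult_smult: "x : carrier A ==> y : carrier A ==> (c \<odot> x) \<otimes> y = c \<odot> (x \<otimes> y)"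
 "x : carrier A ==> y : carrier A ==> x \<otimes> (c \<odot> y) = c \<odot> (x \<otimes> y)"
proof -
 assume h: "x : carrier A" "y : carrier A"
 show l: "(c \<odot> x) \<otimes> y = c \<odot> (x \<otimes> y)" using al.smult_assoc2[of c x y] h by simp
 show "x \<otimes> (c \<odot> y) = c \<odot> (x \<otimes> y)"
  using al.smult_assoc2[of c y x] h al.m_comm[of x "c \<odot> y"] al.m_comm[of x y] by simp
qed

lemma mult_clin: "x : carrier A ==> clin A A (%y. x \<otimes> y)"
 by (intro clin.intro clin_axioms.intro lin_mapI cspace_axioms) (simp_all add: al.r_distr mult_smult)

lemma ideal_subspace:
 assumes "ideal I A"
 shows "csub I A"
proof -
 interpret ideal I A by fact
 show ?thesis
 proof (rule subspaceI)
  fix c x assume x: "x : I"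
  have "c \<odot> x = (c \<odot> \<one>) \<otimes> x" using mult_smult(1)[of \<one> x c] x Icarr by simp
  then show "c \<odot> x : I" using I_l_closed[OF x, of "c \<odot> \<one>"] by simp
 qed (use Icarr in auto)
qed

lemma quot_mult:
 assumes "ideal I A" "x : carrier A" "y : carrier A"
 shows "(I +> x) \<otimes>\<^bsub>quot A I\<^esub> (I +> y) = I +> (x \<otimes> y)"
 using ideal.rcoset_mult_add[OF assms] by (simp add: quot_def FactRing_def)

lemma quot_one: "\<one>\<^bsub>quot A I\<^esub> = I +> \<one>"
 by (simp add: quot_def FactRing_def)

lemma quot_algebra:
 assumes I: "ideal I A"
 shows "algebra CC (quot A I)"
proof -
 note sub = ideal_subspace[OF I]
 interpret Q: cspace "quot A I" by (rule quot_cspace[OF sub])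
 have c: "(\<exists>x\<in>carrier A. X = I +> x)" if "X : carrier (quot A I)" for X
  using quot_carrierE[OF sub that] by blast
 have cl: "I +> x : carrier (quot A I)" if "x : carrier A" for x using quot_closed[OF sub that] .
 note qa = quot_add[OF sub] and qm = quot_mult[OF I] and qs = quot_smult[OF sub]
 show ?thesis
 proof (rule algebraI)
  show "cring (quot A I)"
  proof (rule cringI)
   show "abelian_group (quot A I)" by (rule Q.abelian_group_axioms)
   show "comm_monoid (quot A I)"
   proof (rule comm_monoidI)
    fix X Y assume "X : carrier (quot A I)" "Y : carrier (quot A I)"
    then obtain x y where x: "x : carrier A" "X = I +> x" and y: "y : carrier A" "Y = I +> y" using c by metis
    show "X \<otimes>\<^bsub>quot A I\<^esub> Y : carrier (quot A I)" using qm[OF x(1) y(1)] x y cl by simp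
    show "X \<otimes>\<^bsub>quot A I\<^esub> Y = Y \<otimes>\<^bsub>quot A I\<^esub> X"
     using qm[OF x(1) y(1)] qm[OF y(1) x(1)] x y al.m_comm by simp
    fix Z assume "Z : carrier (quot A I)"
    then obtain z where z: "z : carrier A" "Z = I +> z" using c by metis
    show "X \<otimes>\<^bsub>quot A I\<^esub> Y \<otimes>\<^bsub>quot A I\<^esub> Z = X \<otimes>\<^bsub>quot A I\<^esub> (Y \<otimes>\<^bsub>quot A I\<^esub> Z)"
     using x y z qm al.m_assoc by simp
   next
    fix X assume "X : carrier (quot A I)"
    then obtain x where x: "x : carrier A" "X = I +> x" using c by metis
    show "\<one>\<^bsub>quot A I\<^esub> \<otimes>\<^bsub>quot A I\<^esub> X = X" using qm[of \<one> x] x by (simp add: quot_one)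
   qed (simp add: quot_one cl)
   fix X Y Z assume "X : carrier (quot A I)" "Y : carrier (quot A I)" "Z : carrier (quot A I)"
   then obtain x y z where x: "x : carrier A" "X = I +> x" and y: "y : carrier A" "Y = I +> y"
    and z: "z : carrier A" "Z = I +> z" using c by metis
   show "(X \<oplus>\<^bsub>quot A I\<^esub> Y) \<otimes>\<^bsub>quot A I\<^esub> Z = X \<otimes>\<^bsub>quot A I\<^esub> Z \<oplus>\<^bsub>quot A I\<^esub> Y \<otimes>\<^bsub>quot A I\<^esub> Z"
    using x y z qm qa al.l_distr by simp
  qed
  fix a X Y assume "X : carrier (quot A I)" "Y : carrier (quot A I)"
  then obtain x y where x: "x : carrier A" "X = I +> x" and y: "y : carrier A" "Y = I +> y" using c by metis
  show "(a \<odot>\<^bsub>quot A I\<^esub> X) \<otimes>\<^bsub>quot A I\<^esub> Y = a \<odot>\<^bsub>quot A I\<^esub> (X \<otimes>\<^bsub>quot A I\<^esub> Y)"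
   using x y qs[OF x(1), of a] qm[OF x(1) y(1)] qm[OF sm_closed[OF x(1)] y(1), of a] qs[of "x \<otimes> y" a]
    mult_smult(1)[OF x(1) y(1)] by simp
 qed (simp_all add: Q.sm_add_left Q.sm_add_right class_cring.cring_axioms)
qed

definition mprod :: "'a list => 'a" where "mprod ws = foldr (\<otimes>) ws \<one>"

lemma mprod_closed: "ws : lists (carrier A) ==> mprod ws : carrier A"
 by (induction ws rule: list.induct) (auto simp: mprod_def)

lemma mprod_append: "us : lists (carrier A) ==> ws : lists (carrier A) ==> mprod (us @ ws) = mprod us \<otimes> mprod ws"
proof (induction us rule: list.induct)
 case (Cons u us)
 then show ?case using mprod_closed[of us] mprod_closed[of ws] by (simp add: mprod_def al.m_assoc)
qed (use mprod_closed[of ws] in \<open>simp add: mprod_def\<close>)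

definition generates :: "'a set => bool" where
 "generates S \<longleftrightarrow> finite S & S <= carrier A &
  (\<forall>B. csub B A & subring B A & S <= B --> B = carrier A)"

text \<open>The span of all products of generators contains the unit and is closed under
  multiplication, by bilinearity in two stages, so it is a subring containing S.\<close>

lemma words_span:
 assumes "generates S"
 shows "carrier A = vspan A {mprod ws | ws. ws : lists S}" (is "_ = vspan A ?W")
proof -
 have S: "S <= carrier A" using assms by (simp add: generates_def)
 have SL: "ws : lists (carrier A)" if "ws : lists S" for ws using that S by auto
 have W: "?W <= carrier A" using mprod_closed SL by blast
 note sub = span_subspace[OF W]
 note sD = subspaceD[OF sub]
 have "subring (vspan A ?W) A"
 proof (rule al.subringI)
  show "\<one> : vspan A ?W" by (rule span_incl[OF W]) (auto intro!: exI[of _ "[]"] simp: mprod_def)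
  show "\<ominus> h : vspan A ?W" if "h : vspan A ?W" for h using sD(5)[OF that, of "-1"] neg_sm[OF sD(2)[OF that]] by simp
  fix x y assume x: "x : vspan A ?W" and y: "y : vspan A ?W"
  show "x \<otimes> y : vspan A ?W"
  proof (rule clin.span_into[OF mult_clin[OF sD(2)[OF x]] W sub _ y])
   fix v assume "v : ?W"
   then obtain vs where vs: "v = mprod vs" "vs : lists S" by blast
   have v: "v : carrier A" using vs mprod_closed SL by simp
   have "v \<otimes> x : vspan A ?W"
   proof (rule clin.span_into[OF mult_clin[OF v] W sub _ x])
    fix u assume "u : ?W"
    then obtain us where us: "u = mprod us" "us : lists S" by blast
    have "vs @ us : lists S" using us vs by simp
    then have "mprod (vs @ us) : vspan A ?W" by (intro span_incl[OF W]) blast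
    then show "v \<otimes> u : vspan A ?W" unfolding mprod_append[OF SL[OF vs(2)] SL[OF us(2)]] us(1) vs(1) .
   qed
   then show "x \<otimes> v : vspan A ?W" using al.m_comm[OF v sD(2)[OF x]] by simp
  qed
 qed (use sD in auto)
 moreover have "S <= vspan A ?W"
 proof
  fix s assume s: "s : S"
  then have "s = mprod [s]" using S by (auto simp: mprod_def)
  then show "s : vspan A ?W" using s by (intro span_incl[OF W]) (auto intro!: exI[of _ "[s]"])
 qed
 ultimately show ?thesis using assms sub by (auto simp: generates_def)
qed

text \<open>Substitution of a into a polynomial by Horner's scheme, with the constants entering as
  multiples of the unit.\<close>

definition peval :: "'a => complex poly => 'a" where
 "peval a p = fold_coeffs (%c s. c \<odot> \<one> \<oplus> a \<otimes> s) p \<zero>"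

lemma peval_0 [simp]: "peval a 0 = \<zero>"
 by (simp add: peval_def)

lemma peval_pCons: "a : carrier A ==> peval a (pCons c p) = c \<odot> \<one> \<oplus> a \<otimes> peval a p"
 by (cases "c = 0 & p = 0"; cases "p = 0") (auto simp: peval_def)

context
 fixes a assumes a [simp]: "a : carrier A"
begin

lemma peval_closed [simp]: "peval a p : carrier A"
 by (induction p) (simp_all add: peval_pCons)

lemma peval_add: "peval a (p + q) = peval a p \<oplus> peval a q"
proof (induction p q rule: poly_induct2)
 case (pCons c p d q)
 then show ?case by (simp add: peval_pCons sm_add_left al.r_distr al.a_ac)
qed simp

lemma peval_smult: "peval a (smult c p) = c \<odot> peval a p"
 by (induction p) (simp_all add: peval_pCons sm_add_right mult_smult)

lemma peval_mult: "peval a (p * q) = peval a p \<otimes> peval a q"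
proof (induction p)
 case (pCons c p)
 then show ?case
  by (simp add: peval_add peval_smult peval_pCons al.l_distr mult_smult al.m_assoc)
qed simp

lemma peval_sum: "finite I ==> peval a (\<Sum>i\<in>I. f i) = (\<Oplus>i\<in>I. peval a (f i))"
 by (induction I rule: finite_induct) (simp_all add: peval_add)

lemma peval_linear: "peval a [:- z, 1:] = a \<ominus> z \<odot> \<one>"
 by (simp add: peval_pCons minus_sm al.a_comm)

text \<open>Over the complex numbers p splits into linear factors, and a prime ideal containing p(a)
  contains the value of one of them. The induction cannot end at a nonzero constant, which would put
  the unit into I.\<close>

lemma root_in_prime:
 assumes "primeideal I A" "p ~= 0" "peval a p : I"
 shows "\<exists>z. a \<ominus> z \<odot> \<one> : I"
 using assms(2,3)
proof (induction "degree p" arbitrary: p)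
 case 0
 interpret primeideal I A by fact
 obtain c where c: "p = [:c:]" using 0 degree_eq_zeroE by metis
 then have "c ~= 0" "c \<odot> \<one> : I" using 0 by (auto simp: peval_pCons)
 then have "\<one> : I" using subspaceD(5)[OF ideal_subspace[OF is_ideal], of "c \<odot> \<one>" "inverse c"] by simp
 then show ?case using I_notcarr one_imp_carrier by blast
next
 case (Suc n)
 interpret primeideal I A by fact
 have "\<not> constant (poly p)" using Suc(2) constant_degree[of p] by simp
 then obtain z where "poly p z = 0" using fundamental_theorem_of_algebra by blast
 then obtain q where q: "p = [:- z, 1:] * q" unfolding poly_eq_0_iff_dvd dvd_def by blast
 then have "q ~= 0" using Suc by auto
 then have "degree q = n" using q Suc(2) degree_mult_eq[of "[:- z, 1:]" q] by simp
 have "(a \<ominus> z \<odot> \<one>) \<otimes> peval a q : I" using Suc(4) unfolding q peval_mult peval_linear .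
 then have "a \<ominus> z \<odot> \<one> : I \<or> peval a q : I" by (intro I_prime) auto
 then show ?case using Suc(1)[OF \<open>degree q = n\<close>[symmetric] \<open>q ~= 0\<close>] by blast
qed

end

section \<open>The Nullstellensatz by counting dimensions\<close>

lemma maximal_inverse:
 assumes m: "maximalideal I A" and u: "u : carrier A" "u \<notin> I"
 shows "\<exists>b\<in>carrier A. \<exists>i\<in>I. \<one> = i \<oplus> u \<otimes> b"
proof -
 interpret maximalideal I A by fact
 note PI = additive_subgroup.zero_closed[OF ideal.axioms(1)[OF al.cgenideal_ideal[OF u(1)]]]
 let ?J = "I <+>\<^bsub>A\<^esub> PIdl u"
 have J: "ideal ?J A" by (rule al.add_ideals[OF is_ideal al.cgenideal_ideal[OF u(1)]])
 have Jm: "x \<oplus> y : ?J" if "x : I" "y : PIdl u" for x y using that by (auto simp: set_add_def')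
 have "I <= ?J" using Jm[OF _ PI] Icarr by (auto simp: subset_iff)
 moreover have "u : ?J" using Jm[OF zero_closed al.cgenideal_self[OF u(1)]] u(1) by simp
 ultimately have "?J = carrier A" using I_maximal[OF J] u(2) ideal.Icarr[OF J] by blast
 then have "\<one> : ?J" by simp
 then obtain i x where "i : I" "x : carrier A" "\<one> = i \<oplus> x \<otimes> u"
  unfolding set_add_def' cgenideal_def by blast
 then show ?thesis using al.m_comm[of x u] u(1) by auto
qed

text \<open>An increasing sequence of finite sets whose spans exhaust A; this is the form in which
  countable dimension is used.\<close>

definition word_set :: "'a set => nat => 'a set" where
 "word_set S n = {mprod ws | ws. set ws <= S & length ws \<le> n}"

lemma word_set_finite: "finite S ==> finite (word_set S n)"
 using finite_lists_length_le[of S n] by (simp add: word_set_def setcompr_eq_image)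

lemma word_set_closed: "S <= carrier A ==> word_set S n <= carrier A"
 using mprod_closed by (auto simp: word_set_def)

lemma word_set_exhaust:
 assumes "generates S" "x : carrier A"
 shows "\<exists>n. x : vspan A (word_set S n)"
proof -
 have S: "S <= carrier A" using assms by (simp add: generates_def)
 note sub = span_subspace[OF word_set_closed[OF S]]
 have mono: "vspan A (word_set S m) <= vspan A (word_set S n)" if "m \<le> n" for m n
  using that by (intro span_mono) (force simp: word_set_def)
 have "x : vspan A {mprod ws | ws. ws : lists S}" using words_span[OF assms(1)] assms(2) by simp
 moreover have "{mprod ws | ws. ws : lists S} <= carrier A" using mprod_closed S by blast
 ultimately show ?thesis
 proof (induction rule: span_induct)
  show "\<exists>n. \<zero> : vspan A (word_set S n)" using subspaceD(3)[OF sub] by blast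
  show "\<exists>n. x \<oplus> y : vspan A (word_set S n)"
   if xy: "\<exists>n. x : vspan A (word_set S n)" "\<exists>n. y : vspan A (word_set S n)" for x y
  proof -
   obtain m n where "x : vspan A (word_set S m)" "y : vspan A (word_set S n)" using xy by blast
   then have "x : vspan A (word_set S (max m n))" "y : vspan A (word_set S (max m n))"
    using mono[of m "max m n"] mono[of n "max m n"] by auto
   then show ?thesis using subspaceD(4)[OF sub] by blast
  qed
  show "\<exists>n. c \<odot> x : vspan A (word_set S n)" if "\<exists>n. x : vspan A (word_set S n)" for c x
   using that subspaceD(5)[OF sub] by blast
  fix x assume "x : {mprod ws | ws. ws : lists S}"
  then obtain ws where "x = mprod ws" "set ws <= S" by auto
  then have "x : word_set S (length ws)" by (auto simp: word_set_def)
  then show "\<exists>n. x : vspan A (word_set S n)" using span_incl[OF word_set_closed[OF S]] by blast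
 qed
qed

text \<open>Injectivity of b transfers a dependence among vectors to a finite set of indices, where
  the coefficients are needed.\<close>

lemma infinite_dependent:
 assumes "csub W A" "finite S" "S <= W" "vspan A S = W" "inj_on b C" "infinite C" "b ` C <= W"
 obtains T g c0 where "finite T" "T <= C" "(\<Oplus>c\<in>T. g c \<odot> b c) = \<zero>" "c0 : T" "g c0 ~= 0"
proof -
 interpret W: vectorspace CC "A\<lparr>carrier := W\<rparr>" using subspace_cspace[OF assms(1)] by (rule cspace.vs)
 have sm: "submodule CC W A" using assms(1) by (simp add: VectorSpace.subspace_def)
 have "W.fin_dim" by (rule subspace_fin_dim_iff_span[OF assms(1-4)])
 moreover have "infinite (b ` C)" using assms(5,6) finite_imageD by blast
 ultimately have "W.lin_dep (b ` C)" using W.li_le_dim(1)[of "b ` C"] assms(7) by auto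
 then have "al.lin_dep (b ` C)" using al.span_li_not_depend(2)[OF assms(7) sm] by simp
 then obtain B f v where B: "finite B" "B <= b ` C" "al.lincomb f B = \<zero>" "v : B" "f v ~= \<zero>\<^bsub>CC\<^esub>"
  unfolding al.lin_dep_def by blast
 obtain T where T: "T <= C" "finite T" "B = b ` T" using B(1,2) finite_subset_image by metis
 have bc: "b c : carrier A" if "c : C" for c using that assms(7) subspaceD(1)[OF assms(1)] by blast
 have "(%v. f v \<odot> v) : b ` T \<rightarrow> carrier A" using bc T(1) by auto
 then have "(\<Oplus>c\<in>T. f (b c) \<odot> b c) = \<zero>"
  using B(3) al.finsum_reindex[of "%v. f v \<odot> v" b T] inj_on_subset[OF assms(5) T(1)] unfolding al.lincomb_def T(3) by simp
 moreover obtain c0 where "c0 : T" "v = b c0" using B(4) T(3) by blast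
 ultimately show ?thesis using that[of T "%c. f (b c)" c0] T B(5) by (simp add: class_ring_simps)
qed

text \<open>If no a - z lies in I, each has an inverse b z modulo I. Infinitely many of these fall
  into one finite-dimensional span and satisfy a linear relation; multiplied by the product of the a
  - d involved, it becomes a nonzero polynomial in a lying in I, and \<open>root_in_prime\<close>
  gives the contradiction. The inverses are elements of A, so the quotient field never
  appears.\<close>

theorem nullstellensatz:
 assumes gen: "generates S" and m: "maximalideal I A" and a: "a : carrier A"
 shows "\<exists>z. a \<ominus> z \<odot> \<one> : I"
proof (rule ccontr)
 assume no: "\<not> ?thesis"
 interpret maximalideal I A by fact
 have pr: "primeideal I A" by (rule al.maximalideal_prime[OF m])
 note Is = ideal_subspace[OF is_ideal]
 have S: "S <= carrier A" "finite S" using gen by (simp_all add: generates_def)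
 define u where "u z = a \<ominus> z \<odot> \<one>" for z
 have u: "u z : carrier A" "u z \<notin> I" for z using no a by (auto simp: u_def)
 have "\<forall>z. \<exists>b. \<exists>i. b : carrier A & i : I & \<one> = i \<oplus> u z \<otimes> b" using maximal_inverse[OF m u] by metis
 then obtain b i where b: "!!z. b z : carrier A" and i: "!!z. i z : I" and bi: "!!z. \<one> = i z \<oplus> u z \<otimes> b z" by metis
 have ic: "i z : carrier A" for z using i Icarr by blast
 have bI: "b z \<notin> I" for z
 proof
  assume "b z : I"
  then have "\<one> : I" using bi[of z] subspaceD(4)[OF Is i[of z] I_l_closed[OF _ u(1)[of z]]] by simp
  then show False using I_notcarr one_imp_carrier by blast
 qed
 obtain n where n: "!!z. b z : vspan A (word_set S (n z))" using word_set_exhaust[OF gen b] by metis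
 \<comment> \<open>Uncountably many z are distributed over countably many values N, so some value is
   taken infinitely often; uncountability is inherited from the real line.\<close>
 have "\<exists>N. infinite {z. n z = N}"
 proof (rule ccontr)
  assume "\<not> ?thesis"
  then have "countable (\<Union>N. {z. n z = N})" by (intro countable_UN) (auto intro: countable_finite)
  moreover have "(\<Union>N. {z. n z = N}) = (UNIV :: complex set)" by auto
  ultimately have "countable (range complex_of_real)" using countable_subset[of _ "UNIV :: complex set"] by simp
  then have "countable (UNIV :: real set)" by (rule countable_image_inj_on) (simp add: inj_def)
  then show False using uncountable_UNIV_real by simp
 qed
 then obtain N where inf: "infinite {z. n z = N}" by blast
 note W = word_set_closed[OF S(1), of N]
 \<comment> \<open>Equal inverses for z and w would put (w - z) b z into I, hence b z itself, which
   is impossible for an inverse modulo I.\<close>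
 have inj: "inj b"
 proof (rule injI, rule ccontr)
  fix z w assume e: "b z = b w" and zw: "z ~= w"
  have "u z = u w \<oplus> (w - z) \<odot> \<one>" using a by (simp add: u_def minus_sm al.a_assoc sm_add_left[symmetric])
  then have "u z \<otimes> b z = u w \<otimes> b w \<oplus> (w - z) \<odot> b z"
   using u(1) b e by (simp add: al.l_distr mult_smult)
  then have "\<one> = i z \<oplus> (u w \<otimes> b w \<oplus> (w - z) \<odot> b z)" using bi[of z] by simp
  moreover have "\<one> = i w \<oplus> u w \<otimes> b w" by (rule bi)
  ultimately have "u w \<otimes> b w \<oplus> (i z \<oplus> (w - z) \<odot> b z) = u w \<otimes> b w \<oplus> i w"
   using ic b u(1) by (simp add: al.a_ac)
  then have "i z \<oplus> (w - z) \<odot> b z = i w" using ic b u(1) by simp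
  then have "(w - z) \<odot> b z = i w \<ominus> i z"
   using minus_eq_iff[of "i w" "i z" "(w - z) \<odot> b z"] ic b by (simp add: al.a_comm)
  then have "(w - z) \<odot> b z : I" using subspace_minus[OF Is i i] by simp
  then have "b z : I" using subspaceD(5)[OF Is, of "(w - z) \<odot> b z" "inverse (w - z)"] b zw by simp
  then show False using bI by blast
 qed
 obtain T g c0 where T: "finite T" "(\<Oplus>c\<in>T. g c \<odot> b c) = \<zero>" "c0 : T" "g c0 ~= 0"
 proof (rule infinite_dependent[OF span_subspace[OF W] word_set_finite[OF S(2)] _ refl inj_on_subset[OF inj subset_UNIV] inf])
  show "word_set S N <= vspan A (word_set S N)" using span_incl[OF W] by blast
  show "b ` {z. n z = N} <= vspan A (word_set S N)" using n by auto
 qed (rule that)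
 \<comment> \<open>P c is the product of X - d over the d in T other than c, and Q the value at a of
   the full product. Multiplication by Q turns b c into the value of P c at a, modulo I, so the
   linear relation becomes the statement that p(a) lies in I.\<close>
 define P where "P c = (\<Prod>d\<in>T - {c}. [:- d, 1:])" for c
 define Q where "Q = peval a (\<Prod>d\<in>T. [:- d, 1:])"
 define p where "p = (\<Sum>c\<in>T. smult (g c) (P c))"
 have Qc: "Q : carrier A" using a by (simp add: Q_def)
 have Pc: "peval a (P c) : carrier A" for c using a by simp
 have PQ: "peval a (P c) = peval a (P c) \<otimes> i c \<oplus> Q \<otimes> b c" if c: "c : T" for c
 proof -
  have "Q = peval a (P c) \<otimes> u c"
   unfolding Q_def P_def u_def peval_linear[OF a, symmetric] peval_mult[OF a, symmetric]
   using prod.remove[OF T(1) c, of "%d. [:- d, 1:]"] by (simp add: mult.commute)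
  then have "peval a (P c) \<otimes> \<one> = peval a (P c) \<otimes> i c \<oplus> Q \<otimes> b c"
   using bi[of c] Pc ic u(1) b by (simp add: al.r_distr al.m_assoc)
  then show ?thesis using Pc by simp
 qed
 have "peval a p = (\<Oplus>c\<in>T. g c \<odot> peval a (P c))"
  unfolding p_def peval_sum[OF a T(1)] using a by (simp add: peval_smult)
 also have "... = (\<Oplus>c\<in>T. g c \<odot> (peval a (P c) \<otimes> i c) \<oplus> Q \<otimes> (g c \<odot> b c))"
 proof (rule al.finsum_cong')
  fix c assume "c : T"
  from PQ[OF this] have "g c \<odot> peval a (P c) = g c \<odot> (peval a (P c) \<otimes> i c \<oplus> Q \<otimes> b c)" by simp
  then show "g c \<odot> peval a (P c) = g c \<odot> (peval a (P c) \<otimes> i c) \<oplus> Q \<otimes> (g c \<odot> b c)"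
   using Pc ic Qc b by (simp add: sm_add_right mult_smult)
 qed (use Pc ic Qc b in auto)
 also have "... = (\<Oplus>c\<in>T. g c \<odot> (peval a (P c) \<otimes> i c)) \<oplus> (\<Oplus>c\<in>T. Q \<otimes> (g c \<odot> b c))"
  by (rule al.finsum_addf) (use Pc ic Qc b in auto)
 also have "(\<Oplus>c\<in>T. Q \<otimes> (g c \<odot> b c)) = \<zero>"
  using clin.finsum[OF mult_clin[OF Qc], of "%c. g c \<odot> b c" T] T(2) b clin.zero[OF mult_clin[OF Qc]] by simp
 finally have "peval a p = (\<Oplus>c\<in>T. g c \<odot> (peval a (P c) \<otimes> i c))" using Pc ic by simp
 moreover have "(\<Oplus>c\<in>T. g c \<odot> (peval a (P c) \<otimes> i c)) : I"
  by (rule subspace_finsum[OF Is]) (use subspaceD(5)[OF Is] I_l_closed[OF i Pc] in blast)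
 ultimately have "peval a p : I" by simp
 \<comment> \<open>At c0 every P c with c different from c0 vanishes while P c0 does not, and the
   coefficient g c0 is nonzero.\<close>
 moreover have "p ~= 0"
 proof
  assume "p = 0"
  then have "(\<Sum>c\<in>T. g c * poly (P c) c0) = 0" unfolding p_def by (metis (no_types, lifting) poly_0 poly_smult poly_sum sum.cong)
  moreover have "poly (P c) c0 = 0" if "c : T - {c0}" for c
   using that T(1,3) by (auto simp: P_def poly_prod prod_zero_iff)
  ultimately have "g c0 * poly (P c0) c0 = 0" using T(1,3) by (simp add: sum.remove[of T c0])
  then show False using T(1,4) by (simp add: P_def poly_prod prod_zero_iff)
 qed
 ultimately show False using root_in_prime[OF a pr] no by blast
qed

text \<open>By the Nullstellensatz every generator can be shifted by a scalar into I. A product of p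
  shifted generators lies in the p-th power of I, hence in k, so the finitely many products of
  length at most p span the quotient.\<close>

lemma quot_fin_dim:
 assumes gen: "generates S" and m: "maximalideal I A" and k: "ideal k A" and pk: "I [^]\<^bsub>ideals_set A\<^esub> (p :: nat) <= k"
 shows "findim (quot A k)"
proof -
 interpret maximalideal I A by fact
 have S: "S <= carrier A" "finite S" using gen by (simp_all add: generates_def)
 obtain z where z: "!!a. a : carrier A ==> a \<ominus> z a \<odot> \<one> : I" using nullstellensatz[OF gen m] by metis
 \<comment> \<open>The shifted generators still generate A, because a unital subalgebra contains the
   scalars that were subtracted.\<close>
 define T where "T = (%s. s \<ominus> z s \<odot> \<one>) ` S"
 have TI: "T <= I" using z S by (auto simp: T_def)
 have Tc: "T <= carrier A" using TI Icarr by blast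
 have fT: "finite T" using S by (simp add: T_def)
 have gT: "generates T"
  unfolding generates_def
 proof (intro conjI allI impI fT Tc)
  fix B assume B: "csub B A & subring B A & T <= B"
  have "s : B" if s: "s : S" for s
  proof -
   have "s \<ominus> z s \<odot> \<one> : B" "z s \<odot> \<one> : B"
    using B s subspaceD(5)[OF _ subringE(3)] by (auto simp: T_def)
   then have "(s \<ominus> z s \<odot> \<one>) \<oplus> z s \<odot> \<one> : B" using B subspaceD(4) by blast
   moreover have "(s \<ominus> z s \<odot> \<one>) \<oplus> z s \<odot> \<one> = s"
    using minus_eq_iff[of s "z s \<odot> \<one>" "s \<ominus> z s \<odot> \<one>"] s S by auto
   ultimately show ?thesis by simp
  qed
  then show "B = carrier A" using gen B unfolding generates_def by blast
 qed
 have pw: "mprod ws : I [^]\<^bsub>ideals_set A\<^esub> (length ws)" if "ws : lists T" for ws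
  using that
 proof (induction ws rule: rev_induct)
  case Nil
  then show ?case by (simp add: mprod_def ideals_set_def)
 next
  case (snoc w ws)
  have w: "w : T" "ws : lists T" using snoc.prems by auto
  have "ws : lists (carrier A)" "w : carrier A" using w Tc by auto
  then have "mprod (ws @ [w]) = mprod ws \<otimes> w" using mprod_append[of ws "[w]"] by (simp add: mprod_def)
  moreover have "mprod ws \<otimes> w : ideal_prod A (I [^]\<^bsub>ideals_set A\<^esub> (length ws)) I"
   by (rule ideal_prod.prod[OF snoc.IH[OF w(2)]]) (use w TI in blast)
  ultimately show ?case by (simp add: ideals_set_def)
 qed
 note sub = ideal_subspace[OF k]
 interpret Q: cspace "quot A k" by (rule quot_cspace[OF sub])
 interpret c: clin A "quot A k" "%x. k +> x" by (rule quot_proj_clin[OF sub])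
 let ?F = "(%x. k +> x) ` word_set T p"
 have F: "?F <= carrier (quot A k)" using word_set_closed[OF Tc] by auto
 have "carrier (quot A k) = (%x. k +> x) ` vspan A {mprod ws | ws. ws : lists T}"
  using quot_carrier[OF sub] words_span[OF gT] by auto
 also have "... = vspan (quot A k) ((%x. k +> x) ` {mprod ws | ws. ws : lists T})"
  using mprod_closed Tc by (intro c.span_image) blast
 also have "... <= vspan (quot A k) ?F"
 proof (rule Q.span_least[OF Q.span_subspace[OF F]], rule subsetI)
  fix X assume "X : (%x. k +> x) ` {mprod ws | ws. ws : lists T}"
  then obtain ws where ws: "X = k +> mprod ws" "ws : lists T" by blast
  show "X : vspan (quot A k) ?F"
  proof (cases "length ws \<le> p")
   case True
   then show ?thesis using ws by (intro Q.span_incl[OF F]) (auto simp: word_set_def)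
  next
   case False
   have l: "take p ws : lists T" "drop p ws : lists T"
    using ws(2) set_take_subset[of p ws] set_drop_subset[of p ws] by auto
   have lc: "take p ws : lists (carrier A)" "drop p ws : lists (carrier A)" using l Tc by auto
   have "mprod (take p ws) : k" using pw[OF l(1)] False pk by auto
   then have "mprod (take p ws) \<otimes> mprod (drop p ws) : k" using ideal.I_r_closed[OF k] mprod_closed[OF lc(2)] by blast
   then have mk: "mprod ws : k" using mprod_append[OF lc] by simp
   then have "k +> mprod ws = k +> \<zero>"
    using coset_eq_iff[OF sub ideal.Icarr[OF k mk] al.zero_closed] subspace_minus[OF sub mk subspaceD(3)[OF sub]] by simp
   then have "X = \<zero>\<^bsub>quot A k\<^esub>" by (simp only: ws(1) quot_zero[OF sub])
   then show ?thesis by (simp only: Q.subspaceD(3)[OF Q.span_subspace[OF F]])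
  qed
 qed
 finally have "vspan (quot A k) ?F = carrier (quot A k)" by (intro subset_antisym Q.subspaceD(1)[OF Q.span_subspace[OF F]])
 then show ?thesis by (intro Q.fin_dimI[OF _ F] finite_imageI word_set_finite fT)
qed

end


section \<open>Simultaneous diagonalisation\<close>

context cspace
begin


text \<open>A maximal independent subset of X, which exists because the dimension bounds its size.
  It serves to choose a basis consisting of joint eigenvectors.\<close>

lemma spanning_basis:
 assumes fd: "findim V" and X: "X <= carrier V" "vspan V X = carrier V"
 shows "\<exists>b ph. cbasis V {..<vectorspace.dim CC V} b ph & b ` {..<vectorspace.dim CC V} <= X"
proof -
 interpret vectorspace CC V by (rule vs)
 define P where "P A \<longleftrightarrow> A <= X & lin_indpt A" for A
 have "\<exists>A. finite A & maximal A P"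
 proof (rule maximal_exists)
  show "finite A & card A \<le> dim" if "P A" for A
   using li_le_dim[OF fd, of A] that X(1) by (auto simp: P_def)
  show "P {}" by (auto simp: P_def lin_dep_def)
 qed
 then obtain A where fA: "finite A" and m: "maximal A P" by blast
 then have A: "finite A" "A <= X" "lin_indpt A" by (simp_all add: maximal_def P_def)
 have mx: "B = A" if "B \<supseteq> A" "P B" for B using m that by (simp add: maximal_def)
 have Ac: "A <= carrier V" using A(2) X(1) by blast
 have "v : span A" if v: "v : X" for v
 proof (cases "v : A")
  case True
  then show ?thesis by (rule span_incl[OF Ac])
 next
  case False
  show ?thesis
  proof (rule ccontr)
   assume "v \<notin> span A"
   then have "P (A \<union> {v})" using lin_dep_iff_in_span[OF Ac A(3) _ False] v X(1) A(2) by (auto simp: P_def)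
   then show False using mx[of "A \<union> {v}"] False by blast
  qed
 qed
 then have "carrier V <= span A" using span_least[OF span_subspace[OF Ac], of X] X(2) by blast
 then have bas: "basis A" using A Ac span_closed[OF Ac] by (auto simp: basis_def)
 show ?thesis using cbasis_of_basis[OF A(1) bas] dim_basis[OF A(1) bas] A(2) by auto
qed

text \<open>The characteristic polynomial of the matrix of T has a root; an eigenvector of the
  matrix is translated back through the basis.\<close>

lemma eigenvector_exists:
 assumes bas: "cbasis V {..<n :: nat} e ph" and n: "n > 0" and T: "clin V V T"
 shows "\<exists>v\<in>carrier V. v ~= \<zero> & (\<exists>z. T v = z \<odot> v)"
proof -
 interpret T: clin V V T by fact
 define A where "A = mat n n (%(i, j). ph i (T (e j)))"
 have A: "A : carrier_mat n n" by (simp add: A_def)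
 have e: "e j : carrier V" if "j < n" for j using bas that by (auto simp: cbasis_def)
 have ph: "linear_functional V (ph i)" if "i < n" for i using bas that by (auto simp: cbasis_def)
 have phe: "ph i (e j) = (if i = j then 1 else 0)" if "i < n" "j < n" for i j using bas that by (auto simp: cbasis_def)
 have "\<not> constant (poly (char_poly A))" using degree_monic_char_poly[OF A] n constant_degree[of "char_poly A"] by simp
 then obtain z where "poly (char_poly A) z = 0" using fundamental_theorem_of_algebra by blast
 then obtain x where x: "x : carrier_vec n" "x ~= 0\<^sub>v n" "A *\<^sub>v x = z \<cdot>\<^sub>v x"
  using eigenvalue_root_char_poly[OF A] A unfolding eigenvalue_def eigenvector_def by auto
 define v where "v = (\<Oplus>j\<in>{..<n}. x $ j \<odot> e j)"
 have v: "v : carrier V" unfolding v_def using e by (intro finsum_closed) auto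
 have lc: "ph i (\<Oplus>j\<in>{..<n}. x $ j \<odot> f j) = (\<Sum>j<n. x $ j * ph i (f j))"
  if "i < n" "!!j. j < n ==> f j : carrier V" for i f
  using linear_functional_finsum[OF ph[OF that(1)], of "%j. x $ j \<odot> f j" "{..<n}"] linear_functionalD(2)[OF ph[OF that(1)]] that(2)
  by (simp add: Pi_def)
 have phv: "ph i v = x $ i" if "i < n" for i
 proof -
  have "ph i v = (\<Sum>j<n. x $ j * ph i (e j))" unfolding v_def by (rule lc[OF that e])
  also have "... = (\<Sum>j<n. x $ j * (if i = j then 1 else 0))" by (intro sum.cong) (use phe that in auto)
  also have "... = x $ i" using that by (simp add: if_distrib cong: if_cong)
  finally show ?thesis .
 qed
 have Tv: "T v = (\<Oplus>j\<in>{..<n}. x $ j \<odot> T (e j))"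
  unfolding v_def using T.finsum[of "%j. x $ j \<odot> e j" "{..<n}"] e T.sm by (simp add: Pi_def cong: finsum_cong)
 have phTv: "ph i (T v) = z * x $ i" if i: "i < n" for i
 proof -
  have "ph i (T v) = (\<Sum>j<n. x $ j * ph i (T (e j)))" unfolding Tv using e by (intro lc[OF i]) auto
  also have "... = (A *\<^sub>v x) $ i"
   using i x(1) by (simp add: A_def scalar_prod_def lessThan_atLeast0 mult.commute)
  finally show ?thesis using x(1,3) i by simp
 qed
 have "T v \<ominus> z \<odot> v = \<zero>"
  by (rule cbasis_zero[OF bas]) (use v phTv phv linear_functional_minus[OF ph] linear_functionalD(2)[OF ph] in auto)
 then have "T v = z \<odot> v" using minus_eq_zero_iff v by simp
 moreover have "v ~= \<zero>"
 proof
  assume "v = \<zero>"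
  then have "x $ i = 0" if "i < n" for i using phv[OF that] linear_functional_zero[OF ph[OF that]] by simp
  then have "x = 0\<^sub>v n" using x(1) by (intro eq_vecI) auto
  then show False using x(2) by simp
 qed
 ultimately show ?thesis using v by blast
qed

text \<open>Summands are gathered by eigenvalue. The family v is a total function vanishing off F,
  so that two such sums can be added over the union of their eigenvalue sets.\<close>

lemma eigen_grouping:
 assumes T: "clin V V T" and x: "x : vspan V {v : carrier V. \<exists>c. T v = c \<odot> v}"
 shows "\<exists>F v. finite F & (\<forall>mu. v mu : carrier V & T (v mu) = mu \<odot> v mu) & (\<forall>mu. mu \<notin> F --> v mu = \<zero>) & x = (\<Oplus>mu\<in>F. v mu)"
  (is "?P x")
proof -
 interpret T: clin V V T by fact
 have "{v : carrier V. \<exists>c. T v = c \<odot> v} <= carrier V" by blast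
 with x show ?thesis
 proof (induction rule: span_induct)
  case zero
  show ?case by (intro exI[of _ "{}"] exI[of _ "%_. \<zero>"]) auto
 next
  case (add x y)
  obtain F v where F: "finite F" "!!mu. v mu : carrier V" "!!mu. T (v mu) = mu \<odot> v mu" "!!mu. mu \<notin> F ==> v mu = \<zero>" "x = (\<Oplus>mu\<in>F. v mu)"
   using add(3) by blast
  obtain F' v' where F': "finite F'" "!!mu. v' mu : carrier V" "!!mu. T (v' mu) = mu \<odot> v' mu" "!!mu. mu \<notin> F' ==> v' mu = \<zero>" "y = (\<Oplus>mu\<in>F'. v' mu)"
   using add(4) by blast
  have "x = (\<Oplus>mu\<in>F \<union> F'. v mu)" unfolding F(5)
   by (rule add.finprod_mono_neutral_cong_left) (use F F' in auto)
  moreover have "y = (\<Oplus>mu\<in>F \<union> F'. v' mu)" unfolding F'(5)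
   by (rule add.finprod_mono_neutral_cong_left) (use F F' in auto)
  ultimately have "x \<oplus> y = (\<Oplus>mu\<in>F \<union> F'. v mu \<oplus> v' mu)" using F(2) F'(2) by (simp add: finsum_addf)
  then show ?case using F(1-4) F'(1-4)
   by (intro exI[of _ "F \<union> F'"] exI[of _ "%mu. v mu \<oplus> v' mu"]) (auto simp: T.add sm_add_right)
 next
  case (smult c x)
  obtain F v where F: "finite F" "!!mu. v mu : carrier V" "!!mu. T (v mu) = mu \<odot> v mu" "!!mu. mu \<notin> F ==> v mu = \<zero>" "x = (\<Oplus>mu\<in>F. v mu)"
   using smult(2) by blast
  have "c \<odot> x = (\<Oplus>mu\<in>F. c \<odot> v mu)" unfolding F(5) using F(2) by (intro finsum_sm) auto
  then show ?case using F(1-4)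
   by (intro exI[of _ F] exI[of _ "%mu. c \<odot> v mu"]) (auto simp: T.sm mult.commute)
 next
  case (base x)
  then obtain c where c: "x : carrier V" "T x = c \<odot> x" by blast
  then show ?case
   by (intro exI[of _ "{c}"] exI[of _ "%mu. if mu = c then x else \<zero>"]) auto
 qed
qed

text \<open>Applying T - mu to the sum removes the component at mu and multiplies the others by
  nonzero numbers. By induction these lie in W, and the component at mu is what remains of the
  sum.\<close>

lemma stable_components:
 assumes T: "clin V V T" and W: "csub W V" "!!w. w : W ==> T w : W" and F: "finite F"
 shows "(!!mu. mu : F ==> v mu : carrier V & T (v mu) = mu \<odot> v mu) ==> (\<Oplus>mu\<in>F. v mu) : W ==> l : F ==> v l : W"
 using F
proof (induction F arbitrary: v l rule: finite_induct)
 case (insert mu F)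
 interpret T: clin V V T by fact
 note Ws = subspaceD[OF W(1)]
 define f where "f x = T x \<oplus> (- mu) \<odot> x" for x
 have f: "clin V V f"
  by (intro clin.intro clin_axioms.intro lin_mapI cspace_axioms)
   (simp_all add: f_def T.add T.sm sm_add_right a_ac mult.commute)
 have vc: "v nu : carrier V" if "nu : insert mu F" for nu using insert.prems(1)[OF that] by blast
 have fv: "f (v nu) = (nu - mu) \<odot> v nu" if "nu : insert mu F" for nu
  using insert.prems(1)[OF that] sm_add_left[of "v nu" nu "- mu"] by (simp add: f_def)
 let ?x = "\<Oplus>nu\<in>insert mu F. v nu"
 have x: "?x = v mu \<oplus> (\<Oplus>nu\<in>F. v nu)" using insert.hyps vc by (intro finsum_insert) auto
 have Fc: "(\<Oplus>nu\<in>F. v nu) : carrier V" using vc by (intro finsum_closed) auto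
 have fF: "f (\<Oplus>nu\<in>F. v nu) = (\<Oplus>nu\<in>F. (nu - mu) \<odot> v nu)"
  using clin.finsum[OF f, of v F] vc fv by (simp add: Pi_def cong: finsum_cong)
 have "f ?x = (\<Oplus>nu\<in>F. (nu - mu) \<odot> v nu)"
  unfolding x clin.add[OF f vc[OF insertI1] Fc] fF using fv[of mu] vc by simp
 moreover have "f ?x : W" unfolding f_def using Ws(4,5) W(2) insert.prems(2) by blast
 ultimately have "(\<Oplus>nu\<in>F. (nu - mu) \<odot> v nu) : W" by simp
 then have "(nu - mu) \<odot> v nu : W" if "nu : F" for nu
  by (rule insert.IH[rotated, OF _ that]) (use insert.prems(1) T.sm in \<open>auto simp: mult.commute\<close>)
 then have F: "v nu : W" if "nu : F" for nu
  using Ws(5)[of "(nu - mu) \<odot> v nu" "inverse (nu - mu)"] that insert.hyps(2) vc[of nu] by (cases "nu = mu") auto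
 have "v mu = ?x \<ominus> (\<Oplus>nu\<in>F. v nu)"
  using minus_eq_iff[of ?x "\<Oplus>nu\<in>F. v nu" "v mu"] x Fc vc by simp
 then have "v mu : W" using subspace_minus[OF W(1) insert.prems(2) subspace_finsum[OF W(1) F]] by simp
 then show ?case using F insert.prems(3) by blast
qed simp

text \<open>A joint eigenvector x of F lies in a joint eigenspace W, which T h preserves because the
  operators commute. The components of x along T h stay in W, so they are eigenvectors of all the
  operators.\<close>

lemma simultaneous_diagonal:
 assumes "finite F" "!!h. h : F ==> clin V V (T h)"
  "!!h h' v. h : F ==> h' : F ==> v : carrier V ==> T h (T h' v) = T h' (T h v)"
  "!!h. h : F ==> vspan V {v : carrier V. \<exists>c. T h v = c \<odot> v} = carrier V"
 shows "vspan V {v : carrier V. \<forall>h\<in>F. \<exists>c. T h v = c \<odot> v} = carrier V"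
 using assms
proof (induction F rule: finite_induct)
 case empty
 then show ?case using span_of_subspace[OF subspace_carrier] by simp
next
 case (insert h F)
 let ?S = "%F. {v : carrier V. \<forall>h\<in>F. \<exists>c. T h v = c \<odot> v}"
 have S: "?S F' <= carrier V" for F' by blast
 have IH: "vspan V (?S F) = carrier V" by (rule insert.IH) (use insert.prems in auto)
 note T = insert.prems(1)
 have "?S F <= vspan V (?S (insert h F))"
 proof
  fix x assume x: "x : ?S F"
  then have "\<forall>f\<in>F. \<exists>c. T f x = c \<odot> x" by simp
  from bchoice[OF this] obtain a where a: "\<forall>f\<in>F. T f x = a f \<odot> x" by blast
  define W where "W = {w : carrier V. \<forall>f\<in>F. T f w = a f \<odot> w}"
  have W: "csub W V"
   by (rule subspaceI) (use T in \<open>auto simp: W_def clin.add[OF T] clin.sm[OF T] clin.zero[OF T] sm_add_right mult.commute\<close>)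
  have hW: "T h w : W" if w: "w : W" for w
   unfolding W_def
  proof (intro CollectI conjI ballI)
   have wc: "w : carrier V" using w by (simp add: W_def)
   then show "T h w : carrier V" using clin.closed[OF T[OF insertI1]] by blast
   fix f assume f: "f : F"
   have "T f (T h w) = T h (T f w)" using insert.prems(2)[of f h w] f wc by blast
   also have "T f w = a f \<odot> w" using w f by (simp add: W_def)
   also have "T h (a f \<odot> w) = a f \<odot> T h w" by (rule clin.sm[OF T[OF insertI1] wc])
   finally show "T f (T h w) = a f \<odot> T h w" .
  qed
  have "x : vspan V {v : carrier V. \<exists>c. T h v = c \<odot> v}" using insert.prems(3)[of h] x by auto
  then obtain E v where v: "finite E" "!!mu. v mu : carrier V" "!!mu. T h (v mu) = mu \<odot> v mu" "x = (\<Oplus>mu\<in>E. v mu)"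
   using eigen_grouping[OF T[OF insertI1]] by blast
  have "v mu : W" if "mu : E" for mu
   by (rule stable_components[OF T[OF insertI1] W hW v(1)]) (use v(2,3) that x a in \<open>simp_all add: W_def v(4)[symmetric]\<close>)
  then have "v mu : ?S (insert h F)" if "mu : E" for mu using that v(2,3) by (auto simp: W_def)
  then have "v mu : vspan V (?S (insert h F))" if "mu : E" for mu using that span_incl[OF S] by blast
  then show "x : vspan V (?S (insert h F))" unfolding v(4) by (rule subspace_finsum[OF span_subspace[OF S]])
 qed
 then have "vspan V (?S F) <= vspan V (?S (insert h F))" by (rule span_least[OF span_subspace[OF S]])
 then show ?case unfolding IH by (rule subset_antisym[OF subspaceD(1)[OF span_subspace[OF S]]])
qed

end


section \<open>Current superalgebras of type I\<close>

lemma clinI: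
 assumes "cspace V" "cspace W" "!!x. x : carrier V ==> f x : carrier W"
  "!!x y. x : carrier V ==> y : carrier V ==> f (x \<oplus>\<^bsub>V\<^esub> y) = f x \<oplus>\<^bsub>W\<^esub> f y"
  "!!c x. x : carrier V ==> f (c \<odot>\<^bsub>V\<^esub> x) = c \<odot>\<^bsub>W\<^esub> f x"
 shows "clin V W f"
 using assms by (intro clin.intro clin_axioms.intro lin_mapI)

lemma linear_functional_clin: "cspace V ==> linear_functional V ph \<longleftrightarrow> clin V scalars ph"
 by (auto simp: linear_functional_def clin_def clin_axioms_def scalars_cspace LinearCombinations.module_hom_def)

text \<open>The hypothesis on \<open>ta\<close> has the form of \<open>plus_act\<close>; directness
  of the decomposition of W makes it the action of the component in L0. The module law survives
  because Lp is an ideal of W acting by zero.\<close>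

lemma (in graded_lsa) even_extension:
 assumes W: "direct_sum_decomp L W L0 Lp" and N: "cspace N"
  and \<sigma>: "!!h. h : L0 ==> clin N N (\<sigma> h)" "!!v. v : carrier N ==> clin (L\<lparr>carrier := L0\<rparr>) N (%h. \<sigma> h v)"
  and br: "!!h h' v. h : L0 ==> h' : L0 ==> v : carrier N ==>
   \<sigma> (bracket L h h') v = \<sigma> h (\<sigma> h' v) \<ominus>\<^bsub>N\<^esub> \<sigma> h' (\<sigma> h v)"
  and ta: "!!y. ta y = \<sigma> (THE y0. y0 : L0 & (\<exists>y1\<in>Lp. y = y0 \<oplus> y1))"
 shows "ind L W N ta" "h : L0 ==> ta h = \<sigma> h" "y : Lp ==> v : carrier N ==> ta y v = \<zero>\<^bsub>N\<^esub>"
proof -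
 interpret N: cspace N by fact
 note Ws = dsd_subspace[OF W] and Wm = dsd_mem[OF W]
 note Wc = subspaceD(2)[OF Ws]
 have tas: "ta (h \<oplus> y) = \<sigma> h" if "h : L0" "y : Lp" for h y
 proof -
  have "(THE y0. y0 : L0 & (\<exists>y1\<in>Lp. h \<oplus> y = y0 \<oplus> y1)) = h"
   by (rule the_equality) (use that dsd_unique(1)[OF W] in blast)+
  then show ?thesis using ta by simp
 qed
 have ta0: "ta h = \<sigma> h" if "h : L0" for h using tas[OF that Lp(3)] L0(2)[OF that] by simp
 have z: "\<sigma> \<zero> v = \<zero>\<^bsub>N\<^esub>" if "v : carrier N" for v using clin.zero[OF \<sigma>(2)[OF that]] by simp
 have ta1: "ta y v = \<zero>\<^bsub>N\<^esub>" if "y : Lp" "v : carrier N" for y v using tas[OF L0(3) that(1)] Lp(2)[OF that(1)] z[OF that(2)] by simp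
 show "h : L0 ==> ta h = \<sigma> h" by (rule ta0)
 show "y : Lp ==> v : carrier N ==> ta y v = \<zero>\<^bsub>N\<^esub>" by (rule ta1)
 have We: "x : L0" if "x : hpart L 0" for x using that even by simp
 \<comment> \<open>With x = h + y, comparing even and odd components in h + y = 0 + x gives y =
   x.\<close>
 have Wo: "x : Lp" if x: "x : hpart L 1" "x : W" for x
 proof -
  obtain h y where hy: "h : L0" "y : Lp" "x = h \<oplus> y" using dsd_obtain[OF W x(2)] by blast
  have eq: "h \<oplus> y = \<zero> \<oplus> x" using hy(3) hpart_closed[OF x(1)] by simp
  have "y = x" by (rule dsd_unique(2)[OF hpart_dsd _ _ _ _ eq]) (use hy(1,2) even L0(3) Lp_odd x(1) in simp_all)
  then show ?thesis using hy(2) by simp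
 qed
 have sW: "cspace (sub_super L W)" by (rule cspace_cong[OF _ _ _ _ subspace_cspace[OF Ws]]) simp_all
 have cases: "P" if "x : hpart L p" "y : hpart L q" "x : W" "y : W"
  "p = 0 ==> q = 0 ==> x : L0 ==> y : L0 ==> P" "p = 0 ==> q = 1 ==> x : L0 ==> y : Lp ==> P"
  "p = 1 ==> q = 0 ==> x : Lp ==> y : L0 ==> P" "p = 1 ==> q = 1 ==> x : Lp ==> y : Lp ==> P" for x y p q P
  using that We Wo by (cases p; cases q) auto
 have br_p0: "bracket L x y : Lp" if "x : Lp" "y : L0" for x y
  using br_antisym[OF Lp_odd[OF that(1)], of y 0] that even br_0p[OF that(2,1)] Lp(5) by simp
 have brW: "bracket L x y : W" if "x : hpart L p" "y : hpart L q" "x : W" "y : W" for x y p q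
  by (rule cases[OF that]) (use Wm br_00 br_0p br_p0 br_pp Lp(3) in auto)
 have \<sigma>c: "\<sigma> h v : carrier N" if "h : L0" "v : carrier N" for h v using clin.closed[OF \<sigma>(1)] that by blast
 have add: "ta (x \<oplus> y) v = ta x v \<oplus>\<^bsub>N\<^esub> ta y v" and sm: "ta (a \<odot> x) v = a \<odot>\<^bsub>N\<^esub> ta x v" and cl: "clin N N (ta x)"
  if x: "x : W" and y: "y : W" and v: "v : carrier N" for x y a v
 proof -
  obtain h s where hs: "h : L0" "s : Lp" "x = h \<oplus> s" using dsd_obtain[OF W x] by blast
  obtain h' s' where hs': "h' : L0" "s' : Lp" "y = h' \<oplus> s'" using dsd_obtain[OF W y] by blast
  note c = L0(2)[OF hs(1)] L0(2)[OF hs'(1)] Lp(2)[OF hs(2)] Lp(2)[OF hs'(2)]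
  have "x \<oplus> y = (h \<oplus> h') \<oplus> (s \<oplus> s')" using hs(3) hs'(3) c by (simp add: a_ac)
  then have "ta (x \<oplus> y) = \<sigma> (h \<oplus> h')" using tas[OF L0(4)[OF hs(1) hs'(1)] Lp(4)[OF hs(2) hs'(2)]] by simp
  then show "ta (x \<oplus> y) v = ta x v \<oplus>\<^bsub>N\<^esub> ta y v"
   using clin.add[OF \<sigma>(2)[OF v], of h h'] hs hs' tas by simp
  have "a \<odot> x = a \<odot> h \<oplus> a \<odot> s" using hs(3) c by (simp add: sm_add_right)
  then have "ta (a \<odot> x) = \<sigma> (a \<odot> h)" using tas[OF L0(5)[OF hs(1)] Lp(5)[OF hs(2)]] by simp
  then show "ta (a \<odot> x) v = a \<odot>\<^bsub>N\<^esub> ta x v" using clin.sm[OF \<sigma>(2)[OF v], of h a] hs tas by simp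
  show "clin N N (ta x)" using tas[OF hs(1,2)] \<sigma>(1)[OF hs(1)] hs(3) by simp
 qed
 have "envl_rep (sub_super L W) N ta"
 proof (intro envl_rep.intro envl_rep_axioms.intro envl.intro envl_axioms.intro sW N)
  show "clin (sub_super L W) N (%x. ta x v)" if "v : carrier N" for v
   by (rule clinI[OF sW N]) (use add sm clin.closed[OF cl] that in auto)
  show "clin N N (ta x)" if "x : carrier (sub_super L W)" for x using cl[of x x "\<zero>\<^bsub>N\<^esub>"] that by simp
  fix x y p q v assume "x : hpart (sub_super L W) p" "y : hpart (sub_super L W) q" and v: "v : carrier N"
  then have xy: "x : hpart L p" "y : hpart L q" "x : W" "y : W" by auto
  have tz: "ta x \<zero>\<^bsub>N\<^esub> = \<zero>\<^bsub>N\<^esub>" "ta y \<zero>\<^bsub>N\<^esub> = \<zero>\<^bsub>N\<^esub>" using clin.zero[OF cl] xy v by blast+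
  have tc: "ta x v : carrier N" "ta y v : carrier N" using clin.closed[OF cl] xy v by blast+
  have "\<zero>\<^bsub>N\<^esub> \<ominus>\<^bsub>N\<^esub> \<zero>\<^bsub>N\<^esub> = \<zero>\<^bsub>N\<^esub>" by simp
  then have zz: "a = b \<ominus>\<^bsub>N\<^esub> ssign p q \<odot>\<^bsub>N\<^esub> b'" if "a = \<zero>\<^bsub>N\<^esub>" "b = \<zero>\<^bsub>N\<^esub>" "b' = \<zero>\<^bsub>N\<^esub>" for a b b'
   using that by (simp only: N.sm_zero_right)
  show "ta (bracket (sub_super L W) x y) v = ta x (ta y v) \<ominus>\<^bsub>N\<^esub> ssign p q \<odot>\<^bsub>N\<^esub> ta y (ta x v)"
  proof (rule cases[OF xy])
   assume h: "p = 0" "q = 0" "x : L0" "y : L0"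
   then show ?thesis using br[OF h(3,4) v] ta0[OF h(3)] ta0[OF h(4)] ta0[OF br_00[OF h(3,4)]] \<sigma>c v by (simp add: ssign_def)
  next
   assume h: "p = 0" "q = 1" "x : L0" "y : Lp"
   show ?thesis by (rule zz) (use ta1[OF br_0p[OF h(3,4)] v] ta1[OF h(4)] tc v tz in simp_all)
  next
   assume h: "p = 1" "q = 0" "x : Lp" "y : L0"
   show ?thesis by (rule zz) (use ta1[OF br_p0[OF h(3,4)] v] ta1[OF h(3)] tc v tz in simp_all)
  next
   assume h: "p = 1" "q = 1" "x : Lp" "y : Lp"
   show ?thesis by (rule zz) (use br_pp[OF h(3,4)] ta0[OF L0(3)] z[OF v] ta1[OF h(3)] ta1[OF h(4)] v tz in simp_all)
  qed
 qed (use brW Wc in auto)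
 then show "ind L W N ta"
  by (intro ind.intro ind_axioms.intro envl.intro envl_axioms.intro cspace_axioms Ws) (auto intro: hpart_closed br_closed)
qed

locale type1 = lsa L for L :: "'g lie_super" (structure) and G :: "int => 'g set" +
 assumes grading: "type_I_grading L G"
begin

abbreviation "Z \<equiv> lie_center L (G 0)"
abbreviation "S \<equiv> derived_subalgebra L (G 0)"

lemma G_br: "x : G i ==> y : G j ==> bracket L x y : G (i + j)"
 and G_other: "i \<notin> {- 1, 0, 1} ==> G i = {\<zero>}"
 and G_even: "hpart L 0 = G 0" and G_odd: "direct_sum_decomp L (hpart L 1) (G (- 1)) (G 1)"
 and dec0: "direct_sum_decomp L (G 0) S Z"
 and irr: "irreducible_under L (bracket L) (G 0) (G (- 1))"
 using grading unfolding type_I_grading_def by blast+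

sublocale graded_lsa L "G (- 1)" "G 0" "G 1"
proof (intro graded_lsa.intro graded_lsa_axioms.intro lsa_axioms G_even G_odd)
 show "bracket L x y = \<zero>" if "x : G (- 1)" "y : G (- 1)" for x y using G_br[OF that] G_other[of "- 2"] by simp
 show "bracket L x y = \<zero>" if "x : G 1" "y : G 1" for x y using G_br[OF that] G_other[of 2] by simp
qed (use G_br[of _ 0 _ "- 1"] G_br[of _ 0 _ 1] in auto)

lemma plus_dsd: "direct_sum_decomp L (G 0 <+>\<^bsub>L\<^esub> G 1) (G 0) (G 1)"
 and total_dsd: "direct_sum_decomp L (carrier L) (G 0 <+>\<^bsub>L\<^esub> G 1) (G (- 1))"
proof -
 have P: "G 0 <+>\<^bsub>L\<^esub> G 1 = {a \<oplus> c | a c. a : G 0 & c : G 1}" by (auto simp: set_add_def')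
 show d: "direct_sum_decomp L (G 0 <+>\<^bsub>L\<^esub> G 1) (G 0) (G 1)"
  by (rule dsdI[OF L0_sub Lp_sub]) (use P dsdD(4)[OF hpart_dsd] even Lp_odd in auto)
 show "direct_sum_decomp L (carrier L) (G 0 <+>\<^bsub>L\<^esub> G 1) (G (- 1))"
 proof (rule dsdI[OF dsd_subspace[OF d] Lm_sub])
  fix u assume "u : carrier L"
  then obtain a b where ab: "a : G 0" "b : hpart L 1" "u = a \<oplus> b" using dsd_obtain[OF hpart_dsd] even by metis
  obtain m y where my: "m : G (- 1)" "y : G 1" "b = m \<oplus> y" using dsd_obtain[OF odd ab(2)] by blast
  have "u = (a \<oplus> y) \<oplus> m" using ab my L0(2) Lm(2) Lp(2) by (simp add: a_ac)
  then show "\<exists>a\<in>G 0 <+>\<^bsub>L\<^esub> G 1. \<exists>c\<in>G (- 1). u = a \<oplus> c" using dsd_mem(1)[OF d ab(1) my(2)] my(1) by blast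
 next
  fix x assume x: "x : G 0 <+>\<^bsub>L\<^esub> G 1" "x : G (- 1)"
  obtain h y where hy: "h : G 0" "y : G 1" "x = h \<oplus> y" using dsd_obtain[OF d x(1)] by blast
  have eq: "h \<oplus> y = \<zero> \<oplus> x" using hy(3) Lm(2)[OF x(2)] by simp
  have "y = x" by (rule dsd_unique(2)[OF hpart_dsd _ _ _ _ eq]) (use hy(1,2) even L0(3) Lp_odd Lm_odd x(2) in simp_all)
  then show "x = \<zero>" using dsdD(4)[OF odd] hy(2) x(2) by blast
 qed (use subspaceD(2)[OF dsd_subspace[OF d]] Lm(2) in auto)
qed

lemma ZS: "csub S L" "csub Z L" "S <= G 0" "Z <= G 0" "S <= carrier L" "Z <= carrier L"
 using dsdD(1,2)[OF dec0] dsd_mem(2,3)[OF dec0] L0(2) by auto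

lemma Z_central: "x : Z ==> y : G 0 ==> bracket L x y = \<zero>" "x : Z ==> y : G 0 ==> bracket L y x = \<zero>"
proof -
 show z: "x : Z ==> y : G 0 ==> bracket L x y = \<zero>" for x y by (auto simp: lie_center_def)
 show "x : Z ==> y : G 0 ==> bracket L y x = \<zero>"
  using br_antisym[of y 0 x 0] z[of x y] even ZS(4) by (auto simp: subset_iff)
qed

lemma bracket_S: "x : G 0 ==> y : G 0 ==> bracket L x y : S"
proof -
 have "{bracket L x y | x y. x : G 0 & y : G 0} <= carrier L" using L0(2) by auto
 then show "x : G 0 ==> y : G 0 ==> bracket L x y : S"
  unfolding derived_subalgebra_def bracket_span_def by (intro span_incl) auto
qed

theorem current_graded:
 assumes "algebra CC B"
 shows "graded_lsa (current L B) (current_sub L B (G (- 1))) (current_sub L B (G 0)) (current_sub L B (G 1))"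
proof -
 interpret C: clie_current L B by (intro clie_current.intro lsa_axioms assms)
 \<comment> \<open>The vanishing brackets of the grading become brackets with values in {0}[B],
   which is zero.\<close>
 have z: "current_sub L B {\<zero>} <= {\<zero>\<^bsub>current L B\<^esub>}"
 proof (rule C.current_sub_least[OF _ C.C.subspace_zero])
  show "ptn L B x b : {\<zero>\<^bsub>current L B\<^esub>}" if "x : {\<zero>}" "b : carrier B" for x b
   using C.pure_tensor_smult_left[of \<zero> b 0] that by (simp add: current_simps)
 qed simp
 note s = Lm(1) L0(1) Lp(1)
 show ?thesis
 proof (intro graded_lsa.intro graded_lsa_axioms.intro lsa.intro C.current_lie_superalgebra)
  show "hpart (current L B) 0 = current_sub L B (G 0)" using C.current_hpart even by simp
  show "direct_sum_decomp (current L B) (hpart (current L B) 1) (current_sub L B (G (- 1))) (current_sub L B (G 1))"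
   unfolding C.current_hpart by (rule C.current_sub_dsd[OF dsd_swap[OF hpart_dsd] odd])
  show "bracket (current L B) X Y = \<zero>\<^bsub>current L B\<^esub>"
   if "X : current_sub L B (G (- 1))" "Y : current_sub L B (G (- 1))" for X Y
   using C.current_sub_bracket[OF s(1) s(1) _ _ that, of "{\<zero>}"] br_mm z by auto
  show "bracket (current L B) X Y = \<zero>\<^bsub>current L B\<^esub>"
   if "X : current_sub L B (G 1)" "Y : current_sub L B (G 1)" for X Y
   using C.current_sub_bracket[OF s(3) s(3) _ _ that, of "{\<zero>}"] br_pp z by auto
  show "bracket (current L B) X Y : current_sub L B (G (- 1))"
   if "X : current_sub L B (G 0)" "Y : current_sub L B (G (- 1))" for X Y
   by (rule C.current_sub_bracket[OF s(2) s(1) s(1) br_0m that])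
  show "bracket (current L B) X Y : current_sub L B (G 1)"
   if "X : current_sub L B (G 0)" "Y : current_sub L B (G 1)" for X Y
   by (rule C.current_sub_bracket[OF s(2) s(3) s(3) br_0p that])
 qed
qed

end

text \<open>The vectors e_i \<otimes> b_j are numbered by q = i * d + j, so that i = q div d and j =
  q mod d. The dual functionals are products of those of S and B, extended to all of L \<otimes> B
  along the projection p onto S.\<close>

lemma (in clie_current) current_sub_basis:
 assumes S: "csub S L" and e: "cbasis (L\<lparr>carrier := S\<rparr>) {..<r} e c" and b: "cbasis B {..<d} b ph"
  and p: "clin L L p" "!!x. x : carrier L ==> p x : S" "!!x. x : S ==> p x = x"
 shows "\<exists>psx. cbasis (current L B\<lparr>carrier := current_sub L B S\<rparr>) {..<r * d :: nat}
  (%q. ptn L B (e (q div d)) (b (q mod d))) psx"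
proof -
 note SL = subspaceD(1)[OF S]
 have idx: "q div d < r" "q mod d < d" if "q < r * d" for q
  using that less_mult_imp_div_less[of q r d] by (auto intro!: mod_less_divisor gr0I)
 have ec: "e i : S" if "i < r" for i using e that by (auto simp: cbasis_def)
 have bc: "b j : carrier B" if "j < d" for j using b that by (auto simp: cbasis_def)
 have "linear_functional (L\<lparr>carrier := S\<rparr>) (c i)" if "i < r" for i using e that by (simp add: cbasis_def)
 note c = linear_functionalD[OF this, simplified]
 have "linear_functional B (ph j)" if "j < d" for j using b that by (simp add: cbasis_def)
 note ph = linear_functionalD[OF this]
 have "\<exists>g. clin (current L B) scalars g & (\<forall>x\<in>carrier L. \<forall>y\<in>carrier B. g (ptn L B x y) = c (q div d) (p x) * ph (q mod d) y)"
  if q: "q < r * d" for q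
 proof -
  have "bilinear_map L B scalars (%x y. c (q div d) (p x) * ph (q mod d) y)"
   by (intro bilinear_mapI clinI cspace_axioms B.cspace_axioms scalars_cspace)
    (use c[OF idx(1)[OF q]] ph[OF idx(2)[OF q]] p(2) clin.add[OF p(1)] clin.sm[OF p(1)] in \<open>simp_all add: algebra_simps\<close>)
  then show ?thesis
   unfolding clin_tensor_current[symmetric] by (rule tensor_lift[OF scalars_cspace]) blast
 qed
 then obtain g where g: "!!q. q < r * d ==> clin (current L B) scalars (g q)"
  "!!q x y. q < r * d ==> x : carrier L ==> y : carrier B ==> g q (ptn L B x y) = c (q div d) (p x) * ph (q mod d) y"
  by metis
 let ?E = "%q. ptn L B (e (q div d)) (b (q mod d))"
 have E: "?E q : current_sub L B S" if "q < r * d" for q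
  using current_sub_pure[OF SL ec bc] idx[OF that] by blast
 note sub = current_sub_subspace[OF SL]
 have ES: "?E ` {..<r * d} <= current_sub L B S" using E by auto
 have EC: "?E ` {..<r * d} <= carrier (current L B)" using ES C.subspaceD(1)[OF sub] by blast
 note sp = C.span_subspace[OF EC]
 have "current_sub L B S <= vspan (current L B) (?E ` {..<r * d})"
 proof (rule current_sub_least[OF SL sp])
  fix x y assume x: "x : S" and y: "y : carrier B"
  have pl: "clin L (current L B) (%x. ptn L B x y')" if "y' : carrier B" for y'
   using bilinear_mapD(2)[OF cspace_axioms B.cspace_axioms T.cspace_axioms pure_tensor_bilinear that]
   unfolding clin_tensor_current' .
  have pr: "clin B (current L B) (ptn L B x')" if "x' : carrier L" for x'
   using bilinear_mapD(1)[OF cspace_axioms B.cspace_axioms T.cspace_axioms pure_tensor_bilinear that]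
   unfolding clin_tensor_current' .
  have xs: "x : vspan L (e ` {..<r})"
   using e x span_restrict[OF S, of "e ` {..<r}"] ec by (auto simp: cbasis_def)
  have ys: "y : vspan B (b ` {..<d})" using b y by (auto simp: cbasis_def)
  have "ptn L B (e i) (b j) : vspan (current L B) (?E ` {..<r * d})" if "i < r" "j < d" for i j
  proof (rule C.span_incl[OF EC], rule image_eqI)
   show "ptn L B (e i) (b j) = ?E (i * d + j)" using that by simp
   have "i * d + j < i * d + d" using that by simp
   also have "... \<le> r * d" using that mult_le_mono1[of "Suc i" r d] by simp
   finally show "i * d + j : {..<r * d}" by simp
  qed
  then have "ptn L B (e i) y : vspan (current L B) (?E ` {..<r * d})" if "i < r" for i
   using clin.span_into[OF pr[of "e i"] _ sp _ ys] ec[OF that] SL bc that by auto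
  then show "ptn L B x y : vspan (current L B) (?E ` {..<r * d})"
   using clin.span_into[OF pl[OF y] _ sp _ xs] ec SL by auto
 qed
 then have "vspan (current L B\<lparr>carrier := current_sub L B S\<rparr>) (?E ` {..<r * d}) = current_sub L B S"
  using C.span_restrict[OF sub ES] C.span_least[OF sub ES] by simp
 moreover have "g q (?E q') = (if q = q' then 1 else 0)" if q: "q < r * d" "q' < r * d" for q q'
 proof -
  have "g q (?E q') = c (q div d) (e (q' div d)) * ph (q mod d) (b (q' mod d))"
   using g(2)[OF q(1), of "e (q' div d)" "b (q' mod d)"] ec[OF idx(1)[OF q(2)]] bc[OF idx(2)[OF q(2)]] p(3) SL by auto
  also have "... = (if q div d = q' div d then 1 else 0) * (if q mod d = q' mod d then 1 else 0)"
   using e b idx[OF q(1)] idx[OF q(2)] by (simp add: cbasis_def)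
  also have "... = (if q = q' then 1 else 0)"
   using div_mult_mod_eq[of q d] div_mult_mod_eq[of q' d] by (cases "q = q'") (simp, metis mult_zero_left mult_zero_right)
  finally show ?thesis .
 qed
 moreover have "linear_functional (current L B\<lparr>carrier := current_sub L B S\<rparr>) (g q)" if "q < r * d" for q
  using clin.add[OF g(1)[OF that]] clin.sm[OF g(1)[OF that]] C.subspaceD(2)[OF sub] by (simp add: linear_functional_def)
 ultimately have "cbasis (current L B\<lparr>carrier := current_sub L B S\<rparr>) {..<r * d} ?E g"
  using ES by (simp add: cbasis_def)
 then show ?thesis by blast
qed

text \<open>cx a is the one scalar congruent to a modulo I. Uniqueness, due to I containing no
  nonzero multiple of the unit, gives linearity and multiplicativity. Thus cx is the quotient map to
  A/I followed by its identification with the complex numbers.\<close>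

theorem (in calg) ex_character:
 assumes gen: "generates S" and m: "maximalideal I A"
 obtains cx where "linear_functional A cx" "!!a b. a : carrier A ==> b : carrier A ==> cx (a \<otimes> b) = cx a * cx b"
  "cx \<one> = 1" "!!a. a : I ==> cx a = 0" "!!a. a : carrier A ==> a \<ominus> cx a \<odot> \<one> : I"
proof -
 interpret maximalideal I A by fact
 note sub = ideal_subspace[OF is_ideal]
 obtain cx where cx: "!!a. a : carrier A ==> a \<ominus> cx a \<odot> \<one> : I" using nullstellensatz[OF gen m] by metis
 have z: "c = 0" if "c \<odot> \<one> : I" for c
 proof (rule ccontr)
  assume "c ~= 0"
  then have "\<one> : I" using subspaceD(5)[OF sub that, of "inverse c"] by simp
  then show False using I_notcarr one_imp_carrier by blast
 qed
 have u: "cx a = c" if a: "a : carrier A" "a \<ominus> c \<odot> \<one> : I" for a c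
 proof -
  have "(cx a - c) \<odot> \<one> = (a \<ominus> c \<odot> \<one>) \<ominus> (a \<ominus> cx a \<odot> \<one>)"
  proof -
   have "(a \<ominus> c \<odot> \<one>) \<ominus> (a \<ominus> cx a \<odot> \<one>) = (a \<oplus> (- 1) \<odot> a) \<oplus> ((- c) \<odot> \<one> \<oplus> cx a \<odot> \<one>)"
    using a(1) by (simp add: minus_sm sm_add_right al.a_ac)
   also have "a \<oplus> (- 1) \<odot> a = \<zero>" using sm_add_left[OF a(1), of 1 "- 1"] a(1) by simp
   finally show ?thesis using sm_add_left[of \<one> "- c" "cx a"] by simp
  qed
  then have "(cx a - c) \<odot> \<one> : I" using subspace_minus[OF sub a(2) cx[OF a(1)]] by simp
  from z[OF this] show ?thesis by simp
 qed
 have add: "cx (a \<oplus> b) = cx a + cx b" if "a : carrier A" "b : carrier A" for a b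
 proof (rule u)
  have "a \<oplus> b \<ominus> (cx a + cx b) \<odot> \<one> = (a \<ominus> cx a \<odot> \<one>) \<oplus> (b \<ominus> cx b \<odot> \<one>)"
   using that by (simp add: minus_sm sm_add_right sm_add_left al.a_ac)
  then show "a \<oplus> b \<ominus> (cx a + cx b) \<odot> \<one> : I" using subspaceD(4)[OF sub cx[OF that(1)] cx[OF that(2)]] by simp
 qed (use that in simp)
 have sm: "cx (c \<odot> a) = c * cx a" if "a : carrier A" for a c
 proof (rule u)
  have "c \<odot> a \<ominus> (c * cx a) \<odot> \<one> = c \<odot> (a \<ominus> cx a \<odot> \<one>)" using that by (simp add: sm_minus_right)
  then show "c \<odot> a \<ominus> (c * cx a) \<odot> \<one> : I" using subspaceD(5)[OF sub cx[OF that]] by simp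
 qed (use that in simp)
 have I0: "cx a = 0" if "a : I" for a by (rule u) (use that Icarr minus_sm in auto)
 have mult: "cx (a \<otimes> b) = cx a * cx b" if "a : carrier A" "b : carrier A" for a b
 proof -
  have c: "a \<ominus> cx a \<odot> \<one> : carrier A" using that by simp
  have "a = (a \<ominus> cx a \<odot> \<one>) \<oplus> cx a \<odot> \<one>" using minus_eq_iff[of a "cx a \<odot> \<one>" "a \<ominus> cx a \<odot> \<one>"] that by simp
  then have "a \<otimes> b = ((a \<ominus> cx a \<odot> \<one>) \<oplus> cx a \<odot> \<one>) \<otimes> b" by simp
  also have "... = (a \<ominus> cx a \<odot> \<one>) \<otimes> b \<oplus> cx a \<odot> b" using that c by (simp add: al.l_distr mult_smult)
  finally show ?thesis using I0[OF I_r_closed[OF cx[OF that(1)] that(2)]] add sm that c by simp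
 qed
 have "cx \<one> = 1" by (rule u) (use al.r_neg subspaceD(3)[OF sub] in \<open>simp_all add: al.minus_eq\<close>)
 then show ?thesis using that[of cx] add sm mult I0 cx by (simp add: linear_functional_def)
qed


section \<open>The modules obtained from evaluation and a central functional\<close>

lemma (in lsa) current_proj:
 assumes A: "algebra CC A" and I: "ideal I A"
 shows current_proj_clin: "clin (current L A) (current L (quot A I)) (current_proj L A I)"
  and current_proj_pure: "x : carrier L ==> a : carrier A ==>
   current_proj L A I (ptn L A x a) = ptn L (quot A I) x (I +>\<^bsub>A\<^esub> a)"
proof -
 interpret a: calg A by (intro calg.intro A)
 interpret T: clie_current L A by (intro clie_current.intro lsa_axioms A)
 interpret T': clie_current L "quot A I" by (intro clie_current.intro lsa_axioms a.quot_algebra I)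
 note sub = a.ideal_subspace[OF I]
 let ?ph = "%(x, a). (x, I +>\<^bsub>A\<^esub> a)"
 let ?F = "%f. T'.cls (lin_ext ?ph f)"
 have F: "clin T.FS (tensor L (quot A I)) ?F"
  by (rule clin_comp[OF lin_ext_clin T'.cls_clin]) (auto intro: a.quot_closed[OF sub])
 have b: "bilinear_map L A (tensor L (quot A I)) (%x a. ptn L (quot A I) x (I +>\<^bsub>A\<^esub> a))"
 proof (intro bilinear_mapI cspace_axioms a.cspace_axioms T'.T.cspace_axioms)
  note pt = bilinear_mapD[OF cspace_axioms T'.B.cspace_axioms T'.T.cspace_axioms T'.pure_tensor_bilinear]
  show "clin A (tensor L (quot A I)) (%a. ptn L (quot A I) x (I +>\<^bsub>A\<^esub> a))" if "x : carrier L" for x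
   by (rule clin_comp[OF a.quot_proj_clin[OF sub] pt(1)[OF that]])
  show "clin L (tensor L (quot A I)) (%x. ptn L (quot A I) x (I +>\<^bsub>A\<^esub> a))" if "a : carrier A" for a
   by (rule pt(2)[OF a.quot_closed[OF sub that]])
 qed
 have null: "?F n = \<zero>\<^bsub>tensor L (quot A I)\<^esub>" if "n : tensor_null L A" for n
  by (rule T.kills_tensor_null[OF F b _ that]) (simp add: pure_tensor_def)
 have "\<exists>h. clin (tensor L A) (tensor L (quot A I)) h & (\<forall>f\<in>carrier T.FS. h (T.cls f) = ?F f)"
  unfolding tensor_def[of L A] by (rule T.F.quot_lift[OF T.tensor_null_subspace F null]) blast+
 then obtain h where h: "clin (tensor L A) (tensor L (quot A I)) h" "!!f. f : carrier T.FS ==> h (T.cls f) = ?F f" by blast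
 have cp: "current_proj L A I (T.cls f) = h (T.cls f)" if f: "f : carrier T.FS" for f
  unfolding current_proj_def h(2)[OF f]
 proof (rule T.F.coset_UN[OF T.tensor_null_subspace f])
  fix g assume g: "g : carrier T.FS" "g \<ominus>\<^bsub>T.FS\<^esub> f : tensor_null L A"
  have "T.cls g = T.cls f" using T.F.coset_eq_iff[OF T.tensor_null_subspace g(1) f] g(2) by blast
  then show "?F g = ?F f" using h(2)[OF g(1)] h(2)[OF f] by simp
 qed
 have "clin (tensor L A) (tensor L (quot A I)) (current_proj L A I)"
  by (rule clin_cong[OF h(1)]) (use cp in \<open>auto simp: T.tensor_carrier\<close>)
 then show "clin (current L A) (current L (quot A I)) (current_proj L A I)"
  unfolding T.clin_tensor_current T'.clin_tensor_current' .
 show "current_proj L A I (ptn L A x a) = ptn L (quot A I) x (I +>\<^bsub>A\<^esub> a)" if "x : carrier L" "a : carrier A"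
  using cp[of "sgl (x, a) 1"] h(2)[of "sgl (x, a) 1"] that by (simp add: pure_tensor_def)
qed

text \<open>cx stands for the map from A to A/\<mm>, identified with the complex numbers; k may be
  any ideal inside \<mm> such that \<Theta> vanishes on Z \<otimes> k.\<close>

locale boxmod = type1 L G + A: calg A for L :: "'g lie_super" (structure) and G and A :: "(complex, 'a) module" +
 fixes \<mm> k :: "'a set" and cx :: "'a => complex" and \<Theta> :: "('g \<times> 'a \<Rightarrow>\<^sub>0 complex) set => complex"
  and V :: "(complex, 'v) module" and \<rho> :: "'g => 'v => 'v"
 assumes k: "ideal k A" and m: "maximalideal \<mm> A" and km: "k <= \<mm>"
  and cx_lin: "linear_functional A cx"
  and cx_mult: "a : carrier A ==> b : carrier A ==> cx (a \<otimes>\<^bsub>A\<^esub> b) = cx a * cx b"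
  and cx_one: "cx \<one>\<^bsub>A\<^esub> = 1" and cx_m: "a : \<mm> ==> cx a = 0"
  and cx_diff: "a : carrier A ==> a \<ominus>\<^bsub>A\<^esub> cx a \<odot>\<^bsub>A\<^esub> \<one>\<^bsub>A\<^esub> : \<mm>"
  and \<Theta>: "\<Theta> : dual_space (current L A) (current_sub L A Z)"
  and \<Theta>k: "x : Z ==> a : k ==> \<Theta> (ptn L A x a) = 0"
  and V: "lie_module L S V \<rho>"
begin

abbreviation "B \<equiv> quot A k"
abbreviation "bq \<equiv> box_act_quot L G A \<mm> k \<Theta> V \<rho>"

lemma alg: "algebra CC A" by (rule A.al.algebra_axioms)

lemma algB: "algebra CC B" by (rule A.quot_algebra[OF k])

sublocale CA: clie_current L A by (intro clie_current.intro lsa_axioms alg)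
sublocale CB: clie_current L B by (intro clie_current.intro lsa_axioms algB)
sublocale N: cspace V using V by (intro cspace.intro) (simp add: lie_module_def)

lemma m_ideal: "ideal \<mm> A" using m by (rule maximalideal.axioms(1))

lemma \<rho>_clin: "x : S ==> clin V V (\<rho> x)" "v : carrier V ==> clin (L\<lparr>carrier := S\<rparr>) V (%x. \<rho> x v)"
proof -
 have "bilinear_map (L\<lparr>carrier := S\<rparr>) V V \<rho>" using V by (simp add: lie_module_def)
 note b = bilinear_mapD[OF subspace_cspace[OF ZS(1)] N.cspace_axioms N.cspace_axioms this]
 show "x : S ==> clin V V (\<rho> x)" using b(1) by simp
 show "v : carrier V ==> clin (L\<lparr>carrier := S\<rparr>) V (%x. \<rho> x v)" using b(2) by simp
qed

lemma \<rho>_bracket: "x : S ==> y : S ==> v : carrier V ==> \<rho> (bracket L x y) v = \<rho> x (\<rho> y v) \<ominus>\<^bsub>V\<^esub> \<rho> y (\<rho> x v)"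
 using V by (simp add: lie_module_def)

text \<open>Well defined because cx vanishes on \<mm> and hence on I. It is used for I = k, to
  compute in L[B], and for I = \<mm>, to invert the map from x to x \<otimes> 1.\<close>

lemma evaluation:
 assumes I: "ideal I A" "I <= \<mm>"
 shows "\<exists>eps. clin (current L (quot A I)) L eps &
  (\<forall>x\<in>carrier L. \<forall>a\<in>carrier A. eps (ptn L (quot A I) x (I +>\<^bsub>A\<^esub> a)) = cx a \<odot> x)"
proof -
 note sub = A.ideal_subspace[OF I(1)]
 interpret T: clie_current L "quot A I" by (intro clie_current.intro lsa_axioms A.quot_algebra I)
 have "clin A scalars cx" using cx_lin linear_functional_clin[OF A.cspace_axioms] by blast
 then have "\<exists>g. clin (quot A I) scalars g & (\<forall>a\<in>carrier A. g (I +>\<^bsub>A\<^esub> a) = cx a)"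
  by (rule A.quot_lift[OF sub]) (use cx_m I(2) in auto)
 then obtain g where g: "clin (quot A I) scalars g" "!!a. a : carrier A ==> g (I +>\<^bsub>A\<^esub> a) = cx a" by blast
 have "bilinear_map L (quot A I) L (%x X. g X \<odot> x)"
  by (intro bilinear_mapI clinI cspace_axioms T.B.cspace_axioms)
   (use clin.add[OF g(1)] clin.sm[OF g(1)] in \<open>simp_all add: sm_add_left sm_add_right mult.commute\<close>)
 then have "\<exists>eps. clin (tensor L (quot A I)) L eps &
   (\<forall>x\<in>carrier L. \<forall>X\<in>carrier (quot A I). eps (ptn L (quot A I) x X) = g X \<odot> x)"
  by (rule T.tensor_lift[OF cspace_axioms]) blast
 then obtain eps where "clin (tensor L (quot A I)) L eps"
  "!!x X. x : carrier L ==> X : carrier (quot A I) ==> eps (ptn L (quot A I) x X) = g X \<odot> x" by blast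
 then show ?thesis unfolding T.clin_tensor_current
  by (intro exI[of _ eps] conjI ballI) (simp_all add: g(2) A.quot_closed[OF sub])
qed

text \<open>\<Theta> descends to B because it kills Z \<otimes> k. Composition with a projection of
  L onto Z extends it to all of L[B], so that it is available as an ordinary linear map.\<close>

lemma central_functional:
 assumes pZ: "clin L L pZ" "!!x. x : carrier L ==> pZ x : Z"
 shows "\<exists>t. clin (current L B) scalars t &
  (\<forall>x\<in>carrier L. \<forall>a\<in>carrier A. t (ptn L B x (k +>\<^bsub>A\<^esub> a)) = \<Theta> (ptn L A (pZ x) a))"
proof -
 note sub = A.ideal_subspace[OF k]
 have tl1: "\<Theta> (X \<oplus>\<^bsub>current L A\<^esub> Y) = \<Theta> X + \<Theta> Y" if "X : current_sub L A Z" "Y : current_sub L A Z" for X Y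
  using \<Theta> that by (auto simp: dual_space_def)
 have tl2: "\<Theta> (c \<odot>\<^bsub>current L A\<^esub> X) = c * \<Theta> X" if "X : current_sub L A Z" for X c
  using \<Theta> that by (auto simp: dual_space_def)
 note tl = tl1 tl2
 have pz: "ptn L A (pZ x) a : current_sub L A Z" "pZ x : carrier L" if "x : carrier L" "a : carrier A" for x a
  using CA.current_sub_pure[OF ZS(6) pZ(2)] that clin.closed[OF pZ(1)] by auto
 have "\<exists>g. clin B scalars g & (\<forall>a\<in>carrier A. g (k +>\<^bsub>A\<^esub> a) = \<Theta> (ptn L A (pZ x) a))" if x: "x : carrier L" for x
 proof -
  have "clin A scalars (%a. \<Theta> (ptn L A (pZ x) a))"
   by (rule clinI[OF A.cspace_axioms scalars_cspace])
    (use x pz[OF x] tl[unfolded current_simps] in \<open>simp_all add: CA.pure_tensor_add_right CA.pure_tensor_smult_right\<close>)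
  then show ?thesis by (rule A.quot_lift[OF sub]) (use \<Theta>k pZ(2)[OF x] in auto)
 qed
 then obtain \<theta> where \<theta>: "!!x. x : carrier L ==> clin B scalars (\<theta> x)"
  "!!x a. x : carrier L ==> a : carrier A ==> \<theta> x (k +>\<^bsub>A\<^esub> a) = \<Theta> (ptn L A (pZ x) a)" by metis
 have "bilinear_map L B scalars \<theta>"
 proof (intro bilinear_mapI cspace_axioms CB.B.cspace_axioms scalars_cspace \<theta>(1))
  fix X assume "X : carrier B"
  then obtain a where a: "a : carrier A" "X = k +>\<^bsub>A\<^esub> a" by (rule A.quot_carrierE[OF sub])
  show "clin L scalars (%x. \<theta> x X)"
   by (rule clinI[OF cspace_axioms scalars_cspace])
    (use a pz[OF _ a(1)] tl[unfolded current_simps] clin.add[OF pZ(1)] clin.sm[OF pZ(1)] in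
     \<open>simp_all add: \<theta>(2) CA.pure_tensor_add_left CA.pure_tensor_smult_left\<close>)
 qed
 then have "\<exists>t. clin (tensor L B) scalars t & (\<forall>x\<in>carrier L. \<forall>X\<in>carrier B. t (ptn L B x X) = \<theta> x X)"
  by (rule CB.tensor_lift[OF scalars_cspace]) blast
 then obtain t where "clin (tensor L B) scalars t" "!!x X. x : carrier L ==> X : carrier B ==> t (ptn L B x X) = \<theta> x X" by blast
 then show ?thesis unfolding CB.clin_tensor_current
  by (intro exI[of _ t] conjI ballI) (simp_all add: \<theta>(2) A.quot_closed[OF sub])
qed

text \<open>The nested descriptions in the definitions collapse to one formula: Y acts as the scalar
  t Y plus \<rho> of s Y, with t coming from \<Theta> and s from evaluation followed by projection
  to S. The bracket law follows because brackets of elements of g_0[B] lie in S[B], where t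
  vanishes, while s preserves brackets.\<close>

theorem box_action:
 shows box_clin: "Y : current_sub L B (G 0) ==> clin V V (bq Y)"
  and box_clin_left: "v : carrier V ==> clin (current L B\<lparr>carrier := current_sub L B (G 0)\<rparr>) V (%Y. bq Y v)"
  and box_bracket: "Y : current_sub L B (G 0) ==> Y' : current_sub L B (G 0) ==> v : carrier V ==>
   bq (bracket (current L B) Y Y') v = bq Y (bq Y' v) \<ominus>\<^bsub>V\<^esub> bq Y' (bq Y v)"
  and box_const: "h : G 0 ==> v : carrier V ==> box_act_const L G A \<mm> \<Theta> V \<rho> h v = bq (ptn L B h \<one>\<^bsub>B\<^esub>) v"
proof -
 note sub = A.ideal_subspace[OF k]
 note e0 = hpart_dsd[unfolded even]
 obtain pS where pS: "clin L L pS" "!!x. x : carrier L ==> pS x : S" "!!x. x : S ==> pS x = x" "!!x. x : Z ==> pS x = \<zero>"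
  by (rule dsd_proj_total[OF e0 dec0]) (rule that, assumption+)
 obtain pZ where pZ: "clin L L pZ" "!!x. x : carrier L ==> pZ x : Z" "!!x. x : Z ==> pZ x = x" "!!x. x : S ==> pZ x = \<zero>"
  by (rule dsd_proj_total[OF e0 dsd_swap[OF dec0]]) (rule that, assumption+)
 obtain eps where eps: "clin (current L B) L eps"
  "!!x a. x : carrier L ==> a : carrier A ==> eps (ptn L B x (k +>\<^bsub>A\<^esub> a)) = cx a \<odot> x"
  using evaluation[OF k km] by blast
 obtain et where et: "clin (current L (quot A \<mm>)) L et"
  "!!x a. x : carrier L ==> a : carrier A ==> et (ptn L (quot A \<mm>) x (\<mm> +>\<^bsub>A\<^esub> a)) = cx a \<odot> x"
  using evaluation[OF m_ideal subset_refl] by blast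
 obtain t where t: "clin (current L B) scalars t"
  "!!x a. x : carrier L ==> a : carrier A ==> t (ptn L B x (k +>\<^bsub>A\<^esub> a)) = \<Theta> (ptn L A (pZ x) a)"
  using central_functional[OF pZ(1,2)] by blast
 define pr where "pr = current_proj L A k"
 note prc = current_proj_clin[OF alg k, folded pr_def] and prp = current_proj_pure[OF alg k, folded pr_def]
 note pmc = current_proj_clin[OF alg m_ideal] and pmp = current_proj_pure[OF alg m_ideal]
 interpret CM: clie_current L "quot A \<mm>" by (intro clie_current.intro lsa_axioms A.quot_algebra m_ideal)
 have tl1: "\<Theta> (X \<oplus>\<^bsub>current L A\<^esub> Y) = \<Theta> X + \<Theta> Y" if "X : current_sub L A Z" "Y : current_sub L A Z" for X Y
  using \<Theta> that by (auto simp: dual_space_def)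
 have tl2: "\<Theta> (c \<odot>\<^bsub>current L A\<^esub> X) = c * \<Theta> X" if "X : current_sub L A Z" for X c
  using \<Theta> that by (auto simp: dual_space_def)
 note tl = tl1 tl2
 have t_S: "t Y = 0" if "Y : current_sub L B S" for Y
 proof -
  have "current_sub L B S <= {Y : carrier (current L B). t Y : {\<zero>\<^bsub>scalars\<^esub>}}"
  proof (rule CB.current_sub_least[OF ZS(5) clin.subspace_vimage[OF t(1) cspace.subspace_zero[OF scalars_cspace]]])
   fix x X assume x: "x : S" and X: "X : carrier B"
   obtain a where a: "a : carrier A" "X = k +>\<^bsub>A\<^esub> a" by (rule A.quot_carrierE[OF sub X])
   have xc: "x : carrier L" using x ZS(5) by blast
   have z0: "\<zero> : Z" using subspaceD(3)[OF ZS(2)] .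
   have "\<Theta> (ptn L A \<zero> a) = 0"
    using tl(2)[OF CA.current_sub_pure[OF ZS(6) z0 a(1)], of 0]
     CA.pure_tensor_smult_left[of \<zero> a 0] a(1) by (simp add: current_simps)
   then show "ptn L B x X : {Y : carrier (current L B). t Y : {\<zero>\<^bsub>scalars\<^esub>}}"
    using t(2)[OF xc a(1)] pZ(4)[OF x] xc X a by (simp add: current_simps)
  qed
  then show ?thesis using that by auto
 qed
 have t_Z: "t (pr s) = \<Theta> s" if "s : current_sub L A Z" for s
 proof -
  note Zs = CA.C.subspaceD[OF CA.current_sub_subspace[OF ZS(6)]]
  have "current_sub L A Z <= {s : current_sub L A Z. t (pr s) = \<Theta> s}"
  proof (rule CA.current_sub_least[OF ZS(6)])
   show "csub {s : current_sub L A Z. t (pr s) = \<Theta> s} (current L A)"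
    by (rule CA.C.subspaceI)
     (use Zs tl(1) tl(2)[OF Zs(3), of 0] tl(2) clin.add[OF prc] clin.sm[OF prc] clin.zero[OF prc] clin.add[OF t(1)] clin.sm[OF t(1)] clin.zero[OF t(1)]
      clin.closed[OF prc] in auto)
   show "ptn L A x a : {s : current_sub L A Z. t (pr s) = \<Theta> s}" if "x : Z" "a : carrier A" for x a
    using that CA.current_sub_pure[OF ZS(6) that] prp t(2) pZ(3) ZS(6) by auto
  qed
  then show ?thesis using that by blast
 qed
 have eps_sub: "eps (pr X) : U" if "X : current_sub L A U" "csub U L" for X U
 proof -
  note Us = subspaceD[OF that(2)]
  have "current_sub L A U <= {X : carrier (current L A). eps (pr X) : U}"
   by (rule CA.current_sub_least[OF Us(1) clin.subspace_vimage[OF clin_comp[OF prc eps(1)] that(2)]])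
    (use prp eps(2) Us in \<open>auto simp: current_simps\<close>)
  then show ?thesis using that(1) by blast
 qed
 \<comment> \<open>\<open>eval_max\<close> is defined through A/\<mm>, but the formula on g_0[B]
   needs evaluation through B; both send x \<otimes> a to cx(a) x.\<close>
 have em: "eval_max L A \<mm> S X = eps (pr X)" if X: "X : current_sub L A S" for X
  unfolding eval_max_def
 proof (rule the_equality)
  have XC: "X : carrier (current L A)" by (rule CA.current_sub_closed[OF ZS(5) X])
  note pl = bilinear_mapD(2)[OF cspace_axioms CM.B.cspace_axioms CM.T.cspace_axioms CM.pure_tensor_bilinear CM.al.one_closed,
   unfolded CM.clin_tensor_current']
  have "ptn L (quot A \<mm>) (eps (pr X)) \<one>\<^bsub>quot A \<mm>\<^esub> = current_proj L A \<mm> X"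
  proof (rule clin_eq_on_span[OF clin_comp[OF clin_comp[OF prc eps(1)] pl] pmc CA.pures_closed[OF subset_refl]])
   show "X : vspan (current L A) {ptn L A x b | x b. x : carrier L & b : carrier A}"
    using XC CA.current_sub_carrier unfolding current_sub_def by blast
   fix Y assume "Y : {ptn L A x b | x b. x : carrier L & b : carrier A}"
   then obtain x a where Y: "Y = ptn L A x a" "x : carrier L" "a : carrier A" by blast
   note ms = A.ideal_subspace[OF m_ideal]
   have "\<mm> +>\<^bsub>A\<^esub> a = \<mm> +>\<^bsub>A\<^esub> (cx a \<odot>\<^bsub>A\<^esub> \<one>\<^bsub>A\<^esub>)" using A.coset_eq_iff[OF ms] cx_diff[OF Y(3)] Y(3) by simp
   also have "... = cx a \<odot>\<^bsub>quot A \<mm>\<^esub> \<one>\<^bsub>quot A \<mm>\<^esub>" using A.quot_smult[OF ms, of "\<one>\<^bsub>A\<^esub>" "cx a"] by (simp add: A.quot_one)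
   finally have "current_proj L A \<mm> Y = cx a \<odot>\<^bsub>tensor L (quot A \<mm>)\<^esub> ptn L (quot A \<mm>) x \<one>\<^bsub>quot A \<mm>\<^esub>"
    using pmp Y CM.pure_tensor_smult_right by simp
   then show "ptn L (quot A \<mm>) (eps (pr Y)) \<one>\<^bsub>quot A \<mm>\<^esub> = current_proj L A \<mm> Y"
    using prp eps(2) Y CM.pure_tensor_smult_left by simp
  qed
  then show "eps (pr X) : S & ptn L (quot A \<mm>) (eps (pr X)) \<one>\<^bsub>quot A \<mm>\<^esub> = current_proj L A \<mm> X"
   using eps_sub[OF X ZS(1)] by blast
  fix x assume x: "x : S & ptn L (quot A \<mm>) x \<one>\<^bsub>quot A \<mm>\<^esub> = current_proj L A \<mm> X"
  \<comment> \<open>\<open>et\<close> is a left inverse of the map from x to x \<otimes> 1, which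
    gives the uniqueness behind the description.\<close>
  have "x = et (current_proj L A \<mm> X)" if "x : S & ptn L (quot A \<mm>) x \<one>\<^bsub>quot A \<mm>\<^esub> = current_proj L A \<mm> X" for x
   using that et(2)[of x "\<one>\<^bsub>A\<^esub>"] ZS(5) cx_one by (auto simp: A.quot_one)
  then show "x = eps (pr X)"
   using x \<open>eps (pr X) : S & ptn L (quot A \<mm>) (eps (pr X)) \<one>\<^bsub>quot A \<mm>\<^esub> = current_proj L A \<mm> X\<close> by metis
 qed
 define s where "s Y = pS (eps Y)" for Y
 have s_clin: "clin (current L B) L s" unfolding s_def by (rule clin_comp[OF eps(1) pS(1)])
 have sS: "s Y : S" if "Y : carrier (current L B)" for Y unfolding s_def using pS(2) clin.closed[OF eps(1) that] .
 define \<sigma> where "\<sigma> Y v = t Y \<odot>\<^bsub>V\<^esub> v \<oplus>\<^bsub>V\<^esub> \<rho> (s Y) v" for Y v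
 have box: "box_act L G A \<mm> \<Theta> V \<rho> y v = \<sigma> (pr y) v" if y: "y : current_sub L A (G 0)" and v: "v : carrier V" for y v
 proof -
  note d = CA.current_sub_dsd[OF e0 dsd_swap[OF dec0]]
  obtain z w where zw: "z : current_sub L A Z" "w : current_sub L A S" "y = z \<oplus>\<^bsub>current L A\<^esub> w"
   using CA.C.dsd_obtain[OF d y] by blast
  have the: "(THE (s, t). s : current_sub L A Z & t : current_sub L A S & y = s \<oplus>\<^bsub>current L A\<^esub> t) = (z, w)"
  proof (rule the_equality)
   show "case (z, w) of (s, t) => s : current_sub L A Z & t : current_sub L A S & y = s \<oplus>\<^bsub>current L A\<^esub> t"
    using zw by simp
   fix x assume x: "case x of (s, t) => s : current_sub L A Z & t : current_sub L A S & y = s \<oplus>\<^bsub>current L A\<^esub> t"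
   obtain s' t' where x': "x = (s', t')" by (cases x)
   with x have st: "s' : current_sub L A Z" "t' : current_sub L A S" "y = s' \<oplus>\<^bsub>current L A\<^esub> t'" by auto
   show "x = (z, w)"
    using CA.C.dsd_unique[OF d st(1) zw(1) st(2) zw(2) trans[OF st(3)[symmetric] zw(3)]] x' by simp
  qed
  have c: "z : carrier (current L A)" "w : carrier (current L A)" using CA.current_sub_closed ZS(5,6) zw(1,2) by blast+
  note pc = clin.closed[OF prc c(1)] clin.closed[OF prc c(2)]
  have pw: "pr w : current_sub L B S"
  proof -
   have "current_sub L A S <= {X : carrier (current L A). pr X : current_sub L B S}"
    by (rule CA.current_sub_least[OF ZS(5) clin.subspace_vimage[OF prc CB.current_sub_subspace[OF ZS(5)]]])
     (use prp ZS(5) CB.current_sub_pure[OF ZS(5)] A.quot_closed[OF sub] in \<open>auto simp: current_simps\<close>)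
   then show ?thesis using zw(2) by blast
  qed
  have "t (pr y) = \<Theta> z" unfolding zw(3) clin.add[OF prc c] clin.add[OF t(1) pc] using t_S[OF pw] t_Z[OF zw(1)] by simp
  moreover have "s (pr y) = eps (pr w)"
   unfolding zw(3) clin.add[OF prc c] clin.add[OF s_clin pc] unfolding s_def
   using pS(4)[OF eps_sub[OF zw(1) ZS(2)]] pS(3)[OF eps_sub[OF zw(2) ZS(1)]] clin.closed[OF eps(1) pc(2)] by simp
  ultimately show ?thesis by (simp add: box_act_def the \<sigma>_def em[OF zw(2)])
 qed
 \<comment> \<open>The action of Y is defined as the common value over all its preimages in g_0[A],
   so one preimage has to exist.\<close>
 have surj: "\<exists>y\<in>current_sub L A (G 0). pr y = Y" if Y: "Y : current_sub L B (G 0)" for Y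
 proof -
  have "{ptn L B x b | x b. x : G 0 & b : carrier B} <= pr ` {ptn L A x b | x b. x : G 0 & b : carrier A}"
  proof
   fix X assume "X : {ptn L B x b | x b. x : G 0 & b : carrier B}"
   then obtain x b where xb: "X = ptn L B x b" "x : G 0" "b : carrier B" by blast
   obtain a where a: "a : carrier A" "b = k +>\<^bsub>A\<^esub> a" by (rule A.quot_carrierE[OF sub xb(3)])
   then have "X = pr (ptn L A x a)" using prp[OF L0(2)[OF xb(2)] a(1)] xb(1) by simp
   then show "X : pr ` {ptn L A x b | x b. x : G 0 & b : carrier A}" using xb(2) a(1) by blast
  qed
  then have "current_sub L B (G 0) <= pr ` current_sub L A (G 0)"
   unfolding current_sub_def clin.span_image[OF prc CA.pures_closed[OF L0(1)]] by (rule CB.C.span_mono)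
  then show ?thesis using Y by blast
 qed
 have bq: "bq Y v = \<sigma> Y v" if Y: "Y : current_sub L B (G 0)" and v: "v : carrier V" for Y v
 proof -
  obtain y0 where y0: "y0 : current_sub L A (G 0)" "current_proj L A k y0 = Y" using surj[OF Y] unfolding pr_def by blast
  have u: "box_act L G A \<mm> \<Theta> V \<rho> y v = \<sigma> Y v" if "y : current_sub L A (G 0)" "current_proj L A k y = Y" for y
   using box[OF that(1) v] that(2) by (simp add: pr_def)
  have "{box_act L G A \<mm> \<Theta> V \<rho> y v | y. y : current_sub L A (G 0) & current_proj L A k y = Y} = {\<sigma> Y v}" (is "?S = _")
  proof (intro equalityI subsetI)
   show "x : {\<sigma> Y v}" if "x : ?S" for x using that u by auto
   show "x : ?S" if "x : {\<sigma> Y v}" for x using that u[OF y0, symmetric] y0 by blast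
  qed
  then show ?thesis unfolding box_act_quot_def by simp
 qed
 have G0c: "Y : carrier (current L B)" if "Y : current_sub L B (G 0)" for Y using CB.current_sub_closed[OF L0(1) that] .
 have \<sigma>_clin: "clin V V (\<sigma> Y)" if "Y : carrier (current L B)" for Y
  by (rule clinI[OF N.cspace_axioms N.cspace_axioms])
   (use clin.closed[OF \<rho>_clin(1)[OF sS[OF that]]] clin.add[OF \<rho>_clin(1)[OF sS[OF that]]] clin.sm[OF \<rho>_clin(1)[OF sS[OF that]]]
    in \<open>simp_all add: \<sigma>_def N.sm_add_right N.a_ac mult.commute\<close>)
 have \<sigma>c: "\<sigma> Y v : carrier V" if "Y : carrier (current L B)" "v : carrier V" for Y v using clin.closed[OF \<sigma>_clin] that by blast
 show "clin V V (bq Y)" if "Y : current_sub L B (G 0)" for Y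
  by (rule clin_cong[OF \<sigma>_clin[OF G0c[OF that]]]) (rule bq[OF that, symmetric])
 show "clin (current L B\<lparr>carrier := current_sub L B (G 0)\<rparr>) V (%Y. bq Y v)" if v: "v : carrier V" for v
 proof (rule clin_cong)
  have "clin (current L B) V (%Y. \<sigma> Y v)"
  proof (rule clinI[OF CB.C.cspace_axioms N.cspace_axioms])
   fix X Y assume X: "X : carrier (current L B)"
   have r: "\<rho> (s X) v : carrier V" if "X : carrier (current L B)" for X using clin.closed[OF \<rho>_clin(1)[OF sS[OF that]] v] .
   show "\<sigma> X v : carrier V" using \<sigma>c X v by blast
   have "\<rho> (s (a \<odot>\<^bsub>current L B\<^esub> X)) v = a \<odot>\<^bsub>V\<^esub> \<rho> (s X) v" for a
    using clin.sm[OF \<rho>_clin(2)[OF v], of "s X" a] clin.sm[OF s_clin X, of a] sS[OF X] by simp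
   then show "\<sigma> (a \<odot>\<^bsub>current L B\<^esub> X) v = a \<odot>\<^bsub>V\<^esub> \<sigma> X v" for a
    using clin.sm[OF t(1) X, of a] v r[OF X] by (simp add: \<sigma>_def N.sm_add_right)
   assume Y: "Y : carrier (current L B)"
   have "\<rho> (s (X \<oplus>\<^bsub>current L B\<^esub> Y)) v = \<rho> (s X) v \<oplus>\<^bsub>V\<^esub> \<rho> (s Y) v"
    using clin.add[OF \<rho>_clin(2)[OF v], of "s X" "s Y"] clin.add[OF s_clin X Y] sS[OF X] sS[OF Y] by simp
   then show "\<sigma> (X \<oplus>\<^bsub>current L B\<^esub> Y) v = \<sigma> X v \<oplus>\<^bsub>V\<^esub> \<sigma> Y v"
    using clin.add[OF t(1) X Y] v r[OF X] r[OF Y] by (simp add: \<sigma>_def N.sm_add_left N.a_ac)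
  qed
  then show "clin (current L B\<lparr>carrier := current_sub L B (G 0)\<rparr>) V (%Y. \<sigma> Y v)"
   by (rule CB.C.carrier_update_clin[OF CB.current_sub_subspace[OF L0(1)]])
 qed (use bq[OF _ v] in simp)
 \<comment> \<open>s is evaluation followed by removal of the central part. Removing central parts
   does not change brackets within G 0, and cx is multiplicative.\<close>
 have s_br: "s (bracket (current L B) Y Y') = bracket L (s Y) (s Y')"
  if Y: "Y : current_sub L B (G 0)" and Y': "Y' : current_sub L B (G 0)" for Y Y'
 proof -
  let ?P = "{ptn L B x b | x b. x : G 0 & b : carrier B}"
  note Pc = CB.pures_closed[OF L0(1)]
  have sc: "s X : carrier L" if "X : carrier (current L B)" for X using clin.closed[OF s_clin that] .
  have sP: "\<exists>x a. x : G 0 & a : carrier A & X = ptn L B x (k +>\<^bsub>A\<^esub> a)" if X: "X : ?P" for X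
  proof -
   obtain x b where xb: "X = ptn L B x b" "x : G 0" "b : carrier B" using X by blast
   obtain a where "a : carrier A" "b = k +>\<^bsub>A\<^esub> a" by (rule A.quot_carrierE[OF sub xb(3)])
   then show ?thesis using xb(1,2) by blast
  qed
  have spx: "s (ptn L B x (k +>\<^bsub>A\<^esub> a)) = cx a \<odot> pS x" if "x : carrier L" "a : carrier A" for x a
   using that eps(2) clin.sm[OF pS(1)] by (simp add: s_def)
  have dec: "bracket L (pS x) (pS y) = bracket L x y" if "x : G 0" "y : G 0" for x y
  proof -
   have eq: "pS x \<oplus> pZ x = x" if x: "x : G 0" for x
   proof -
    obtain a b where ab: "a : S" "b : Z" "x = a \<oplus> b" using dsd_obtain[OF dec0 x] by blast
    have c: "a : carrier L" "b : carrier L" using ab ZS by auto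
    show ?thesis unfolding ab(3) clin.add[OF pS(1) c] clin.add[OF pZ(1) c] using pS(3,4) pZ(3,4) ab(1,2) c by simp
   qed
   have c: "pS x : carrier L" "pZ x : carrier L" "pS y : carrier L" "pZ y : carrier L" "y : carrier L"
    using that L0(2) clin.closed[OF pS(1)] clin.closed[OF pZ(1)] by auto
   have g: "pS x : G 0" using pS(2) L0(2)[OF that(1)] ZS(3) by blast
   have "bracket L x y = bracket L (pS x \<oplus> pZ x) y" using eq[OF that(1)] by simp
   also have "... = bracket L (pS x) y" using br_add_left[OF c(5,1,2)] Z_central(1)[OF pZ(2) that(2)] L0(2)[OF that(1)] c by simp
   also have "... = bracket L (pS x) (pS y \<oplus> pZ y)" using eq[OF that(2)] by simp
   also have "... = bracket L (pS x) (pS y)" using br_add_right[OF c(1,3,4)] Z_central(2)[OF pZ(2) g] c by simp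
   finally show ?thesis ..
  qed
  have base: "s (bracket (current L B) X X') = bracket L (s X) (s X')" if X: "X : ?P" and X': "X' : ?P" for X X'
  proof -
   obtain x a where x: "x : G 0" "a : carrier A" "X = ptn L B x (k +>\<^bsub>A\<^esub> a)" using sP[OF X] by blast
   obtain y b where y: "y : G 0" "b : carrier A" "X' = ptn L B y (k +>\<^bsub>A\<^esub> b)" using sP[OF X'] by blast
   have c: "x : carrier L" "y : carrier L" "pS x : carrier L" "pS y : carrier L" "a \<otimes>\<^bsub>A\<^esub> b : carrier A"
    using x y L0(2) clin.closed[OF pS(1)] A.al.m_closed by auto
   have "bracket (current L B) X X' = ptn L B (bracket L x y) (k +>\<^bsub>A\<^esub> (a \<otimes>\<^bsub>A\<^esub> b))"
    using x y CB.current_bracket_pure[OF c(1,2) A.quot_closed[OF sub x(2)] A.quot_closed[OF sub y(2)]] A.quot_mult[OF k x(2) y(2)] by simp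
   then have "s (bracket (current L B) X X') = (cx a * cx b) \<odot> bracket L x y"
    using spx[OF br_closed[OF c(1,2)] c(5)] pS(3)[OF bracket_S[OF x(1) y(1)]] cx_mult[OF x(2) y(2)] by simp
   moreover have "bracket L (s X) (s X') = (cx a * cx b) \<odot> bracket L x y"
    using x y spx c dec[OF x(1) y(1)] br_smult_left[of "cx b \<odot> pS y" "pS x" "cx a"] br_smult_right[of "pS x" "pS y" "cx b"] by simp
   ultimately show ?thesis by simp
  qed
  have one: "s (bracket (current L B) X Y') = bracket L (s X) (s Y')" if X: "X : ?P" for X
  proof (rule clin_eq_on_span[OF clin_comp[OF CB.current_bracket_bilinear(1) s_clin] clin_comp[OF s_clin br_lin(1)] Pc base[OF X]])
   show "X : carrier (current L B)" using X Pc by blast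
   then show "s X : carrier L" by (rule sc)
   show "Y' : vspan (current L B) ?P" using Y' by (simp add: current_sub_def)
  qed
  show ?thesis
  proof (rule clin_eq_on_span[OF clin_comp[OF CB.current_bracket_bilinear(2) s_clin] clin_comp[OF s_clin br_lin(2)] Pc one])
   show "Y' : carrier (current L B)" using G0c[OF Y'] .
   then show "s Y' : carrier L" by (rule sc)
   show "Y : vspan (current L B) ?P" using Y by (simp add: current_sub_def)
  qed
 qed
 show "bq (bracket (current L B) Y Y') v = bq Y (bq Y' v) \<ominus>\<^bsub>V\<^esub> bq Y' (bq Y v)"
  if Y: "Y : current_sub L B (G 0)" and Y': "Y' : current_sub L B (G 0)" and v: "v : carrier V" for Y Y' v
 proof -
  note c = G0c[OF Y] G0c[OF Y'] and rY = \<rho>_clin(1)[OF sS[OF G0c[OF Y]]] and rY' = \<rho>_clin(1)[OF sS[OF G0c[OF Y']]]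
  have YS: "bracket (current L B) Y Y' : current_sub L B S"
   by (rule CB.current_sub_bracket[OF L0(1) L0(1) ZS(5) bracket_S Y Y'])
  have Y0: "bracket (current L B) Y Y' : current_sub L B (G 0)" using YS CB.current_sub_mono[OF ZS(3)] by blast
  let ?a = "\<rho> (s Y) v" and ?a' = "\<rho> (s Y') v"
  have ac: "?a : carrier V" "?a' : carrier V" using clin.closed[OF rY v] clin.closed[OF rY' v] by auto
  let ?b = "\<rho> (s Y) ?a'" and ?b' = "\<rho> (s Y') ?a"
  have bc: "?b : carrier V" "?b' : carrier V" using clin.closed[OF rY ac(2)] clin.closed[OF rY' ac(1)] by auto
  \<comment> \<open>The part of the iterated action that is symmetric in Y and Y'; it cancels in the
    commutator.\<close>
  let ?w = "(t Y * t Y') \<odot>\<^bsub>V\<^esub> v \<oplus>\<^bsub>V\<^esub> t Y \<odot>\<^bsub>V\<^esub> ?a' \<oplus>\<^bsub>V\<^esub> t Y' \<odot>\<^bsub>V\<^esub> ?a"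
  have wc: "?w : carrier V" using v ac by simp
  have 1: "\<sigma> Y (\<sigma> Y' v) = ?w \<oplus>\<^bsub>V\<^esub> ?b"
   using v ac bc clin.add[OF rY, of "t Y' \<odot>\<^bsub>V\<^esub> v" ?a'] clin.sm[OF rY v, of "t Y'"]
   by (simp add: \<sigma>_def N.sm_add_right N.a_ac)
  have 2: "\<sigma> Y' (\<sigma> Y v) = ?w \<oplus>\<^bsub>V\<^esub> ?b'"
   using v ac bc clin.add[OF rY', of "t Y \<odot>\<^bsub>V\<^esub> v" ?a] clin.sm[OF rY' v, of "t Y"]
   by (simp add: \<sigma>_def N.sm_add_right N.a_ac mult.commute)
  have bb: "(?b \<ominus>\<^bsub>V\<^esub> ?b') \<oplus>\<^bsub>V\<^esub> ?b' = ?b" using N.minus_eq_iff[of ?b ?b' "?b \<ominus>\<^bsub>V\<^esub> ?b'"] bc by simp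
  have "(?b \<ominus>\<^bsub>V\<^esub> ?b') \<oplus>\<^bsub>V\<^esub> (?w \<oplus>\<^bsub>V\<^esub> ?b') = ?w \<oplus>\<^bsub>V\<^esub> ((?b \<ominus>\<^bsub>V\<^esub> ?b') \<oplus>\<^bsub>V\<^esub> ?b')"
   using wc bc by (intro N.a_lcomm) auto
  then have 3: "(?w \<oplus>\<^bsub>V\<^esub> ?b) \<ominus>\<^bsub>V\<^esub> (?w \<oplus>\<^bsub>V\<^esub> ?b') = ?b \<ominus>\<^bsub>V\<^esub> ?b'"
   using N.minus_eq_iff[of "?w \<oplus>\<^bsub>V\<^esub> ?b" "?w \<oplus>\<^bsub>V\<^esub> ?b'" "?b \<ominus>\<^bsub>V\<^esub> ?b'"] wc bc bb by simp
  have "bq (bracket (current L B) Y Y') v = ?b \<ominus>\<^bsub>V\<^esub> ?b'"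
   unfolding bq[OF Y0 v] \<sigma>_def t_S[OF YS] s_br[OF Y Y'] \<rho>_bracket[OF sS[OF c(1)] sS[OF c(2)] v] using v bc by simp
  then show ?thesis
   unfolding bq[OF Y v] bq[OF Y' v] bq[OF Y \<sigma>c[OF c(2) v]] bq[OF Y' \<sigma>c[OF c(1) v]] 1 2 3 .
 qed
 show "box_act_const L G A \<mm> \<Theta> V \<rho> h v = bq (ptn L B h \<one>\<^bsub>B\<^esub>) v" if h: "h : G 0" and v: "v : carrier V" for h v
 proof -
  have "pr (ptn L A h \<one>\<^bsub>A\<^esub>) = ptn L B h \<one>\<^bsub>B\<^esub>" using prp[OF L0(2)[OF h], of "\<one>\<^bsub>A\<^esub>"] by (simp add: A.quot_one)
  then show ?thesis
   using box[OF CA.current_sub_pure[OF L0(1) h] v, of "\<one>\<^bsub>A\<^esub>"] bq[OF CB.current_sub_pure[OF L0(1) h] v, of "\<one>\<^bsub>B\<^esub>"]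
   by (simp add: box_act_const_def)
 qed
qed

end


section \<open>Finiteness and weights\<close>

text \<open>The matrix entries of f x are finitely many functionals, and they separate points
  because f is injective.\<close>

lemma matrix_fin_dim:
 assumes L: "cspace L" and f: "f : lin_maps L M" "inj_on f (carrier L)"
  and M: "carrier M <= carrier_mat n n" "add M = (+)" "module.smult M = (\<cdot>\<^sub>m)"
 shows "findim L"
proof -
 interpret cspace L by fact
 have fc: "f x : carrier_mat n n" if "x : carrier L" for x using lin_mapD(1)[OF f(1) that] M(1) by blast
 have fa: "f (x \<oplus>\<^bsub>L\<^esub> y) = f x + f y" if "x : carrier L" "y : carrier L" for x y using lin_mapD(2)[OF f(1) that] M(2) by simp
 have fs: "f (c \<odot>\<^bsub>L\<^esub> x) = c \<cdot>\<^sub>m f x" if "x : carrier L" for x c using lin_mapD(3)[OF f(1) that] M(3) by simp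
 let ?F = "(%(i, j) x. f x $$ (i, j)) ` ({..<n} \<times> {..<n})"
 have "\<exists>S. finite S & S <= carrier L & vspan L S = carrier L"
 proof (rule subspace_generated_if_functionals[of ?F, OF _ _ subspace_carrier])
  fix ph assume "ph : ?F"
  then obtain i j where ij: "i < n" "j < n" "ph = (%x. f x $$ (i, j))" by auto
  show "linear_functional L ph"
   unfolding linear_functional_def ij(3)
  proof (intro conjI ballI allI)
   fix x y assume "x : carrier L" "y : carrier L"
   then show "f (x \<oplus>\<^bsub>L\<^esub> y) $$ (i, j) = f x $$ (i, j) + f y $$ (i, j)" using fa fc[of x] fc[of y] ij by simp
  next
   fix c x assume "x : carrier L"
   then show "f (c \<odot>\<^bsub>L\<^esub> x) $$ (i, j) = c * f x $$ (i, j)" using fs fc[of x] ij by simp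
  qed
 next
  fix v assume v: "v : carrier L" "!!ph. ph : ?F ==> ph v = 0"
  have "f v $$ (i, j) = 0" if "i < n" "j < n" for i j using v(2)[of "%x. f x $$ (i, j)"] that by force
  moreover have "f \<zero>\<^bsub>L\<^esub> = 0 \<cdot>\<^sub>m f \<zero>\<^bsub>L\<^esub>" using fs[of "\<zero>\<^bsub>L\<^esub>" 0] by simp
  then have "f \<zero>\<^bsub>L\<^esub> $$ (i, j) = 0" if "i < n" "j < n" for i j
   using fc[of "\<zero>\<^bsub>L\<^esub>"] that index_smult_mat(1)[of i "f \<zero>\<^bsub>L\<^esub>" j 0] by simp
  ultimately have "f v = f \<zero>\<^bsub>L\<^esub>" using fc[OF v(1)] fc[of "\<zero>\<^bsub>L\<^esub>"] by (intro eq_matI) auto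
  then show "v = \<zero>\<^bsub>L\<^esub>" using inj_onD[OF f(2)] v(1) by simp
 qed auto
 then show ?thesis using fin_dimI by blast
qed

lemma isomorphic_fin_dim:
 assumes "cspace L" "lie_super_isomorphic L (sl_super m n) \<or> lie_super_isomorphic L (osp_super n)"
 shows "findim L"
 using assms(2)
proof
 assume "lie_super_isomorphic L (sl_super m n)"
 then obtain f where "f : lin_maps L (sl_super m n)" "bij_betw f (carrier L) (carrier (sl_super m n))"
  unfolding lie_super_isomorphic_def by blast
 then show ?thesis
  by (intro matrix_fin_dim[OF assms(1), where n = "m + n" and M = "sl_super m n"])
   (auto simp: bij_betw_def sl_super_def gl_super_def sub_super_def)
next
 assume "lie_super_isomorphic L (osp_super n)"
 then obtain f where "f : lin_maps L (osp_super n)" "bij_betw f (carrier L) (carrier (osp_super n))"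
  unfolding lie_super_isomorphic_def by blast
 then show ?thesis
  by (intro matrix_fin_dim[OF assms(1), where n = "2 + 2 * n" and M = "osp_super n"])
   (auto simp: bij_betw_def osp_super_def gl_super_def sub_super_def)
qed

text \<open>Diagonalisability of h on G 0 lets every element of G 0 be expanded into eigenvectors of
  h, and these carry eigenvectors of h in G (- 1) to eigenvectors, the eigenvalues adding up.
  Irreducibility then diagonalises each h separately, and commutativity of H diagonalises a finite
  spanning set jointly.\<close>

theorem (in type1) weight_basis:
 assumes fd: "findim L" and H: "cartan_subalgebra L (G 0) H"
 shows "\<exists>e c a. cbasis (L\<lparr>carrier := G (- 1)\<rparr>) {..<sub_dim L (G (- 1))} e c &
  (\<forall>i<sub_dim L (G (- 1)). a i : dual_space L H & (\<forall>h\<in>H. bracket L h (e i) = a i h \<odot> e i))"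
proof -
 have Hs: "csub H L" and HG: "H <= G 0" and Hc: "!!x y. x : H ==> y : H ==> bracket L x y = \<zero>"
  and Hd: "!!h. h : H ==> vspan L {v : G 0. \<exists>c. bracket L h v = c \<odot> v} = G 0"
  using H unfolding cartan_subalgebra_def by blast+
 let ?M = "L\<lparr>carrier := G (- 1)\<rparr>"
 interpret M: cspace ?M by (rule subspace_cspace[OF Lm_sub])
 have fdM: "findim ?M" by (rule subspace_fin_dim[OF fd Lm_sub])
 have nz: "\<exists>v\<in>G (- 1). v ~= \<zero>" using irr Lm(3) unfolding irreducible_under_def by blast
 have T: "clin ?M ?M (bracket L h)" if "h : G 0" for h
  by (rule clinI[OF M.cspace_axioms M.cspace_axioms])
   (use br_0m[OF that] br_add_right br_smult_right L0(2)[OF that] Lm(2) in simp_all)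
 have Hcar: "h : carrier L" if "h : H" for h using that HG L0(2) by blast
 have eig: "\<exists>v\<in>G (- 1). v ~= \<zero> & (\<exists>z. bracket L h v = z \<odot> v)" if h: "h : H" for h
 proof -
  obtain b ph where b: "cbasis ?M {..<vectorspace.dim CC ?M} b ph" using M.ex_cbasis[OF fdM] by blast
  have "vectorspace.dim CC ?M > 0"
   using nz M.cbasis_zero[OF b] by (cases "vectorspace.dim CC ?M") auto
  then show ?thesis using M.eigenvector_exists[OF b _ T] h HG by auto
 qed
 have diag: "vspan ?M {v : carrier ?M. \<exists>c. bracket L h v = c \<odot>\<^bsub>?M\<^esub> v} = carrier ?M" if h: "h : H" for h
 proof -
  let ?E = "{v : G (- 1). \<exists>c. bracket L h v = c \<odot> v}"
  have hG: "h : G 0" and hc: "h : carrier L" using h HG Hcar by auto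
  have E: "?E <= carrier L" using Lm(2) by auto
  note Us = span_subspace[OF E]
  have UM: "vspan L ?E <= G (- 1)" by (rule span_least[OF Lm_sub]) auto
  have st: "bracket L y u : vspan L ?E" if y: "y : G 0" and u: "u : vspan L ?E" for y u
  proof (rule clin.span_into[OF br_lin(1)[OF L0(2)[OF y]] E Us _ u])
   fix v assume v: "v : ?E"
   then obtain b where b: "v : G (- 1)" "v : carrier L" "bracket L h v = b \<odot> v" using Lm(2) by auto
   show "bracket L y v : vspan L ?E"
   proof (rule clin.span_into[OF br_lin(2)[OF b(2)] _ Us])
    show "y : vspan L {v : G 0. \<exists>c. bracket L h v = c \<odot> v}" using Hd[OF h] y by simp
    show "{v : G 0. \<exists>c. bracket L h v = c \<odot> v} <= carrier L" using L0(2) by auto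
    fix x assume "x : {v : G 0. \<exists>c. bracket L h v = c \<odot> v}"
    then obtain a where a: "x : G 0" "x : carrier L" "bracket L h x = a \<odot> x" using L0(2) by auto
    have "bracket L h (bracket L x v) = bracket L (bracket L h x) v \<oplus> ssign 0 0 \<odot> bracket L x (bracket L h v)"
     by (rule br_jacobi) (use hG a even b in auto)
    also have "... = (a + b) \<odot> bracket L x v"
     using a b by (simp add: ssign_def br_smult_left br_smult_right sm_add_left)
    finally show "bracket L x v : vspan L ?E" using br_0m[OF a(1) b(1)] by (intro span_incl[OF E]) auto
   qed
  qed
  have "vspan L ?E = {\<zero>} \<or> vspan L ?E = G (- 1)"
   using irr Us UM st unfolding irreducible_under_def by (metis (no_types, lifting) image_subsetI)
  moreover have "vspan L ?E ~= {\<zero>}"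
  proof -
   obtain v where "v : ?E" "v ~= \<zero>" using eig[OF h] by auto
   then show ?thesis using span_incl[OF E] by blast
  qed
  ultimately have "vspan L ?E = G (- 1)" by blast
  then show ?thesis using span_restrict[OF Lm_sub, of ?E] by (simp add: Collect_mono_iff)
 qed
 note HM = subspace_cspace[OF Hs]
 obtain hb hc where "cbasis (L\<lparr>carrier := H\<rparr>) {..<vectorspace.dim CC (L\<lparr>carrier := H\<rparr>)} hb hc"
  using cspace.ex_cbasis[OF HM subspace_fin_dim[OF fd Hs]] by blast
 \<comment> \<open>Joint diagonalisation works for finite sets of operators. Eigenvectors for a
   finite spanning set of H are eigenvectors for all of H by linearity in h, as shown in
   \<open>line\<close>.\<close>
 then obtain F where F: "finite F" "F <= H" "vspan (L\<lparr>carrier := H\<rparr>) F = H"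
  unfolding cbasis_def by (metis finite_imageI partial_object.select_convs(1) partial_object.update_convs(1) partial_object.surjective finite_lessThan)
 then have FH: "vspan L F = H" using span_restrict[OF Hs F(2)] by simp
 let ?X = "{v : carrier ?M. \<forall>h\<in>F. \<exists>c. bracket L h v = c \<odot>\<^bsub>?M\<^esub> v}"
 have "vspan ?M ?X = carrier ?M"
 proof (rule M.simultaneous_diagonal[OF F(1)])
  fix h h' v assume h: "h : F" "h' : F" and "v : carrier ?M"
  then have v: "v : carrier L" using Lm(2) by simp
  have hh: "h : H" "h' : H" using h F(2) by auto
  have "bracket L h (bracket L h' v) = bracket L (bracket L h h') v \<oplus> ssign 0 0 \<odot> bracket L h' (bracket L h v)"
   by (rule br_jacobi) (use hh HG even v in auto)
  then show "bracket L h (bracket L h' v) = bracket L h' (bracket L h v)"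
   using Hc[OF hh] v Hcar[OF hh(1)] Hcar[OF hh(2)] by (simp add: ssign_def br_zero_left)
 qed (use T diag F(2) HG in auto)
 then obtain e c where e: "cbasis ?M {..<vectorspace.dim CC ?M} e c" "e ` {..<vectorspace.dim CC ?M} <= ?X"
  using M.spanning_basis[OF fdM, of ?X] by blast
 let ?r = "vectorspace.dim CC ?M"
 \<comment> \<open>The eigenvalue is read off as the i-th coordinate, which makes it linear in h,
   and is set to zero off H as \<open>dual_space\<close> demands.\<close>
 define a where "a i h = (if h : H then c i (bracket L h (e i)) else 0)" for i h
 have line: "\<exists>z. bracket L h (e i) = z \<odot> e i" if i: "i < ?r" and h: "h : H" for i h
 proof -
  have ec: "e i : carrier L" and eF: "\<forall>h\<in>F. \<exists>c. bracket L h (e i) = c \<odot> e i" using e(2) i Lm(2) by auto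
  have "bracket L h (e i) : {x : carrier L. \<exists>z. x = z \<odot> e i}"
  proof (rule clin.span_into[OF br_lin(2)[OF ec]])
   show "F <= carrier L" using F(2) Hcar by blast
   show "h : vspan L F" using FH h by simp
   show "csub {x : carrier L. \<exists>z. x = z \<odot> e i} L"
   proof (rule subspaceI)
    show "\<zero> : {x : carrier L. \<exists>z. x = z \<odot> e i}" using ec by (auto intro!: exI[of _ 0])
   qed (use ec in \<open>auto simp: sm_add_left[symmetric]\<close>)
  qed (use eF ec F(2) Hcar in auto)
  then show ?thesis by blast
 qed
 have ei: "e i : G (- 1)" if "i < ?r" for i using e(2) that by auto
 have lf: "linear_functional ?M (c i)" if "i < ?r" for i using e(1) that by (auto simp: cbasis_def)
 note cl = linear_functionalD[OF lf, simplified]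
 have ah: "bracket L h (e i) = a i h \<odot> e i" if i: "i < ?r" and h: "h : H" for i h
 proof -
  obtain z where z: "bracket L h (e i) = z \<odot> e i" using line[OF i h] by blast
  have "c i (e i) = 1" using e(1) i by (auto simp: cbasis_def)
  then have "a i h = z" using cl(2)[OF i ei[OF i]] h z by (simp add: a_def)
  then show ?thesis using z by simp
 qed
 have "a i : dual_space L H" if i: "i < ?r" for i
 proof -
  have m: "bracket L x (e i) : G (- 1)" if "x : H" for x using br_0m ei[OF i] that HG by blast
  show ?thesis
   unfolding dual_space_def
   using subspaceD(4,5)[OF Hs] Hcar ei[OF i] Lm(2) m cl[OF i] by (auto simp: a_def br_add_left br_smult_left)
 qed
 then show ?thesis using e(1) ah by blast
qed

text \<open>The largest ideal is written down explicitly: all a such that \<Theta> vanishes on z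
  \<otimes> ab for every z in Z and b in A. It contains every competing ideal, so the greatest
  element in the definition exists and equals it.\<close>

lemma (in type1) k_ideal_properties:
 assumes A: "algebra CC A" and \<Theta>: "\<Theta> : dual_space (current L A) (current_sub L A Z)" "\<Theta> ~= (%_. 0)"
 shows "ideal (k_ideal L Z A \<Theta>) A" "k_ideal L Z A \<Theta> ~= carrier A"
  "x : Z ==> a : k_ideal L Z A \<Theta> ==> \<Theta> (ptn L A x a) = 0"
proof -
 interpret A: calg A by (intro calg.intro A)
 interpret C: clie_current L A by (intro clie_current.intro lsa_axioms A)
 note Zs = C.C.subspaceD[OF C.current_sub_subspace[OF ZS(6)]]
 have tl1: "\<Theta> (X \<oplus>\<^bsub>current L A\<^esub> Y) = \<Theta> X + \<Theta> Y" if "X : current_sub L A Z" "Y : current_sub L A Z" for X Y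
  using \<Theta>(1) that by (auto simp: dual_space_def)
 have tl2: "\<Theta> (c \<odot>\<^bsub>current L A\<^esub> X) = c * \<Theta> X" if "X : current_sub L A Z" for X c
  using \<Theta>(1) that by (auto simp: dual_space_def)
 note tl = tl1 tl2
 have p: "ptn L A x a : current_sub L A Z" "x : carrier L" if "x : Z" "a : carrier A" for x a
  using C.current_sub_pure[OF ZS(6)] that ZS(6) by auto
 have add: "\<Theta> (ptn L A x (a \<oplus>\<^bsub>A\<^esub> b)) = \<Theta> (ptn L A x a) + \<Theta> (ptn L A x b)"
  and sm: "\<Theta> (ptn L A x (c \<odot>\<^bsub>A\<^esub> a)) = c * \<Theta> (ptn L A x a)"
  if "x : Z" "a : carrier A" "b : carrier A" for x a b c
  using tl(1)[OF p(1)[OF that(1,2)] p(1)[OF that(1,3)]] tl(2)[OF p(1), OF that(1,2)] p(2)[OF that(1,2)] that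
  by (simp_all add: C.pure_tensor_add_right C.pure_tensor_smult_right current_simps)
 define k0 where "k0 = {a : carrier A. \<forall>x\<in>Z. \<forall>b\<in>carrier A. \<Theta> (ptn L A x (a \<otimes>\<^bsub>A\<^esub> b)) = 0}"
 have ideal: "ideal k0 A"
 proof (rule idealI[OF A.al.ring_axioms])
  have s: "\<Theta> (ptn L A x \<zero>\<^bsub>A\<^esub>) = 0" if "x : Z" for x using sm[OF that, of "\<zero>\<^bsub>A\<^esub>" "\<zero>\<^bsub>A\<^esub>" 0] by simp
  show "subgroup k0 (add_monoid A)"
  proof (rule A.al.add.subgroupI)
   show "k0 ~= {}" using s by (auto simp: k0_def intro!: exI[of _ "\<zero>\<^bsub>A\<^esub>"])
   fix a assume a: "a : k0"
   then have ac: "a : carrier A" by (simp add: k0_def)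
   show "\<ominus>\<^bsub>A\<^esub> a : k0"
    unfolding k0_def
   proof (intro CollectI conjI ballI)
    show "\<ominus>\<^bsub>A\<^esub> a : carrier A" using ac by simp
    fix x b assume x: "x : Z" and b: "b : carrier A"
    have "\<ominus>\<^bsub>A\<^esub> a \<otimes>\<^bsub>A\<^esub> b = (- 1) \<odot>\<^bsub>A\<^esub> (a \<otimes>\<^bsub>A\<^esub> b)" using ac b by (simp only: A.neg_sm A.mult_smult(1))
    then show "\<Theta> (ptn L A x (\<ominus>\<^bsub>A\<^esub> a \<otimes>\<^bsub>A\<^esub> b)) = 0"
     using sm[OF x, of "a \<otimes>\<^bsub>A\<^esub> b" "a \<otimes>\<^bsub>A\<^esub> b" "- 1"] a ac x b by (simp add: k0_def)
   qed
   fix b assume b: "b : k0"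
   then show "a \<oplus>\<^bsub>A\<^esub> b : k0" using a by (auto simp: k0_def A.al.l_distr add)
  qed (auto simp: k0_def)
  fix a x assume a: "a : k0" and x: "x : carrier A"
  have ac: "a : carrier A" using a by (simp add: k0_def)
  show ax: "a \<otimes>\<^bsub>A\<^esub> x : k0" using a x by (auto simp: k0_def A.al.m_assoc)
  show "x \<otimes>\<^bsub>A\<^esub> a : k0" using ax A.al.m_comm[OF x ac] by simp
 qed
 have van: "\<Theta> (ptn L A x a) = 0" if "x : Z" "a : k0" for x a
  using that by (auto simp: k0_def dest!: bspec[where x = "\<one>\<^bsub>A\<^esub>"])
 \<comment> \<open>Here \<Theta> being nonzero enters: it vanishes off Z[A] by the convention of
   \<open>dual_space\<close>, so vanishing on the pure tensors that span Z[A] would make it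
   zero.\<close>
 have proper: "k0 ~= carrier A"
 proof
  assume e: "k0 = carrier A"
  have "current_sub L A Z <= {X : current_sub L A Z. \<Theta> X = 0}"
  proof (rule C.current_sub_least[OF ZS(6)])
   show "csub {X : current_sub L A Z. \<Theta> X = 0} (current L A)"
    by (rule C.C.subspaceI) (use Zs tl tl(2)[OF Zs(3), of 0] in auto)
  qed (use van e p in auto)
  moreover have "\<Theta> X = 0" if "X \<notin> current_sub L A Z" for X using \<Theta>(1) that by (auto simp: dual_space_def)
  ultimately have "\<Theta> = (%_. 0)" by blast
  then show False using \<Theta>(2) by blast
 qed
 have "k_ideal L Z A \<Theta> = k0"
  unfolding k_ideal_def
 proof (rule Greatest_equality)
  fix I assume I: "ideal I A & I ~= carrier A & (\<forall>x\<in>Z. \<forall>a\<in>I. \<Theta> (ptn L A x a) = 0)"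
  then show "I \<le> k0" using ideal.I_r_closed[of I A] ideal.Icarr[of I A] by (auto simp: k0_def)
 qed (use ideal proper van in blast)
 then show "ideal (k_ideal L Z A \<Theta>) A" "k_ideal L Z A \<Theta> ~= carrier A"
  "x : Z ==> a : k_ideal L Z A \<Theta> ==> \<Theta> (ptn L A x a) = 0"
  using ideal proper van by auto
qed

text \<open>The difference of the two numbers is the expansion of (1 - 1)^r over subsets, which
  vanishes for r > 0.\<close>

lemma even_odd_subsets:
 assumes "0 < (r :: nat)"
 shows "card {T : Pow {..<r}. of_nat (card T) = (0 :: bit)} = card {T : Pow {..<r}. of_nat (card T) = (1 :: bit)}"
  (is "card ?E = card ?O")
proof -
 have fin: "finite ?E" "finite ?O" by (rule finite_subset[of _ "Pow {..<r}"]; auto)+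
 have "int (card ?E) - int (card ?O) = (\<Sum>T\<in>?E \<union> ?O. bsign (of_nat (card T)))"
  by (subst sum.union_disjoint[OF fin]) (auto simp: bsign_def)
 also have "?E \<union> ?O = Pow {..<r}" by (auto intro: bit.exhaust)
 also have "(\<Sum>T\<in>Pow {..<r}. bsign (of_nat (card T))) = (\<Sum>T\<in>Pow {..<r}. (\<Prod>x\<in>T. - 1) * (\<Prod>x\<in>{..<r} - T. 1))"
  by (simp add: bsign_of_nat)
 also have "... = (\<Prod>x<r. - 1 + 1)" by (rule prod_add[symmetric]) simp
 finally show ?thesis using assms by (simp add: zero_power)
qed

theorem proposition2p7:
  fixes \<gg> :: "'g lie_super" and G :: "int \<Rightarrow> 'g set" and H :: "'g set"
    and A :: "(complex, 'a) module" and \<mm> :: "'a set"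
    and \<Theta> :: "('g \<times> 'a \<Rightarrow>\<^sub>0 complex) set \<Rightarrow> complex"
    and V :: "(complex, 'v) module" and \<rho> :: "'g \<Rightarrow> 'v \<Rightarrow> 'v"
    and m n p :: nat
  defines "Z \<equiv> lie_center \<gg> (G 0)"
  defines "S \<equiv> derived_subalgebra \<gg> (G 0)"
  defines "k \<equiv> k_ideal \<gg> Z A \<Theta>"
  defines "B \<equiv> quot A k"
  defines "\<sigma> \<equiv> box_act_quot \<gg> G A \<mm> k \<Theta> V \<rho>"
  defines "K \<equiv> kac_module \<gg> G B V \<sigma>"
  defines "d \<equiv> vectorspace.dim CC B"
  assumes "1 \<le> m" and "m \<le> n" and "1 < n"
    and "lie_superalgebra \<gg>"
    and "lie_super_isomorphic \<gg> (sl_super m n) \<or> lie_super_isomorphic \<gg> (osp_super n)"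
    and "type_I_grading \<gg> G"
    and "cartan_subalgebra \<gg> (G 0) H"
    and "algebra CC A" and "fin_gen_algebra A"
    and "maximalideal \<mm> A"
    and "\<Theta> \<in> dual_space (current \<gg> A) (current_sub \<gg> A Z)" and "\<Theta> \<noteq> (\<lambda>_. 0)"
    and "1 < p" and "\<mm> [^]\<^bsub>ideals_set A\<^esub> p \<subseteq> k" and "k \<subset> \<mm>"
    and "lie_module \<gg> S V \<rho>" and "vectorspace.fin_dim CC V"
    and "irreducible_under V \<rho> S (carrier V)"
  shows "vectorspace.fin_dim CC B \<and> vectorspace.fin_dim CC K \<and>
    vectorspace.dim CC K = 2 ^ (sub_dim \<gg> (G (- 1)) * d) * vectorspace.dim CC V \<and>
    sdim K (kac_part \<gg> G B V \<sigma>) = 0 \<and>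
    ch \<gg> H K (kac_act_const \<gg> G B V \<sigma>) =
      ch \<gg> H (grassmann \<gg> G) (grassmann_act \<gg> G) ^ d *
      ch \<gg> H V (box_act_const \<gg> G A \<mm> \<Theta> V \<rho>) \<and>
    sch \<gg> H K (kac_part \<gg> G B V \<sigma>) (kac_act_const \<gg> G B V \<sigma>) =
      sch \<gg> H (grassmann \<gg> G) (grassmann_part \<gg> G) (grassmann_act \<gg> G) ^ d *
      ch \<gg> H V (box_act_const \<gg> G A \<mm> \<Theta> V \<rho>)"
proof -
 interpret T: type1 \<gg> G
  by (intro type1.intro type1_axioms.intro lsa.intro \<open>lie_superalgebra \<gg>\<close> \<open>type_I_grading \<gg> G\<close>)
 interpret A: calg A by (intro calg.intro \<open>algebra CC A\<close>)
 obtain S0 where gen: "A.generates S0"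
  using \<open>fin_gen_algebra A\<close> unfolding fin_gen_algebra_def A.generates_def by blast
 note kp = T.k_ideal_properties[OF \<open>algebra CC A\<close> \<open>\<Theta> : dual_space (current \<gg> A) (current_sub \<gg> A Z)\<close>[unfolded Z_def]
  \<open>\<Theta> ~= (%_. 0)\<close>, folded Z_def, folded k_def]
 obtain cx where cx: "linear_functional A cx" "!!a b. a : carrier A ==> b : carrier A ==> cx (a \<otimes>\<^bsub>A\<^esub> b) = cx a * cx b"
  "cx \<one>\<^bsub>A\<^esub> = 1" "!!a. a : \<mm> ==> cx a = 0" "!!a. a : carrier A ==> a \<ominus>\<^bsub>A\<^esub> cx a \<odot>\<^bsub>A\<^esub> \<one>\<^bsub>A\<^esub> : \<mm>"
  by (rule A.ex_character[OF gen \<open>maximalideal \<mm> A\<close>]) (rule that, assumption+)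
 interpret X: boxmod \<gg> G A \<mm> k cx \<Theta> V \<rho>
 proof (intro boxmod.intro boxmod_axioms.intro T.type1_axioms A.calg_axioms)
  show "lie_module \<gg> (derived_subalgebra \<gg> (G 0)) V \<rho>" using \<open>lie_module \<gg> S V \<rho>\<close> unfolding S_def .
  show "\<Theta> : dual_space (current \<gg> A) (current_sub \<gg> A (lie_center \<gg> (G 0)))"
   using \<open>\<Theta> : dual_space (current \<gg> A) (current_sub \<gg> A Z)\<close> unfolding Z_def .
  show "\<Theta> (ptn \<gg> A x a) = 0" if "x : lie_center \<gg> (G 0)" "a : k" for x a
   using kp(3) that unfolding Z_def .
 qed (use kp(1) \<open>k \<subset> \<mm>\<close> \<open>maximalideal \<mm> A\<close> cx in auto)
 have finB: "findim B"
  unfolding B_def by (rule A.quot_fin_dim[OF gen \<open>maximalideal \<mm> A\<close> kp(1) \<open>\<mm> [^]\<^bsub>ideals_set A\<^esub> p <= k\<close>])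
 have algB: "algebra CC B" unfolding B_def by (rule X.algB)
 interpret CB: clie_current \<gg> B by (intro clie_current.intro T.lsa_axioms algB)
 \<comment> \<open>The realisation by matrices supplies the finite dimension of g.\<close>
 note fd = isomorphic_fin_dim[OF T.cspace_axioms \<open>lie_super_isomorphic \<gg> (sl_super m n) \<or> lie_super_isomorphic \<gg> (osp_super n)\<close>]
 let ?r = "sub_dim \<gg> (G (- 1))"
 obtain e c a where e: "cbasis (\<gg>\<lparr>carrier := G (- 1)\<rparr>) {..<?r} e c" and a: "!!i. i < ?r ==> a i : dual_space \<gg> H"
  "!!i h. i < ?r ==> h : H ==> bracket \<gg> h (e i) = a i h \<odot>\<^bsub>\<gg>\<^esub> e i"
  using T.weight_basis[OF fd \<open>cartan_subalgebra \<gg> (G 0) H\<close>] by blast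
 have HG: "H <= G 0" using \<open>cartan_subalgebra \<gg> (G 0) H\<close> by (simp add: cartan_subalgebra_def)
 obtain b ph where b: "cbasis B {..<d} b ph" using CB.B.ex_cbasis[OF finB] unfolding d_def by blast
 obtain pm where pm: "clin \<gg> \<gg> pm" "!!x. x : carrier \<gg> ==> pm x : G (- 1)" "!!x. x : G (- 1) ==> pm x = x"
  by (rule T.dsd_proj_total[OF T.dsd_swap[OF T.hpart_dsd] T.odd]) (rule that, assumption+)
 \<comment> \<open>Weight vectors e_i tensored with a basis of B, in the numbering by q = i * d + j;
   the weight of the q-th vector is a (q div d).\<close>
 let ?E = "%q. ptn \<gg> B (e (q div d)) (b (q mod d))"
 obtain psx where psx: "cbasis (current \<gg> B\<lparr>carrier := current_sub \<gg> B (G (- 1))\<rparr>) {..<?r * d} ?E psx"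
  using CB.current_sub_basis[OF T.Lm_sub e b pm] by blast
 let ?L = "current \<gg> B" and ?W = "plus_current \<gg> G B" and ?ta = "plus_act \<gg> G B \<sigma>"
 interpret GB: graded_lsa ?L "current_sub \<gg> B (G (- 1))" "current_sub \<gg> B (G 0)" "current_sub \<gg> B (G 1)"
  by (rule T.current_graded[OF algB])
 have W: "direct_sum_decomp ?L ?W (current_sub \<gg> B (G 0)) (current_sub \<gg> B (G 1))"
  unfolding plus_current_def by (rule CB.current_sub_dsd[OF T.total_dsd T.plus_dsd])
 note bx = X.box_action[folded B_def \<sigma>_def]
 \<comment> \<open>The module over g_0[B] is extended by zero on g_1[B]; \<open>plus_act\<close> has
   the form required of \<open>ta\<close>.\<close>
 note ext = GB.even_extension[where N = V and \<sigma> = \<sigma> and ta = ?ta, OF W X.N.cspace_axioms bx(1,2,3) plus_act_def]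
 have ext1: "ind ?L ?W V ?ta" by (rule ext(1); assumption)
 have ext2: "?ta y = \<sigma> y" if "y : current_sub \<gg> B (G 0)" for y by (rule ext(2); (assumption | rule that))
 have ext3: "?ta y v = \<zero>\<^bsub>V\<^esub>" if "y : current_sub \<gg> B (G 1)" "v : carrier V" for y v
  by (rule ext(3); (assumption | rule that))
 interpret I: ind ?L ?W V ?ta by (rule ext1)
 interpret Kc: kac ?L "current_sub \<gg> B (G (- 1))" "current_sub \<gg> B (G 0)" "current_sub \<gg> B (G 1)" ?W V ?ta "?r * d" ?E psx
  by (intro kac.intro kac_axioms.intro GB.graded_lsa_axioms ext1 W ext3 psx \<open>findim V\<close>)
 obtain pj where pj: "fin_decomp V Kc.IK (Pow {..<?r * d}) Kc.kT pj"
  "!!p. induced_part ?L ?W V ?ta p = vspan Kc.IK {Kc.kT T v | T v. T : Pow {..<?r * d} & of_nat (card T) = p & v : carrier V}"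
  by (rule Kc.kac_decomp) (rule that, assumption+)
 have KI: "K = Kc.IK" by (simp add: K_def kac_module_def)
 let ?alp = "kac_act_const \<gg> G B V \<sigma>" and ?be = "box_act_const \<gg> G A \<mm> \<Theta> V \<rho>"
 have one: "\<one>\<^bsub>B\<^esub> : carrier B" by (rule CB.al.one_closed)
 have h1: "ptn \<gg> B h \<one>\<^bsub>B\<^esub> : current_sub \<gg> B (G 0)" if "h : H" for h
  using CB.current_sub_pure[OF T.L0(1) _ one] that HG by blast
 have alp: "?alp h = induced_act ?L ?W V ?ta (ptn \<gg> B h \<one>\<^bsub>B\<^esub>)" for h
  by (simp add: kac_act_const_def kac_act_def)
 have be: "?be h v = ?ta (ptn \<gg> B h \<one>\<^bsub>B\<^esub>) v" if "h : H" "v : carrier V" for h v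
  using bx(4)[OF _ that(2), of h] ext2[OF h1[OF that(1)]] HG that(1) by auto
 have idx: "q div d < ?r" "q mod d < d" if "q < ?r * d" for q
  using that less_mult_imp_div_less[of q ?r d] by (auto intro!: mod_less_divisor gr0I)
 have eig: "bracket ?L (ptn \<gg> B h \<one>\<^bsub>B\<^esub>) (?E q) = a (q div d) h \<odot>\<^bsub>?L\<^esub> ?E q" if h: "h : H" and q: "q < ?r * d" for h q
 proof -
  have c: "h : carrier \<gg>" "e (q div d) : carrier \<gg>" "b (q mod d) : carrier B"
   using h HG T.L0(2) e b idx[OF q] T.Lm(2) by (auto simp: cbasis_def)
  have "bracket ?L (ptn \<gg> B h \<one>\<^bsub>B\<^esub>) (?E q) = ptn \<gg> B (bracket \<gg> h (e (q div d))) (\<one>\<^bsub>B\<^esub> \<otimes>\<^bsub>B\<^esub> b (q mod d))"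
   by (rule CB.current_bracket_pure[OF c(1,2) one c(3)])
  then show ?thesis using a(2)[OF idx(1)[OF q] h] c CB.pure_tensor_smult_left by (simp add: current_simps)
 qed
 interpret D: weighted_decomp V Kc.IK "Pow {..<?r * d}" Kc.kT pj \<gg> H ?alp ?be "%T. \<Sum>q\<in>T. a (q div d)" "%T. of_nat (card T)"
  "kac_part \<gg> G B V \<sigma>"
 proof (intro weighted_decomp.intro weighted_decomp_axioms.intro pj(1))
  fix h assume h: "h : H"
  show "clin Kc.IK Kc.IK (?alp h)" unfolding alp by (rule I.induced_act_clin(1)[OF GB.L0(2)[OF h1[OF h]]])
  show "clin V V (?be h)"
   by (rule clin_cong[OF bx(1)[OF h1[OF h]]]) (use bx(4)[of h] h HG in auto)
  fix T v assume T: "T : Pow {..<?r * d}" and v: "v : carrier V"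
  show "?alp h (Kc.kT T v) = Kc.kT T (?be h v \<oplus>\<^bsub>V\<^esub> (\<Sum>q\<in>T. a (q div d)) h \<odot>\<^bsub>V\<^esub> v)"
   unfolding alp be[OF h v] sum_fun_apply by (rule Kc.even_act_kT[OF h1[OF h] eig[OF h] T v])
 next
  show "(\<Sum>q\<in>T. a (q div d)) : dual_space \<gg> H" if "T : Pow {..<?r * d}" for T
   by (rule dual_space_sum) (use a(1) idx(1) that in blast)
 next
  show "kac_part \<gg> G B V \<sigma> p = vspan Kc.IK {Kc.kT T v | T v. T : Pow {..<?r * d} & of_nat (card T) = p & v : carrier V}" for p
   unfolding kac_part_def by (rule pj(2))
 qed
 interpret Gr: grass \<gg> "G (- 1)" "G 0" "G 1" ?r e c
  by (intro grass.intro grass_axioms.intro T.graded_lsa_axioms e)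
 have gr: "grassmann_act \<gg> G h (Gr.G.ecls f) = (\<Union>f\<in>Gr.G.ecls f. env_ideal Gr.GL +>\<^bsub>Gr.G.FA\<^esub> Gr.gact h f)" for h f
  by (simp add: grassmann_act_def Gr.gact_def)
 have gc: "ch \<gg> H Gr.GE (grassmann_act \<gg> G) = (\<Sum>T\<in>Pow {..<?r}. sgl (\<Sum>i\<in>T. a i) 1)"
  "sch \<gg> H Gr.GE (env_part Gr.GL) (grassmann_act \<gg> G) =
   (\<Sum>T\<in>Pow {..<?r}. sgl (\<Sum>i\<in>T. a i) (bsign (of_nat (card T))))"
  by (rule Gr.grassmann_decomp[OF HG a(2) a(1) gr]; assumption)+
 note blocks = sum_Pow_blocks[of a d _ ?r]
 \<comment> \<open>An irreducible module is nonzero and k is a proper ideal, so both r and d are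
   positive. This is what makes the even and odd subsets balance in the superdimension.\<close>
 have r0: "0 < ?r"
 proof (rule ccontr)
  assume "\<not> ?thesis"
  then have "v = \<zero>\<^bsub>\<gg>\<^esub>" if "v : G (- 1)" for v
   using cspace.cbasis_zero[OF T.subspace_cspace[OF T.Lm_sub] e, of v] that by simp
  then show False using T.irr T.Lm(3) unfolding irreducible_under_def by blast
 qed
 have d0: "0 < d"
 proof (rule ccontr)
  assume "\<not> ?thesis"
  then have "\<one>\<^bsub>B\<^esub> = \<zero>\<^bsub>B\<^esub>" using CB.B.cbasis_zero[OF b one] by simp
  then have "k +>\<^bsub>A\<^esub> \<one>\<^bsub>A\<^esub> = k +>\<^bsub>A\<^esub> \<zero>\<^bsub>A\<^esub>" unfolding B_def A.quot_one A.quot_zero[OF A.ideal_subspace[OF kp(1)]] .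
  then have "\<one>\<^bsub>A\<^esub> \<ominus>\<^bsub>A\<^esub> \<zero>\<^bsub>A\<^esub> : k" using A.coset_eq_iff[OF A.ideal_subspace[OF kp(1)]] by simp
  then have "\<one>\<^bsub>A\<^esub> : k" by (simp add: A.minus_sm)
  then show False using ideal.one_imp_carrier[OF kp(1)] kp(2) by blast
 qed
 have "sdim Kc.IK (kac_part \<gg> G B V \<sigma>) = 0"
  unfolding sdim_def D.P_dim using even_odd_subsets[of "?r * d"] r0 d0 by simp
 moreover have "ch \<gg> H Kc.IK ?alp = ch \<gg> H (grassmann \<gg> G) (grassmann_act \<gg> G) ^ d * ch \<gg> H V ?be"
  unfolding D.ch_eq grassmann_def unfolding gc(1) using blocks[of 1] by simp
 moreover have "sch \<gg> H Kc.IK (kac_part \<gg> G B V \<sigma>) ?alp =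
   sch \<gg> H (grassmann \<gg> G) (grassmann_part \<gg> G) (grassmann_act \<gg> G) ^ d * ch \<gg> H V ?be"
  unfolding D.sch_eq grassmann_def grassmann_part_def unfolding gc(2) bsign_of_nat using blocks[of "- 1"] by simp
 ultimately show ?thesis
  unfolding KI using finB D.total_dim by (simp add: card_Pow)
qed

end
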